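(* Let $u\in[\frac12,1)$. Let $(\mathcal{L}_j,p_j)_{j\in\mathbb{N}}$ be a sequence of pairs consisting of a function $\mathcal{L}_j\in\mathcal{N}(u)$ and a continuous function $p_j:\mathbb{C}\to\mathbb{C}$ satisfying $p_j(z)\ll_j|z|^2$ as $|z|\to\infty$. Let $L_j$ denote the extension of $\mathcal{L}_j$ to a function of $(s,x)$, $x\in K$. Then, for any $\alpha\in(u,1]$ and $l>0$, there exist an $l$-set $A\subset[1,\infty)$ of density zero and a sequence $(N_j)_j$ of positive integers such that the following holds: (i) For every $j\in\mathbb{N}$, as $T\to\infty$, $$\frac1T\int_{N_j}^T\int_\alpha^2p_j\bigl(\mathcal{L}_j(\sigma+it)\bigr)\,\mathbf{1}_{A^c}(t)\,d\sigma\,dt=\int_\alpha^2\int_Kp_j\bigl(L_j(\sigma,x)\bigr)\,d\boldsymbol{\sigma}(x)\,d\sigma+o_j(1).$$ (ii) For every $j\in\mathbb{N}$, uniformly for $\alpha\le\sigma\le2$, as $T\to\infty$, $$\frac1T\int_{N_j}^Tp_j\bigl(\mathcal{L}_j(\sigma+it)\bigr)\,\mathbf{1}_{A^c}(t)\,dt=\int_Kp_j\bigl(L_j(\sigma,x)\bigr)\,d\boldsymbol{\sigma}(x)+o_j(1).$$ (iii) Suppose that $l\notin\Gamma_P:=\{2\pi k(\log\frac nm)^{-1}:k,n,m\in\mathbb{N},\,n\ne m\}$. Then, for every $j\in\mathbb{N}$, uniformly for $\alpha\le\sigma\le2$ and $0\le\lambda\le l$, as $N\to\infty$, $$\frac1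N\sum_{n=N_j}^Np_j\bigl(\mathcal{L}_j(\sigma+i\lambda+inl)\bigr)\,\mathbf{1}_{A^c}(nl)=\int_{K_{2\pi/l}}p_j\bigl(L_j(\sigma,x)\bigr)\,d\boldsymbol{\tau}(x)+o_j(1).$$
   Context: $\mathbf{1}_X$ is the indicator function of $X\subset\mathbb{R}$, $X^c=\mathbb{R}\setminus X$, $\mathbb{N}=\{1,2,\dots\}$. For $J\subset\mathbb{N}$, $\mathrm{dens}_*J$ is the lower limit of $\#(J\cap[1,N])/N$ as $N\to\infty$; $\mathrm{dens}\,J$ is the limit if it exists. A set $A\subset[1,\infty)$ is an $l$-set of density zero if $A=\bigcup_{n\in J}[nl,(n+1)l)$ for some $J\subset\mathbb{N}$ with $\mathrm{dens}\,J=0$. The class $\mathcal{N}(u)$, $u\in[\frac12,1)$: functions $\mathcal{L}$ on the half-plane $\sigma>1$ such that (N.1) $\mathcal{L}(s)=\sum_{n\ge1}a(n)n^{-s}$ for $\sigma>1$ with $\sum_n|a(n)|^2n^{-\sigma}<\infty$ for every $\sigma>1$; (N.2) for all $\alpha\in(u,1]$ and $l,\varepsilon>0$ there is $J_\varepsilon\subset\mathbb{N}$ with $\mathrm{dens}_*J_\varepsilon>1-\varepsilon$ such that for every $n\in J_\varepsilon$ the function $s\mapsto\mathcal{L}(s+inl)$ extends to an analytic function on $Q(\alpha,l):=\{\sigma+it:\sigma>\alpha,\,-l<t<2l\}$, and the family of these functions, $n\in J_\varepsilon$, is normal in $Q(\alpha,l)$ (every sequence has a subsequence converging locally uniformly in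 the chordal metric). By (N.2) $\mathcal{L}$ is continued analytically to $\{\sigma>1\}\cup\bigcup_{n\in J_\varepsilon}(Q(\alpha,l)+inl)$, and $\mathcal{L}(\sigma+it)$ denotes the value of this continuation. The group $K$ (for given $l>0$): let $\Lambda=\{\log p:p\text{ prime}\}\cup\{\frac{2\pi}l\}$ if $l\notin\Gamma_P$, and $\Lambda=\{\log p:p\text{ prime}\}$ if $l\in\Gamma_P$. Let $\Gamma$ be the additive subgroup of $\mathbb{R}$ generated by $\Lambda$ with the discrete topology, and $K$ its (compact) dual group of characters $x:\Gamma\to\{|z|=1\}$, with Haar measure $\boldsymbol{\sigma}$, $\boldsymbol{\sigma}(K)=1$. For $\gamma\in\Gamma$ let $\chi_\gamma(x):=x(\gamma)$. If $l\notin\Gamma_P$, $K_{2\pi/l}:=\{x\in K:\chi_{2\pi/l}(x)=1\}$, a compact subgroup with Haar measure $\boldsymbol{\tau}$, $\boldsymbol{\tau}(K_{2\pi/l})=1$. For $\mathcal{L}(s)=\sum a(n)n^{-s}$ as in (N.1), $L(s,x):=\sum_{n\ge1}a(n)n^{-s}\chi_{\log n}(x)$; for fixed $\sigma>\frac12$ this series converges in $L^2(K,\boldsymbol{\sigma})$ (and, for $l\notin\Gamma_P$, in $L^2(K_{2\pi/l},\boldsymbol{\tau})$) and $L(\sigma,\cdot)$ denotes its sum. *)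

theory Defs
  imports
    "HOL-Probability.Probability_Measure"
    "HOL-Library.Landau_Symbols"
    "HOL-Computational_Algebra.Group_Closure"
    "HOL-Computational_Algebra.Primes"
begin

text \<open>Throughout, the natural numbers of the source are the positive ones, so index sets
  \<open>J\<close> are subsets of \<open>{1..}\<close>.\<close>

subsection \<open>Densities\<close>

definition lower_dens :: "nat set \<Rightarrow> ereal" where
  "lower_dens J = liminf (\<lambda>N. ereal (real (card (J \<inter> {1..N})) / real N))"

definition has_dens :: "nat set \<Rightarrow> real \<Rightarrow> bool" where
  "has_dens J d \<longleftrightarrow> (\<lambda>N. real (card (J \<inter> {1..N})) / real N) \<longlonglongrightarrow> d"

definition l_set_dens_zero :: "real \<Rightarrow> real set \<Rightarrow> bool" where
  "l_set_dens_zero l A \<longleftrightarrow> A \<subseteq> {1..} \<and>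
     (\<exists>J\<subseteq>{1..}. has_dens J 0 \<and> A = (\<Union>n\<in>J. {real n * l..<(real n + 1) * l}))"

subsection \<open>Normal families with respect to the chordal metric\<close>

text \<open>Points of the Riemann sphere are encoded as \<open>complex option\<close>, \<open>None\<close> being infinity;
  in particular the limit of a convergent sequence may take the value infinity.\<close>

fun chordal :: "complex option \<Rightarrow> complex option \<Rightarrow> real" where
  "chordal (Some z) (Some w) =
     2 * cmod (z - w) / (sqrt (1 + (cmod z)\<^sup>2) * sqrt (1 + (cmod w)\<^sup>2))"
| "chordal (Some z) None = 2 / sqrt (1 + (cmod z)\<^sup>2)"
| "chordal None (Some w) = 2 / sqrt (1 + (cmod w)\<^sup>2)"
| "chordal None None = 0"

definition chordal_loc_unif_limit ::
  "complex set \<Rightarrow> (nat \<Rightarrow> complex \<Rightarrow> complex) \<Rightarrow> (complex \<Rightarrow> complex option) \<Rightarrow> bool" where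
  "chordal_loc_unif_limit D f g \<longleftrightarrow>
     (\<forall>z\<in>D. \<exists>r>0. \<forall>e>0. \<forall>\<^sub>F k in sequentially.
        \<forall>w\<in>ball z r \<inter> D. chordal (Some (f k w)) (g w) < e)"

definition normal_family :: "complex set \<Rightarrow> (complex \<Rightarrow> complex) set \<Rightarrow> bool" where
  "normal_family D F \<longleftrightarrow>
     (\<forall>f :: nat \<Rightarrow> complex \<Rightarrow> complex. range f \<subseteq> F \<longrightarrow>
        (\<exists>r g. strict_mono r \<and> chordal_loc_unif_limit D (f \<circ> r) g))"

subsection \<open>The class N(u)\<close>

definition dirichlet_rep :: "(nat \<Rightarrow> complex) \<Rightarrow> (complex \<Rightarrow> complex) \<Rightarrow> bool" where
  "dirichlet_rep a L \<longleftrightarrow>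
     (\<forall>s. Re s > 1 \<longrightarrow> (\<lambda>n. a (Suc n) * of_nat (Suc n) powr (- s)) sums L s) \<and>
     (\<forall>\<sigma>>1. summable (\<lambda>n. (cmod (a (Suc n)))\<^sup>2 * real (Suc n) powr (- \<sigma>)))"

definition Q_strip :: "real \<Rightarrow> real \<Rightarrow> complex set" where
  "Q_strip \<alpha> l = {s. Re s > \<alpha> \<and> - l < Im s \<and> Im s < 2 * l}"

definition class_N :: "real \<Rightarrow> (complex \<Rightarrow> complex) set" where
  "class_N u = {L.
     (\<exists>a. dirichlet_rep a L) \<and>
     (\<forall>\<alpha> l \<epsilon>. u < \<alpha> \<and> \<alpha> \<le> 1 \<and> 0 < l \<and> 0 < \<epsilon> \<longrightarrow>
        (\<exists>J F. J \<subseteq> {1..} \<and> lower_dens J > ereal (1 - \<epsilon>) \<and>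
           (\<forall>n\<in>J. F n holomorphic_on Q_strip \<alpha> l \<and>
              (\<forall>s\<in>Q_strip \<alpha> l. Re s > 1 \<longrightarrow> F n s = L (s + \<i> * of_real (real n * l)))) \<and>
           normal_family (Q_strip \<alpha> l) (F ` J)))}"

subsection \<open>Analytic continuation\<close>

text \<open>A function on the half-plane \<open>\<sigma> > 1\<close> is continued to \<open>s\<close> along an open horizontal
  half-strip that contains \<open>s\<close>. The half-strip meets the half-plane, so the
  identity theorem makes the value unique. Each strip \<open>Q_strip \<alpha> l + inl\<close> contains such a half-strip
  around each of its points, so on these strips the value is that of the continuation
  given by \<open>class_N\<close>, whatever the choice of \<open>\<alpha>\<close>, \<open>l\<close>, \<open>\<epsilon>\<close> and \<open>J\<close>.\<close>

definition right_strip :: "complex \<Rightarrow> real \<Rightarrow> complex set" where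
  "right_strip s e = {w. Re w > Re s - e \<and> \<bar>Im w - Im s\<bar> < e}"

definition continues_to :: "(complex \<Rightarrow> complex) \<Rightarrow> complex \<Rightarrow> complex \<Rightarrow> bool" where
  "continues_to L s v \<longleftrightarrow>
     (\<exists>e>0. \<exists>g. g holomorphic_on right_strip s e \<and>
        (\<forall>w\<in>right_strip s e. Re w > 1 \<longrightarrow> g w = L w) \<and> g s = v)"

definition continuable :: "(complex \<Rightarrow> complex) \<Rightarrow> complex \<Rightarrow> bool" where
  "continuable L s \<longleftrightarrow> (\<exists>v. continues_to L s v)"

definition continuation :: "(complex \<Rightarrow> complex) \<Rightarrow> complex \<Rightarrow> complex" where
  "continuation L s = (THE v. continues_to L s v)"

subsection \<open>The groups of characters and their Haar measures\<close>

definition Gamma_P :: "real set" where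
  "Gamma_P = {2 * pi * real k / ln (real n / real m) | k n m :: nat.
     k \<ge> 1 \<and> n \<ge> 1 \<and> m \<ge> 1 \<and> n \<noteq> m}"

definition Lambda_gen :: "real \<Rightarrow> real set" where
  "Lambda_gen l = {ln (real p) | p :: nat. prime p} \<union> (if l \<in> Gamma_P then {} else {2 * pi / l})"

definition freq_group :: "real \<Rightarrow> real set" where
  "freq_group l = group_closure (Lambda_gen l)"

text \<open>Characters of a discrete group \<open>G\<close> are represented by functions that are \<open>undefined\<close> off
  \<open>G\<close>. As \<open>G\<close> is discrete, the compact-open topology of the dual is the topology of pointwise
  convergence.\<close>

definition dual_group :: "real set \<Rightarrow> (real \<Rightarrow> complex) set" where
  "dual_group G = {x \<in> extensional G.
     (\<forall>\<gamma>\<in>G. cmod (x \<gamma>) = 1) \<and> (\<forall>\<gamma>\<in>G. \<forall>\<delta>\<in>G. x (\<gamma> + \<delta>) = x \<gamma> * x \<delta>)}"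

definition char_mult ::
  "real set \<Rightarrow> (real \<Rightarrow> complex) \<Rightarrow> (real \<Rightarrow> complex) \<Rightarrow> real \<Rightarrow> complex" where
  "char_mult G x y = restrict (\<lambda>\<gamma>. x \<gamma> * y \<gamma>) G"

definition char_topology ::
  "real set \<Rightarrow> (real \<Rightarrow> complex) set \<Rightarrow> (real \<Rightarrow> complex) topology" where
  "char_topology G H = subtopology (product_topology (\<lambda>_. euclidean) G) H"

text \<open>\<open>M\<close> is the normalised Haar measure of the closed subgroup \<open>H\<close> of the dual of \<open>G\<close>, on the Borel
  sets of \<open>H\<close>. For countable \<open>G\<close>, as here, \<open>H\<close> is metrisable and regularity is automatic.\<close>

definition haar_prob :: "real set \<Rightarrow> (real \<Rightarrow> complex) set \<Rightarrow> (real \<Rightarrow> complex) measure \<Rightarrow> bool" where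
  "haar_prob G H M \<longleftrightarrow>
     prob_space M \<and> space M = H \<and>
     sets M = sigma_sets H {U. openin (char_topology G H) U} \<and>
     (\<forall>y\<in>H. \<forall>B\<in>sets M. emeasure M (char_mult G y ` B) = emeasure M B)"

definition K_group :: "real \<Rightarrow> (real \<Rightarrow> complex) set" where
  "K_group l = dual_group (freq_group l)"

definition K_sub :: "real \<Rightarrow> (real \<Rightarrow> complex) set" where
  "K_sub l = {x \<in> K_group l. x (2 * pi / l) = 1}"

subsection \<open>The extension of a Dirichlet series to the group\<close>

definition is_L2_sum :: "'a measure \<Rightarrow> (nat \<Rightarrow> 'a \<Rightarrow> complex) \<Rightarrow> ('a \<Rightarrow> complex) \<Rightarrow> bool" where
  "is_L2_sum M f g \<longleftrightarrow> g \<in> borel_measurable M \<and>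
     (\<lambda>N. \<integral>\<^sup>+x. ennreal ((cmod ((\<Sum>n=1..N. f n x) - g x))\<^sup>2) \<partial>M) \<longlonglongrightarrow> 0"

text \<open>A representative of the \<open>L\<^sup>2\<close>-sum; it is determined up to a null set.\<close>

definition dirichlet_ext ::
  "(real \<Rightarrow> complex) measure \<Rightarrow> (nat \<Rightarrow> complex) \<Rightarrow> complex \<Rightarrow> (real \<Rightarrow> complex) \<Rightarrow> complex" where
  "dirichlet_ext M a s =
     (SOME g. is_L2_sum M (\<lambda>n x. a n * of_nat n powr (- s) * x (ln (real n))) g)"

end

theory Submission
  imports Defs "HOL-Complex_Analysis.Complex_Analysis" "HOL-Real_Asymp.Real_Asymp"
begin

text \<open>If \<open>P\<^sub>k\<close> is the \<open>k\<close>-th partial sum of the Dirichlet series and \<open>p\<close> is continuous, then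
  \<open>p(P\<^sub>k(\<sigma> + it))\<close> is a uniform limit of trigonometric polynomials in \<open>t\<close>, by the
  Weierstrass approximation theorem. The mean of a trigonometric polynomial is its constant term,
  and by orthogonality of characters so is the integral over \<open>K\<close> of the corresponding function
  of \<open>x\<close>; for sampling at \<open>\<lambda> + nl\<close> the same holds with
  \<open>K\<^bsub>2\<pi>/l\<^esub>\<close>, because \<open>l \<notin> \<Gamma>\<^sub>P\<close> says that
  \<open>(m/n)\<^bsup>-il\<^esup> \<noteq> 1\<close> for \<open>m \<noteq> n\<close>. So the theorem holds for partial sums
  (\<open>continuous_trig_poly_averages\<close>), and in mean square the partial sums converge to
  \<open>L(\<sigma>, x)\<close> on the group. What has to be shown is that they also approximate
  \<open>\<L>(\<sigma> + it)\<close> in mean square over \<open>t\<close>, once a set \<open>A\<close> of density zero is removed.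
  A function \<open>p\<close> with \<open>p(z) = O(|z|\<^sup>2)\<close> can then be passed to the limit
  (\<open>mean_value_of_quadratic_growth\<close>).

  Membership in the class \<open>N(u)\<close> gives blocks \<open>[nl, (n+1)l)\<close>, with \<open>n\<close> in a set of lower
  density close to \<open>1\<close>, near which \<open>\<L>\<close> is holomorphic and bounded by a constant \<open>M\<close>: since
  \<open>\<L>\<close> is bounded on the line \<open>\<sigma> = 2\<close>, Hurwitz's theorem rules out the limit function
  infinity, and a normal family without this limit is locally bounded
  (\<open>normal_family_bounded_on_compact\<close>). In such a block let \<open>f = \<L> - P\<^sub>k\<close>.

  The mean square of \<open>f\<close> over these blocks is estimated without any convexity theorem. For a
  rectangle that reaches to the left of \<open>\<sigma>\<close> and to the right of \<open>1\<close>, and for \<open>\<eta> > 0\<close>, there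
  are points \<open>s\<^sub>i > 1\<close> and coefficients \<open>c\<^sub>i\<close> such that
  \<open>|F(\<sigma>) - \<Sum> c\<^sub>i F(s\<^sub>i)| \<le> \<eta> M\<close> for all holomorphic \<open>F\<close> bounded by \<open>M\<close> on the
  rectangle (\<open>right_functional_near\<close>); this is interpolation along a chain of discs.
  Applied to \<open>F(s) = f(s + it)\<close>, it replaces \<open>f(\<sigma> + it)\<close> by an absolutely convergent series
  \<open>\<Sum> b\<^sub>m d\<^sub>m m\<^bsup>-it\<^esup>\<close>, whose mean square is known. Applied to \<open>F(s) = m\<^bsup>-s\<^esup>\<close>, it
  shows that \<open>|d\<^sub>m| \<le> 2 m\<^bsup>-\<beta>\<^esup>\<close>, where \<open>\<beta>\<close> is the left edge of the rectangle. Letting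
  \<open>\<eta>\<close> tend to \<open>0\<close> for fixed \<open>M\<close>, the mean square of \<open>f\<close> over the good blocks is at most
  a constant times \<open>\<Sum>\<^bsub>m>k\<^esub> |a(m)|\<^sup>2 m\<^bsup>-2\<beta>\<^esup>\<close> in the limit, whatever \<open>M\<close> is
  (\<open>mean_square_on_good_times\<close>).

  The bound does not depend on the density of the good blocks nor on \<open>M\<close>, so
  sets of good blocks of densities tending to \<open>1\<close> can be used one after the other on rapidly
  growing intervals (\<open>diagonal_density\<close>). The blocks left out form the set \<open>A\<close>, and the
  procedure treats all pairs of a function \<open>\<L>\<^sub>j\<close> and an index \<open>k\<close> at once.\<close>

section \<open>Trigonometric polynomials and their mean values\<close>

text \<open>Both sides of the theorem evaluate polynomials in completely multiplicative unimodular functions: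
  \<open>n \<mapsto> n\<^bsup>-it\<^esup>\<close> at time \<open>t\<close>, and \<open>n \<mapsto> x(log n)\<close> at a point \<open>x\<close> of the group.
  The comparison of means takes place at this level of abstraction.\<close>

definition unimodular_mult :: "(nat \<Rightarrow> complex) \<Rightarrow> bool" where
  "unimodular_mult \<psi> \<longleftrightarrow>
     (\<forall>n\<ge>1. cmod (\<psi> n) = 1) \<and> (\<forall>m\<ge>1. \<forall>n\<ge>1. \<psi> (m * n) = \<psi> m * \<psi> n)"

lemma unimodular_multD:
  assumes "unimodular_mult \<psi>"
  shows "n \<ge> 1 \<Longrightarrow> cmod (\<psi> n) = 1" and "n \<ge> 1 \<Longrightarrow> \<psi> n * cnj (\<psi> n) = 1"
    and "m \<ge> 1 \<Longrightarrow> n \<ge> 1 \<Longrightarrow> \<psi> (m * n) = \<psi> m * \<psi> n" and "\<psi> 1 = 1" and "\<psi> (Suc 0) = 1"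
proof -
  show 1: "n \<ge> 1 \<Longrightarrow> cmod (\<psi> n) = 1" for n
    using assms by (auto simp: unimodular_mult_def)
  show 2: "n \<ge> 1 \<Longrightarrow> \<psi> n * cnj (\<psi> n) = 1"
    by (simp add: complex_norm_square [symmetric] 1)
  show 3: "m \<ge> 1 \<Longrightarrow> n \<ge> 1 \<Longrightarrow> \<psi> (m * n) = \<psi> m * \<psi> n" for m n
    using assms by (auto simp: unimodular_mult_def)
  have "\<psi> 1 = \<psi> 1 * \<psi> 1" "\<psi> 1 \<noteq> 0"
    using 3[of 1 1] 1[of 1] by auto
  then show "\<psi> 1 = 1" by simp
  then show "\<psi> (Suc 0) = 1" by simp
qed

text \<open>The coefficients may depend on a parameter \<open>\<sigma> \<in> S\<close>, but only in a bounded way; this makes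
  every limit of means below uniform in \<open>\<sigma>\<close>. The rule \<open>cong\<close> lets two expressions count as equal
  when they agree on the functions that occur.\<close>

inductive trig_poly :: "'s set \<Rightarrow> ('s \<Rightarrow> (nat \<Rightarrow> complex) \<Rightarrow> complex) \<Rightarrow> bool" for S where
  monomial: "\<lbrakk>1 \<le> A; 1 \<le> B; bounded (c ` S)\<rbrakk>
     \<Longrightarrow> trig_poly S (\<lambda>\<sigma> \<psi>. c \<sigma> * (\<psi> A * cnj (\<psi> B)))"
| add: "\<lbrakk>trig_poly S \<Phi>; trig_poly S \<Psi>\<rbrakk> \<Longrightarrow> trig_poly S (\<lambda>\<sigma> \<psi>. \<Phi> \<sigma> \<psi> + \<Psi> \<sigma> \<psi>)"
| cong: "\<lbrakk>trig_poly S \<Phi>; \<And>\<sigma> \<psi>. \<sigma> \<in> S \<Longrightarrow> unimodular_mult \<psi> \<Longrightarrow> \<Psi> \<sigma> \<psi> = \<Phi> \<sigma> \<psi>\<rbrakk>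
     \<Longrightarrow> trig_poly S \<Psi>"

lemma trig_poly_const: "bounded (c ` S) \<Longrightarrow> trig_poly S (\<lambda>\<sigma> \<psi>. c \<sigma>)"
  by (rule trig_poly.cong[OF trig_poly.monomial[of 1 1 c]]) (auto simp: unimodular_multD)

lemma trig_poly_constant: "trig_poly S (\<lambda>\<sigma> \<psi>. c)"
  by (rule trig_poly_const) (auto simp: bounded_iff)

lemma trig_poly_sum:
  assumes "\<And>i. i \<in> I \<Longrightarrow> trig_poly S (\<Phi> i)"
  shows "trig_poly S (\<lambda>\<sigma> \<psi>. \<Sum>i\<in>I. \<Phi> i \<sigma> \<psi>)"
  using assms
proof (induction I rule: infinite_finite_induct)
  case (insert i I)
  then show ?case using trig_poly.add[of S "\<Phi> i" "\<lambda>\<sigma> \<psi>. \<Sum>i\<in>I. \<Phi> i \<sigma> \<psi>"] by simp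
qed (simp_all add: trig_poly_constant)

lemma trig_poly_cnj:
  assumes "trig_poly S \<Phi>" shows "trig_poly S (\<lambda>\<sigma> \<psi>. cnj (\<Phi> \<sigma> \<psi>))"
  using assms
proof induction
  case (monomial A B c)
  have "bounded ((\<lambda>\<sigma>. cnj (c \<sigma>)) ` S)"
    using monomial by (auto simp: bounded_iff)
  with monomial show ?case
    by (intro trig_poly.cong[OF trig_poly.monomial[of B A "\<lambda>\<sigma>. cnj (c \<sigma>)"]]) auto
next
  case (add \<Phi> \<Psi>)
  then show ?case by (auto intro: trig_poly.add)
next
  case (cong \<Phi> \<Psi>)
  show ?case by (rule trig_poly.cong[OF cong.IH]) (simp add: cong)
qed

lemma bounded_mult_image:
  fixes c d :: "'s \<Rightarrow> complex"
  assumes "bounded (c ` S)" "bounded (d ` S)"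
  shows "bounded ((\<lambda>\<sigma>. c \<sigma> * d \<sigma>) ` S)"
proof -
  from assms obtain C D where "\<And>s. s \<in> S \<Longrightarrow> cmod (c s) \<le> C" "\<And>s. s \<in> S \<Longrightarrow> cmod (d s) \<le> D"
    unfolding bounded_iff by auto
  then have "\<forall>s\<in>S. cmod (c s * d s) \<le> C * D"
    by (auto simp: norm_mult intro!: mult_mono' norm_ge_zero)
  then show ?thesis unfolding bounded_iff by auto
qed

text \<open>Complete multiplicativity turns a product of two monomials into a monomial.\<close>

lemma trig_poly_mult:
  assumes "trig_poly S \<Phi>" "trig_poly S \<Psi>"
  shows "trig_poly S (\<lambda>\<sigma> \<psi>. \<Phi> \<sigma> \<psi> * \<Psi> \<sigma> \<psi>)"
  using assms(1)
proof induction
  case (monomial A B c)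
  show ?case using assms(2)
  proof induction
    case (monomial A' B' d)
    have "trig_poly S (\<lambda>\<sigma> \<psi>. (c \<sigma> * d \<sigma>) * (\<psi> (A * A') * cnj (\<psi> (B * B'))))"
      by (rule trig_poly.monomial)
         (use \<open>1 \<le> A\<close> \<open>1 \<le> B\<close> monomial \<open>bounded (c ` S)\<close> in
           \<open>auto intro!: bounded_mult_image simp: Suc_le_eq\<close>)
    then show ?case
      by (rule trig_poly.cong)
         (use monomial \<open>1 \<le> A\<close> \<open>1 \<le> B\<close> in \<open>simp add: unimodular_multD(3)\<close>)
  next
    case (add \<Phi> \<Psi>)
    show ?case by (rule trig_poly.cong[OF trig_poly.add[OF add.IH]]) (simp add: algebra_simps)
  next
    case (cong \<Phi> \<Psi>)
    show ?case by (rule trig_poly.cong[OF cong.IH]) (simp add: cong)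
  qed
next
  case (add \<Phi> \<Psi>)
  show ?case by (rule trig_poly.cong[OF trig_poly.add[OF add.IH]]) (simp add: algebra_simps)
next
  case (cong \<Phi> \<Psi>)
  show ?case by (rule trig_poly.cong[OF cong.IH]) (simp add: cong)
qed

lemma trig_poly_bounded:
  assumes "trig_poly S \<Phi>"
  shows "\<exists>C. \<forall>\<sigma>\<in>S. \<forall>\<psi>. unimodular_mult \<psi> \<longrightarrow> cmod (\<Phi> \<sigma> \<psi>) \<le> C"
  using assms
proof induction
  case (monomial A B c)
  then obtain C where "\<forall>\<sigma>\<in>S. cmod (c \<sigma>) \<le> C" by (auto simp: bounded_iff)
  with monomial show ?case
    by (intro exI[of _ C]) (auto simp: norm_mult unimodular_multD)
next
  case (add \<Phi> \<Psi>)
  then obtain C D where "\<forall>\<sigma>\<in>S. \<forall>\<psi>. unimodular_mult \<psi> \<longrightarrow> cmod (\<Phi> \<sigma> \<psi>) \<le> C"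
    "\<forall>\<sigma>\<in>S. \<forall>\<psi>. unimodular_mult \<psi> \<longrightarrow> cmod (\<Psi> \<sigma> \<psi>) \<le> D" by auto
  then show ?case
    by (intro exI[of _ "C + D"]) (auto intro!: order.trans[OF norm_triangle_ineq] add_mono)
next
  case (cong \<Phi> \<Psi>)
  then show ?case by auto
qed

lemma trig_poly_measurable:
  assumes "trig_poly S \<Phi>" "\<sigma> \<in> S"
    and "\<And>n. 1 \<le> n \<Longrightarrow> (\<lambda>\<omega>. W \<omega> n) \<in> borel_measurable N"
    and "\<And>\<omega>. \<omega> \<in> space N \<Longrightarrow> unimodular_mult (W \<omega>)"
  shows "(\<lambda>\<omega>. \<Phi> \<sigma> (W \<omega>)) \<in> borel_measurable N"
  using assms(1)
proof induction
  case (monomial A B c)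
  have [measurable]: "(\<lambda>\<omega>. W \<omega> A) \<in> borel_measurable N" "(\<lambda>\<omega>. W \<omega> B) \<in> borel_measurable N"
    using monomial assms by auto
  have "(\<lambda>\<omega>. cnj (W \<omega> B)) \<in> borel_measurable N"
    by (rule borel_measurable_continuous_on[of cnj]) (auto intro!: continuous_intros)
  then show ?case by measurable
next
  case (add \<Phi> \<Psi>)
  then show ?case by auto
next
  case (cong \<Phi> \<Psi>)
  have "(\<lambda>\<omega>. \<Psi> \<sigma> (W \<omega>)) \<in> borel_measurable N \<longleftrightarrow> (\<lambda>\<omega>. \<Phi> \<sigma> (W \<omega>)) \<in> borel_measurable N"
    by (rule measurable_cong) (use cong assms in auto)
  with cong show ?case by simp
qed

text \<open>A real-linear functional of \<open>z\<close> is a combination of \<open>z\<close> and its conjugate.\<close>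

lemma trig_poly_real_polynomial:
  assumes P: "trig_poly S P" and "real_polynomial_function r"
  shows "trig_poly S (\<lambda>\<sigma> \<psi>. of_real (r (P \<sigma> \<psi>)))"
  using assms(2)
proof induction
  case (linear f)
  interpret bounded_linear f by fact
  have f: "complex_of_real (f z) = of_real (f 1) * ((z + cnj z) * (1/2)) +
      of_real (f \<i>) * ((z + (-1) * cnj z) * (- \<i> / 2))" for z
  proof -
    have "f z = f (Re z *\<^sub>R 1 + Im z *\<^sub>R \<i>)"
      by (rule arg_cong[of _ _ f], simp add: complex_eq_iff)
    also have "\<dots> = Re z * f 1 + Im z * f \<i>" by (simp only: add scaleR real_scaleR_def)
    finally show ?thesis
      by (auto simp: complex_eq_iff)
  qed
  have "trig_poly S (\<lambda>\<sigma> \<psi>. of_real (f 1) * ((P \<sigma> \<psi> + cnj (P \<sigma> \<psi>)) * (1/2)) +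
      of_real (f \<i>) * ((P \<sigma> \<psi> + (-1) * cnj (P \<sigma> \<psi>)) * (- \<i> / 2)))"
    by (intro trig_poly.add trig_poly_mult trig_poly_constant P trig_poly_cnj)
  then show ?case by (rule trig_poly.cong) (rule f)
next
  case (const c)
  then show ?case by (simp add: trig_poly_constant)
next
  case (add f g)
  show ?case using trig_poly.add[OF add.IH] by simp
next
  case (mult f g)
  show ?case using trig_poly_mult[OF mult.IH] by simp
qed

lemma trig_poly_polynomial:
  fixes g :: "complex \<Rightarrow> complex"
  assumes P: "trig_poly S P" and g: "polynomial_function g"
  shows "trig_poly S (\<lambda>\<sigma> \<psi>. g (P \<sigma> \<psi>))"
proof -
  have "real_polynomial_function (Re \<circ> g)" "real_polynomial_function (Im \<circ> g)"
    using g bounded_linear_Re bounded_linear_Im by (auto simp: polynomial_function_def)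
  from this[THEN trig_poly_real_polynomial[OF P]]
  have "trig_poly S (\<lambda>\<sigma> \<psi>. of_real (Re (g (P \<sigma> \<psi>))))" "trig_poly S (\<lambda>\<sigma> \<psi>. of_real (Im (g (P \<sigma> \<psi>))))"
    by (auto simp: o_def)
  moreover have "trig_poly S (\<lambda>\<sigma> \<psi>. \<i>)"
    by (rule trig_poly_constant)
  ultimately have "trig_poly S (\<lambda>\<sigma> \<psi>. of_real (Re (g (P \<sigma> \<psi>))) + \<i> * of_real (Im (g (P \<sigma> \<psi>))))"
    by (intro trig_poly.add trig_poly_mult)
  then show ?thesis
    by (rule trig_poly.cong) (simp add: complex_eq)
qed

text \<open>A trigonometric polynomial \<open>P\<close> takes values in a fixed disc, on which \<open>p\<close> is uniformly
  approximated by a real polynomial function (Stone-Weierstrass).\<close>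

lemma trig_poly_approx_continuous:
  fixes p :: "complex \<Rightarrow> complex"
  assumes P: "trig_poly S P" and p: "continuous_on UNIV p" and e: "0 < e"
  obtains \<Phi> where "trig_poly S \<Phi>"
    "\<And>\<sigma> \<psi>. \<sigma> \<in> S \<Longrightarrow> unimodular_mult \<psi> \<Longrightarrow> cmod (p (P \<sigma> \<psi>) - \<Phi> \<sigma> \<psi>) < e"
proof -
  obtain C where C: "\<forall>\<sigma>\<in>S. \<forall>\<psi>. unimodular_mult \<psi> \<longrightarrow> cmod (P \<sigma> \<psi>) \<le> C"
    using trig_poly_bounded[OF P] by auto
  have "continuous_on (cball 0 C) p" using p continuous_on_subset by blast
  then obtain g where g: "polynomial_function g" "\<forall>x\<in>cball 0 C. cmod (p x - g x) < e"
    using Stone_Weierstrass_polynomial_function[of "cball 0 C" p e] e by auto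
  show ?thesis
    by (rule that[OF trig_poly_polynomial[OF P g(1)]]) (use g C in auto)
qed

lemma trig_poly_approx_integral:
  fixes p :: "complex \<Rightarrow> complex"
  assumes P: "trig_poly S P" and p: "continuous_on UNIV p" and \<Phi>: "trig_poly S \<Phi>"
    "\<And>\<sigma> \<psi>. \<sigma> \<in> S \<Longrightarrow> unimodular_mult \<psi> \<Longrightarrow> cmod (p (P \<sigma> \<psi>) - \<Phi> \<sigma> \<psi>) < e"
    and "\<sigma> \<in> S" "prob_space N" and W: "\<And>n. 1 \<le> n \<Longrightarrow> (\<lambda>\<omega>. W \<omega> n) \<in> borel_measurable N"
    and uni: "\<And>\<omega>. \<omega> \<in> space N \<Longrightarrow> unimodular_mult (W \<omega>)"
  shows "cmod ((\<integral>\<omega>. p (P \<sigma> (W \<omega>)) \<partial>N) - (\<integral>\<omega>. \<Phi> \<sigma> (W \<omega>) \<partial>N)) \<le> e"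
proof -
  interpret N: prob_space N by fact
  obtain C where C: "\<forall>\<sigma>\<in>S. \<forall>\<psi>. unimodular_mult \<psi> \<longrightarrow> cmod (\<Phi> \<sigma> \<psi>) \<le> C"
    using trig_poly_bounded[OF \<Phi>(1)] by auto
  note m = trig_poly_measurable[OF P \<open>\<sigma> \<in> S\<close> W, simplified]
           trig_poly_measurable[OF \<Phi>(1) \<open>\<sigma> \<in> S\<close> W, simplified]
  have m1: "(\<lambda>\<omega>. p (P \<sigma> (W \<omega>))) \<in> borel_measurable N"
    by (rule borel_measurable_continuous_on[OF p]) (use m assms in auto)
  have m2: "(\<lambda>\<omega>. \<Phi> \<sigma> (W \<omega>)) \<in> borel_measurable N"
    by (use m assms in auto)
  have b: "cmod (p (P \<sigma> (W \<omega>))) \<le> C + e" if "\<omega> \<in> space N" for \<omega>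
  proof -
    have "unimodular_mult (W \<omega>)" using that uni by auto
    then have "cmod (p (P \<sigma> (W \<omega>)) - \<Phi> \<sigma> (W \<omega>)) < e" "cmod (\<Phi> \<sigma> (W \<omega>)) \<le> C"
      using \<Phi>(2) C \<open>\<sigma> \<in> S\<close> by auto
    then show ?thesis
      using norm_triangle_ineq2[of "p (P \<sigma> (W \<omega>))" "\<Phi> \<sigma> (W \<omega>)"] by linarith
  qed
  have i1: "integrable N (\<lambda>\<omega>. p (P \<sigma> (W \<omega>)))"
    by (rule N.integrable_const_bound[OF _ m1, of "C + e"]) (use b in auto)
  have i2: "integrable N (\<lambda>\<omega>. \<Phi> \<sigma> (W \<omega>))"
    by (rule N.integrable_const_bound[OF _ m2, of C]) (use C assms uni in auto)
  have "cmod ((\<integral>\<omega>. p (P \<sigma> (W \<omega>)) \<partial>N) - (\<integral>\<omega>. \<Phi> \<sigma> (W \<omega>) \<partial>N))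
      = cmod (\<integral>\<omega>. p (P \<sigma> (W \<omega>)) - \<Phi> \<sigma> (W \<omega>) \<partial>N)"
    using i1 i2 by simp
  also have "\<dots> \<le> (\<integral>\<omega>. cmod (p (P \<sigma> (W \<omega>)) - \<Phi> \<sigma> (W \<omega>)) \<partial>N)"
    by (rule integral_norm_bound)
  also have "\<dots> \<le> (\<integral>\<omega>. e \<partial>N)"
    by (rule integral_mono) (use i1 i2 \<Phi>(2) assms in \<open>auto intro!: less_imp_le\<close>)
  also have "\<dots> = e" by (simp add: N.prob_space)
  finally show ?thesis .
qed

text \<open>An averaging procedure along the filter \<open>F\<close>: a probability measure \<open>M i\<close> on sampling points and,
  for each parameter \<open>y\<close>, a multiplicative function attached to each sampling point. Asymptotic
  orthogonality is required uniformly in \<open>y\<close>.\<close>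

locale averaging_scheme =
  fixes F :: "'i filter" and M :: "'i \<Rightarrow> 'b measure"
    and X :: "'y \<Rightarrow> 'b \<Rightarrow> nat \<Rightarrow> complex" and Y :: "'y set"
  assumes prob: "\<And>i. prob_space (M i)"
    and meas: "\<And>i y n. y \<in> Y \<Longrightarrow> 1 \<le> n \<Longrightarrow> (\<lambda>\<omega>. X y \<omega> n) \<in> borel_measurable (M i)"
    and unimodular: "\<And>i y \<omega>. y \<in> Y \<Longrightarrow> \<omega> \<in> space (M i) \<Longrightarrow> unimodular_mult (X y \<omega>)"
    and orth: "\<And>A B. 1 \<le> A \<Longrightarrow> 1 \<le> B \<Longrightarrow> A \<noteq> B \<Longrightarrow>
      uniform_limit Y (\<lambda>i y. \<integral>\<omega>. X y \<omega> A * cnj (X y \<omega> B) \<partial>M i) (\<lambda>_. 0) F"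

locale orthonormal_characters =
  fixes \<mu> :: "'k measure" and Z :: "'k \<Rightarrow> nat \<Rightarrow> complex"
  assumes prob_K: "prob_space \<mu>"
    and meas_K: "\<And>n. 1 \<le> n \<Longrightarrow> (\<lambda>x. Z x n) \<in> borel_measurable \<mu>"
    and unimodular_K: "\<And>x. x \<in> space \<mu> \<Longrightarrow> unimodular_mult (Z x)"
    and orth_K: "\<And>A B. 1 \<le> A \<Longrightarrow> 1 \<le> B \<Longrightarrow> A \<noteq> B \<Longrightarrow> (\<integral>x. Z x A * cnj (Z x B) \<partial>\<mu>) = 0"
begin

sublocale K: prob_space \<mu> by (rule prob_K)

lemma trig_poly_integrable_K:
  assumes "trig_poly S \<Phi>" "\<sigma> \<in> S"
  shows "integrable \<mu> (\<lambda>x. \<Phi> \<sigma> (Z x))"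
proof -
  obtain C where "\<forall>\<sigma>\<in>S. \<forall>\<psi>. unimodular_mult \<psi> \<longrightarrow> cmod (\<Phi> \<sigma> \<psi>) \<le> C"
    using trig_poly_bounded[OF assms(1)] by auto
  then show ?thesis
    by (intro K.integrable_const_bound[of _ C] trig_poly_measurable[OF assms] meas_K
        unimodular_K AE_I2) (use assms in \<open>auto simp: unimodular_K\<close>)
qed

end

context averaging_scheme
begin

lemma trig_poly_integrable:
  assumes "trig_poly S \<Phi>" "\<sigma> \<in> S" "y \<in> Y"
  shows "integrable (M i) (\<lambda>\<omega>. \<Phi> \<sigma> (X y \<omega>))"
proof -
  interpret prob_space "M i" by (rule prob)
  obtain C where "\<forall>\<sigma>\<in>S. \<forall>\<psi>. unimodular_mult \<psi> \<longrightarrow> cmod (\<Phi> \<sigma> \<psi>) \<le> C"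
    using trig_poly_bounded[OF assms(1)] by auto
  then show ?thesis
    by (intro integrable_const_bound[of _ C] trig_poly_measurable[OF assms(1,2)] meas
        unimodular AE_I2) (use assms in \<open>auto simp: unimodular\<close>)
qed

end

locale averaging_to_characters = averaging_scheme F M X Y + orthonormal_characters \<mu> Z
  for F :: "'i filter" and M :: "'i \<Rightarrow> 'b measure"
    and X :: "'y \<Rightarrow> 'b \<Rightarrow> nat \<Rightarrow> complex" and Y :: "'y set"
    and \<mu> :: "'k measure" and Z :: "'k \<Rightarrow> nat \<Rightarrow> complex"
begin

text \<open>Both integrals pick out the coefficients of the monomials with \<open>A = B\<close>, the first in the limit.\<close>

lemma trig_poly_averages:
  assumes "trig_poly S \<Phi>"
  shows "uniform_limit (S \<times> Y) (\<lambda>i (\<sigma>, y). \<integral>\<omega>. \<Phi> \<sigma> (X y \<omega>) \<partial>M i)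
           (\<lambda>(\<sigma>, y). \<integral>x. \<Phi> \<sigma> (Z x) \<partial>\<mu>) F"
  using assms
proof induction
  case (monomial A B c)
  then obtain C where C: "\<forall>\<sigma>\<in>S. cmod (c \<sigma>) \<le> C" by (auto simp: bounded_iff)
  show ?case
  proof (cases "A = B")
    case True
    have *: "(\<integral>\<omega>. c \<sigma> * (X y \<omega> A * cnj (X y \<omega> B)) \<partial>M i) = c \<sigma>" if "y \<in> Y" for i \<sigma> y
    proof -
      interpret prob_space "M i" by (rule prob)
      have "(\<integral>\<omega>. c \<sigma> * (X y \<omega> A * cnj (X y \<omega> B)) \<partial>M i) = (\<integral>\<omega>. c \<sigma> \<partial>M i)"
        by (rule Bochner_Integration.integral_cong)
           (use True monomial that in \<open>auto simp: unimodular_multD(2)[OF unimodular]\<close>)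
      then show ?thesis by (simp add: prob_space)
    qed
    have **: "(\<integral>x. c \<sigma> * (Z x A * cnj (Z x B)) \<partial>\<mu>) = c \<sigma>" for \<sigma>
    proof -
      have "(\<integral>x. c \<sigma> * (Z x A * cnj (Z x B)) \<partial>\<mu>) = (\<integral>x. c \<sigma> \<partial>\<mu>)"
        by (rule Bochner_Integration.integral_cong)
           (use True monomial in \<open>auto simp: unimodular_multD(2)[OF unimodular_K]\<close>)
      then show ?thesis by (simp add: K.prob_space)
    qed
    show ?thesis
    proof (rule uniform_limitI)
      fix e :: real assume "0 < e"
      then show "\<forall>\<^sub>F i in F. \<forall>x\<in>S \<times> Y.
          dist (case x of (\<sigma>, y) \<Rightarrow> \<integral>\<omega>. c \<sigma> * (X y \<omega> A * cnj (X y \<omega> B)) \<partial>M i)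
               (case x of (\<sigma>, y) \<Rightarrow> \<integral>x. c \<sigma> * (Z x A * cnj (Z x B)) \<partial>\<mu>) < e"
        by (intro always_eventually allI ballI, elim SigmaE) (simp only: prod.case * ** dist_self)
    qed
  next
    case False
    show ?thesis
    proof (rule uniform_limitI)
      fix e :: real assume e: "e > 0"
      have "\<forall>\<^sub>F i in F. \<forall>y\<in>Y. dist (\<integral>\<omega>. X y \<omega> A * cnj (X y \<omega> B) \<partial>M i) 0 < e / (\<bar>C\<bar> + 1)"
        by (rule uniform_limitD[OF orth]) (use monomial False e in auto)
      then show "\<forall>\<^sub>F i in F. \<forall>x\<in>S \<times> Y.
          dist (case x of (\<sigma>, y) \<Rightarrow> \<integral>\<omega>. c \<sigma> * (X y \<omega> A * cnj (X y \<omega> B)) \<partial>M i)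
               (case x of (\<sigma>, y) \<Rightarrow> \<integral>x. c \<sigma> * (Z x A * cnj (Z x B)) \<partial>\<mu>) < e"
      proof eventually_elim
        case (elim i)
        have "cmod (c \<sigma>) * cmod (\<integral>\<omega>. X y \<omega> A * cnj (X y \<omega> B) \<partial>M i) < e"
          if "\<sigma> \<in> S" "y \<in> Y" for \<sigma> y
        proof -
          have "cmod (c \<sigma>) * cmod (\<integral>\<omega>. X y \<omega> A * cnj (X y \<omega> B) \<partial>M i)
             \<le> (\<bar>C\<bar> + 1) * cmod (\<integral>\<omega>. X y \<omega> A * cnj (X y \<omega> B) \<partial>M i)"
            using C that by (intro mult_right_mono) auto
          also have "\<dots> < (\<bar>C\<bar> + 1) * (e / (\<bar>C\<bar> + 1))"
            using elim that by (intro mult_strict_left_mono) auto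
          also have "\<dots> = e" by (simp add: add_pos_nonneg field_simps)
          finally show ?thesis .
        qed
        then show ?case using False monomial by (auto simp: orth_K norm_mult)
      qed
    qed
  qed
next
  case (add \<Phi> \<Psi>)
  show ?case
    using uniform_limit_add[OF add.IH] 
    by (rule uniform_limit_cong'[THEN iffD1, rotated -1])
       (auto simp: trig_poly_integrable[OF add.hyps(1)] trig_poly_integrable[OF add.hyps(2)]
         trig_poly_integrable_K[OF add.hyps(1)] trig_poly_integrable_K[OF add.hyps(2)])
next
  case (cong \<Phi> \<Psi>)
  have 1: "(\<integral>\<omega>. \<Psi> \<sigma> (X y \<omega>) \<partial>M i) = (\<integral>\<omega>. \<Phi> \<sigma> (X y \<omega>) \<partial>M i)" if "\<sigma> \<in> S" "y \<in> Y" for \<sigma> y i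
    by (rule Bochner_Integration.integral_cong) (use cong that unimodular in auto)
  have 2: "(\<integral>x. \<Psi> \<sigma> (Z x) \<partial>\<mu>) = (\<integral>x. \<Phi> \<sigma> (Z x) \<partial>\<mu>)" if "\<sigma> \<in> S" for \<sigma>
    by (rule Bochner_Integration.integral_cong) (use cong that unimodular_K in auto)
  show ?case
    using cong.IH by (rule uniform_limit_cong'[THEN iffD1, rotated -1]) (auto simp: 1 2)
qed

end

lemma continuous_trig_poly_averages:
  fixes p :: "complex \<Rightarrow> complex"
  assumes "averaging_to_characters F M X Y \<mu> Z"
    and P: "trig_poly S P" and p: "continuous_on UNIV p"
  shows "uniform_limit (S \<times> Y) (\<lambda>i (\<sigma>, y). \<integral>\<omega>. p (P \<sigma> (X y \<omega>)) \<partial>M i)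
           (\<lambda>(\<sigma>, y). \<integral>x. p (P \<sigma> (Z x)) \<partial>\<mu>) F"
proof -
  interpret averaging_to_characters F M X Y \<mu> Z by fact
  have main: "\<forall>\<^sub>F i in F. \<forall>\<sigma>\<in>S. \<forall>y\<in>Y.
      dist (\<integral>\<omega>. p (P \<sigma> (X y \<omega>)) \<partial>M i) (\<integral>x. p (P \<sigma> (Z x)) \<partial>\<mu>) < e" if e: "0 < e" for e
  proof -
    obtain \<Phi> where \<Phi>: "trig_poly S \<Phi>"
      and \<Phi>2: "\<And>\<sigma> \<psi>. \<sigma> \<in> S \<Longrightarrow> unimodular_mult \<psi> \<Longrightarrow> cmod (p (P \<sigma> \<psi>) - \<Phi> \<sigma> \<psi>) < e / 4"
      by (rule trig_poly_approx_continuous[OF P p, of "e / 4"]) (use e in auto)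
    have lim: "\<forall>\<^sub>F i in F. \<forall>x\<in>S \<times> Y. dist (case x of (\<sigma>, y) \<Rightarrow> \<integral>\<omega>. \<Phi> \<sigma> (X y \<omega>) \<partial>M i)
          (case x of (\<sigma>, y) \<Rightarrow> \<integral>x. \<Phi> \<sigma> (Z x) \<partial>\<mu>) < e / 4"
      by (rule uniform_limitD[OF trig_poly_averages[OF \<Phi>]]) (use e in auto)
    show ?thesis
      using lim
    proof (rule eventually_mono, intro ballI)
      fix i \<sigma> y
      assume A: "\<forall>x\<in>S \<times> Y. dist (case x of (\<sigma>, y) \<Rightarrow> \<integral>\<omega>. \<Phi> \<sigma> (X y \<omega>) \<partial>M i)
          (case x of (\<sigma>, y) \<Rightarrow> \<integral>x. \<Phi> \<sigma> (Z x) \<partial>\<mu>) < e / 4"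
        and sy: "\<sigma> \<in> S" "y \<in> Y"
      define a b c d where "a = (\<integral>\<omega>. p (P \<sigma> (X y \<omega>)) \<partial>M i)" and "b = (\<integral>\<omega>. \<Phi> \<sigma> (X y \<omega>) \<partial>M i)"
        and "c = (\<integral>x. \<Phi> \<sigma> (Z x) \<partial>\<mu>)" and "d = (\<integral>x. p (P \<sigma> (Z x)) \<partial>\<mu>)"
      have 1: "cmod (a - b) \<le> e / 4" unfolding a_def b_def
        by (rule trig_poly_approx_integral[OF P p \<Phi> \<Phi>2 sy(1) prob meas[OF sy(2)] unimodular[OF sy(2)]])
      have 2: "cmod (d - c) \<le> e / 4" unfolding c_def d_def
        by (rule trig_poly_approx_integral[OF P p \<Phi> \<Phi>2 sy(1) prob_K meas_K unimodular_K])
      have 3: "dist b c < e / 4"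
        using A sy unfolding b_def c_def by force
      have "dist a d < e"
        using dist_triangle[of a d b] dist_triangle[of b d c] 1 2 3 e dist_commute[of c d]
        unfolding dist_norm[of a b] dist_norm[of d c] by linarith
      then show "dist (\<integral>\<omega>. p (P \<sigma> (X y \<omega>)) \<partial>M i) (\<integral>x. p (P \<sigma> (Z x)) \<partial>\<mu>) < e"
        unfolding a_def d_def .
    qed
  qed
  show ?thesis
    by (rule uniform_limitI, rule eventually_mono[OF main]) auto
qed

section \<open>Functions of quadratic growth\<close>

lemma quadratic_growth_bound:
  fixes p :: "complex \<Rightarrow> complex"
  assumes p: "continuous_on UNIV p" and O: "p \<in> O[at_infinity](\<lambda>z. of_real ((cmod z)\<^sup>2))"
  obtains C where "0 < C" "\<And>z. cmod (p z) \<le> C * (1 + (cmod z)\<^sup>2)"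
proof -
  obtain c where c: "c > 0" "\<forall>\<^sub>F z in at_infinity. cmod (p z) \<le> c * cmod (of_real ((cmod z)\<^sup>2))"
    using O by (elim landau_o.bigE)
  then obtain b where b: "\<And>z. b \<le> cmod z \<Longrightarrow> cmod (p z) \<le> c * (cmod z)\<^sup>2"
    unfolding eventually_at_infinity by (auto simp: norm_power)
  have "compact (p ` cball 0 b)"
    by (intro compact_continuous_image continuous_on_subset[OF p]) auto
  then obtain B where B: "\<forall>z\<in>cball 0 b. cmod (p z) \<le> B"
    by (auto simp: bounded_iff dest!: compact_imp_bounded)
  show ?thesis
  proof (rule that[of "c + \<bar>B\<bar>"])
    show "0 < c + \<bar>B\<bar>" using c by auto
    fix z
    have "c * (cmod z)\<^sup>2 \<le> (c + \<bar>B\<bar>) * (1 + (cmod z)\<^sup>2)" "\<bar>B\<bar> \<le> (c + \<bar>B\<bar>) * (1 + (cmod z)\<^sup>2)"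
      using c by (auto simp: algebra_simps)
    moreover have "cmod (p z) \<le> \<bar>B\<bar> \<or> cmod (p z) \<le> c * (cmod z)\<^sup>2"
      using b[of z] B by (cases "b \<le> cmod z") (auto simp: abs_le_iff intro: order.trans[OF _ abs_ge_self])
    ultimately show "cmod (p z) \<le> (c + \<bar>B\<bar>) * (1 + (cmod z)\<^sup>2)" by linarith
  qed
qed

text \<open>Here \<open>w\<close> and \<open>v\<close> are two approximations of \<open>z\<close>, of which \<open>w\<close> is bounded by \<open>r\<close>. The coarse one
  controls the large values of \<open>z\<close>: if \<open>|z| \<ge> 2r\<close> then \<open>|z - w| \<ge> |z|/2\<close>, so that, when also \<open>|z| \<ge> 2\<close>,
  \<open>|p(z)|\<close> is at most a multiple of \<open>|z - w|\<^sup>2\<close> with a factor depending on \<open>C\<close> only. The fine one is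
  compared with \<open>z\<close> through the truncated function \<open>q\<close>, at the price of a factor \<open>D\<close> that depends
  on \<open>r\<close> and \<open>\<epsilon>\<close>. As \<open>w\<close> is chosen before \<open>D\<close> is known and \<open>v\<close> afterwards, both
  errors can be made small.\<close>

lemma cutoff_comparison:
  fixes p :: "complex \<Rightarrow> complex"
  assumes p: "continuous_on UNIV p" and C: "0 < C" "\<And>z. cmod (p z) \<le> C * (1 + (cmod z)\<^sup>2)"
    and \<epsilon>: "0 < \<epsilon>"
  obtains q B D where "continuous_on UNIV q" "\<And>z. cmod (q z) \<le> B" "0 < D"
    "\<And>z w v. cmod w \<le> r \<Longrightarrow>
       cmod (p z - q v) \<le> \<epsilon> + 8 * C * (cmod (z - w))\<^sup>2 + D * (cmod (z - v))\<^sup>2"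
proof -
  \<comment> \<open>At least \<open>1\<close>, so that \<open>1 + |z|\<^sup>2 \<le> 2|z|\<^sup>2\<close> beyond \<open>R\<close>, and at least \<open>2r\<close>.\<close>
  define R where "R = 2 * max 1 r"
  have R: "R \<ge> 2" "R \<ge> 2 * r" by (auto simp: R_def)
  define \<phi> where "\<phi> z = max 0 (min 1 (2 - cmod z / R))" for z :: complex
  have \<phi>: "0 \<le> \<phi> z" "\<phi> z \<le> 1" "cmod z \<le> R \<Longrightarrow> \<phi> z = 1" "2 * R \<le> cmod z \<Longrightarrow> \<phi> z = 0" for z
    using R by (auto simp: \<phi>_def field_simps)
  define q where "q z = of_real (\<phi> z) * p z" for z
  have q: "continuous_on UNIV q"
    unfolding q_def \<phi>_def by (intro continuous_intros p) (use R in auto)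
  have q0: "2 * R \<le> cmod z \<Longrightarrow> q z = 0" for z by (simp add: q_def \<phi>)
  define B where "B = C * (1 + (2 * R)\<^sup>2)"
  have B0: "B > 0" unfolding B_def using C by (intro mult_pos_pos) (auto intro: add_pos_nonneg)
  have qB: "cmod (q z) \<le> B" for z
  proof (cases "2 * R \<le> cmod z")
    case False
    have "cmod (q z) \<le> cmod (p z)"
      using \<phi>[of z] by (auto simp: q_def norm_mult intro!: mult_left_le_one_le)
    also have "\<dots> \<le> C * (1 + (cmod z)\<^sup>2)" by (rule C)
    also have "\<dots> \<le> B" unfolding B_def using C False
      by (intro mult_left_mono add_left_mono power_mono) auto
    finally show ?thesis .
  qed (use B0 q0 in auto)
  have "uniformly_continuous_on (cball 0 (2 * R + 1)) q"
    by (intro compact_uniformly_continuous continuous_on_subset[OF q]) auto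
  then obtain \<delta> where \<delta>: "\<delta> > 0"
    "\<And>z w. z \<in> cball 0 (2*R+1) \<Longrightarrow> w \<in> cball 0 (2*R+1) \<Longrightarrow> dist w z < \<delta> \<Longrightarrow> dist (q w) (q z) < \<epsilon>"
    unfolding uniformly_continuous_on_def using \<epsilon> by metis
  define \<eta> where "\<eta> = min \<delta> 1"
  have \<eta>: "0 < \<eta>" "\<eta> \<le> \<delta>" "\<eta> \<le> 1" using \<delta> by (auto simp: \<eta>_def)
  define D where "D = 2 * B / \<eta>\<^sup>2"
  have D0: "D > 0" using B0 \<eta> by (simp add: D_def)
  have qd: "cmod (q z - q v) \<le> \<epsilon> + D * (cmod (z - v))\<^sup>2" for z v
  proof (cases "cmod (z - v) < \<eta>")
    case True
    show ?thesis
    proof (cases "2 * R \<le> cmod z \<and> 2 * R \<le> cmod v")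
      case True
      then show ?thesis using q0 \<epsilon> D0 by auto
    next
      case False
      have "cmod z \<le> 2 * R + 1" "cmod v \<le> 2 * R + 1"
        using False norm_triangle_ineq2[of z v] norm_triangle_ineq2[of v z] \<open>cmod (z - v) < \<eta>\<close> \<eta>
        by (auto simp: norm_minus_commute)
      then have "dist (q z) (q v) < \<epsilon>"
        using \<open>cmod (z - v) < \<eta>\<close> \<eta> by (intro \<delta>) (auto simp: dist_norm)
      then show ?thesis using D0 by (auto simp: dist_norm intro: add_increasing2)
    qed
  next
    case False
    have "cmod (q z - q v) \<le> 2 * B"
      using norm_triangle_ineq4[of "q z" "q v"] qB[of z] qB[of v] by linarith
    also have "2 * B = D * \<eta>\<^sup>2" using \<eta> by (simp add: D_def)
    also have "\<dots> \<le> D * (cmod (z - v))\<^sup>2"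
      using False D0 \<eta> by (intro mult_left_mono power_mono) auto
    finally show ?thesis using \<epsilon> by simp
  qed
  have pq: "cmod (p z - q z) \<le> 8 * C * (cmod (z - w))\<^sup>2" if w: "cmod w \<le> r" for z w
  proof (cases "cmod z \<le> R")
    case True
    then show ?thesis using C by (simp add: q_def \<phi>)
  next
    case False
    then have z: "cmod z > R" by simp
    have "cmod (p z - q z) = (1 - \<phi> z) * cmod (p z)"
    proof -
      have "p z - q z = of_real (1 - \<phi> z) * p z" by (simp add: q_def algebra_simps)
      then show ?thesis using \<phi>[of z] by (simp only: norm_mult norm_of_real)
    qed
    also have "\<dots> \<le> cmod (p z)" using \<phi>[of z] by (intro mult_left_le_one_le) auto
    also have "\<dots> \<le> C * (1 + (cmod z)\<^sup>2)" by (rule C)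
    also have "\<dots> \<le> C * (2 * (cmod z)\<^sup>2)"
    proof -
      have "1\<^sup>2 \<le> (cmod z)\<^sup>2" using z R by (intro power_mono) auto
      then show ?thesis using C by (intro mult_left_mono) auto
    qed
    also have "(cmod z)\<^sup>2 \<le> (2 * cmod (z - w))\<^sup>2"
    proof (rule power_mono)
      show "cmod z \<le> 2 * cmod (z - w)"
        using norm_triangle_ineq2[of z w] z R w by linarith
    qed auto
    finally show ?thesis using C by (simp add: power2_eq_square mult_left_mono)
  qed
  show ?thesis
  proof (rule that[OF q qB D0])
    fix z w v assume "cmod w \<le> r"
    then show "cmod (p z - q v) \<le> \<epsilon> + 8 * C * (cmod (z - w))\<^sup>2 + D * (cmod (z - v))\<^sup>2"
      using norm_triangle_ineq[of "p z - q z" "q z - q v"] pq[of w z] qd[of z v] by simp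
  qed
qed

lemma cmod_add_squared_le: "(cmod (a + b))\<^sup>2 \<le> 2 * (cmod a)\<^sup>2 + 2 * (cmod b)\<^sup>2"
proof -
  have "(cmod (a + b))\<^sup>2 \<le> (cmod a + cmod b)\<^sup>2"
    by (intro power_mono norm_triangle_ineq) auto
  also have "\<dots> \<le> 2 * (cmod a)\<^sup>2 + 2 * (cmod b)\<^sup>2"
    using sum_squares_bound[of "cmod a" "cmod b"] by (simp add: power2_sum)
  finally show ?thesis .
qed

lemma quadratic_growth_integrable:
  fixes p :: "complex \<Rightarrow> complex" and f :: "'b \<Rightarrow> complex"
  assumes p: "continuous_on UNIV p" and C: "0 < C" "\<And>z. cmod (p z) \<le> C * (1 + (cmod z)\<^sup>2)"
    and N: "finite_measure N" and G: "G \<in> sets N"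
    and f: "(\<lambda>\<omega>. f \<omega> * indicator G \<omega>) \<in> borel_measurable N"
    and w: "\<And>\<omega>. \<omega> \<in> space N \<Longrightarrow> cmod (w \<omega>) \<le> r"
    and fw: "integrable N (\<lambda>\<omega>. (cmod (f \<omega> - w \<omega>))\<^sup>2 * indicator G \<omega>)"
  shows "integrable N (\<lambda>\<omega>. p (f \<omega>) * indicator G \<omega>)"
proof (rule Bochner_Integration.integrable_bound)
  interpret finite_measure N by fact
  have "(\<lambda>\<omega>. p (f \<omega> * indicator G \<omega>) * indicator G \<omega>) \<in> borel_measurable N"
    using borel_measurable_continuous_on[OF p f] G by measurable
  also have "(\<lambda>\<omega>. p (f \<omega> * indicator G \<omega>) * indicator G \<omega>) = (\<lambda>\<omega>. p (f \<omega>) * indicator G \<omega>)"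
    by (auto simp: indicator_def)
  finally show "(\<lambda>\<omega>. p (f \<omega>) * indicator G \<omega>) \<in> borel_measurable N" .
  show "integrable N (\<lambda>\<omega>. C * (1 + 2 * r\<^sup>2) + 2 * C * ((cmod (f \<omega> - w \<omega>))\<^sup>2 * indicator G \<omega>))"
    using fw by auto
  show "AE \<omega> in N. norm (p (f \<omega>) * indicator G \<omega>) \<le>
      norm (C * (1 + 2 * r\<^sup>2) + 2 * C * ((cmod (f \<omega> - w \<omega>))\<^sup>2 * indicator G \<omega>))"
  proof (rule AE_I2)
    fix \<omega> assume \<omega>: "\<omega> \<in> space N"
    have pos: "0 \<le> C * (1 + 2 * r\<^sup>2) + 2 * C * ((cmod (f \<omega> - w \<omega>))\<^sup>2 * indicator G \<omega>)"
      using C by (intro add_nonneg_nonneg mult_nonneg_nonneg) auto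
    have "(cmod (f \<omega>))\<^sup>2 \<le> 2 * (cmod (f \<omega> - w \<omega>))\<^sup>2 + 2 * (cmod (w \<omega>))\<^sup>2"
      using cmod_add_squared_le[of "f \<omega> - w \<omega>" "w \<omega>"] by simp
    also have "(cmod (w \<omega>))\<^sup>2 \<le> r\<^sup>2" using w[OF \<omega>] by (intro power_mono) auto
    finally have *: "C * (1 + (cmod (f \<omega>))\<^sup>2) \<le> C * (1 + (2 * (cmod (f \<omega> - w \<omega>))\<^sup>2 + 2 * r\<^sup>2))"
      using C by (intro mult_left_mono add_left_mono) auto
    show "norm (p (f \<omega>) * indicator G \<omega>) \<le>
      norm (C * (1 + 2 * r\<^sup>2) + 2 * C * ((cmod (f \<omega> - w \<omega>))\<^sup>2 * indicator G \<omega>))"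
    proof (cases "\<omega> \<in> G")
      case True
      then show ?thesis using order.trans[OF C(2)[of "f \<omega>"] *] pos
        by (simp add: algebra_simps)
    next
      case False
      then show ?thesis using pos by simp
    qed
  qed
qed

text \<open>The set \<open>G\<close> on which \<open>f\<close> is known to be close to its approximations need not be everything; the part
  outside costs at most the bound of \<open>q\<close> times its measure.\<close>

lemma cutoff_integral_comparison:
  fixes p q :: "complex \<Rightarrow> complex" and f w v :: "'b \<Rightarrow> complex"
  assumes p: "continuous_on UNIV p" and C: "0 < C" "\<And>z. cmod (p z) \<le> C * (1 + (cmod z)\<^sup>2)"
    and q: "continuous_on UNIV q" "\<And>z. cmod (q z) \<le> B" and D: "0 < D"
    and pq: "\<And>z w v. cmod w \<le> r \<Longrightarrow>
       cmod (p z - q v) \<le> \<epsilon> + 8 * C * (cmod (z - w))\<^sup>2 + D * (cmod (z - v))\<^sup>2"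
    and \<epsilon>: "0 < \<epsilon>"
    and N: "prob_space N" and G: "G \<in> sets N"
    and f: "(\<lambda>\<omega>. f \<omega> * indicator G \<omega>) \<in> borel_measurable N"
    and v: "v \<in> borel_measurable N"
    and w: "\<And>\<omega>. \<omega> \<in> space N \<Longrightarrow> cmod (w \<omega>) \<le> r"
    and fw: "integrable N (\<lambda>\<omega>. (cmod (f \<omega> - w \<omega>))\<^sup>2 * indicator G \<omega>)"
      "(\<integral>\<omega>. (cmod (f \<omega> - w \<omega>))\<^sup>2 * indicator G \<omega> \<partial>N) \<le> a"
    and fv: "integrable N (\<lambda>\<omega>. (cmod (f \<omega> - v \<omega>))\<^sup>2 * indicator G \<omega>)"
      "(\<integral>\<omega>. (cmod (f \<omega> - v \<omega>))\<^sup>2 * indicator G \<omega> \<partial>N) \<le> b"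
  shows "cmod ((\<integral>\<omega>. p (f \<omega>) * indicator G \<omega> \<partial>N) - (\<integral>\<omega>. q (v \<omega>) \<partial>N))
           \<le> \<epsilon> + 8 * C * a + D * b + B * measure N (space N - G)"
proof -
  interpret prob_space N by fact
  have i1: "integrable N (\<lambda>\<omega>. p (f \<omega>) * indicator G \<omega>)"
    by (rule quadratic_growth_integrable[OF p C _ G f w fw(1)]) unfold_locales
  have mq: "(\<lambda>\<omega>. q (v \<omega>)) \<in> borel_measurable N" by (rule borel_measurable_continuous_on[OF q(1) v])
  have i2: "integrable N (\<lambda>\<omega>. q (v \<omega>))" by (rule integrable_const_bound[OF _ mq]) (use q in auto)
  have "space N - G \<in> sets N" using G by auto
  then have Gc: "integrable N (indicator (space N - G) :: 'b \<Rightarrow> real)" "space N - G \<in> sets N"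
    by (auto intro!: integrable_real_indicator simp: emeasure_eq_measure)
  have "cmod ((\<integral>\<omega>. p (f \<omega>) * indicator G \<omega> \<partial>N) - (\<integral>\<omega>. q (v \<omega>) \<partial>N))
      = cmod (\<integral>\<omega>. p (f \<omega>) * indicator G \<omega> - q (v \<omega>) \<partial>N)"
    using i1 i2 by simp
  also have "\<dots> \<le> (\<integral>\<omega>. \<epsilon> + 8 * C * ((cmod (f \<omega> - w \<omega>))\<^sup>2 * indicator G \<omega>) +
      D * ((cmod (f \<omega> - v \<omega>))\<^sup>2 * indicator G \<omega>) + B * indicator (space N - G) \<omega> \<partial>N)"
  proof (rule order.trans[OF integral_norm_bound], rule integral_mono)
    show "integrable N (\<lambda>\<omega>. cmod (p (f \<omega>) * indicator G \<omega> - q (v \<omega>)))" using i1 i2 by auto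
    show "integrable N (\<lambda>\<omega>. \<epsilon> + 8 * C * ((cmod (f \<omega> - w \<omega>))\<^sup>2 * indicator G \<omega>) +
      D * ((cmod (f \<omega> - v \<omega>))\<^sup>2 * indicator G \<omega>) + B * indicator (space N - G) \<omega>)"
      using fw fv Gc by (intro Bochner_Integration.integrable_add integrable_mult_right) auto
    fix \<omega> assume "\<omega> \<in> space N"
    then show "cmod (p (f \<omega>) * indicator G \<omega> - q (v \<omega>)) \<le> \<epsilon> +
        8 * C * ((cmod (f \<omega> - w \<omega>))\<^sup>2 * indicator G \<omega>) +
        D * ((cmod (f \<omega> - v \<omega>))\<^sup>2 * indicator G \<omega>) + B * indicator (space N - G) \<omega>"
      using pq[OF w, of \<omega> "f \<omega>" "v \<omega>"] q(2)[of "v \<omega>"] \<epsilon> by (cases "\<omega> \<in> G") auto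
  qed
  also have "\<dots> = \<epsilon> + 8 * C * (\<integral>\<omega>. (cmod (f \<omega> - w \<omega>))\<^sup>2 * indicator G \<omega> \<partial>N) +
      D * (\<integral>\<omega>. (cmod (f \<omega> - v \<omega>))\<^sup>2 * indicator G \<omega> \<partial>N) + B * measure N (space N - G)"
    using fw fv Gc by (simp add: prob_space)
  also have "\<dots> \<le> \<epsilon> + 8 * C * a + D * b + B * measure N (space N - G)"
    using fw fv C D by (intro add_right_mono add_mono mult_left_mono order.refl) auto
  finally show ?thesis .
qed

text \<open>Mean-square approximation by the same trigonometric polynomials, over the sampling points in \<open>G\<close> and
  over the group, implies equality of means for every continuous function of quadratic growth.\<close>

lemma mean_value_of_quadratic_growth:
  fixes p :: "complex \<Rightarrow> complex" and f :: "'s \<Rightarrow> 'y \<Rightarrow> 'b \<Rightarrow> complex" and g :: "'s \<Rightarrow> 'k \<Rightarrow> complex"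
  assumes atc: "averaging_to_characters F M X Y \<mu> Z"
    and P: "\<And>k. trig_poly S (P k)"
    and p: "continuous_on UNIV p" and C: "0 < C" "\<And>z. cmod (p z) \<le> C * (1 + (cmod z)\<^sup>2)"
    and e: "e \<longlonglongrightarrow> 0"
    and G: "\<And>i. G \<in> sets (M i)"
    and f: "\<And>i \<sigma> y. \<sigma> \<in> S \<Longrightarrow> y \<in> Y \<Longrightarrow> (\<lambda>\<omega>. f \<sigma> y \<omega> * indicator G \<omega>) \<in> borel_measurable (M i)"
    and mass: "((\<lambda>i. measure (M i) (space (M i) - G)) \<longlongrightarrow> 0) F"
    and approx: "\<And>k. \<forall>\<^sub>F i in F. \<forall>\<sigma>\<in>S. \<forall>y\<in>Y.
        integrable (M i) (\<lambda>\<omega>. (cmod (f \<sigma> y \<omega> - P k \<sigma> (X y \<omega>)))\<^sup>2 * indicator G \<omega>) \<and>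
        (\<integral>\<omega>. (cmod (f \<sigma> y \<omega> - P k \<sigma> (X y \<omega>)))\<^sup>2 * indicator G \<omega> \<partial>M i) \<le> e k"
    and g: "\<And>\<sigma>. \<sigma> \<in> S \<Longrightarrow> g \<sigma> \<in> borel_measurable \<mu>"
    and approx_K: "\<And>k \<sigma>. \<sigma> \<in> S \<Longrightarrow> integrable \<mu> (\<lambda>x. (cmod (g \<sigma> x - P k \<sigma> (Z x)))\<^sup>2) \<and>
        (\<integral>x. (cmod (g \<sigma> x - P k \<sigma> (Z x)))\<^sup>2 \<partial>\<mu>) \<le> e k"
  shows "\<And>\<sigma>. \<sigma> \<in> S \<Longrightarrow> integrable \<mu> (\<lambda>x. p (g \<sigma> x))"
    and "uniform_limit (S \<times> Y) (\<lambda>i (\<sigma>, y). \<integral>\<omega>. p (f \<sigma> y \<omega>) * indicator G \<omega> \<partial>M i)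
           (\<lambda>(\<sigma>, y). \<integral>x. p (g \<sigma> x) \<partial>\<mu>) F"
proof -
  interpret averaging_to_characters F M X Y \<mu> Z by fact
  have "\<exists>r. \<forall>\<sigma>\<in>S. \<forall>\<psi>. unimodular_mult \<psi> \<longrightarrow> cmod (P k \<sigma> \<psi>) \<le> r" for k
    using trig_poly_bounded[OF P] by blast
  then obtain r where r: "\<And>k \<sigma> \<psi>. \<sigma> \<in> S \<Longrightarrow> unimodular_mult \<psi> \<Longrightarrow> cmod (P k \<sigma> \<psi>) \<le> r k"
    by metis
  have eq_K: "(\<integral>x. h x * indicator (space \<mu>) x \<partial>\<mu>) = (\<integral>x. h x \<partial>\<mu>)"
    "integrable \<mu> (\<lambda>x. h x * indicator (space \<mu>) x) \<longleftrightarrow> integrable \<mu> h"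
    "(\<lambda>x. h x * indicator (space \<mu>) x) \<in> borel_measurable \<mu> \<longleftrightarrow> h \<in> borel_measurable \<mu>"
    for h :: "'k \<Rightarrow> 'z::{real_normed_field,second_countable_topology,banach}"
    by (intro Bochner_Integration.integral_cong Bochner_Integration.integrable_cong measurable_cong; simp)+
  show int_K: "integrable \<mu> (\<lambda>x. p (g \<sigma> x))" if "\<sigma> \<in> S" for \<sigma>
  proof -
    have "integrable \<mu> (\<lambda>x. p (g \<sigma> x) * indicator (space \<mu>) x)"
      by (rule quadratic_growth_integrable[OF p C _ _ _, where w = "\<lambda>x. P 0 \<sigma> (Z x)" and r = "r 0"])
         (use that g approx_K r unimodular_K in \<open>auto simp: eq_K K.finite_measure_axioms\<close>)
    then show ?thesis by (simp add: eq_K)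
  qed
  have main: "\<forall>\<^sub>F i in F. \<forall>\<sigma>\<in>S. \<forall>y\<in>Y.
      dist (\<integral>\<omega>. p (f \<sigma> y \<omega>) * indicator G \<omega> \<partial>M i) (\<integral>x. p (g \<sigma> x) \<partial>\<mu>) < \<epsilon>" if \<epsilon>: "0 < \<epsilon>" for \<epsilon>
  proof -
    \<comment> \<open>The coarse approximation \<open>k0\<close> depends on \<open>C\<close> and \<open>\<epsilon>\<close> only; it determines the truncation \<open>q\<close> and hence
        \<open>D\<close>, and the fine approximation \<open>k1\<close> is chosen after that.\<close>
    have "\<forall>\<^sub>F k in sequentially. e k < \<epsilon> / (100 * C)"
      by (rule order_tendstoD(2)[OF e]) (use \<epsilon> C in auto)
    then obtain k0 where "e k0 < \<epsilon> / (100 * C)"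
      by (auto simp: eventually_sequentially)
    then have k0: "8 * C * e k0 < \<epsilon> * 8 / 100" using C by (simp add: field_simps)
    obtain q B D where q: "continuous_on UNIV q" "\<And>z. cmod (q z) \<le> B" and D: "0 < D" and
      pq: "\<And>z w v. cmod w \<le> r k0 \<Longrightarrow>
         cmod (p z - q v) \<le> \<epsilon> / 10 + 8 * C * (cmod (z - w))\<^sup>2 + D * (cmod (z - v))\<^sup>2"
      by (rule cutoff_comparison[OF p C, of "\<epsilon> / 10" "r k0"]) (use \<epsilon> in auto)
    have B: "0 \<le> B" using q(2)[of 0] norm_ge_zero[of "q 0"] by linarith
    have "\<forall>\<^sub>F k in sequentially. e k < \<epsilon> / (10 * D)"
      by (rule order_tendstoD(2)[OF e]) (use \<epsilon> D in auto)
    then obtain k1 where "e k1 < \<epsilon> / (10 * D)"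
      by (auto simp: eventually_sequentially)
    then have k1: "D * e k1 < \<epsilon> / 10" using D by (simp add: field_simps)
    have "\<forall>\<^sub>F i in F. measure (M i) (space (M i) - G) < \<epsilon> / (10 * (B + 1))"
      by (rule order_tendstoD(2)[OF mass]) (use \<epsilon> B in auto)
    moreover have "\<forall>\<^sub>F i in F. \<forall>x\<in>S \<times> Y. dist (case x of (\<sigma>, y) \<Rightarrow> \<integral>\<omega>. q (P k1 \<sigma> (X y \<omega>)) \<partial>M i)
           (case x of (\<sigma>, y) \<Rightarrow> \<integral>x. q (P k1 \<sigma> (Z x)) \<partial>\<mu>) < \<epsilon> / 10"
      by (rule uniform_limitD[OF continuous_trig_poly_averages[OF atc P q(1)]]) (use \<epsilon> in auto)
    ultimately show ?thesis
      using approx[of k0] approx[of k1]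
    proof eventually_elim
      case (elim i)
      show ?case
      proof (intro ballI)
        fix \<sigma> y assume sy: "\<sigma> \<in> S" "y \<in> Y"
        define t1 t2 t3 t4 where "t1 = (\<integral>\<omega>. p (f \<sigma> y \<omega>) * indicator G \<omega> \<partial>M i)"
          and "t2 = (\<integral>\<omega>. q (P k1 \<sigma> (X y \<omega>)) \<partial>M i)" and "t3 = (\<integral>x. q (P k1 \<sigma> (Z x)) \<partial>\<mu>)"
          and "t4 = (\<integral>x. p (g \<sigma> x) \<partial>\<mu>)"
        have 1: "cmod (t1 - t2) \<le> \<epsilon> / 10 + 8 * C * e k0 + D * e k1 + B * measure (M i) (space (M i) - G)"
          unfolding t1_def t2_def
          by (rule cutoff_integral_comparison[OF p C q D pq _ prob G f[OF sy], where w = "\<lambda>\<omega>. P k0 \<sigma> (X y \<omega>)"])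
             (use elim sy \<epsilon> r unimodular trig_poly_measurable[OF P sy(1) meas[OF sy(2)] unimodular[OF sy(2)]]
               in auto)
        have "B * measure (M i) (space (M i) - G) \<le> B * (\<epsilon> / (10 * (B + 1)))"
          using elim B by (intro mult_left_mono) auto
        also have "\<dots> \<le> \<epsilon> / 10" using B \<epsilon> by (simp add: field_simps)
        finally have 2: "cmod (t1 - t2) \<le> \<epsilon> * 4 / 10" using 1 k0 k1 \<epsilon> by linarith
        have "cmod ((\<integral>x. p (g \<sigma> x) * indicator (space \<mu>) x \<partial>\<mu>) - t3)
            \<le> \<epsilon> / 10 + 8 * C * e k0 + D * e k1 + B * measure \<mu> (space \<mu> - space \<mu>)"
          unfolding t3_def
          by (rule cutoff_integral_comparison[OF p C q D pq _ prob_K, where w = "\<lambda>x. P k0 \<sigma> (Z x)"])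
             (use sy \<epsilon> r unimodular_K g approx_K trig_poly_measurable[OF P sy(1) meas_K unimodular_K]
               in \<open>auto simp: eq_K\<close>)
        then have 3: "cmod (t4 - t3) \<le> \<epsilon> * 3 / 10" unfolding eq_K t4_def[symmetric]
          using k0 k1 \<epsilon> by auto
        have 4: "dist t2 t3 < \<epsilon> / 10" using elim(2) sy unfolding t2_def t3_def by force
        show "dist t1 t4 < \<epsilon>"
          using dist_triangle[of t1 t4 t2] dist_triangle[of t2 t4 t3] 2 3 4 \<epsilon> dist_commute[of t3 t4]
          unfolding dist_norm[of t1 t2] dist_norm[of t4 t3] by linarith
      qed
    qed
  qed
  show "uniform_limit (S \<times> Y) (\<lambda>i (\<sigma>, y). \<integral>\<omega>. p (f \<sigma> y \<omega>) * indicator G \<omega> \<partial>M i)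
           (\<lambda>(\<sigma>, y). \<integral>x. p (g \<sigma> x) \<partial>\<mu>) F"
    by (rule uniform_limitI, rule eventually_mono[OF main]) auto
qed

section \<open>Square-summable series of orthonormal characters\<close>

context orthonormal_characters
begin

definition partial_sum :: "(nat \<Rightarrow> complex) \<Rightarrow> nat set \<Rightarrow> 'k \<Rightarrow> complex" where
  "partial_sum d I x = (\<Sum>n\<in>I. d n * Z x n)"

lemma partial_sum_measurable [measurable]:
  "I \<subseteq> {1..} \<Longrightarrow> partial_sum d I \<in> borel_measurable \<mu>"
  unfolding partial_sum_def
  by (intro borel_measurable_sum borel_measurable_times meas_K borel_measurable_const) auto

lemma integral_pair:
  assumes "1 \<le> A" "1 \<le> B"
  shows "integrable \<mu> (\<lambda>x. Z x A * cnj (Z x B))"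
    and "(\<integral>x. Z x A * cnj (Z x B) \<partial>\<mu>) = (if A = B then 1 else 0)"
proof -
  have "trig_poly UNIV (\<lambda>(_::unit) \<psi>. 1 * (\<psi> A * cnj (\<psi> B)))"
    using assms by (intro trig_poly.monomial) auto
  from trig_poly_integrable_K[OF this, of "()"]
  show "integrable \<mu> (\<lambda>x. Z x A * cnj (Z x B))" by simp
  have "(\<integral>x. Z x A * cnj (Z x A) \<partial>\<mu>) = (\<integral>x. 1 \<partial>\<mu>)"
    by (rule Bochner_Integration.integral_cong) (use assms unimodular_multD(2)[OF unimodular_K] in auto)
  then show "(\<integral>x. Z x A * cnj (Z x B) \<partial>\<mu>) = (if A = B then 1 else 0)"
    using orth_K[OF assms] by (auto simp: K.prob_space)
qed

lemma parseval:
  assumes I: "finite I" "I \<subseteq> {1..}"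
  shows "integrable \<mu> (\<lambda>x. (cmod (partial_sum d I x))\<^sup>2)"
    and "(\<integral>x. (cmod (partial_sum d I x))\<^sup>2 \<partial>\<mu>) = (\<Sum>n\<in>I. (cmod (d n))\<^sup>2)"
proof -
  have I1: "1 \<le> m" if "m \<in> I" for m using I that by auto
  have eq: "complex_of_real ((cmod (partial_sum d I x))\<^sup>2) =
      (\<Sum>m\<in>I. \<Sum>n\<in>I. (d m * cnj (d n)) * (Z x m * cnj (Z x n)))" for x
  proof -
    have "complex_of_real ((cmod (partial_sum d I x))\<^sup>2) = partial_sum d I x * cnj (partial_sum d I x)"
      by (simp only: complex_norm_square)
    also have "\<dots> = (\<Sum>m\<in>I. \<Sum>n\<in>I. (d m * cnj (d n)) * (Z x m * cnj (Z x n)))"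
      unfolding partial_sum_def cnj_sum sum_product by (intro sum.cong refl) (simp add: mult_ac)
    finally show ?thesis .
  qed
  have int: "integrable \<mu> (\<lambda>x. \<Sum>m\<in>I. \<Sum>n\<in>I. (d m * cnj (d n)) * (Z x m * cnj (Z x n)))"
    by (intro Bochner_Integration.integrable_sum integrable_mult_right integral_pair I1)
  then have intc: "integrable \<mu> (\<lambda>x. complex_of_real ((cmod (partial_sum d I x))\<^sup>2))"
    unfolding eq .
  then show "integrable \<mu> (\<lambda>x. (cmod (partial_sum d I x))\<^sup>2)"
    unfolding complex_of_real_integrable_eq .
  have "complex_of_real (\<integral>x. (cmod (partial_sum d I x))\<^sup>2 \<partial>\<mu>) =
      (\<integral>x. complex_of_real ((cmod (partial_sum d I x))\<^sup>2) \<partial>\<mu>)"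
    by (simp only: integral_complex_of_real)
  also have "\<dots> = (\<Sum>m\<in>I. \<Sum>n\<in>I. (d m * cnj (d n)) * (if m = n then 1 else 0))"
    unfolding eq using integral_pair I1 by simp
  also have "\<dots> = (\<Sum>m\<in>I. d m * cnj (d m))"
    using I(1) by (intro sum.cong refl) (simp add: if_distrib if_distribR sum.delta cong: if_cong)
  also have "\<dots> = complex_of_real (\<Sum>n\<in>I. (cmod (d n))\<^sup>2)"
    by (simp only: complex_norm_square of_real_sum)
  finally show "(\<integral>x. (cmod (partial_sum d I x))\<^sup>2 \<partial>\<mu>) = (\<Sum>n\<in>I. (cmod (d n))\<^sup>2)"
    by (simp only: of_real_eq_iff)
qed

lemma nn_parseval:
  assumes I: "finite I" "I \<subseteq> {1..}"
  shows "(\<integral>\<^sup>+x. ennreal ((cmod (partial_sum d I x))\<^sup>2) \<partial>\<mu>) = ennreal (\<Sum>n\<in>I. (cmod (d n))\<^sup>2)"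
  by (subst nn_integral_eq_integral[OF parseval(1)[OF I]]) (auto simp: parseval(2)[OF I])

lemma partial_sum_diff:
  "M \<le> N \<Longrightarrow> partial_sum d {1..N} x - partial_sum d {1..M} x = partial_sum d {M<..N} x"
proof -
  assume "M \<le> N"
  then have "{1..N} = {1..M} \<union> {M<..N}" by auto
  then have "(\<Sum>n\<in>{1..N}. d n * Z x n) = (\<Sum>n\<in>{1..M}. d n * Z x n) + (\<Sum>n\<in>{M<..N}. d n * Z x n)"
    by (simp only:) (rule sum.union_disjoint, auto)
  then show ?thesis unfolding partial_sum_def by simp
qed

lemma tail_block_le:
  assumes s: "summable (\<lambda>n. (cmod (d (Suc n)))\<^sup>2)"
  shows "(\<Sum>n\<in>{M<..N}. (cmod (d n))\<^sup>2) \<le> (\<Sum>n. (cmod (d (Suc (n + M))))\<^sup>2)"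
proof (cases "M \<le> N")
  case True
  have "(\<Sum>n\<in>{M<..N}. (cmod (d n))\<^sup>2) = (\<Sum>n<N - M. (cmod (d (Suc (n + M))))\<^sup>2)"
    by (rule sum.reindex_bij_witness[of _ "\<lambda>n. Suc (n + M)" "\<lambda>n. n - Suc M"]) auto
  also have "\<dots> \<le> (\<Sum>n. (cmod (d (Suc (n + M))))\<^sup>2)"
    using summable_ignore_initial_segment[OF s, of M] by (intro sum_le_suminf) auto
  finally show ?thesis .
qed (auto intro!: suminf_nonneg summable_ignore_initial_segment[OF s])

lemma tail_tendsto_0:
  assumes s: "summable (\<lambda>n. (cmod (d (Suc n)))\<^sup>2)"
  shows "(\<lambda>M. \<Sum>n. (cmod (d (Suc (n + M))))\<^sup>2) \<longlonglongrightarrow> 0"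
  using suminf_exist_split2[OF s] by simp

text \<open>Completeness of \<open>L\<^sup>2\<close> in the case at hand: a subsequence of the partial sums with rapidly decreasing
  differences converges almost everywhere, and Fatou's lemma gives the convergence in mean square to
  the pointwise limit.\<close>

lemma L2_sum_exists:
  assumes s: "summable (\<lambda>n. (cmod (d (Suc n)))\<^sup>2)"
  shows "\<exists>g. is_L2_sum \<mu> (\<lambda>n x. d n * Z x n) g"
proof -
  define t where "t M = (\<Sum>n. (cmod (d (Suc (n + M))))\<^sup>2)" for M
  have t: "t \<longlonglongrightarrow> 0" unfolding t_def by (rule tail_tendsto_0[OF s])
  have "\<exists>M>n. t M \<le> (1/4)^k" for n k
  proof -
    have "\<forall>\<^sub>F M in sequentially. t M < (1/4)^k" by (rule order_tendstoD(2)[OF t]) simp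
    moreover have "\<forall>\<^sub>F M in sequentially. M > n" by (rule eventually_gt_at_top)
    ultimately have "\<forall>\<^sub>F M in sequentially. M > n \<and> t M \<le> (1/4)^k" by eventually_elim auto
    then show ?thesis by (auto simp: eventually_sequentially)
  qed
  then obtain f where f: "\<And>n k. f n k > n" "\<And>n k. t (f n k) \<le> (1/4)^k" by metis
  define r where "r = rec_nat (f 0 0) (\<lambda>k n. f n (Suc k))"
  have r_Suc: "r (Suc k) = f (r k) (Suc k)" and r_0: "r 0 = f 0 0" for k by (simp_all add: r_def)
  have r: "strict_mono r" by (rule strict_monoI_Suc) (simp add: r_Suc f)
  have rt: "t (r k) \<le> (1/4)^k" for k using f(2)[of 0 0] by (cases k) (auto simp: r_Suc r_0 f simp del: power_Suc)
  define P where "P N = partial_sum d {1..N}" for N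
  have Pm [measurable]: "P N \<in> borel_measurable \<mu>" for N unfolding P_def by simp
  have diff: "(\<integral>\<^sup>+x. ennreal ((cmod (P N x - P M x))\<^sup>2) \<partial>\<mu>) \<le> ennreal (t M)" if "M \<le> N" for M N
    unfolding P_def partial_sum_diff[OF that]
    by (subst nn_parseval) (auto simp: t_def intro!: ennreal_leI tail_block_le[OF s])
  define D where "D k x = cmod (P (r (Suc k)) x - P (r k) x)" for k x
  have Dm [measurable]: "D k \<in> borel_measurable \<mu>" for k unfolding D_def by measurable
  have D1: "(\<integral>\<^sup>+x. ennreal (D k x) \<partial>\<mu>) \<le> ennreal (2 * (1/2)^k)" for k
  proof -
    \<comment> \<open>Balances the first against the second power; \<open>2\<^sup>k \<sqdot> 4\<^bsup>-k\<^esup>\<close> and \<open>2\<^bsup>-k\<^esup>\<close> are both summable.\<close>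
    have "D k x \<le> 2^k * (D k x)\<^sup>2 + (1/2)^k" for x
    proof -
      have "2 * (2^k * D k x) * 1 \<le> (2^k * D k x)\<^sup>2 + 1\<^sup>2" by (rule sum_squares_bound)
      moreover have "0 \<le> 2 ^ k * D k x" by (simp add: D_def)
      ultimately have "2^k * D k x \<le> (2^k * D k x)\<^sup>2 + 1" by simp
      then have "(1/2)^k * (2^k * D k x) \<le> (1/2)^k * ((2^k * D k x)\<^sup>2 + 1)" by (intro mult_left_mono) auto
      then show ?thesis by (simp add: power_mult_distrib field_simps power2_eq_square)
    qed
    then have "(\<integral>\<^sup>+x. ennreal (D k x) \<partial>\<mu>) \<le> (\<integral>\<^sup>+x. ennreal (2^k) * ennreal ((D k x)\<^sup>2) + ennreal ((1/2)^k) \<partial>\<mu>)"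
      by (intro nn_integral_mono) (simp add: ennreal_mult'[symmetric] ennreal_plus[symmetric] ennreal_leI del: ennreal_plus)
    also have "\<dots> = ennreal (2^k) * (\<integral>\<^sup>+x. ennreal ((D k x)\<^sup>2) \<partial>\<mu>) + ennreal ((1/2)^k)"
      by (simp add: nn_integral_add nn_integral_cmult K.emeasure_space_1)
    also have "(\<integral>\<^sup>+x. ennreal ((D k x)\<^sup>2) \<partial>\<mu>) \<le> ennreal ((1/4)^k)"
      unfolding D_def using diff[of "r k" "r (Suc k)"] strict_mono_less_eq[OF r, of k "Suc k"] rt[of k]
      by (auto intro: order.trans ennreal_leI)
    also have "ennreal (2^k) * ennreal ((1/4)^k) + ennreal ((1/2)^k) = ennreal (2 * (1/2)^k)"
    proof -
      have "(2::real)^k * (1/4)^k = (1/2)^k" by (simp add: power_mult_distrib[symmetric])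
      then show ?thesis by (simp add: ennreal_mult'[symmetric] ennreal_plus[symmetric] del: ennreal_plus)
    qed
    finally show ?thesis by (simp add: mult_left_mono)
  qed
  have "(\<integral>\<^sup>+x. (\<Sum>k. ennreal (D k x)) \<partial>\<mu>) = (\<Sum>k. \<integral>\<^sup>+x. ennreal (D k x) \<partial>\<mu>)"
    by (rule nn_integral_suminf) simp
  also have "\<dots> \<le> (\<Sum>k. ennreal (2 * (1/2)^k))" by (intro suminf_le D1) auto
  also have "\<dots> = ennreal (\<Sum>k. 2 * (1/2)^k)"
    by (intro suminf_ennreal2) (auto intro!: summable_mult summable_geometric)
  finally have "(\<integral>\<^sup>+x. (\<Sum>k. ennreal (D k x)) \<partial>\<mu>) \<noteq> \<infinity>" by (auto simp: top_unique)
  then have "AE x in \<mu>. (\<Sum>k. ennreal (D k x)) \<noteq> \<infinity>"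
    by (intro nn_integral_PInf_AE) auto
  then have conv: "AE x in \<mu>. (\<lambda>k. P (r k) x) \<longlonglongrightarrow> lim (\<lambda>k. P (r k) x)"
  proof eventually_elim
    case (elim x)
    have "summable (\<lambda>k. D k x)"
      using elim by (intro summable_suminf_not_top) (auto simp: D_def)
    then have "summable (\<lambda>k. P (r (Suc k)) x - P (r k) x)"
      unfolding D_def by (rule summable_norm_cancel)
    then have "convergent (\<lambda>n. \<Sum>k<n. P (r (Suc k)) x - P (r k) x)"
      by (simp add: summable_iff_convergent)
    then have "convergent (\<lambda>n. P (r n) x - P (r 0) x)" using sum_lessThan_telescope[of "\<lambda>k. P (r k) x"] by simp
    then have "convergent (\<lambda>n. (P (r n) x - P (r 0) x) + P (r 0) x)" by (intro convergent_add convergent_const)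
    then show ?case by (simp add: convergent_LIMSEQ_iff)
  qed
  define g where "g x = lim (\<lambda>k. P (r k) x)" for x
  have gm [measurable]: "g \<in> borel_measurable \<mu>" unfolding g_def by (rule borel_measurable_lim_metric) simp
  have fatou: "(\<integral>\<^sup>+x. ennreal ((cmod (P N x - g x))\<^sup>2) \<partial>\<mu>) \<le> ennreal (t N)" for N
  proof -
    have "(\<integral>\<^sup>+x. ennreal ((cmod (P N x - g x))\<^sup>2) \<partial>\<mu>) =
        (\<integral>\<^sup>+x. liminf (\<lambda>k. ennreal ((cmod (P N x - P (r k) x))\<^sup>2)) \<partial>\<mu>)"
    proof (rule nn_integral_cong_AE)
      show "AE x in \<mu>. ennreal ((cmod (P N x - g x))\<^sup>2) = liminf (\<lambda>k. ennreal ((cmod (P N x - P (r k) x))\<^sup>2))"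
        using conv
      proof eventually_elim
        case (elim x)
        have "(\<lambda>k. ennreal ((cmod (P N x - P (r k) x))\<^sup>2)) \<longlonglongrightarrow> ennreal ((cmod (P N x - g x))\<^sup>2)"
          unfolding g_def by (intro tendsto_ennrealI tendsto_intros elim)
        then show ?case using lim_imp_Liminf[OF sequentially_bot] by metis
      qed
    qed
    also have "\<dots> \<le> liminf (\<lambda>k. \<integral>\<^sup>+x. ennreal ((cmod (P N x - P (r k) x))\<^sup>2) \<partial>\<mu>)"
      by (rule nn_integral_liminf) simp
    also have "\<dots> \<le> ennreal (t N)"
    proof (rule Liminf_le)
      have "\<forall>\<^sub>F k in sequentially. k \<ge> N" by (rule eventually_ge_at_top)
      then show "\<forall>\<^sub>F k in sequentially. (\<integral>\<^sup>+x. ennreal ((cmod (P N x - P (r k) x))\<^sup>2) \<partial>\<mu>) \<le> ennreal (t N)"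
      proof eventually_elim
        case (elim k)
        then have "N \<le> r k" using seq_suble[OF r, of k] by linarith
        then show ?case using diff[of N "r k"] by (simp add: norm_minus_commute)
      qed
    qed simp
    finally show ?thesis .
  qed
  have "(\<lambda>N. \<integral>\<^sup>+x. ennreal ((cmod (P N x - g x))\<^sup>2) \<partial>\<mu>) \<longlonglongrightarrow> 0"
  proof (rule tendsto_sandwich[OF _ _ tendsto_const])
    have "(\<lambda>N. ennreal (t N)) \<longlonglongrightarrow> ennreal 0" by (intro tendsto_ennrealI t)
    then show "(\<lambda>N. ennreal (t N)) \<longlonglongrightarrow> 0" by simp
  qed (use fatou in auto)
  then have "is_L2_sum \<mu> (\<lambda>n x. d n * Z x n) g"
    unfolding is_L2_sum_def P_def partial_sum_def using gm by simp
  then show ?thesis by blast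
qed

text \<open>The factor 2 comes from inserting a later partial sum between \<open>g\<close> and the \<open>M\<close>-th one.\<close>

lemma L2_sum_approx:
  assumes s: "summable (\<lambda>n. (cmod (d (Suc n)))\<^sup>2)" and g: "is_L2_sum \<mu> (\<lambda>n x. d n * Z x n) g"
  shows "integrable \<mu> (\<lambda>x. (cmod (g x - partial_sum d {1..M} x))\<^sup>2)"
    and "(\<integral>x. (cmod (g x - partial_sum d {1..M} x))\<^sup>2 \<partial>\<mu>) \<le> 2 * (\<Sum>n. (cmod (d (Suc (n + M))))\<^sup>2)"
proof -
  define t where "t = (\<Sum>n. (cmod (d (Suc (n + M))))\<^sup>2)"
  have t0: "0 \<le> t" unfolding t_def by (intro suminf_nonneg summable_ignore_initial_segment[OF s]) auto
  define P where "P N = partial_sum d {1..N}" for N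
  have Pm [measurable]: "P N \<in> borel_measurable \<mu>" for N unfolding P_def by simp
  have gm [measurable]: "g \<in> borel_measurable \<mu>" using g by (simp add: is_L2_sum_def)
  define E where "E N = (\<integral>\<^sup>+x. ennreal ((cmod (P N x - g x))\<^sup>2) \<partial>\<mu>)" for N
  have E: "E \<longlonglongrightarrow> 0" using g unfolding is_L2_sum_def E_def P_def partial_sum_def by simp
  have le: "(\<integral>\<^sup>+x. ennreal ((cmod (g x - P M x))\<^sup>2) \<partial>\<mu>) \<le> 2 * E N + ennreal (2 * t)" if N: "M \<le> N" for N
  proof -
    have pt: "(cmod (g x - P M x))\<^sup>2 \<le> 2 * (cmod (P N x - g x))\<^sup>2 + 2 * (cmod (P N x - P M x))\<^sup>2" for x
      using cmod_add_squared_le[of "g x - P N x" "P N x - P M x"] by (simp add: norm_minus_commute)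
    have "(\<integral>\<^sup>+x. ennreal ((cmod (g x - P M x))\<^sup>2) \<partial>\<mu>) \<le>
        (\<integral>\<^sup>+x. 2 * ennreal ((cmod (P N x - g x))\<^sup>2) + 2 * ennreal ((cmod (P N x - P M x))\<^sup>2) \<partial>\<mu>)"
    proof (rule nn_integral_mono)
      fix x
      have "ennreal ((cmod (g x - P M x))\<^sup>2) \<le> ennreal (2 * (cmod (P N x - g x))\<^sup>2 + 2 * (cmod (P N x - P M x))\<^sup>2)"
        by (rule ennreal_leI[OF pt])
      then show "ennreal ((cmod (g x - P M x))\<^sup>2) \<le>
          2 * ennreal ((cmod (P N x - g x))\<^sup>2) + 2 * ennreal ((cmod (P N x - P M x))\<^sup>2)"
        by (simp add: ennreal_mult)
    qed
    also have "\<dots> = 2 * E N + 2 * (\<integral>\<^sup>+x. ennreal ((cmod (P N x - P M x))\<^sup>2) \<partial>\<mu>)"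
      by (simp add: nn_integral_add nn_integral_cmult E_def)
    also have "(\<integral>\<^sup>+x. ennreal ((cmod (P N x - P M x))\<^sup>2) \<partial>\<mu>) \<le> ennreal t"
      unfolding P_def partial_sum_diff[OF N]
      by (subst nn_parseval) (auto simp: t_def intro!: ennreal_leI tail_block_le[OF s])
    finally show ?thesis using t0 by (simp add: ennreal_mult mult_left_mono)
  qed
  have "(\<lambda>N. 2 * E N + ennreal (2 * t)) \<longlonglongrightarrow> 2 * 0 + ennreal (2 * t)"
    by (intro tendsto_add ennreal_tendsto_cmult E tendsto_const) auto
  then have lim: "(\<lambda>N. 2 * E N + ennreal (2 * t)) \<longlonglongrightarrow> ennreal (2 * t)" by simp
  have nn: "(\<integral>\<^sup>+x. ennreal ((cmod (g x - P M x))\<^sup>2) \<partial>\<mu>) \<le> ennreal (2 * t)"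
    by (rule LIMSEQ_le_const[OF lim]) (use le in auto)
  show int: "integrable \<mu> (\<lambda>x. (cmod (g x - partial_sum d {1..M} x))\<^sup>2)"
    unfolding P_def[symmetric]
    by (rule integrableI_bounded) (use nn in \<open>auto simp: le_less_trans top.not_eq_extremum intro: le_less_trans[OF _ ennreal_less_top]\<close>)
  have "ennreal (\<integral>x. (cmod (g x - P M x))\<^sup>2 \<partial>\<mu>) \<le> ennreal (2 * t)"
    using nn nn_integral_eq_integral[OF int[unfolded P_def[symmetric]]] by simp
  then show "(\<integral>x. (cmod (g x - partial_sum d {1..M} x))\<^sup>2 \<partial>\<mu>) \<le> 2 * (\<Sum>n. (cmod (d (Suc (n + M))))\<^sup>2)"
    using t0 unfolding P_def t_def[symmetric] by simp
qed

end

section \<open>Normal families and the chordal metric\<close>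

text \<open>The inverse stereographic projection onto the unit sphere in \<open>\<complex> \<times> \<real>\<close>, with infinity as north
  pole. It identifies the chordal distance with the Euclidean one, which supplies the triangle
  inequality and the continuity of chordal limits.\<close>

definition stereo :: "complex option \<Rightarrow> complex \<times> real" where
  "stereo q = (case q of None \<Rightarrow> (0, 1)
     | Some z \<Rightarrow> (of_real (2 / (1 + (cmod z)\<^sup>2)) * z, 1 - 2 / (1 + (cmod z)\<^sup>2)))"

lemma one_plus_square_pos: "0 < 1 + (x::real)\<^sup>2"
  by (simp add: add_pos_nonneg)

lemma chordal_identity:
  fixes x y u v a b :: real
  assumes a: "a = 1 + (x\<^sup>2 + y\<^sup>2)" and b: "b = 1 + (u\<^sup>2 + v\<^sup>2)"
  shows "(2 / a * x - 2 / b * u)\<^sup>2 + (2 / a * y - 2 / b * v)\<^sup>2 + ((1 - 2 / a) - (1 - 2 / b))\<^sup>2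
      = 4 * ((x - u)\<^sup>2 + (y - v)\<^sup>2) / (a * b)"
proof -
  have "a > 0" "b > 0" unfolding a b by (auto intro: add_pos_nonneg)
  then have "(2 / a * x - 2 / b * u)\<^sup>2 + (2 / a * y - 2 / b * v)\<^sup>2 + ((1 - 2 / a) - (1 - 2 / b))\<^sup>2
     = ((2 * x * b - 2 * u * a)\<^sup>2 + (2 * y * b - 2 * v * a)\<^sup>2 + (2 * a - 2 * b)\<^sup>2) / (a\<^sup>2 * b\<^sup>2)"
    by (simp add: field_simps power2_eq_square)
  also have "(2 * x * b - 2 * u * a)\<^sup>2 + (2 * y * b - 2 * v * a)\<^sup>2 + (2 * a - 2 * b)\<^sup>2
     = 4 * ((x - u)\<^sup>2 + (y - v)\<^sup>2) * (a * b)"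
    using a b by algebra
  also have "\<dots> / (a\<^sup>2 * b\<^sup>2) = 4 * ((x - u)\<^sup>2 + (y - v)\<^sup>2) / (a * b)"
    using \<open>a > 0\<close> \<open>b > 0\<close> by (simp add: field_simps power2_eq_square)
  finally show ?thesis .
qed

lemma chordal_eq_dist_stereo: "chordal q q' = dist (stereo q) (stereo q')"
proof -
  have *: "2 / sqrt (1 + (cmod z)\<^sup>2) = dist (stereo (Some z)) (stereo None)" for z
  proof -
    define a where "a = 1 + (cmod z)\<^sup>2"
    have a: "a > 0" "(cmod z)\<^sup>2 = a - 1" by (auto simp: a_def one_plus_square_pos)
    have "(dist (stereo (Some z)) (stereo None))\<^sup>2 = (cmod (of_real (2 / a) * z))\<^sup>2 + (2 / a)\<^sup>2"
      by (simp add: stereo_def dist_norm norm_Pair a_def[symmetric] power_divide norm_divide norm_mult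
          power_mult_distrib)
    also have "\<dots> = (2 / a)\<^sup>2 * (cmod z)\<^sup>2 + (2 / a)\<^sup>2"
      by (simp add: norm_mult norm_divide power_mult_distrib power_divide)
    also have "\<dots> = (2 / sqrt a)\<^sup>2"
      unfolding a(2) using a(1) by (simp add: field_simps power2_eq_square)
    finally have "dist (stereo (Some z)) (stereo None) = 2 / sqrt a"
      by (rule power2_eq_imp_eq) (use a in auto)
    then show ?thesis unfolding a_def[symmetric] by simp
  qed
  have **: "2 * cmod (z - w) / (sqrt (1 + (cmod z)\<^sup>2) * sqrt (1 + (cmod w)\<^sup>2)) =
      dist (stereo (Some z)) (stereo (Some w))" for z w
  proof -
    define a b where "a = 1 + (cmod z)\<^sup>2" and "b = 1 + (cmod w)\<^sup>2"
    have a: "a > 0" "b > 0" by (auto simp: a_def b_def one_plus_square_pos)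
    have "(dist (stereo (Some z)) (stereo (Some w)))\<^sup>2 =
        (cmod (of_real (2 / a) * z - of_real (2 / b) * w))\<^sup>2 + ((1 - 2 / a) - (1 - 2 / b))\<^sup>2"
      by (simp add: stereo_def dist_norm norm_Pair a_def[symmetric] b_def[symmetric])
    also have "\<dots> = (2 / a * Re z - 2 / b * Re w)\<^sup>2 + (2 / a * Im z - 2 / b * Im w)\<^sup>2
         + ((1 - 2 / a) - (1 - 2 / b))\<^sup>2"
      by (simp add: cmod_power2)
    also have "\<dots> = 4 * ((Re z - Re w)\<^sup>2 + (Im z - Im w)\<^sup>2) / (a * b)"
      by (rule chordal_identity) (simp_all add: a_def b_def cmod_power2)
    also have "(Re z - Re w)\<^sup>2 + (Im z - Im w)\<^sup>2 = (cmod (z - w))\<^sup>2" by (simp add: cmod_power2)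
    also have "4 * (cmod (z - w))\<^sup>2 / (a * b) = (2 * cmod (z - w) / (sqrt a * sqrt b))\<^sup>2"
      using a by (simp add: power_divide power_mult_distrib)
    finally have "dist (stereo (Some z)) (stereo (Some w)) = 2 * cmod (z - w) / (sqrt a * sqrt b)"
      by (rule power2_eq_imp_eq) (use a in auto)
    then show ?thesis unfolding a_def[symmetric] b_def[symmetric] by simp
  qed
  show ?thesis
    by (cases q; cases q') (simp_all add: * ** dist_commute del: dist_self)
qed

lemma snd_stereo_Some: "snd (stereo (Some z)) = 1 - 2 / (1 + (cmod z)\<^sup>2)"
  and fst_stereo_Some: "fst (stereo (Some z)) = of_real (2 / (1 + (cmod z)\<^sup>2)) * z"
  and stereo_None: "stereo None = (0, 1)"
  by (simp_all add: stereo_def)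

lemma snd_stereo_Some_less: "snd (stereo (Some z)) < 1"
  by (simp add: snd_stereo_Some one_plus_square_pos)

lemma snd_stereo_bounds: "\<bar>snd (stereo q)\<bar> \<le> 1"
proof (cases q)
  case (Some z)
  have "2 / (1 + (cmod z)\<^sup>2) \<le> 2" "0 \<le> 2 / (1 + (cmod z)\<^sup>2)"
    by (auto simp: field_simps one_plus_square_pos intro: add_nonneg_nonneg)
  then show ?thesis unfolding Some snd_stereo_Some by linarith
qed (simp add: stereo_None)

lemma cmod_fst_stereo: "cmod (fst (stereo q)) \<le> 1"
proof (cases q)
  case (Some z)
  have "2 * cmod z \<le> 1 + (cmod z)\<^sup>2" using sum_squares_bound[of 1 "cmod z"] by simp
  moreover have "cmod (of_real (2 / (1 + (cmod z)\<^sup>2)) * z) = 2 / (1 + (cmod z)\<^sup>2) * cmod z"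
    using one_plus_square_pos[of "cmod z"] by (simp only: norm_mult norm_of_real) simp
  ultimately show ?thesis
    using one_plus_square_pos[of "cmod z"] unfolding Some fst_stereo_Some
    by (simp only:) (simp add: field_simps)
qed (simp add: stereo_None)

lemma snd_stereo_le_iff:
  assumes "c < 1"
  shows "snd (stereo (Some z)) \<le> c \<longleftrightarrow> (cmod z)\<^sup>2 \<le> 2 / (1 - c) - 1"
proof -
  have "snd (stereo (Some z)) \<le> c \<longleftrightarrow> (1 - c) * (1 + (cmod z)\<^sup>2) \<le> 2"
    unfolding snd_stereo_Some using one_plus_square_pos[of "cmod z"] by (simp add: field_simps)
  also have "\<dots> \<longleftrightarrow> (cmod z)\<^sup>2 \<le> 2 / (1 - c) - 1" using assms by (simp add: field_simps)
  finally show ?thesis .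
qed

text \<open>In the coordinates of the sphere the map \<open>z \<mapsto> 1/z\<close> is a quotient that stays regular at the north
  pole, where it takes the value \<open>0\<close>.\<close>

lemma inverse_from_stereo:
  assumes "z \<noteq> 0"
  shows "cnj (fst (stereo (Some z))) / of_real (1 + snd (stereo (Some z))) = 1 / z"
proof -
  define a where "a = 1 + (cmod z)\<^sup>2"
  have a: "a > 0" "(cmod z)\<^sup>2 = a - 1" by (auto simp: a_def one_plus_square_pos)
  have "a \<noteq> 1" using assms by (simp add: a_def)
  have zz: "z * cnj z = of_real (a - 1)" by (simp add: complex_norm_square[symmetric] a)
  have "1 + snd (stereo (Some z)) = 2 * (a - 1) / a"
    using a by (simp add: snd_stereo_Some a_def[symmetric] field_simps)
  then have "cnj (fst (stereo (Some z))) / of_real (1 + snd (stereo (Some z)))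
      = (of_real (2 / a) * cnj z) / of_real (2 * (a - 1) / a)"
    by (simp add: fst_stereo_Some a_def[symmetric])
  also have "\<dots> = cnj z / of_real (a - 1)"
  proof -
    define b where "b = a - 1"
    then show ?thesis unfolding b_def[symmetric]
      using a \<open>a \<noteq> 1\<close> by (simp add: field_simps)
  qed
  also have "\<dots> = 1 / z" unfolding zz[symmetric] using assms by simp
  finally show ?thesis .
qed

lemma inverse_stereo_lipschitz:
  assumes "0 \<le> snd (stereo q)" "0 \<le> snd (stereo q')"
  shows "cmod (cnj (fst (stereo q)) / of_real (1 + snd (stereo q)) -
               cnj (fst (stereo q')) / of_real (1 + snd (stereo q'))) \<le> 3 * dist (stereo q) (stereo q')"
proof -
  define a b a' b' where "a = cnj (fst (stereo q))" "b = 1 + snd (stereo q)"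
     "a' = cnj (fst (stereo q'))" "b' = 1 + snd (stereo q')"
  note d = a_b_a'_b'_def
  have b: "1 \<le> b" "1 \<le> b'" "b' \<le> 2" using assms snd_stereo_bounds[of q'] unfolding d by auto
  have ca: "cmod a' \<le> 1" using cmod_fst_stereo unfolding d by simp
  have "cmod (a - a') = cmod (fst (stereo q) - fst (stereo q'))"
    unfolding d by (simp flip: complex_cnj_diff)
  then have d1: "cmod (a - a') \<le> dist (stereo q) (stereo q')"
    using dist_fst_le[of "stereo q" "stereo q'"] by (simp add: dist_norm)
  have d2: "\<bar>b' - b\<bar> \<le> dist (stereo q) (stereo q')"
    using dist_snd_le[of "stereo q" "stereo q'"] unfolding d by (simp add: dist_real_def)
  have "a / of_real b - a' / of_real b' = ((a - a') * of_real b' + a' * of_real (b' - b)) / of_real (b * b')"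
    using b by (simp add: field_simps)
  then have "cmod (a / of_real b - a' / of_real b') = cmod ((a - a') * of_real b' + a' * of_real (b' - b)) / (b * b')"
    using b by (simp add: norm_divide norm_mult)
  also have "\<dots> \<le> cmod ((a - a') * of_real b' + a' * of_real (b' - b)) / 1"
    using b mult_mono[of 1 b 1 b'] by (intro divide_left_mono) auto
  also have "\<dots> \<le> cmod (a - a') * b' + cmod a' * \<bar>b' - b\<bar>"
    using norm_triangle_ineq[of "(a - a') * of_real b'" "a' * of_real (b' - b)"] b
    by (simp add: norm_mult del: of_real_diff)
  also have "\<dots> \<le> dist (stereo q) (stereo q') * 2 + 1 * dist (stereo q) (stereo q')"
    using b ca d1 d2 by (intro add_mono mult_mono) auto
  finally show ?thesis unfolding d by simp
qed

lemma chordal_limit_continuous: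
  assumes "open D" and f: "\<And>k. continuous_on D (f k)" and lim: "chordal_loc_unif_limit D f g"
  shows "continuous_on D (\<lambda>z. stereo (g z))"
proof (rule continuous_at_imp_continuous_on, rule ballI)
  fix z assume z: "z \<in> D"
  obtain r where r: "r > 0" "\<And>e. e > 0 \<Longrightarrow> \<forall>\<^sub>F k in sequentially. \<forall>w\<in>ball z r \<inter> D. chordal (Some (f k w)) (g w) < e"
    using lim z unfolding chordal_loc_unif_limit_def by blast
  have "continuous_on (ball z r \<inter> D) (\<lambda>z. stereo (g z))"
  proof (rule uniform_limit_theorem)
    show "uniform_limit (ball z r \<inter> D) (\<lambda>k z. stereo (Some (f k z))) (\<lambda>z. stereo (g z)) sequentially"
      using r(2) by (intro uniform_limitI) (simp add: chordal_eq_dist_stereo)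
    have "continuous_on D (\<lambda>z. stereo (Some (f k z)))" for k
      unfolding stereo_def option.case
      by (intro continuous_intros f) (simp_all add: less_imp_neq[OF one_plus_square_pos, symmetric])
    then show "\<forall>\<^sub>F k in sequentially. continuous_on (ball z r \<inter> D) (\<lambda>z. stereo (Some (f k z)))"
      by (intro always_eventually allI) (rule continuous_on_subset, auto)
  qed simp
  then show "isCont (\<lambda>z. stereo (g z)) z"
    using z r \<open>open D\<close> by (simp add: continuous_on_eq_continuous_at open_Int)
qed

text \<open>The set where the limit is infinite is open: near such a point the reciprocals are holomorphic,
  zero-free and converge uniformly to a function that vanishes there, so by Hurwitz's
  theorem this function vanishes identically near the point. The set where the limit is finite is open
  by continuity and contains \<open>z1\<close>. As \<open>D\<close> is connected, the former set is empty.\<close>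

lemma chordal_limit_finite:
  assumes D: "open D" "connected D" and f: "\<And>k. f k holomorphic_on D"
    and lim: "chordal_loc_unif_limit D f g" and z1: "z1 \<in> D" "\<And>k. cmod (f k z1) \<le> C"
    and z: "z \<in> D"
  shows "g z \<noteq> None"
proof -
  have cont: "continuous_on D (\<lambda>z. stereo (g z))"
    using chordal_limit_continuous[OF D(1) _ lim] f holomorphic_on_imp_continuous_on by blast
  define U V where "U = {z \<in> D. g z = None}" and "V = {z \<in> D. snd (stereo (g z)) < 1}"
  have "continuous_on D (\<lambda>z. snd (stereo (g z)))" by (intro continuous_intros cont)
  moreover have "V = D \<inter> (\<lambda>z. snd (stereo (g z))) -` {..<1}" by (auto simp only: V_def)
  ultimately have "open V"
    using continuous_open_preimage[of D "\<lambda>z. snd (stereo (g z))" "{..<1}"] D(1) by simp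
  have UV: "U \<inter> V = {}" "D \<subseteq> U \<union> V"
  proof -
    show "U \<inter> V = {}" by (auto simp: U_def V_def stereo_None)
    have "z \<in> U \<union> V" if "z \<in> D" for z
    proof (cases "g z")
      case (Some w)
      then show ?thesis using that snd_stereo_Some_less[of w] by (simp add: V_def)
    qed (use that in \<open>simp add: U_def\<close>)
    then show "D \<subseteq> U \<union> V" by auto
  qed
  have "open U"
    unfolding open_contains_ball
  proof
    fix z0 assume z0: "z0 \<in> U"
    then have z0D: "z0 \<in> D" and gz0: "g z0 = None" by (auto simp: U_def)
    obtain r where r: "r > 0" "\<And>e. e > 0 \<Longrightarrow> \<forall>\<^sub>F k in sequentially. \<forall>w\<in>ball z0 r \<inter> D. chordal (Some (f k w)) (g w) < e"
      using lim z0D unfolding chordal_loc_unif_limit_def by blast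
    have "isCont (\<lambda>z. snd (stereo (g z))) z0"
      using cont D z0D by (intro continuous_intros) (simp add: continuous_on_eq_continuous_at)
    then obtain d where d: "d > 0" "\<And>w. dist w z0 < d \<Longrightarrow> dist (snd (stereo (g w))) (snd (stereo (g z0))) < 1/2"
      unfolding continuous_at_eps_delta by (metis half_gt_zero zero_less_one)
    obtain t where t: "t > 0" "ball z0 t \<subseteq> D" using D z0D open_contains_ball by blast
    \<comment> \<open>On this ball the limit stays in the upper hemisphere and the convergence is uniform.\<close>
    define \<rho> where "\<rho> = min r (min d t)"
    define B where "B = ball z0 \<rho>"
    have \<rho>: "\<rho> > 0" "B \<subseteq> ball z0 r \<inter> D" "open B" "connected B" "z0 \<in> B"
      using r d t by (auto simp: \<rho>_def B_def)
    have big: "snd (stereo (g w)) > 1/2" if "w \<in> B" for w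
    proof -
      have "\<bar>snd (stereo (g w)) - 1\<bar> < 1/2"
        using d(2)[of w] that by (simp add: B_def \<rho>_def dist_commute gz0 stereo_None dist_real_def abs_minus_commute)
      then show ?thesis by linarith
    qed
    obtain k0 where k0: "\<And>k w. k \<ge> k0 \<Longrightarrow> w \<in> B \<Longrightarrow> chordal (Some (f k w)) (g w) < 1/2"
      using r(2)[of "1/2"] \<rho>(2) unfolding eventually_sequentially by auto blast
    have pos: "snd (stereo (Some (f k w))) > 0" if "k \<ge> k0" "w \<in> B" for k w
    proof -
      have "dist (snd (stereo (Some (f k w)))) (snd (stereo (g w))) < 1/2"
        using k0[OF that] dist_snd_le[of "stereo (Some (f k w))" "stereo (g w)"]
        by (simp add: chordal_eq_dist_stereo)
      then show ?thesis using big[OF that(2)] unfolding dist_real_def by linarith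
    qed
    have nz: "f k w \<noteq> 0" if "k \<ge> k0" "w \<in> B" for k w
      using pos[OF that] by (auto simp: snd_stereo_Some)
    define h where "h w = cnj (fst (stereo (g w))) / of_real (1 + snd (stereo (g w)))" for w
    have hol: "(\<lambda>w. 1 / f (k + k0) w) holomorphic_on B" for k
      using f \<rho>(2) nz by (intro holomorphic_intros holomorphic_on_subset[OF f]) auto
    have ul: "uniform_limit B (\<lambda>k w. 1 / f (k + k0) w) h sequentially"
    proof (rule uniform_limitI)
      fix e :: real assume e: "e > 0"
      have "\<forall>\<^sub>F k in sequentially. \<forall>w\<in>ball z0 r \<inter> D. chordal (Some (f k w)) (g w) < e / 4"
        using r(2)[of "e/4"] e by simp
      then have "\<forall>\<^sub>F k in sequentially. \<forall>w\<in>ball z0 r \<inter> D. chordal (Some (f (k + k0) w)) (g w) < e / 4"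
        by (subst eventually_sequentially_seg)
      then show "\<forall>\<^sub>F k in sequentially. \<forall>w\<in>B. dist (1 / f (k + k0) w) (h w) < e"
      proof eventually_elim
        case (elim k)
        show ?case
        proof
          fix w assume w: "w \<in> B"
          have "dist (1 / f (k + k0) w) (h w) \<le> 3 * dist (stereo (Some (f (k + k0) w))) (stereo (g w))"
            unfolding dist_norm h_def
            by (subst inverse_from_stereo[symmetric], use nz w in force, rule inverse_stereo_lipschitz[unfolded dist_norm])
               (use pos[of "k + k0" w] big[OF w] w in auto)
          also have "\<dots> < e" using elim w \<rho>(2) e by (force simp: chordal_eq_dist_stereo)
          finally show "dist (1 / f (k + k0) w) (h w) < e" .
        qed
      qed
    qed
    have holh: "h holomorphic_on B"
    proof (rule holomorphic_uniform_sequence[OF \<rho>(3) hol])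
      fix x assume "x \<in> B"
      then obtain d where "d > 0" "cball x d \<subseteq> B" using \<rho>(3) open_contains_cball by blast
      then show "\<exists>d>0. cball x d \<subseteq> B \<and> uniform_limit (cball x d) (\<lambda>k w. 1 / f (k + k0) w) h sequentially"
        using uniform_limit_on_subset[OF ul] by blast
    qed
    have h0: "h z0 = 0" by (simp add: h_def gz0 stereo_None)
    have "h constant_on B"
    proof (rule ccontr)
      assume "\<not> h constant_on B"
      then have "h z0 \<noteq> 0"
        by (intro Hurwitz_no_zeros[OF \<rho>(3,4) hol holh])
           (use nz \<rho> uniform_limit_on_subset[OF ul] in auto)
      with h0 show False by simp
    qed
    then have h_zero: "h w = 0" if "w \<in> B" for w
      using h0 \<rho>(5) that unfolding constant_on_def by metis
    have "B \<subseteq> U"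
    proof
      fix w assume w: "w \<in> B"
      have "fst (stereo (g w)) = 0"
        using h_zero[OF w] big[OF w] unfolding h_def
        by (auto simp: complex_eq_iff)
      have "g w = None"
      proof (rule ccontr)
        assume "g w \<noteq> None"
        then obtain a where a: "g w = Some a" by auto
        have "a = 0"
          using \<open>fst (stereo (g w)) = 0\<close> one_plus_square_pos[of "cmod a"]
          unfolding a fst_stereo_Some mult_eq_0_iff of_real_eq_0_iff by auto
        then show False using big[OF w] by (simp add: a snd_stereo_Some)
      qed
      then show "w \<in> U" using w \<rho>(2) by (auto simp: U_def)
    qed
    then show "\<exists>e>0. ball z0 e \<subseteq> U" using \<rho>(1) B_def by blast
  qed
  have "z1 \<in> V"
  proof -
    define c where "c = 1 - 2 / (1 + C\<^sup>2)"
    have c: "c < 1" by (simp add: c_def one_plus_square_pos)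
    have "C \<ge> 0" using z1(2)[of 0] norm_ge_zero order.trans by blast
    have *: "snd (stereo (Some (f k z1))) \<le> c" for k
      unfolding snd_stereo_le_iff[OF c] using power_mono[OF z1(2), of k 2] by (simp add: c_def field_simps)
    have "(\<lambda>k. stereo (Some (f k z1))) \<longlonglongrightarrow> stereo (g z1)"
    proof (rule tendstoI)
      fix e :: real assume "e > 0"
      obtain r where r: "r > 0" "\<And>e. e > 0 \<Longrightarrow> \<forall>\<^sub>F k in sequentially. \<forall>w\<in>ball z1 r \<inter> D. chordal (Some (f k w)) (g w) < e"
        using lim z1 unfolding chordal_loc_unif_limit_def by blast
      from r(2)[OF \<open>e > 0\<close>] show "\<forall>\<^sub>F k in sequentially. dist (stereo (Some (f k z1))) (stereo (g z1)) < e"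
        by eventually_elim (use r(1) z1(1) in \<open>auto simp: chordal_eq_dist_stereo\<close>)
    qed
    then have "(\<lambda>k. snd (stereo (Some (f k z1)))) \<longlonglongrightarrow> snd (stereo (g z1))" by (rule tendsto_snd)
    then have "snd (stereo (g z1)) \<le> c" by (rule LIMSEQ_le_const2) (use * in auto)
    then show ?thesis using c z1 by (auto simp: V_def)
  qed
  then have "V \<inter> D \<noteq> {}" using z1 by auto
  then have "U \<inter> D = {}"
    using connectedD[OF D(2) \<open>open U\<close> \<open>open V\<close>] UV by blast
  then show ?thesis using z by (auto simp: U_def)
qed

text \<open>If the family were unbounded on \<open>K\<close>, a convergent subsequence of witnesses would have a limit that
  is finite at an accumulation point of the witnesses, and hence would be bounded near that point.\<close>

lemma normal_family_bounded_on_compact: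
  assumes D: "open D" "connected D" and hol: "\<And>f. f \<in> \<F> \<Longrightarrow> f holomorphic_on D"
    and normal: "normal_family D \<F>" and z1: "z1 \<in> D" "\<And>f. f \<in> \<F> \<Longrightarrow> cmod (f z1) \<le> C"
    and K: "compact K" "K \<subseteq> D"
  shows "\<exists>B. \<forall>f\<in>\<F>. \<forall>z\<in>K. cmod (f z) \<le> B"
proof (rule ccontr)
  assume "\<not> ?thesis"
  then have "\<forall>n. \<exists>f z. f \<in> \<F> \<and> z \<in> K \<and> cmod (f z) > real n" by (meson not_le)
  then obtain f z where fz: "\<And>n::nat. f n \<in> \<F>" "\<And>n. z n \<in> K" "\<And>n. cmod (f n (z n)) > real n" by metis
  obtain r g where r: "strict_mono r" and lim: "chordal_loc_unif_limit D (f \<circ> r) g"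
    using normal fz(1) unfolding normal_family_def by blast
  have hol': "(f \<circ> r) k holomorphic_on D" for k using hol fz(1) by simp
  obtain zs r2 where zs: "zs \<in> K" and r2: "strict_mono r2" "((\<lambda>n. z (r n)) \<circ> r2) \<longlonglongrightarrow> zs"
    using K(1) fz(2) unfolding compact_def by metis
  have zsD: "zs \<in> D" using zs K by auto
  have cont: "continuous_on D (\<lambda>z. stereo (g z))"
    using chordal_limit_continuous[OF D(1) _ lim] hol' holomorphic_on_imp_continuous_on by blast
  have "g zs \<noteq> None"
    by (rule chordal_limit_finite[OF D hol' lim z1(1) _ zsD]) (use z1 fz in auto)
  then have lt: "snd (stereo (g zs)) < 1" using snd_stereo_Some_less by auto
  define c where "c = (1 - snd (stereo (g zs))) / 3"
  have c: "c > 0" and c3: "snd (stereo (g zs)) = 1 - 3 * c" using lt by (simp_all add: c_def field_simps)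
  obtain \<rho> where \<rho>: "\<rho> > 0" "\<And>e. e > 0 \<Longrightarrow> \<forall>\<^sub>F k in sequentially. \<forall>w\<in>ball zs \<rho> \<inter> D. chordal (Some ((f \<circ> r) k w)) (g w) < e"
    using lim zsD unfolding chordal_loc_unif_limit_def by blast
  have "isCont (\<lambda>z. snd (stereo (g z))) zs"
    using cont D zsD by (intro continuous_intros) (simp add: continuous_on_eq_continuous_at)
  then obtain d where d: "d > 0" "\<And>w. dist w zs < d \<Longrightarrow> dist (snd (stereo (g w))) (snd (stereo (g zs))) < c"
    unfolding continuous_at_eps_delta using c by metis
  have "\<forall>\<^sub>F n in sequentially. dist (((\<lambda>n. z (r n)) \<circ> r2) n) zs < min d \<rho>"
    by (rule tendstoD[OF r2(2)]) (use d \<rho> in auto)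
  moreover have "\<forall>\<^sub>F n in sequentially. \<forall>w\<in>ball zs \<rho> \<inter> D. chordal (Some ((f \<circ> r) (r2 n) w)) (g w) < c"
    using \<rho>(2)[OF c] filterlim_subseq[OF r2(1)] unfolding filterlim_iff by blast
  moreover have "\<forall>\<^sub>F n in sequentially. 2 / c + 1 < real n"
    using filterlim_real_sequentially unfolding filterlim_at_top_dense by blast
  ultimately have "\<forall>\<^sub>F n in sequentially. False"
  proof eventually_elim
    case (elim n)
    define w where "w = z (r (r2 n))"
    define h where "h = f (r (r2 n))"
    have wD: "w \<in> D" using fz K by (auto simp: w_def)
    have w: "dist w zs < d" "w \<in> ball zs \<rho>" using elim(1) by (auto simp: w_def dist_commute)
    have "dist (snd (stereo (Some (h w)))) (snd (stereo (g w))) < c"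
      using elim(2) w wD dist_snd_le[of "stereo (Some (h w))" "stereo (g w)"]
      by (force simp: chordal_eq_dist_stereo h_def)
    then have "snd (stereo (Some (h w))) \<le> 1 - c"
      using d(2)[OF w(1)] c3 unfolding dist_real_def by linarith
    then have "(cmod (h w))\<^sup>2 \<le> 2 / c - 1"
      using snd_stereo_le_iff[of "1 - c" "h w"] c by simp
    moreover have "cmod (h w) > 2 / c + 1"
    proof -
      have "n \<le> r (r2 n)" using seq_suble[OF r, of "r2 n"] seq_suble[OF r2(1), of n] by linarith
      then have "real n \<le> real (r (r2 n))" by simp
      then show ?thesis using fz(3)[of "r (r2 n)"] elim(3) by (simp add: h_def w_def)
    qed
    moreover have "cmod (h w) \<le> (cmod (h w))\<^sup>2"
    proof -
      have "2 / c > 0" using c by simp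
      then have "1 \<le> cmod (h w)" using \<open>cmod (h w) > 2 / c + 1\<close> by linarith
      then show ?thesis by (simp add: self_le_power)
    qed
    ultimately show False by linarith
  qed
  then show False by simp
qed

section \<open>Analytic continuation in blocks\<close>

lemma norm_of_nat_powr: "n \<ge> 1 \<Longrightarrow> cmod (of_nat n powr s) = real n powr Re s"
  by (subst norm_powr_real_powr) auto

text \<open>The coefficients are square-summable against \<open>n\<^bsup>-\<sigma>\<^esup>\<close> for every \<open>\<sigma> > 1\<close>, and so is the
  constant sequence \<open>1\<close>; now \<open>|a| \<le> |a|\<^sup>2 + 1\<close>.\<close>

lemma dirichlet_abs_summable:
  assumes "dirichlet_rep a L" "\<sigma> > 1"
  shows "summable (\<lambda>n. cmod (a (Suc n)) * real (Suc n) powr (- \<sigma>))"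
proof (rule summable_comparison_test)
  have "summable (\<lambda>n. real (Suc n) powr (- \<sigma>))"
    using assms(2) summable_Suc_iff[of "\<lambda>n. real n powr (- \<sigma>)"] summable_real_powr_iff[of "- \<sigma>"] by simp
  moreover have "summable (\<lambda>n. (cmod (a (Suc n)))\<^sup>2 * real (Suc n) powr (- \<sigma>))"
    using assms unfolding dirichlet_rep_def by blast
  ultimately show "summable (\<lambda>n. (cmod (a (Suc n)))\<^sup>2 * real (Suc n) powr (- \<sigma>) + real (Suc n) powr (- \<sigma>))"
    by (rule summable_add[rotated])
  show "\<exists>N. \<forall>n\<ge>N. norm (cmod (a (Suc n)) * real (Suc n) powr (- \<sigma>))
      \<le> (cmod (a (Suc n)))\<^sup>2 * real (Suc n) powr (- \<sigma>) + real (Suc n) powr (- \<sigma>)"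
  proof (intro exI allI impI)
    fix n
    have "cmod (a (Suc n)) \<le> (cmod (a (Suc n)))\<^sup>2 + 1"
      using sum_squares_bound[of "cmod (a (Suc n))" 1] norm_ge_zero[of "a (Suc n)"]
      by (smt (verit) mult_cancel_left1 one_power2 power2_less_0)
    from mult_right_mono[OF this, of "real (Suc n) powr (- \<sigma>)"]
    show "norm (cmod (a (Suc n)) * real (Suc n) powr (- \<sigma>))
      \<le> (cmod (a (Suc n)))\<^sup>2 * real (Suc n) powr (- \<sigma>) + real (Suc n) powr (- \<sigma>)"
      by (simp add: algebra_simps)
  qed
qed

lemma dirichlet_bound:
  assumes "dirichlet_rep a L" "\<sigma> > 1"
  obtains C where "\<And>s. Re s = \<sigma> \<Longrightarrow> cmod (L s) \<le> C"
proof (rule that)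
  fix s assume s: "Re s = \<sigma>"
  have *: "norm (a (Suc n) * of_nat (Suc n) powr (- s)) = cmod (a (Suc n)) * real (Suc n) powr (- \<sigma>)" for n
    using norm_of_nat_powr[of "Suc n" "- s"] s by (simp add: norm_mult del: of_nat_Suc)
  have "(\<lambda>n. a (Suc n) * of_nat (Suc n) powr (- s)) sums L s"
    using assms s unfolding dirichlet_rep_def by auto
  then have "L s = (\<Sum>n. a (Suc n) * of_nat (Suc n) powr (- s))" by (simp add: sums_iff)
  also have "cmod \<dots> \<le> (\<Sum>n. norm (a (Suc n) * of_nat (Suc n) powr (- s)))"
    by (rule summable_norm) (unfold *, rule dirichlet_abs_summable[OF assms])
  finally show "cmod (L s) \<le> (\<Sum>n. cmod (a (Suc n)) * real (Suc n) powr (- \<sigma>))" unfolding * .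
qed

lemma open_right_strip: "open (right_strip s e)"
proof -
  have "right_strip s e = {w. Re s - e < Re w} \<inter> ({w. Im w < Im s + e} \<inter> {w. Im s - e < Im w})"
    by (auto simp: right_strip_def abs_less_iff)
  then show ?thesis
    by (simp only:) (intro open_Int open_halfspace_Re_gt open_halfspace_Im_lt open_halfspace_Im_gt)
qed

lemma convex_right_strip: "convex (right_strip s e)"
proof -
  have "right_strip s e = {w. Re s - e < Re w} \<inter> ({w. Im w < Im s + e} \<inter> {w. Im s - e < Im w})"
    by (auto simp: right_strip_def abs_less_iff)
  then show ?thesis
    by (simp only:) (intro convex_Int convex_halfspace_Re_gt convex_halfspace_Im_lt convex_halfspace_Im_gt)
qed

lemma continues_to_unique:
  assumes "continues_to L s v" "continues_to L s v'"
  shows "v = v'"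
proof -
  obtain e g where e: "e > 0" "g holomorphic_on right_strip s e"
    "\<And>w. w \<in> right_strip s e \<Longrightarrow> Re w > 1 \<Longrightarrow> g w = L w" "g s = v"
    using assms(1) unfolding continues_to_def by blast
  obtain e' g' where e': "e' > 0" "g' holomorphic_on right_strip s e'"
    "\<And>w. w \<in> right_strip s e' \<Longrightarrow> Re w > 1 \<Longrightarrow> g' w = L w" "g' s = v'"
    using assms(2) unfolding continues_to_def by blast
  define d where "d = min e e'"
  have sub: "right_strip s d \<subseteq> right_strip s e" "right_strip s d \<subseteq> right_strip s e'"
    by (auto simp: right_strip_def d_def)
  have s: "s \<in> right_strip s d" using e e' by (auto simp: right_strip_def d_def)
  have "g s = g' s"
  proof (rule analytic_continuation_open[of "right_strip s d \<inter> {w. Re w > 1}" "right_strip s d" g g'])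
    have "Complex (max (Re s) 2) (Im s) \<in> right_strip s d \<inter> {w. Re w > 1}"
      using e e' by (auto simp: right_strip_def d_def)
    then show "right_strip s d \<inter> {w. Re w > 1} \<noteq> {}" by blast
    show "g holomorphic_on right_strip s d" "g' holomorphic_on right_strip s d"
      using e(2) e'(2) sub holomorphic_on_subset by blast+
    show "g z = g' z" if "z \<in> right_strip s d \<inter> {w. Re w > 1}" for z
      using e(3)[of z] e'(3)[of z] that subsetD[OF sub(1), of z] subsetD[OF sub(2), of z] by auto
  qed (auto intro: open_right_strip open_Int open_halfspace_Re_gt convex_connected convex_right_strip s)
  then show ?thesis using e e' by simp
qed

lemma continuation_eq: "continues_to L s v \<Longrightarrow> continuation L s = v"
  unfolding continuation_def by (rule the_equality) (auto dest: continues_to_unique)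

text \<open>The translate of \<open>Q_strip\<close> by \<open>inl\<close>.\<close>

definition block_strip :: "real \<Rightarrow> real \<Rightarrow> nat \<Rightarrow> complex set" where
  "block_strip \<alpha> l n = {s. \<alpha> < Re s \<and> (real n - 1) * l < Im s \<and> Im s < (real n + 2) * l}"

text \<open>The rectangle of the last clause exceeds the block \<open>[nl, (n+1)l]\<close> by \<open>l/2\<close> on both sides, so that a
  rectangle of height \<open>l\<close> centred at any \<open>\<sigma> + it\<close> with \<open>t\<close> in the block lies inside.\<close>

definition regular_block :: "(complex \<Rightarrow> complex) \<Rightarrow> real \<Rightarrow> real \<Rightarrow> real \<Rightarrow> real \<Rightarrow> nat \<Rightarrow> bool" where
  "regular_block L \<alpha> \<beta> l M n \<longleftrightarrow>
     (\<forall>s\<in>block_strip \<alpha> l n. continuable L s) \<and>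
     continuation L holomorphic_on block_strip \<alpha> l n \<and>
     (\<forall>s\<in>block_strip \<alpha> l n. Re s > 1 \<longrightarrow> continuation L s = L s) \<and>
     (\<forall>s. \<beta> \<le> Re s \<and> Re s \<le> 4 \<and> (real n - 1/2) * l \<le> Im s \<and> Im s \<le> (real n + 3/2) * l
        \<longrightarrow> cmod (continuation L s) \<le> M)"

lemma open_block_strip: "open (block_strip \<alpha> l n)"
proof -
  have "block_strip \<alpha> l n = {w. \<alpha> < Re w} \<inter> ({w. Im w < (real n + 2) * l} \<inter> {w. (real n - 1) * l < Im w})"
    by (auto simp: block_strip_def)
  then show ?thesis
    by (simp only:) (intro open_Int open_halfspace_Re_gt open_halfspace_Im_lt open_halfspace_Im_gt)
qed

lemma continues_to_in_block:
  assumes F: "F holomorphic_on Q_strip \<alpha> l"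
    and FL: "\<And>s. s \<in> Q_strip \<alpha> l \<Longrightarrow> Re s > 1 \<Longrightarrow> F s = L (s + \<i> * of_real (real n * l))"
    and s: "s \<in> block_strip \<alpha> l n"
  shows "continues_to L s (F (s - \<i> * of_real (real n * l)))"
proof -
  define e where "e = min (Re s - \<alpha>) (min (Im s - (real n - 1) * l) ((real n + 2) * l - Im s))"
  have e: "e > 0" using s by (auto simp: e_def block_strip_def)
  have sub: "w - \<i> * of_real (real n * l) \<in> Q_strip \<alpha> l" if "w \<in> right_strip s e" for w
    using that by (auto simp: right_strip_def Q_strip_def e_def abs_less_iff algebra_simps)
  have "(\<lambda>w. F (w - \<i> * of_real (real n * l))) holomorphic_on right_strip s e"
    by (rule holomorphic_on_compose_gen[OF _ F, unfolded o_def]) (use sub in \<open>auto simp: holomorphic_on_diff\<close>)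
  then show ?thesis
    unfolding continues_to_def using e sub FL
    by (intro exI[of _ e] conjI exI[of _ "\<lambda>w. F (w - \<i> * of_real (real n * l))"]) auto
qed

lemma connected_Q_strip: "connected (Q_strip \<alpha> l)" and open_Q_strip: "open (Q_strip \<alpha> l)"
proof -
  have *: "Q_strip \<alpha> l = {w. \<alpha> < Re w} \<inter> ({w. Im w < 2 * l} \<inter> {w. - l < Im w})"
    by (auto simp: Q_strip_def)
  show "connected (Q_strip \<alpha> l)" unfolding *
    by (intro convex_connected convex_Int convex_halfspace_Re_gt convex_halfspace_Im_lt convex_halfspace_Im_gt)
  show "open (Q_strip \<alpha> l)" unfolding *
    by (intro open_Int open_halfspace_Re_gt open_halfspace_Im_lt open_halfspace_Im_gt)
qed

text \<open>Absolute convergence bounds all members of the family at the point \<open>2\<close>, which turns normality in the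
  chordal metric into local boundedness. Passing from \<open>\<alpha>\<close> to \<open>\<beta>\<close> is passing to a compact
  subset.\<close>

lemma class_N_regular_blocks:
  assumes L: "L \<in> class_N u" and a: "dirichlet_rep a L"
    and \<alpha>: "u < \<alpha>" "\<alpha> \<le> 1" and l: "0 < l" and \<epsilon>: "0 < \<epsilon>" and \<beta>: "\<alpha> < \<beta>"
  obtains J M where "J \<subseteq> {1..}" "lower_dens J > ereal (1 - \<epsilon>)" "\<And>n. n \<in> J \<Longrightarrow> regular_block L \<alpha> \<beta> l M n"
proof -
  obtain J F where J: "J \<subseteq> {1..}" "lower_dens J > ereal (1 - \<epsilon>)"
    and F: "\<And>n. n \<in> J \<Longrightarrow> F n holomorphic_on Q_strip \<alpha> l"
      "\<And>n s. n \<in> J \<Longrightarrow> s \<in> Q_strip \<alpha> l \<Longrightarrow> Re s > 1 \<Longrightarrow> F n s = L (s + \<i> * of_real (real n * l))"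
    and normal: "normal_family (Q_strip \<alpha> l) (F ` J)"
  proof -
    have "u < \<alpha> \<and> \<alpha> \<le> 1 \<and> 0 < l \<and> 0 < \<epsilon>" using \<alpha> l \<epsilon> by simp
    from L[unfolded class_N_def mem_Collect_eq, THEN conjunct2, THEN spec, THEN spec, THEN spec, THEN mp, OF this]
    show ?thesis by (elim exE conjE) (rule that, auto)
  qed
  obtain C where C: "\<And>s. Re s = 2 \<Longrightarrow> cmod (L s) \<le> C"
    using dirichlet_bound[OF a, of 2] by auto
  have two: "2 \<in> Q_strip \<alpha> l" using \<alpha> l by (simp add: Q_strip_def)
  define K where "K = cbox (Complex \<beta> (- l / 2)) (Complex 4 (3 * l / 2))"
  have K: "compact K" "K \<subseteq> Q_strip \<alpha> l"
  proof -
    show "compact K" by (simp add: K_def)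
    show "K \<subseteq> Q_strip \<alpha> l"
    proof
      fix z assume "z \<in> K"
      then have "\<beta> \<le> Re z" "- l / 2 \<le> Im z" "Im z \<le> 3 * l / 2"
        by (simp_all add: K_def in_cbox_complex_iff)
      then show "z \<in> Q_strip \<alpha> l" using \<beta> l by (simp add: Q_strip_def)
    qed
  qed
  have "\<exists>B. \<forall>f\<in>F ` J. \<forall>z\<in>K. cmod (f z) \<le> B"
  proof (rule normal_family_bounded_on_compact[OF open_Q_strip connected_Q_strip _ normal two _ K])
    show "f holomorphic_on Q_strip \<alpha> l" if "f \<in> F ` J" for f using that F(1) by auto
    show "cmod (f 2) \<le> C" if "f \<in> F ` J" for f using that F(2) two C by auto
  qed
  then obtain B where B: "\<And>n z. n \<in> J \<Longrightarrow> z \<in> K \<Longrightarrow> cmod (F n z) \<le> B" by auto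
  show ?thesis
  proof (rule that[OF J])
    fix n assume n: "n \<in> J"
    let ?c = "\<i> * of_real (real n * l)"
    have ct: "continues_to L s (F n (s - ?c))" if "s \<in> block_strip \<alpha> l n" for s
      by (rule continues_to_in_block[OF F(1)[OF n] F(2)[OF n] that])
    have cont: "continuation L s = F n (s - ?c)" if "s \<in> block_strip \<alpha> l n" for s
      using continuation_eq[OF ct[OF that]] by simp
    have shift: "s - ?c \<in> Q_strip \<alpha> l" if "s \<in> block_strip \<alpha> l n" for s
      using that by (auto simp: block_strip_def Q_strip_def algebra_simps)
    show "regular_block L \<alpha> \<beta> l B n"
      unfolding regular_block_def
    proof (intro conjI ballI allI impI)
      show "continuable L s" if "s \<in> block_strip \<alpha> l n" for s
        using ct[OF that] unfolding continuable_def by auto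
      have "(\<lambda>s. F n (s - ?c)) holomorphic_on block_strip \<alpha> l n"
        by (rule holomorphic_on_compose_gen[OF _ F(1)[OF n], unfolded o_def])
           (use shift in \<open>auto simp: holomorphic_on_diff\<close>)
      then show "continuation L holomorphic_on block_strip \<alpha> l n"
        by (rule holomorphic_transform) (simp add: cont)
      show "continuation L s = L s" if "s \<in> block_strip \<alpha> l n" "1 < Re s" for s
        using cont[OF that(1)] F(2)[OF n shift[OF that(1)]] that by simp
      fix s assume s: "\<beta> \<le> Re s \<and> Re s \<le> 4 \<and> (real n - 1/2) * l \<le> Im s \<and> Im s \<le> (real n + 3/2) * l"
      have "s \<in> block_strip \<alpha> l n" using s \<beta> l by (auto simp: block_strip_def algebra_simps)
      moreover have "s - ?c \<in> K" using s by (auto simp: K_def in_cbox_complex_iff algebra_simps)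
      ultimately show "cmod (continuation L s) \<le> B" using cont B[OF n] by auto
    qed
  qed
qed

section \<open>Reaching the left of the line of convergence\<close>

text \<open>The left-hand side is the kernel of Hermite's remainder formula for Lagrange
  interpolation at the nodes \<open>Z\<close>. The partial fraction decomposition says that integrating \<open>F\<close> against
  it gives \<open>F(s)\<close> minus a combination of the values at the nodes.\<close>

lemma cauchy_kernel_partial_fractions:
  fixes s :: complex
  assumes "finite Z" "s \<notin> Z"
  shows "\<exists>c. \<forall>z. z \<notin> Z \<and> z \<noteq> s \<longrightarrow>
    (\<Prod>a\<in>Z. (s - a) / (z - a)) / (z - s) = 1 / (z - s) - (\<Sum>a\<in>Z. c a / (z - a))"
  using assms
proof (induction Z rule: finite_induct)
  case empty
  show ?case by simp
next
  case (insert a Z)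
  then obtain c where c: "\<And>z. z \<notin> Z \<Longrightarrow> z \<noteq> s \<Longrightarrow>
    (\<Prod>a\<in>Z. (s - a) / (z - a)) / (z - s) = 1 / (z - s) - (\<Sum>a\<in>Z. c a / (z - a))" by auto
  define e where "e b = c b * (s - a) / (a - b)" for b
  define c' where "c' b = (if b = a then 1 + sum e Z else - e b)" for b
  show ?case
  proof (intro exI[of _ c'] allI impI)
    fix z assume z: "z \<notin> insert a Z \<and> z \<noteq> s"
    have *: "(s - a) / (z - a) * (c b / (z - b)) = e b / (z - a) - e b / (z - b)" if "b \<in> Z" for b
    proof -
      have "b \<noteq> a" "z \<noteq> b" "z \<noteq> a" using that insert z by auto
      then have nz: "a - b \<noteq> 0" "z - b \<noteq> 0" "z - a \<noteq> 0" by auto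
      have "e b / (z - a) - e b / (z - b) = e b * ((z - b) - (z - a)) / ((z - a) * (z - b))"
        using nz by (simp add: field_simps)
      also have "e b * ((z - b) - (z - a)) = c b * (s - a)"
        using nz by (simp add: e_def)
      finally show ?thesis by (simp add: mult_ac)
    qed
    have "(\<Prod>a\<in>insert a Z. (s - a) / (z - a)) / (z - s) =
        (s - a) / (z - a) * ((\<Prod>a\<in>Z. (s - a) / (z - a)) / (z - s))"
      using insert by simp
    also have "\<dots> = (s - a) / (z - a) * (1 / (z - s)) - (\<Sum>b\<in>Z. (s - a) / (z - a) * (c b / (z - b)))"
      using c[of z] z by (simp add: right_diff_distrib sum_distrib_left)
    also have "(\<Sum>b\<in>Z. (s - a) / (z - a) * (c b / (z - b))) = (\<Sum>b\<in>Z. e b / (z - a) - e b / (z - b))"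
      by (rule sum.cong[OF refl], rule *)
    also have "\<dots> = sum e Z / (z - a) - (\<Sum>b\<in>Z. e b / (z - b))"
      by (simp add: sum_subtractf sum_divide_distrib)
    also have "(s - a) / (z - a) * (1 / (z - s)) = 1 / (z - s) - 1 / (z - a)"
      using z by (simp add: field_simps)
    also have "1 / (z - s) - 1 / (z - a) - (sum e Z / (z - a) - (\<Sum>b\<in>Z. e b / (z - b)))
       = 1 / (z - s) - ((1 + sum e Z) / (z - a) + (\<Sum>b\<in>Z. - e b / (z - b)))"
      by (simp add: add_divide_distrib sum_negf)
    also have "(\<Sum>b\<in>Z. - e b / (z - b)) = (\<Sum>b\<in>Z. c' b / (z - b))"
      using insert by (intro sum.cong) (auto simp: c'_def)
    also have "(1 + sum e Z) / (z - a) + (\<Sum>b\<in>Z. c' b / (z - b)) = (\<Sum>b\<in>insert a Z. c' b / (z - b))"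
      using insert by (simp add: c'_def)
    finally show "(\<Prod>a\<in>insert a Z. (s - a) / (z - a)) / (z - s) =
       1 / (z - s) - (\<Sum>a\<in>insert a Z. c' a / (z - a))" .
  qed
qed

lemma cauchy_kernel_functional_bound:
  assumes F: "continuous_on (cball x r) F" "F holomorphic_on ball x r" and r: "0 < r"
    and M: "\<And>z. cmod (z - x) = r \<Longrightarrow> cmod (F z) \<le> M" "0 \<le> M"
    and s: "s \<in> ball x r" and Z: "finite Z" "Z \<subseteq> ball x r"
    and q: "\<And>z. cmod (z - x) = r \<Longrightarrow> cmod (1 / (z - s) - (\<Sum>a\<in>Z. c a / (z - a))) \<le> q" "0 \<le> q"
  shows "cmod (F s - (\<Sum>a\<in>Z. c a * F a)) \<le> q * M * r"
proof -
  have ci: "((\<lambda>u. F u / (u - w)) has_contour_integral (2 * of_real pi * \<i> * F w)) (circlepath x r)"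
    if "w \<in> ball x r" for w
    using Cauchy_integral_circlepath[OF F, of w] that by (simp add: dist_norm norm_minus_commute)
  have "((\<lambda>u. F u / (u - s) - (\<Sum>a\<in>Z. c a * (F u / (u - a)))) has_contour_integral
      (2 * of_real pi * \<i> * F s - (\<Sum>a\<in>Z. c a * (2 * of_real pi * \<i> * F a)))) (circlepath x r)"
    using Z s by (intro has_contour_integral_diff has_contour_integral_sum has_contour_integral_lmul ci) auto
  also have "(\<lambda>u. F u / (u - s) - (\<Sum>a\<in>Z. c a * (F u / (u - a)))) =
      (\<lambda>u. F u * (1 / (u - s) - (\<Sum>a\<in>Z. c a / (u - a))))"
    by (rule ext) (simp add: right_diff_distrib sum_distrib_left mult_ac)
  finally have "cmod (2 * of_real pi * \<i> * F s - (\<Sum>a\<in>Z. c a * (2 * of_real pi * \<i> * F a))) \<le> (M * q) * (2 * pi * r)"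
    by (rule has_contour_integral_bound_circlepath)
       (use M q r in \<open>auto simp: norm_mult intro!: mult_mono\<close>)
  also have "2 * of_real pi * \<i> * F s - (\<Sum>a\<in>Z. c a * (2 * of_real pi * \<i> * F a)) =
      2 * of_real pi * \<i> * (F s - (\<Sum>a\<in>Z. c a * F a))"
    by (simp add: right_diff_distrib sum_distrib_left mult_ac)
  also have "cmod (2 * of_real pi * \<i> * (F s - (\<Sum>a\<in>Z. c a * F a))) = 2 * pi * cmod (F s - (\<Sum>a\<in>Z. c a * F a))"
    unfolding norm_mult by simp
  also have "(M * q) * (2 * pi * r) = 2 * pi * (q * M * r)" by (simp only: mult_ac)
  finally show ?thesis by (rule mult_left_le_imp_le) simp
qed

text \<open>The right edge \<open>4\<close> leaves room for discs around points of \<open>[\<alpha>, 2]\<close>.\<close>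

definition rect :: "real \<Rightarrow> real \<Rightarrow> complex set" where
  "rect \<beta> h = {z. \<beta> < Re z \<and> Re z < 4 \<and> \<bar>Im z\<bar> < h}"

text \<open>Finite linear combinations of evaluations at real points of \<open>(1, 4)\<close>, where the Dirichlet series
  converges absolutely. The inductive form avoids carrying index sets along.\<close>

inductive_set right_functionals :: "((complex \<Rightarrow> complex) \<Rightarrow> complex) set" where
  zero: "(\<lambda>F. 0) \<in> right_functionals"
| step: "\<lbrakk>\<nu> \<in> right_functionals; 1 < s; s < 4\<rbrakk>
    \<Longrightarrow> (\<lambda>F. \<nu> F + c * F (complex_of_real s)) \<in> right_functionals"

lemma right_functionals_scale_add:
  assumes "\<nu>' \<in> right_functionals" "\<nu> \<in> right_functionals"
  shows "(\<lambda>F. \<nu> F + c * \<nu>' F) \<in> right_functionals"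
  using assms(1)
proof induction
  case zero
  then show ?case using assms(2) by simp
next
  case (step \<nu>' s d)
  have "(\<lambda>F. (\<nu> F + c * \<nu>' F) + (c * d) * F (complex_of_real s)) \<in> right_functionals"
    using step by (intro right_functionals.step) auto
  then show ?case by (simp add: algebra_simps)
qed

lemma right_functionals_sum:
  assumes "finite Z" "\<And>a. a \<in> Z \<Longrightarrow> \<nu> a \<in> right_functionals"
  shows "(\<lambda>F. \<Sum>a\<in>Z. c a * \<nu> a F) \<in> right_functionals"
  using assms
proof (induction Z rule: finite_induct)
  case empty
  then show ?case by (simp add: right_functionals.zero)
next
  case (insert a Z)
  have "(\<lambda>F. (\<Sum>a\<in>Z. c a * \<nu> a F) + c a * \<nu> a F) \<in> right_functionals"
    using insert by (intro right_functionals_scale_add) auto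
  then show ?case using insert by (simp add: add.commute)
qed

text \<open>The functional depends on \<open>\<eta>\<close> but serves all functions at once. This uniformity is what allows to apply it
  both to the remainder of the Dirichlet series at all good times and to \<open>m\<^bsup>-s\<^esup>\<close> for all \<open>m\<close>.\<close>

definition reachable :: "real \<Rightarrow> real \<Rightarrow> real \<Rightarrow> bool" where
  "reachable \<beta> h \<sigma> \<longleftrightarrow> (\<forall>\<eta>>0. \<exists>\<nu>\<in>right_functionals. \<forall>F M.
      F holomorphic_on rect \<beta> h \<longrightarrow> (\<forall>z\<in>rect \<beta> h. cmod (F z) \<le> M) \<longrightarrow>
      cmod (F (of_real \<sigma>) - \<nu> F) \<le> \<eta> * M)"

lemma reachable_right: "1 < \<sigma> \<Longrightarrow> \<sigma> < 4 \<Longrightarrow> \<beta> < \<sigma> \<Longrightarrow> 0 < h \<Longrightarrow> reachable \<beta> h \<sigma>"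
  unfolding reachable_def
proof (intro allI impI)
  fix \<eta> :: real assume \<sigma>: "1 < \<sigma>" "\<sigma> < 4" "\<beta> < \<sigma>" "0 < h" and \<eta>: "0 < \<eta>"
  have "(\<lambda>F. 0 + 1 * F (complex_of_real \<sigma>)) \<in> right_functionals"
    using \<sigma> by (intro right_functionals.intros)
  moreover have "0 \<le> \<eta> * M" if "\<forall>z\<in>rect \<beta> h. cmod (F z) \<le> M" for F :: "complex \<Rightarrow> complex" and M
  proof -
    have "of_real \<sigma> \<in> rect \<beta> h" using \<sigma> by (simp add: rect_def)
    then have "0 \<le> M" using that norm_ge_zero order.trans by blast
    then show ?thesis using \<eta> by simp
  qed
  ultimately show "\<exists>\<nu>\<in>right_functionals. \<forall>F M.
      F holomorphic_on rect \<beta> h \<longrightarrow> (\<forall>z\<in>rect \<beta> h. cmod (F z) \<le> M) \<longrightarrow>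
      cmod (F (of_real \<sigma>) - \<nu> F) \<le> \<eta> * M"
    by (intro bexI[of _ "\<lambda>F. 0 + 1 * F (complex_of_real \<sigma>)"]) auto
qed

lemma cball_subset_rect:
  assumes "0 \<le> r" "\<beta> < x - r" "x + r < 4" "r < h"
  shows "cball (of_real x) r \<subseteq> rect \<beta> h"
proof
  fix z assume "z \<in> cball (complex_of_real x) r"
  then have "cmod (z - of_real x) \<le> r" by (simp add: dist_norm norm_minus_commute)
  then have "\<bar>Re z - x\<bar> \<le> r" "\<bar>Im z\<bar> \<le> r"
    using abs_Re_le_cmod[of "z - of_real x"] abs_Im_le_cmod[of "z - of_real x"] by auto
  then show "z \<in> rect \<beta> h" using assms by (auto simp: rect_def)
qed

text \<open>Interpolation at \<open>K\<close> nodes in \<open>[\<sigma> + r/8, \<sigma> + r/4]\<close> has an error that decays like \<open>(1/2)\<^sup>K\<close>,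
  because on the circle of radius \<open>r\<close> around \<open>\<sigma> + r/8\<close> each node is at least twice as far from the
  circle as from \<open>\<sigma>\<close>. The values at the nodes are then replaced by functionals.\<close>

lemma reachable_step:
  assumes r: "0 < r" and \<sigma>: "\<beta> < \<sigma> - r" "\<sigma> + 2 * r < 4" "r < h"
    and near: "\<And>x. \<sigma> + r / 8 \<le> x \<Longrightarrow> x \<le> \<sigma> + r / 4 \<Longrightarrow> reachable \<beta> h x"
  shows "reachable \<beta> h \<sigma>"
  unfolding reachable_def
proof (intro allI impI)
  fix \<eta> :: real assume \<eta>: "0 < \<eta>"
  obtain K where K: "(1/2)^K < \<eta> / 4" using real_arch_pow_inv[of "\<eta> / 4" "1/2"] \<eta> by auto
  define x where "x = \<sigma> + r / 8"
  define node where "node j = x + r / 8 * (real j / real K)" for j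
  define Z where "Z = (\<lambda>j. complex_of_real (node j)) ` {..<K}"
  have node: "x \<le> node j" "node j \<le> x + r / 8" if "j < K" for j
  proof -
    have "0 \<le> real j / real K" "real j / real K \<le> 1" using that by auto
    then show "x \<le> node j" "node j \<le> x + r / 8"
      using r mult_left_le[of "real j / real K" "r / 8"] by (auto simp: node_def)
  qed
  have inj: "inj_on (\<lambda>j. complex_of_real (node j)) {..<K}"
    by (rule inj_onI) (use r in \<open>auto simp: node_def\<close>)
  have Z: "finite Z" "card Z = K" by (auto simp: Z_def card_image[OF inj])
  have Zx: "a = of_real (Re a) \<and> x \<le> Re a \<and> Re a \<le> x + r / 8" if "a \<in> Z" for a
    using that node by (auto simp: Z_def)
  have sub: "cball (of_real x) r \<subseteq> rect \<beta> h"
    using r \<sigma> by (intro cball_subset_rect) (auto simp: x_def)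
  have sZ: "of_real \<sigma> \<notin> Z" using Zx[of "of_real \<sigma>"] r by (auto simp: x_def)
  obtain c where c: "\<And>z. z \<notin> Z \<Longrightarrow> z \<noteq> of_real \<sigma> \<Longrightarrow>
    (\<Prod>a\<in>Z. (of_real \<sigma> - a) / (z - a)) / (z - of_real \<sigma>) = 1 / (z - of_real \<sigma>) - (\<Sum>a\<in>Z. c a / (z - a))"
    using cauchy_kernel_partial_fractions[OF Z(1) sZ] by auto
  have Zb: "Z \<subseteq> ball (of_real x) r"
  proof
    fix a assume "a \<in> Z"
    from Zx[OF this] obtain y where "a = of_real y" "x \<le> y" "y \<le> x + r / 8" by blast
    then show "a \<in> ball (of_real x) r" using r by (simp add: dist_norm flip: of_real_diff)
  qed
  have q: "cmod (1 / (z - of_real \<sigma>) - (\<Sum>a\<in>Z. c a / (z - a))) \<le> (1/2)^K * (2 / r)"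
    if z: "cmod (z - of_real x) = r" for z
  proof -
    have "z \<notin> ball (of_real x) r" using z by (simp add: dist_norm norm_minus_commute)
    then have nz: "z \<notin> Z" using Zb by auto
    have zs: "cmod (z - of_real \<sigma>) \<ge> r / 2"
      using norm_triangle_ineq4[of "z - of_real \<sigma>" "of_real (x - \<sigma>)"] z r
      by (simp add: x_def algebra_simps)
    then have ns: "z \<noteq> of_real \<sigma>" using r by auto
    have fac: "cmod ((of_real \<sigma> - a) / (z - a)) \<le> 1/2" if "a \<in> Z" for a
    proof -
      from Zx[OF that] obtain y where y: "a = of_real y" "x \<le> y" "y \<le> x + r / 8" by blast
      have "cmod (of_real \<sigma> - a) \<le> r / 4" using y r by (simp add: x_def flip: of_real_diff)
      moreover have "cmod (z - a) \<ge> r / 2"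
      proof -
        have "cmod (of_real x - of_real y :: complex) \<le> r / 8" using y by (simp flip: of_real_diff)
        then show ?thesis
          using norm_triangle_ineq4[of "z - a" "of_real x - of_real y"] z r y(1) by simp
      qed
      ultimately show ?thesis using r by (simp add: norm_divide divide_simps)
    qed
    have "cmod (\<Prod>a\<in>Z. (of_real \<sigma> - a) / (z - a)) \<le> (\<Prod>a\<in>Z. 1/2)"
      unfolding prod_norm[symmetric] by (rule prod_mono) (use fac in auto)
    then have "cmod (\<Prod>a\<in>Z. (of_real \<sigma> - a) / (z - a)) \<le> (1/2)^K" using Z by simp
    moreover have "1 / cmod (z - of_real \<sigma>) \<le> 2 / r"
      using zs r by (simp add: divide_simps)
    ultimately have "cmod (\<Prod>a\<in>Z. (of_real \<sigma> - a) / (z - a)) * (1 / cmod (z - of_real \<sigma>)) \<le> (1/2)^K * (2 / r)"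
      by (intro mult_mono) auto
    then show ?thesis unfolding c[OF nz ns, symmetric] by (simp add: norm_divide)
  qed
  define A where "A = (\<Sum>a\<in>Z. cmod (c a)) + 1"
  have A: "A > 0" unfolding A_def by (intro add_nonneg_pos sum_nonneg) auto
  have "\<forall>a\<in>Z. \<exists>\<nu>\<in>right_functionals. \<forall>F M.
      F holomorphic_on rect \<beta> h \<longrightarrow> (\<forall>z\<in>rect \<beta> h. cmod (F z) \<le> M) \<longrightarrow>
      cmod (F a - \<nu> F) \<le> \<eta> / (2 * A) * M"
  proof
    fix a assume "a \<in> Z"
    from Zx[OF this] obtain y where y: "a = of_real y" "x \<le> y" "y \<le> x + r / 8" by blast
    have "reachable \<beta> h y" using y by (intro near) (auto simp: x_def)
    moreover have "\<eta> / (2 * A) > 0" using \<eta> A by simp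
    ultimately show "\<exists>\<nu>\<in>right_functionals. \<forall>F M.
      F holomorphic_on rect \<beta> h \<longrightarrow> (\<forall>z\<in>rect \<beta> h. cmod (F z) \<le> M) \<longrightarrow>
      cmod (F a - \<nu> F) \<le> \<eta> / (2 * A) * M" unfolding y(1) reachable_def by blast
  qed
  then obtain \<nu> where \<nu>: "\<And>a. a \<in> Z \<Longrightarrow> \<nu> a \<in> right_functionals"
    "\<And>a F M. a \<in> Z \<Longrightarrow> F holomorphic_on rect \<beta> h \<Longrightarrow> (\<forall>z\<in>rect \<beta> h. cmod (F z) \<le> M) \<Longrightarrow>
      cmod (F a - \<nu> a F) \<le> \<eta> / (2 * A) * M" by metis
  show "\<exists>\<nu>\<in>right_functionals. \<forall>F M. F holomorphic_on rect \<beta> h \<longrightarrow> (\<forall>z\<in>rect \<beta> h. cmod (F z) \<le> M) \<longrightarrow>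
      cmod (F (of_real \<sigma>) - \<nu> F) \<le> \<eta> * M"
  proof (intro bexI allI impI)
    show "(\<lambda>F. \<Sum>a\<in>Z. c a * \<nu> a F) \<in> right_functionals"
      by (rule right_functionals_sum) (use Z \<nu> in auto)
    fix F M assume F: "F holomorphic_on rect \<beta> h" "\<forall>z\<in>rect \<beta> h. cmod (F z) \<le> M"
    have "of_real x \<in> rect \<beta> h" using sub r by auto
    then have M: "0 \<le> M" using F norm_ge_zero order.trans by blast
    have "cmod (F (of_real \<sigma>) - (\<Sum>a\<in>Z. c a * F a)) \<le> (1/2)^K * (2 / r) * M * r"
    proof (rule cauchy_kernel_functional_bound[OF _ _ r _ M _ Z(1) Zb q])
      show "continuous_on (cball (of_real x) r) F" "F holomorphic_on ball (of_real x) r"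
        using F(1) sub holomorphic_on_imp_continuous_on holomorphic_on_subset ball_subset_cball by blast+
      show "cmod (F z) \<le> M" if "cmod (z - of_real x) = r" for z
      proof -
        have "z \<in> cball (of_real x) r" using that by (simp add: dist_norm norm_minus_commute)
        then show ?thesis using F sub by auto
      qed
      show "of_real \<sigma> \<in> ball (complex_of_real x) r" using r by (simp add: x_def dist_norm)
    qed (use r in auto)
    also have "\<dots> = 2 * (1/2)^K * M" using r by simp
    also have "\<dots> \<le> \<eta> / 2 * M" using K M by (intro mult_right_mono) auto
    finally have 1: "cmod (F (of_real \<sigma>) - (\<Sum>a\<in>Z. c a * F a)) \<le> \<eta> / 2 * M" .
    have "cmod ((\<Sum>a\<in>Z. c a * F a) - (\<Sum>a\<in>Z. c a * \<nu> a F)) = cmod (\<Sum>a\<in>Z. c a * (F a - \<nu> a F))"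
      by (simp add: sum_subtractf right_diff_distrib)
    also have "\<dots> \<le> (\<Sum>a\<in>Z. cmod (c a) * (\<eta> / (2 * A) * M))"
      by (rule order.trans[OF norm_sum sum_mono], unfold norm_mult)
         (rule mult_left_mono[OF \<nu>(2)[OF _ F]], auto)
    also have "\<dots> = (A - 1) * (\<eta> / (2 * A) * M)"
    proof -
      have "(\<Sum>a\<in>Z. cmod (c a)) = A - 1" by (simp add: A_def)
      then show ?thesis by (simp only: sum_distrib_right[symmetric])
    qed
    also have "\<dots> \<le> A * (\<eta> / (2 * A) * M)"
      using A \<eta> M by (intro mult_right_mono) auto
    also have "\<dots> = \<eta> / 2 * M" using A by simp
    finally have 2: "cmod ((\<Sum>a\<in>Z. c a * F a) - (\<Sum>a\<in>Z. c a * \<nu> a F)) \<le> \<eta> / 2 * M" .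
    show "cmod (F (of_real \<sigma>) - (\<Sum>a\<in>Z. c a * \<nu> a F)) \<le> \<eta> * M"
      using norm_triangle_ineq[of "F (of_real \<sigma>) - (\<Sum>a\<in>Z. c a * F a)" "(\<Sum>a\<in>Z. c a * F a) - (\<Sum>a\<in>Z. c a * \<nu> a F)"] 1 2
      by simp
  qed
qed

text \<open>Each application of the interpolation step gains \<open>r/8\<close>, with \<open>r\<close> fixed by the distance to the boundary of
  the rectangle.\<close>

lemma reachable_all:
  assumes "\<beta> < \<alpha>" "0 < h" "\<alpha> \<le> \<sigma>" "\<sigma> \<le> 2"
  shows "reachable \<beta> h \<sigma>"
proof -
  define r where "r = min (\<alpha> - \<beta>) (min h 1) / 2"
  have "0 < min (\<alpha> - \<beta>) (min h 1)" using assms by simp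
  moreover have "min (\<alpha> - \<beta>) (min h 1) \<le> \<alpha> - \<beta>" "min (\<alpha> - \<beta>) (min h 1) \<le> h" "min (\<alpha> - \<beta>) (min h 1) \<le> 1" by auto
  ultimately have r: "0 < r" "r < \<alpha> - \<beta>" "r < h" "r < 1" unfolding r_def by linarith+
  have "\<forall>\<sigma>. \<alpha> \<le> \<sigma> \<longrightarrow> \<sigma> \<le> 2 \<longrightarrow> 1 - real n * (r / 8) < \<sigma> \<longrightarrow> reachable \<beta> h \<sigma>" for n
  proof (induction n)
    case 0
    then show ?case using assms by (auto intro!: reachable_right)
  next
    case (Suc n)
    show ?case
    proof (intro allI impI)
      fix \<sigma> assume \<sigma>: "\<alpha> \<le> \<sigma>" "\<sigma> \<le> 2" "1 - real (Suc n) * (r / 8) < \<sigma>"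
      show "reachable \<beta> h \<sigma>"
      proof (cases "1 < \<sigma>")
        case True
        then show ?thesis using \<sigma> assms by (intro reachable_right) auto
      next
        case False
        show ?thesis
        proof (rule reachable_step[OF r(1)])
          fix x assume x: "\<sigma> + r / 8 \<le> x" "x \<le> \<sigma> + r / 4"
          have "real (Suc n) * (r / 8) = real n * (r / 8) + r / 8" by (simp add: algebra_simps)
          then have "1 - real n * (r / 8) < x" using \<sigma>(3) x(1) by linarith
          then show "reachable \<beta> h x" using Suc.IH x \<sigma> False r by auto
        qed (use False \<sigma> r in auto)
      qed
    qed
  qed
  moreover obtain n where "(1 - \<sigma>) / (r / 8) < real n" using reals_Archimedean2 by blast
  then have "1 - real n * (r / 8) < \<sigma>" using r by (simp add: field_simps)
  ultimately show ?thesis using assms by blast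
qed

text \<open>Functions bounded by \<open>M\<close> on the rectangle are uniformly Lipschitz near \<open>\<sigma>0\<close>, so one functional
  serves a neighbourhood of \<open>\<sigma>0\<close>. Compactness of \<open>[\<alpha>, 2]\<close> will give uniformity in \<open>\<sigma>\<close>.\<close>

lemma right_functional_near:
  assumes "\<beta> < \<alpha>" "0 < h" "\<alpha> \<le> \<sigma>0" "\<sigma>0 \<le> 2" and \<eta>: "0 < \<eta>"
  obtains \<nu> \<delta> where "\<nu> \<in> right_functionals" "0 < \<delta>"
    "\<And>\<sigma> F M. \<bar>\<sigma> - \<sigma>0\<bar> < \<delta> \<Longrightarrow> F holomorphic_on rect \<beta> h \<Longrightarrow> (\<forall>z\<in>rect \<beta> h. cmod (F z) \<le> M) \<Longrightarrow>
       cmod (F (of_real \<sigma>) - \<nu> F) \<le> \<eta> * M"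
proof -
  define r where "r = min (\<alpha> - \<beta>) (min h 1) / 2"
  have "0 < min (\<alpha> - \<beta>) (min h 1)" using assms by simp
  moreover have "min (\<alpha> - \<beta>) (min h 1) \<le> \<alpha> - \<beta>" "min (\<alpha> - \<beta>) (min h 1) \<le> h" "min (\<alpha> - \<beta>) (min h 1) \<le> 1" by auto
  ultimately have r: "0 < r" "r < \<alpha> - \<beta>" "r < h" "r < 1" unfolding r_def by linarith+
  have "reachable \<beta> h \<sigma>0" by (rule reachable_all[OF assms(1-4)])
  then obtain \<nu> where \<nu>: "\<nu> \<in> right_functionals"
    "\<And>F M. F holomorphic_on rect \<beta> h \<Longrightarrow> (\<forall>z\<in>rect \<beta> h. cmod (F z) \<le> M) \<Longrightarrow>
       cmod (F (of_real \<sigma>0) - \<nu> F) \<le> \<eta> / 2 * M"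
    unfolding reachable_def using \<eta> by (metis half_gt_zero)
  \<comment> \<open>The kernels at \<open>\<sigma>\<close> and \<open>\<sigma>0\<close> differ by at most \<open>2|\<sigma> - \<sigma>0|/r\<^sup>2\<close> on the circle.\<close>
  define \<delta> where "\<delta> = min (r / 2) (\<eta> * r / 4)"
  have \<delta>: "0 < \<delta>" "\<delta> \<le> r / 2" "\<delta> \<le> \<eta> * r / 4" using r \<eta> by (auto simp: \<delta>_def)
  show ?thesis
  proof (rule that[OF \<nu>(1) \<delta>(1)])
    fix \<sigma> F M
    assume \<sigma>: "\<bar>\<sigma> - \<sigma>0\<bar> < \<delta>" and F: "F holomorphic_on rect \<beta> h" "\<forall>z\<in>rect \<beta> h. cmod (F z) \<le> M"
    have sub: "cball (of_real \<sigma>0) r \<subseteq> rect \<beta> h"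
      using r assms by (intro cball_subset_rect) auto
    have "of_real \<sigma>0 \<in> rect \<beta> h" using sub r by auto
    then have M: "0 \<le> M" using F norm_ge_zero order.trans by blast
    have n\<sigma>: "cmod (of_real \<sigma> - of_real \<sigma>0) < \<delta>" using \<sigma> by (simp flip: of_real_diff)
    have "cmod (F (of_real \<sigma>) - (\<Sum>a\<in>{of_real \<sigma>0}. 1 * F a)) \<le> (2 * \<delta> / r\<^sup>2) * M * r"
    proof (rule cauchy_kernel_functional_bound[OF _ _ r(1) _ M])
      show "continuous_on (cball (of_real \<sigma>0) r) F" "F holomorphic_on ball (of_real \<sigma>0) r"
        using F(1) sub holomorphic_on_imp_continuous_on holomorphic_on_subset ball_subset_cball by blast+
      show "cmod (F z) \<le> M" if "cmod (z - of_real \<sigma>0) = r" for z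
      proof -
        have "z \<in> cball (of_real \<sigma>0) r" using that by (simp add: dist_norm norm_minus_commute)
        then show ?thesis using F sub by auto
      qed
      show "of_real \<sigma> \<in> ball (complex_of_real \<sigma>0) r"
        using n\<sigma> \<delta> r by (simp add: dist_norm norm_minus_commute)
      show "cmod (1 / (z - of_real \<sigma>) - (\<Sum>a\<in>{of_real \<sigma>0}. 1 / (z - a))) \<le> 2 * \<delta> / r\<^sup>2"
        if z: "cmod (z - of_real \<sigma>0) = r" for z
      proof -
        have zs: "cmod (z - of_real \<sigma>) \<ge> r / 2"
          using norm_triangle_ineq4[of "z - of_real \<sigma>" "of_real \<sigma>0 - of_real \<sigma>"] z n\<sigma> \<delta> r
          by (simp add: norm_minus_commute)
        then have nz: "z - of_real \<sigma> \<noteq> 0" "z - of_real \<sigma>0 \<noteq> 0" using z r by auto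
        have "1 / (z - of_real \<sigma>) - 1 / (z - of_real \<sigma>0) =
           (of_real \<sigma> - of_real \<sigma>0) / ((z - of_real \<sigma>) * (z - of_real \<sigma>0))"
          using nz by (simp add: field_simps)
        then have "cmod (1 / (z - of_real \<sigma>) - 1 / (z - of_real \<sigma>0)) =
           cmod (of_real \<sigma> - of_real \<sigma>0) / (cmod (z - of_real \<sigma>) * r)"
          by (simp only: norm_divide norm_mult z)
        also have "\<dots> \<le> \<delta> / (r / 2 * r)"
          using n\<sigma> zs r \<delta> by (intro frac_le mult_right_mono) auto
        also have "\<dots> = 2 * \<delta> / r\<^sup>2" by (simp add: power2_eq_square)
        finally show ?thesis by simp
      qed
    qed (use r \<delta> in auto)
    also have "\<dots> = 2 * \<delta> / r * M" using r by (simp add: power2_eq_square)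
    also have "\<dots> \<le> \<eta> / 2 * M" using \<delta> r M by (intro mult_right_mono) (auto simp: field_simps)
    finally have "cmod (F (of_real \<sigma>) - F (of_real \<sigma>0)) \<le> \<eta> / 2 * M" by simp
    then show "cmod (F (of_real \<sigma>) - \<nu> F) \<le> \<eta> * M"
      using norm_triangle_ineq[of "F (of_real \<sigma>) - F (of_real \<sigma>0)" "F (of_real \<sigma>0) - \<nu> F"] \<nu>(2)[OF F] by simp
  qed
qed

section \<open>Mean squares over good times\<close>

lemma right_functional_dirichlet:
  assumes "\<nu> \<in> right_functionals"
    and b: "\<And>s. s > 1 \<Longrightarrow> summable (\<lambda>n. cmod (b (Suc n)) * real (Suc n) powr (- s))"
  shows "summable (\<lambda>n. cmod (b (Suc n)) * cmod (\<nu> (\<lambda>s. of_nat (Suc n) powr (- s)))) \<and>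
    (\<forall>F t. (\<forall>s. 1 < s \<longrightarrow> s < 4 \<longrightarrow>
        (\<lambda>n. b (Suc n) * of_nat (Suc n) powr (- (complex_of_real s + \<i> * of_real t))) sums F (of_real s)) \<longrightarrow>
      (\<lambda>n. b (Suc n) * \<nu> (\<lambda>s. of_nat (Suc n) powr (- s)) * of_nat (Suc n) powr (- (\<i> * of_real t))) sums \<nu> F)"
  using assms(1)
proof induction
  case zero
  show ?case by simp
next
  case (step \<nu> s c)
  show ?case
  proof (intro conjI allI impI)
    have 1: "summable (\<lambda>n. cmod (b (Suc n)) * cmod (\<nu> (\<lambda>s. of_nat (Suc n) powr (- s))) +
        cmod c * (cmod (b (Suc n)) * real (Suc n) powr (- s)))"
      using step b by (intro summable_add summable_mult) auto
    show "summable (\<lambda>n. cmod (b (Suc n)) * cmod (\<nu> (\<lambda>s. of_nat (Suc n) powr (- s)) +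
        c * of_nat (Suc n) powr (- complex_of_real s)))"
    proof (rule summable_comparison_test'[OF 1])
      fix n
      have "cmod (\<nu> (\<lambda>s. of_nat (Suc n) powr (- s)) + c * of_nat (Suc n) powr (- complex_of_real s))
         \<le> cmod (\<nu> (\<lambda>s. of_nat (Suc n) powr (- s))) + cmod c * real (Suc n) powr (- s)"
        by (rule order.trans[OF norm_triangle_ineq])
           (use norm_of_nat_powr[of "Suc n" "- complex_of_real s"] in \<open>simp add: norm_mult del: of_nat_Suc\<close>)
      from mult_left_mono[OF this, of "cmod (b (Suc n))"]
      show "norm (cmod (b (Suc n)) * cmod (\<nu> (\<lambda>s. of_nat (Suc n) powr (- s)) +
           c * of_nat (Suc n) powr (- complex_of_real s)))
        \<le> cmod (b (Suc n)) * cmod (\<nu> (\<lambda>s. of_nat (Suc n) powr (- s))) +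
           cmod c * (cmod (b (Suc n)) * real (Suc n) powr (- s))"
        by (simp add: algebra_simps del: of_nat_Suc)
    qed
    fix F :: "complex \<Rightarrow> complex" and t :: real
    assume F: "\<forall>s. 1 < s \<longrightarrow> s < 4 \<longrightarrow>
        (\<lambda>n. b (Suc n) * of_nat (Suc n) powr (- (complex_of_real s + \<i> * of_real t))) sums F (of_real s)"
    have "(\<lambda>n. b (Suc n) * \<nu> (\<lambda>s. of_nat (Suc n) powr (- s)) * of_nat (Suc n) powr (- (\<i> * of_real t)) +
        c * (b (Suc n) * of_nat (Suc n) powr (- (complex_of_real s + \<i> * of_real t)))) sums
        (\<nu> F + c * F (of_real s))"
      using step F by (intro sums_add sums_mult) auto
    moreover have "of_nat (Suc n) powr (- (complex_of_real s + \<i> * of_real t)) =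
        of_nat (Suc n) powr (- complex_of_real s) * of_nat (Suc n) powr (- (\<i> * of_real t))" for n
      unfolding minus_add_distrib by (rule powr_add)
    ultimately show "(\<lambda>n. b (Suc n) * (\<nu> (\<lambda>s. of_nat (Suc n) powr (- s)) +
          c * of_nat (Suc n) powr (- complex_of_real s)) * of_nat (Suc n) powr (- (\<i> * of_real t)))
        sums (\<nu> F + c * F (of_real s))"
      by (simp add: algebra_simps del: of_nat_Suc)
  qed
qed

text \<open>The functional is tested on \<open>m\<^bsup>-s\<^esup>\<close> itself, which is bounded by \<open>m\<^bsup>-\<beta>\<^esup>\<close> on the
  rectangle. It thus cannot enlarge coefficients by more than passing to the left edge does.\<close>

lemma right_functional_coeff_bound:
  assumes \<nu>: "\<And>F M. F holomorphic_on rect \<beta> h \<Longrightarrow> (\<forall>z\<in>rect \<beta> h. cmod (F z) \<le> M) \<Longrightarrow>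
       cmod (F (of_real \<sigma>) - \<nu> F) \<le> \<eta> * M"
    and "\<beta> < \<sigma>" "\<eta> \<le> 1" "1 \<le> m"
  shows "cmod (\<nu> (\<lambda>s. of_nat m powr (- s))) \<le> 2 * real m powr (- \<beta>)"
proof -
  have "cmod (of_nat m powr (- complex_of_real \<sigma>) - \<nu> (\<lambda>s. of_nat m powr (- s))) \<le> \<eta> * real m powr (- \<beta>)"
  proof (rule \<nu>)
    show "(\<lambda>s. of_nat m powr (- s)) holomorphic_on rect \<beta> h"
      using assms by (intro holomorphic_intros) auto
    show "\<forall>z\<in>rect \<beta> h. cmod (of_nat m powr (- z)) \<le> real m powr (- \<beta>)"
      using assms by (auto simp: norm_of_nat_powr rect_def intro!: powr_mono)
  qed
  also have "\<dots> \<le> 1 * real m powr (- \<beta>)" using assms by (intro mult_right_mono) auto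
  finally have "cmod (of_nat m powr (- complex_of_real \<sigma>) - \<nu> (\<lambda>s. of_nat m powr (- s))) \<le> real m powr (- \<beta>)"
    by simp
  moreover have "cmod (of_nat m powr (- complex_of_real \<sigma>)) \<le> real m powr (- \<beta>)"
    using assms by (auto simp: norm_of_nat_powr intro!: powr_mono)
  ultimately show ?thesis
    using norm_triangle_sub[of "\<nu> (\<lambda>s. of_nat m powr (- s))" "of_nat m powr (- complex_of_real \<sigma>)"]
    by (simp add: norm_minus_commute)
qed

context averaging_to_characters
begin

text \<open>A uniformly small tail is split off; for the rest, the mean of \<open>|P|\<^sup>2\<close> is compared with
  Parseval's identity on the group. The factor 2 comes from the splitting.\<close>

lemma abs_series_mean_square:
  assumes d: "summable (\<lambda>n. cmod (d (Suc n)))" and \<epsilon>: "0 < \<epsilon>"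
  shows "\<forall>\<^sub>F i in F. \<forall>y\<in>Y.
      integrable (M i) (\<lambda>\<omega>. (cmod (\<Sum>n. d (Suc n) * X y \<omega> (Suc n)))\<^sup>2) \<and>
      (\<integral>\<omega>. (cmod (\<Sum>n. d (Suc n) * X y \<omega> (Suc n)))\<^sup>2 \<partial>M i) \<le> 2 * (\<Sum>n. (cmod (d (Suc n)))\<^sup>2) + \<epsilon>"
proof -
  define C where "C = (\<Sum>n. cmod (d (Suc n)))"
  define \<delta> where "\<delta> = sqrt (\<epsilon> / 4)"
  have \<delta>: "0 < \<delta>" "\<delta>\<^sup>2 = \<epsilon> / 4" using \<epsilon> by (auto simp: \<delta>_def)
  obtain K where K: "norm (\<Sum>n. cmod (d (Suc (n + K)))) < \<delta>"
    using suminf_exist_split[OF \<delta>(1) d] by auto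
  have d2: "summable (\<lambda>n. (cmod (d (Suc n)))\<^sup>2)"
  proof (rule summable_comparison_test_ev[OF _ d])
    have "(\<lambda>n. cmod (d (Suc n))) \<longlonglongrightarrow> 0" by (rule summable_LIMSEQ_zero[OF d])
    then have "\<forall>\<^sub>F n in sequentially. cmod (d (Suc n)) < 1" by (rule order_tendstoD) simp
    then show "\<forall>\<^sub>F n in sequentially. norm ((cmod (d (Suc n)))\<^sup>2) \<le> cmod (d (Suc n))"
      by eventually_elim (simp add: power2_eq_square mult_left_le)
  qed
  define P where "P \<psi> = (\<Sum>n<K. d (Suc n) * \<psi> (Suc n))" for \<psi> :: "nat \<Rightarrow> complex"
  have trigP: "trig_poly UNIV (\<lambda>(_::unit) \<psi>. P \<psi>)"
    unfolding P_def
  proof (rule trig_poly_sum)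
    fix n
    have "trig_poly UNIV (\<lambda>(_::unit) \<psi>. d (Suc n) * (\<psi> (Suc n) * cnj (\<psi> 1)))"
      by (rule trig_poly.monomial) auto
    then show "trig_poly UNIV (\<lambda>(_::unit) \<psi>. d (Suc n) * \<psi> (Suc n))"
      by (rule trig_poly.cong) (simp add: unimodular_multD)
  qed
  have trigP2: "trig_poly UNIV (\<lambda>(_::unit) \<psi>. P \<psi> * cnj (P \<psi>))"
    by (intro trig_poly_mult trig_poly_cnj trigP)
  have sm: "summable (\<lambda>n. d (Suc n) * X y \<omega> (Suc n))" if "y \<in> Y" "\<omega> \<in> space (M i)" for y \<omega> i
    by (rule summable_norm_cancel) (use d unimodular_multD(1)[OF unimodular[OF that]] in \<open>simp add: norm_mult\<close>)
  have bound: "(cmod (\<Sum>n. d (Suc n) * X y \<omega> (Suc n)))\<^sup>2 \<le> 2 * (cmod (P (X y \<omega>)))\<^sup>2 + \<epsilon> / 2"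
    if "y \<in> Y" "\<omega> \<in> space (M i)" for y \<omega> i
  proof -
    have u: "cmod (X y \<omega> (Suc n)) = 1" for n using unimodular_multD(1)[OF unimodular[OF that]] by simp
    have "(\<Sum>n. d (Suc n) * X y \<omega> (Suc n)) = (\<Sum>n. d (Suc (n + K)) * X y \<omega> (Suc (n + K))) + P (X y \<omega>)"
      unfolding P_def using suminf_split_initial_segment[OF sm[OF that], of K] by simp
    moreover have "cmod (\<Sum>n. d (Suc (n + K)) * X y \<omega> (Suc (n + K))) \<le> \<delta>"
    proof -
      have "cmod (\<Sum>n. d (Suc (n + K)) * X y \<omega> (Suc (n + K))) \<le> (\<Sum>n. cmod (d (Suc (n + K)) * X y \<omega> (Suc (n + K))))"
        using summable_ignore_initial_segment[OF d, of K] by (intro summable_norm) (simp add: norm_mult u)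
      also have "\<dots> \<le> \<delta>" using K by (simp add: norm_mult u)
      finally show ?thesis .
    qed
    ultimately show ?thesis
      using cmod_add_squared_le[of "P (X y \<omega>)" "\<Sum>n. d (Suc (n + K)) * X y \<omega> (Suc (n + K))"]
        power_mono[of "cmod (\<Sum>n. d (Suc (n + K)) * X y \<omega> (Suc (n + K)))" \<delta> 2] \<delta>
      by (simp add: add.commute)
  qed
  have bound2: "(cmod (\<Sum>n. d (Suc n) * X y \<omega> (Suc n)))\<^sup>2 \<le> C\<^sup>2" if "y \<in> Y" "\<omega> \<in> space (M i)" for y \<omega> i
  proof (rule power_mono)
    have u: "cmod (X y \<omega> (Suc n)) = 1" for n using unimodular_multD(1)[OF unimodular[OF that]] by simp
    have "cmod (\<Sum>n. d (Suc n) * X y \<omega> (Suc n)) \<le> (\<Sum>n. cmod (d (Suc n) * X y \<omega> (Suc n)))"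
      using d by (intro summable_norm) (simp add: norm_mult u)
    then show "cmod (\<Sum>n. d (Suc n) * X y \<omega> (Suc n)) \<le> C" by (simp add: norm_mult u C_def)
  qed simp
  have int: "integrable (M i) (\<lambda>\<omega>. (cmod (\<Sum>n. d (Suc n) * X y \<omega> (Suc n)))\<^sup>2)" if "y \<in> Y" for y i
  proof -
    interpret prob_space "M i" by (rule prob)
    have "(\<lambda>\<omega>. (cmod (\<Sum>n. d (Suc n) * X y \<omega> (Suc n)))\<^sup>2) \<in> borel_measurable (M i)"
      using meas[OF that] by measurable
    then show ?thesis by (rule integrable_const_bound[OF AE_I2[of _ _], of _ "C\<^sup>2", rotated -1])
       (use bound2[OF that] in auto)
  qed
  have lim: "(\<integral>x. P (Z x) * cnj (P (Z x)) \<partial>\<mu>) = of_real (\<Sum>n<K. (cmod (d (Suc n)))\<^sup>2)"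
  proof -
    have "P (Z x) = partial_sum d {1..K} x" for x
      unfolding P_def partial_sum_def
      by (rule sum.reindex_bij_witness[of _ "\<lambda>n. n - 1" Suc]) auto
    then have "(\<integral>x. P (Z x) * cnj (P (Z x)) \<partial>\<mu>) = (\<integral>x. complex_of_real ((cmod (partial_sum d {1..K} x))\<^sup>2) \<partial>\<mu>)"
      by (simp only: complex_norm_square)
    also have "\<dots> = of_real (\<Sum>n\<in>{1..K}. (cmod (d n))\<^sup>2)"
      unfolding integral_complex_of_real by (subst parseval) auto
    also have "(\<Sum>n\<in>{1..K}. (cmod (d n))\<^sup>2) = (\<Sum>n<K. (cmod (d (Suc n)))\<^sup>2)"
      by (rule sum.reindex_bij_witness[of _ Suc "\<lambda>n. n - 1"]) auto
    finally show ?thesis .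
  qed
  have "\<forall>\<^sub>F i in F. \<forall>x\<in>UNIV \<times> Y. dist (case x of (_::unit, y) \<Rightarrow> \<integral>\<omega>. P (X y \<omega>) * cnj (P (X y \<omega>)) \<partial>M i)
      (case x of (_::unit, y) \<Rightarrow> \<integral>x. P (Z x) * cnj (P (Z x)) \<partial>\<mu>) < \<epsilon> / 4"
    by (rule uniform_limitD[OF trig_poly_averages[OF trigP2]]) (use \<epsilon> in auto)
  then show ?thesis
  proof eventually_elim
    case (elim i)
    show ?case
    proof (intro ballI conjI int)
      fix y assume y: "y \<in> Y"
      interpret prob_space "M i" by (rule prob)
      have "cmod ((\<integral>\<omega>. P (X y \<omega>) * cnj (P (X y \<omega>)) \<partial>M i) - of_real (\<Sum>n<K. (cmod (d (Suc n)))\<^sup>2)) < \<epsilon> / 4"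
        using elim y by (auto simp: dist_norm lim)
      moreover have "(\<integral>\<omega>. P (X y \<omega>) * cnj (P (X y \<omega>)) \<partial>M i) = of_real (\<integral>\<omega>. (cmod (P (X y \<omega>)))\<^sup>2 \<partial>M i)"
        by (simp only: complex_norm_square[symmetric] integral_complex_of_real)
      ultimately have "\<bar>(\<integral>\<omega>. (cmod (P (X y \<omega>)))\<^sup>2 \<partial>M i) - (\<Sum>n<K. (cmod (d (Suc n)))\<^sup>2)\<bar> < \<epsilon> / 4"
        by (simp only: of_real_diff[symmetric] norm_of_real)
      moreover have "(\<Sum>n<K. (cmod (d (Suc n)))\<^sup>2) \<le> (\<Sum>n. (cmod (d (Suc n)))\<^sup>2)"
        by (rule sum_le_suminf[OF d2]) auto
      ultimately have P: "(\<integral>\<omega>. (cmod (P (X y \<omega>)))\<^sup>2 \<partial>M i) \<le> (\<Sum>n. (cmod (d (Suc n)))\<^sup>2) + \<epsilon> / 4" by linarith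
      have "integrable (M i) (\<lambda>\<omega>. P (X y \<omega>) * cnj (P (X y \<omega>)))"
        using trig_poly_integrable[OF trigP2 _ y, of "()"] by simp
      then have Pint: "integrable (M i) (\<lambda>\<omega>. (cmod (P (X y \<omega>)))\<^sup>2)"
        unfolding complex_norm_square[symmetric] complex_of_real_integrable_eq .
      have "(\<integral>\<omega>. (cmod (\<Sum>n. d (Suc n) * X y \<omega> (Suc n)))\<^sup>2 \<partial>M i) \<le> (\<integral>\<omega>. 2 * (cmod (P (X y \<omega>)))\<^sup>2 + \<epsilon> / 2 \<partial>M i)"
        by (rule integral_mono[OF int[OF y]]) (use Pint bound[OF y] in auto)
      also have "\<dots> = 2 * (\<integral>\<omega>. (cmod (P (X y \<omega>)))\<^sup>2 \<partial>M i) + \<epsilon> / 2"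
        using Pint by (simp add: prob_space)
      finally show "(\<integral>\<omega>. (cmod (\<Sum>n. d (Suc n) * X y \<omega> (Suc n)))\<^sup>2 \<partial>M i) \<le> 2 * (\<Sum>n. (cmod (d (Suc n)))\<^sup>2) + \<epsilon>"
        using P by linarith
    qed
  qed
qed

text \<open>On good times \<open>f\<close> differs from an absolutely convergent series \<open>w\<close> by at most \<open>\<eta> C\<close>, and \<open>\<eta>\<close> can be
  chosen small in terms of \<open>C\<close>, which therefore does not enter the bound. The factor 16 is \<open>2 \<sqdot> 2 \<sqdot> 4\<close>: two
  from splitting \<open>f\<close>, two from the mean square of \<open>w\<close>, four from the bound on its coefficients.
  The conclusion provides an integrable majorant \<open>g\<close> that is defined on all sampling points,
  so that the good times may be any set.\<close>

lemma mean_square_on_good_times: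
  fixes f :: "complex \<Rightarrow> complex" and \<theta> :: "'y \<Rightarrow> 'b \<Rightarrow> real"
  assumes X: "\<And>y \<omega> n. X y \<omega> n = of_nat n powr (- (\<i> * of_real (\<theta> y \<omega>)))"
    and \<beta>: "\<beta> < \<alpha>" "0 < h" and \<alpha>: "\<alpha> \<le> 2"
    and b: "\<And>s. s > 1 \<Longrightarrow> summable (\<lambda>n. cmod (b (Suc n)) * real (Suc n) powr (- s))"
    and S: "summable (\<lambda>n. (cmod (b (Suc n)))\<^sup>2 * real (Suc n) powr (- (2 * \<beta>)))"
    and good: "\<And>y \<omega>. y \<in> Y \<Longrightarrow> \<omega> \<in> Good y \<Longrightarrow>
        (\<lambda>s. f (s + \<i> * of_real (\<theta> y \<omega>))) holomorphic_on rect \<beta> h \<and>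
        (\<forall>z\<in>rect \<beta> h. cmod (f (z + \<i> * of_real (\<theta> y \<omega>))) \<le> C) \<and>
        (\<forall>s. 1 < s \<longrightarrow> s < 4 \<longrightarrow>
          (\<lambda>n. b (Suc n) * of_nat (Suc n) powr (- (complex_of_real s + \<i> * of_real (\<theta> y \<omega>))))
             sums f (of_real s + \<i> * of_real (\<theta> y \<omega>)))"
    and B: "16 * (\<Sum>n. (cmod (b (Suc n)))\<^sup>2 * real (Suc n) powr (- (2 * \<beta>))) < B"
  shows "\<forall>\<^sub>F i in F. \<forall>\<sigma>\<in>{\<alpha>..2}. \<forall>y\<in>Y. \<exists>g. integrable (M i) g \<and> (\<forall>\<omega>. 0 \<le> g \<omega>) \<and>
      (\<forall>\<omega>\<in>Good y. (cmod (f (of_real \<sigma> + \<i> * of_real (\<theta> y \<omega>))))\<^sup>2 \<le> g \<omega>) \<and> (\<integral>\<omega>. g \<omega> \<partial>M i) \<le> B"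
proof -
  define S where "S = (\<Sum>n. (cmod (b (Suc n)))\<^sup>2 * real (Suc n) powr (- (2 * \<beta>)))"
  define \<kappa> where "\<kappa> = B - 16 * S"
  have \<kappa>: "0 < \<kappa>" using B by (simp add: \<kappa>_def S_def)
  \<comment> \<open>Small enough for the error \<open>\<eta> C\<close> to disappear in the gap \<open>\<kappa>\<close>, and at most \<open>1\<close> for the coefficient bound.\<close>
  define \<eta> where "\<eta> = min 1 (sqrt (\<kappa> / 4) / (\<bar>C\<bar> + 1))"
  have \<eta>: "0 < \<eta>" "\<eta> \<le> 1" using \<kappa> by (auto simp: \<eta>_def)
  have \<eta>C: "2 * (\<eta> * C)\<^sup>2 \<le> \<kappa> / 2"
  proof -
    have "\<bar>\<eta> * C\<bar> \<le> sqrt (\<kappa> / 4) / (\<bar>C\<bar> + 1) * (\<bar>C\<bar> + 1)"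
      unfolding abs_mult using \<eta> by (intro mult_mono) (auto simp: \<eta>_def)
    also have "\<dots> = sqrt (\<kappa> / 4)" by (simp add: add_nonneg_eq_0_iff)
    finally have "\<bar>\<eta> * C\<bar>\<^sup>2 \<le> (sqrt (\<kappa> / 4))\<^sup>2" by (intro power_mono) auto
    then show ?thesis using \<kappa> by simp
  qed
  let ?Q = "\<lambda>i \<sigma>. \<forall>y\<in>Y. \<exists>g. integrable (M i) g \<and> (\<forall>\<omega>. 0 \<le> g \<omega>) \<and>
      (\<forall>\<omega>\<in>Good y. (cmod (f (of_real \<sigma> + \<i> * of_real (\<theta> y \<omega>))))\<^sup>2 \<le> g \<omega>) \<and> (\<integral>\<omega>. g \<omega> \<partial>M i) \<le> B"
  have local: "\<exists>\<delta>>0. \<forall>\<^sub>F i in F. \<forall>\<sigma>\<in>ball \<sigma>0 \<delta>. ?Q i \<sigma>" if \<sigma>0: "\<sigma>0 \<in> {\<alpha>..2}" for \<sigma>0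
  proof -
    obtain \<nu> \<delta> where \<nu>: "\<nu> \<in> right_functionals" and \<delta>: "0 < \<delta>"
      and near: "\<And>\<sigma> F M. \<bar>\<sigma> - \<sigma>0\<bar> < \<delta> \<Longrightarrow> F holomorphic_on rect \<beta> h \<Longrightarrow> (\<forall>z\<in>rect \<beta> h. cmod (F z) \<le> M) \<Longrightarrow>
         cmod (F (of_real \<sigma>) - \<nu> F) \<le> \<eta> * M"
      by (rule right_functional_near[OF \<beta>, of \<sigma>0 \<eta>]) (use \<sigma>0 \<eta> in auto)
    define d where "d n = b n * \<nu> (\<lambda>s. of_nat n powr (- s))" for n
    have rd: "summable (\<lambda>n. cmod (b (Suc n)) * cmod (\<nu> (\<lambda>s. of_nat (Suc n) powr (- s)))) \<and>
      (\<forall>F t. (\<forall>s. 1 < s \<longrightarrow> s < 4 \<longrightarrow>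
        (\<lambda>n. b (Suc n) * of_nat (Suc n) powr (- (complex_of_real s + \<i> * of_real t))) sums F (of_real s)) \<longrightarrow>
      (\<lambda>n. b (Suc n) * \<nu> (\<lambda>s. of_nat (Suc n) powr (- s)) * of_nat (Suc n) powr (- (\<i> * of_real t))) sums \<nu> F)"
      by (rule right_functional_dirichlet[OF \<nu> b])
    have d: "summable (\<lambda>n. cmod (d (Suc n)))"
      using rd[THEN conjunct1] unfolding d_def norm_mult .
    have "cmod (\<nu> (\<lambda>s. of_nat (Suc n) powr (- s))) \<le> 2 * real (Suc n) powr (- \<beta>)" for n
      by (rule right_functional_coeff_bound[of \<beta> h \<sigma>0 \<nu> \<eta>])
         (use near[of \<sigma>0] \<delta> \<sigma>0 \<beta> \<eta> in auto)
    then have "(cmod (d (Suc n)))\<^sup>2 \<le> (cmod (b (Suc n)) * (2 * real (Suc n) powr (- \<beta>)))\<^sup>2" for n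
      unfolding d_def norm_mult by (intro power_mono mult_left_mono) auto
    then have dle: "(cmod (d (Suc n)))\<^sup>2 \<le> 4 * ((cmod (b (Suc n)))\<^sup>2 * real (Suc n) powr (- (2 * \<beta>)))" for n
      by (simp add: power_mult_distrib powr_power mult_ac del: of_nat_Suc)
    have d2: "summable (\<lambda>n. (cmod (d (Suc n)))\<^sup>2)"
      by (rule summable_comparison_test'[OF summable_mult[OF S, of 4]]) (use dle in auto)
    have "(\<Sum>n. (cmod (d (Suc n)))\<^sup>2) \<le> (\<Sum>n. 4 * ((cmod (b (Suc n)))\<^sup>2 * real (Suc n) powr (- (2 * \<beta>))))"
      by (rule suminf_le[OF dle d2 summable_mult[OF S]])
    also have "\<dots> = 4 * S" unfolding S_def by (rule suminf_mult[OF S])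
    finally have dS: "(\<Sum>n. (cmod (d (Suc n)))\<^sup>2) \<le> 4 * S" .
    have "\<forall>\<^sub>F i in F. \<forall>y\<in>Y.
      integrable (M i) (\<lambda>\<omega>. (cmod (\<Sum>n. d (Suc n) * X y \<omega> (Suc n)))\<^sup>2) \<and>
      (\<integral>\<omega>. (cmod (\<Sum>n. d (Suc n) * X y \<omega> (Suc n)))\<^sup>2 \<partial>M i) \<le> 2 * (\<Sum>n. (cmod (d (Suc n)))\<^sup>2) + \<kappa> / 4"
      by (rule abs_series_mean_square[OF d]) (use \<kappa> in auto)
    then have "\<forall>\<^sub>F i in F. \<forall>\<sigma>\<in>ball \<sigma>0 \<delta>. ?Q i \<sigma>"
    proof eventually_elim
      case (elim i)
      show ?case
      proof (intro ballI)
        fix \<sigma> y assume \<sigma>: "\<sigma> \<in> ball \<sigma>0 \<delta>" and y: "y \<in> Y"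
        interpret prob_space "M i" by (rule prob)
        define w where "w \<omega> = (\<Sum>n. d (Suc n) * X y \<omega> (Suc n))" for \<omega>
        have w: "integrable (M i) (\<lambda>\<omega>. (cmod (w \<omega>))\<^sup>2)"
          "(\<integral>\<omega>. (cmod (w \<omega>))\<^sup>2 \<partial>M i) \<le> 2 * (\<Sum>n. (cmod (d (Suc n)))\<^sup>2) + \<kappa> / 4"
          using elim y unfolding w_def by auto
        show "\<exists>g. integrable (M i) g \<and> (\<forall>\<omega>. 0 \<le> g \<omega>) \<and>
          (\<forall>\<omega>\<in>Good y. (cmod (f (of_real \<sigma> + \<i> * of_real (\<theta> y \<omega>))))\<^sup>2 \<le> g \<omega>) \<and> (\<integral>\<omega>. g \<omega> \<partial>M i) \<le> B"
        proof (intro exI conjI allI ballI)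
          show "integrable (M i) (\<lambda>\<omega>. 2 * (cmod (w \<omega>))\<^sup>2 + 2 * (\<eta> * C)\<^sup>2)" using w by auto
          show "0 \<le> 2 * (cmod (w \<omega>))\<^sup>2 + 2 * (\<eta> * C)\<^sup>2" for \<omega> by simp
          have "(\<integral>\<omega>. 2 * (cmod (w \<omega>))\<^sup>2 + 2 * (\<eta> * C)\<^sup>2 \<partial>M i) = 2 * (\<integral>\<omega>. (cmod (w \<omega>))\<^sup>2 \<partial>M i) + 2 * (\<eta> * C)\<^sup>2"
            using w by (simp add: prob_space)
          also have "\<dots> \<le> 2 * (2 * (4 * S) + \<kappa> / 4) + \<kappa> / 2"
          proof (rule add_mono[OF mult_left_mono \<eta>C])
            show "(\<integral>\<omega>. (cmod (w \<omega>))\<^sup>2 \<partial>M i) \<le> 2 * (4 * S) + \<kappa> / 4"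
              by (rule order.trans[OF w(2)]) (use dS in \<open>intro add_right_mono mult_left_mono; simp\<close>)
          qed simp
          also have "\<dots> = B" by (simp add: \<kappa>_def field_simps)
          finally show "(\<integral>\<omega>. 2 * (cmod (w \<omega>))\<^sup>2 + 2 * (\<eta> * C)\<^sup>2 \<partial>M i) \<le> B" .
          fix \<omega> assume \<omega>: "\<omega> \<in> Good y"
          note g = good[OF y \<omega>]
          define F where "F s = f (s + \<i> * of_real (\<theta> y \<omega>))" for s
          have "(\<lambda>n. d (Suc n) * X y \<omega> (Suc n)) sums \<nu> F"
            unfolding d_def X
            by (rule rd[THEN conjunct2, THEN spec, THEN spec, THEN mp])
               (use g[THEN conjunct2, THEN conjunct2] in \<open>simp only: F_def simp_thms\<close>)
          then have "w \<omega> = \<nu> F" unfolding w_def by (simp add: sums_iff)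
          moreover have "cmod (F (of_real \<sigma>) - \<nu> F) \<le> \<eta> * C"
            using near[of \<sigma> F C] g \<sigma> unfolding F_def by (auto simp: dist_real_def abs_minus_commute)
          ultimately have "(cmod (F (of_real \<sigma>) - w \<omega>))\<^sup>2 \<le> (\<eta> * C)\<^sup>2"
            by (intro power_mono) auto
          then show "(cmod (f (of_real \<sigma> + \<i> * of_real (\<theta> y \<omega>))))\<^sup>2 \<le> 2 * (cmod (w \<omega>))\<^sup>2 + 2 * (\<eta> * C)\<^sup>2"
            using cmod_add_squared_le[of "w \<omega>" "F (of_real \<sigma>) - w \<omega>"] by (simp add: F_def)
        qed
      qed
    qed
    with \<delta> show ?thesis by blast
  qed
  define Q where "Q i \<sigma> \<longleftrightarrow> ?Q i \<sigma>" for i \<sigma>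
  have "\<forall>\<sigma>0\<in>{\<alpha>..2}. \<exists>\<delta>. 0 < \<delta> \<and> (\<forall>\<^sub>F i in F. \<forall>\<sigma>\<in>ball \<sigma>0 \<delta>. Q i \<sigma>)"
    using local unfolding Q_def by simp
  from bchoice[OF this] obtain \<delta> where \<delta>': "\<forall>\<sigma>0\<in>{\<alpha>..2}. 0 < \<delta> \<sigma>0 \<and> (\<forall>\<^sub>F i in F. \<forall>\<sigma>\<in>ball \<sigma>0 (\<delta> \<sigma>0). Q i \<sigma>)" ..
  then have \<delta>: "\<And>\<sigma>. \<sigma> \<in> {\<alpha>..2} \<Longrightarrow> \<delta> \<sigma> > 0"
    "\<And>\<sigma>. \<sigma> \<in> {\<alpha>..2} \<Longrightarrow> \<forall>\<^sub>F i in F. \<forall>\<sigma>'\<in>ball \<sigma> (\<delta> \<sigma>). Q i \<sigma>'" by auto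
  have "{\<alpha>..2} \<subseteq> (\<Union>\<sigma>\<in>{\<alpha>..2}. ball \<sigma> (\<delta> \<sigma>))"
  proof
    fix \<sigma> assume "\<sigma> \<in> {\<alpha>..2}"
    then show "\<sigma> \<in> (\<Union>\<sigma>\<in>{\<alpha>..2}. ball \<sigma> (\<delta> \<sigma>))" using \<delta>(1) by (intro UN_I[of \<sigma>]) auto
  qed
  then obtain D where D: "D \<subseteq> {\<alpha>..2}" "finite D" "{\<alpha>..2} \<subseteq> (\<Union>\<sigma>\<in>D. ball \<sigma> (\<delta> \<sigma>))"
    by (rule compactE_image[OF compact_Icc, of "{\<alpha>..2}" "\<lambda>\<sigma>. ball \<sigma> (\<delta> \<sigma>)", OF open_ball])
  have "\<forall>\<^sub>F i in F. \<forall>\<sigma>\<in>D. \<forall>\<sigma>'\<in>ball \<sigma> (\<delta> \<sigma>). Q i \<sigma>'"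
    using D \<delta>(2) by (intro eventually_ball_finite) auto
  then have "\<forall>\<^sub>F i in F. \<forall>\<sigma>\<in>{\<alpha>..2}. Q i \<sigma>"
  proof (rule eventually_mono)
    fix i assume *: "\<forall>\<sigma>\<in>D. \<forall>\<sigma>'\<in>ball \<sigma> (\<delta> \<sigma>). Q i \<sigma>'"
    show "\<forall>\<sigma>\<in>{\<alpha>..2}. Q i \<sigma>"
    proof
      fix \<sigma> assume "\<sigma> \<in> {\<alpha>..2}"
      then obtain \<sigma>' where "\<sigma>' \<in> D" "\<sigma> \<in> ball \<sigma>' (\<delta> \<sigma>')" using D(3) by blast
      with * show "Q i \<sigma>" by blast
    qed
  qed
  then show ?thesis unfolding Q_def .
qed

end

section \<open>A diagonal choice of indices\<close>

text \<open>Since the \<open>T i\<close> at least double, the bounds \<open>B \<sqdot> T(i + 1)\<close> for the complete blocks form a geometric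
  series dominated by its last term.\<close>

lemma block_sum_bound:
  fixes T :: "nat \<Rightarrow> nat" and c :: "nat \<Rightarrow> nat \<Rightarrow> real"
  assumes T: "\<And>i. 2 * T i \<le> T (Suc i)" "\<And>i. 1 \<le> T i"
    and nonneg: "\<And>i n. 0 \<le> c i n"
    and bound: "\<And>i N. q \<le> i \<Longrightarrow> T i \<le> N \<Longrightarrow> (\<Sum>n=1..N. c i n) \<le> B * real N"
    and blk: "\<And>i n. T i \<le> n \<Longrightarrow> n < T (Suc i) \<Longrightarrow> d n = c i n"
    and N: "T q \<le> N" and B: "0 \<le> B"
  shows "(\<Sum>n=T q..N. d n) \<le> 3 * B * real N"
proof -
  have mono: "T i < T (Suc i)" for i using T(1)[of i] T(2)[of i] by linarith
  then have sm: "strict_mono T" by (rule strict_monoI_Suc)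
  have full: "(\<Sum>n=T q..<T (q + k). d n) \<le> 2 * B * real (T (q + k))" for k
  proof (induction k)
    case 0 show ?case using B by simp
  next
    case (Suc k)
    have "(\<Sum>n=T q..<T (q + Suc k). d n) = (\<Sum>n=T q..<T (q + k). d n) + (\<Sum>n=T (q+k)..<T (Suc (q + k)). d n)"
      using strict_mono_less_eq[OF sm] by (subst sum.atLeastLessThan_concat) (auto intro: less_imp_le mono)
    also have "(\<Sum>n=T (q+k)..<T (Suc (q + k)). d n) = (\<Sum>n=T (q+k)..<T (Suc (q + k)). c (q+k) n)"
      by (rule sum.cong) (auto simp: blk)
    also have "\<dots> \<le> (\<Sum>n=1..T (Suc (q + k)). c (q+k) n)"
      by (rule sum_mono2) (use T(2)[of "q + k"] nonneg in auto)
    also have "\<dots> \<le> B * real (T (Suc (q + k)))"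
      by (rule bound) (auto intro: less_imp_le mono)
    also note Suc.IH
    finally have *: "(\<Sum>n=T q..<T (q + Suc k). d n) \<le> 2 * B * real (T (q + k)) + B * real (T (Suc (q + k)))"
      by simp
    have "B * real (2 * T (q + k)) \<le> B * real (T (Suc (q + k)))"
      by (rule mult_left_mono) (use T(1)[of "q+k"] B in \<open>auto simp del: of_nat_mult\<close>)
    with * show ?case by (simp add: algebra_simps)
  qed
  obtain k where k: "T (q + k) \<le> N" "N < T (Suc (q + k))"
  proof -
    have "\<exists>i. N < T i"
      using seq_suble[OF sm, of "Suc N"] by (intro exI[of _ "Suc N"]) auto
    define i where "i = (LEAST i. N < T i)"
    have i: "N < T i" unfolding i_def by (rule LeastI_ex) fact
    have "q < i" using i N strict_mono_less[OF sm, of q i] by linarith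
    then obtain k where k: "i = Suc (q + k)" using less_imp_Suc_add by blast
    have "\<not> N < T (q + k)" using not_less_Least[of "q + k" "\<lambda>i. N < T i"] k by (auto simp: i_def)
    then show ?thesis using i k by (intro that[of k]) auto
  qed
  have "{T q..N} = {T q..<T (q + k)} \<union> {T (q + k)..N}"
    using k strict_mono_less_eq[OF sm, of q "q + k"] by auto
  then have "(\<Sum>n=T q..N. d n) = (\<Sum>n=T q..<T (q + k). d n) + (\<Sum>n=T (q+k)..N. d n)"
    by (simp only:) (rule sum.union_disjoint, auto)
  also have "(\<Sum>n=T (q+k)..N. d n) = (\<Sum>n=T (q+k)..N. c (q+k) n)"
    by (rule sum.cong) (use k in \<open>auto simp: blk\<close>)
  also have "\<dots> \<le> (\<Sum>n=1..N. c (q+k) n)"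
    by (rule sum_mono2) (use T(2)[of "q + k"] nonneg in auto)
  also have "\<dots> \<le> B * real N"
    by (rule bound) (use k in auto)
  also note full[of k]
  also have "2 * B * real (T (q + k)) \<le> 2 * B * real N" using k B by (intro mult_left_mono) auto
  finally show ?thesis by simp
qed

text \<open>On \<open>[T i, T (i + 1))\<close> the set \<open>G\<close> is \<open>J i\<close>. Every requirement \<open>q\<close> is met by all \<open>J i\<close> with
  \<open>i \<ge> q\<close>, and \<open>T i\<close> is chosen so large that the requirements up to \<open>i\<close> hold for \<open>J i\<close> beyond
  \<open>T i\<close>. For a requirement \<open>q\<close> the terms between \<open>T (\<rho> q)\<close> and \<open>T q\<close> are only known to be bounded,
  which suffices since they are finitely many; thus the starting point \<open>T (\<rho> q)\<close> is common to all
  requirements with the same \<open>\<rho> q\<close>.\<close>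

lemma diagonal_density:
  fixes J :: "nat \<Rightarrow> nat set" and \<C> :: "nat \<Rightarrow> (nat \<Rightarrow> real) set" and B :: "nat \<Rightarrow> real" and \<rho> :: "nat \<Rightarrow> nat"
  assumes nonneg: "\<And>q c n. c \<in> \<C> q \<Longrightarrow> 0 \<le> c n"
    and B: "\<And>q. 0 < B q"
    and mean: "\<And>i q. q \<le> i \<Longrightarrow>
      \<forall>\<^sub>F N in sequentially. \<forall>c\<in>\<C> q. (\<Sum>n=1..N. indicator (J i) n * c n) \<le> B q * real N"
    and dens: "\<And>i. \<forall>\<^sub>F N in sequentially. real (card ({1..N} - J i)) \<le> (1/2)^i * real N"
    and bdd: "\<And>i q n. \<rho> q \<le> i \<Longrightarrow> n \<in> J i \<Longrightarrow> \<exists>D. \<forall>c\<in>\<C> q. c n \<le> D"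
  obtains G :: "nat set" and T :: "nat \<Rightarrow> nat" where
    "has_dens ({1..} - G) 0" "\<And>i. 1 \<le> T i"
    "\<And>i n. n \<in> G \<Longrightarrow> T i \<le> n \<Longrightarrow> \<exists>k\<ge>i. n \<in> J k"
    "\<And>q. \<forall>\<^sub>F N in sequentially. \<forall>c\<in>\<C> q. (\<Sum>n=T (\<rho> q)..N. indicator G n * c n) \<le> 4 * B q * real N"
proof -
  have "\<exists>T0. \<forall>N\<ge>T0. (\<forall>q\<le>i. \<forall>c\<in>\<C> q. (\<Sum>n=1..N. indicator (J i) n * c n) \<le> B q * real N) \<and>
      real (card ({1..N} - J i)) \<le> (1/2)^i * real N" for i
  proof -
    have "\<forall>\<^sub>F N in sequentially. (\<forall>q\<in>{..i}. \<forall>c\<in>\<C> q. (\<Sum>n=1..N. indicator (J i) n * c n) \<le> B q * real N) \<and>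
      real (card ({1..N} - J i)) \<le> (1/2)^i * real N"
      by (intro eventually_conj eventually_ball_finite dens ballI mean) auto
    then show ?thesis unfolding eventually_sequentially by (simp only: Ball_def atMost_iff)
  qed
  then obtain T0 where T0: "\<And>i N. T0 i \<le> N \<Longrightarrow>
      (\<forall>q\<le>i. \<forall>c\<in>\<C> q. (\<Sum>n=1..N. indicator (J i) n * c n) \<le> B q * real N) \<and>
      real (card ({1..N} - J i)) \<le> (1/2)^i * real N" by metis
  \<comment> \<open>Beyond the thresholds \<open>T0\<close>, positive, and at least doubling.\<close>
  define T where "T = rec_nat (Suc (T0 0)) (\<lambda>i t. 2 * t + T0 (Suc i))"
  have T_Suc: "T (Suc i) = 2 * T i + T0 (Suc i)" and T_0: "T 0 = Suc (T0 0)" for i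
    by (simp_all add: T_def)
  have T1: "2 * T i \<le> T (Suc i)" for i by (simp add: T_Suc)
  have T2: "1 \<le> T i" for i by (induction i) (auto simp: T_0 T_Suc)
  have T3: "T0 i \<le> T i" for i by (cases i) (auto simp: T_0 T_Suc)
  have mono: "T i < T (Suc i)" for i using T1[of i] T2[of i] by linarith
  then have sm: "strict_mono T" by (rule strict_monoI_Suc)
  define lev where "lev n = (GREATEST i. T i \<le> n)" for n
  have lev_eq: "lev n = i" if "T i \<le> n" "n < T (Suc i)" for i n
    unfolding lev_def
  proof (rule Greatest_equality)
    show "T i \<le> n" by fact
    fix k assume "T k \<le> n"
    then have "T k < T (Suc i)" using that by linarith
    then show "k \<le> i" using strict_mono_less[OF sm] by auto
  qed
  have lev_ex: "\<exists>i\<ge>k. T i \<le> n \<and> n < T (Suc i)" if "T k \<le> n" for n k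
  proof -
    have "\<exists>i. n < T i"
      using seq_suble[OF sm, of "Suc n"] by (intro exI[of _ "Suc n"]) auto
    define i where "i = (LEAST i. n < T i)"
    have i: "n < T i" unfolding i_def by (rule LeastI_ex) fact
    have "k < i" using i that strict_mono_less[OF sm, of k i] by linarith
    then obtain m where m: "i = Suc (k + m)" using less_imp_Suc_add by blast
    have "\<not> n < T (k + m)" using not_less_Least[of "k + m" "\<lambda>i. n < T i"] m by (auto simp: i_def)
    with i m show ?thesis by (intro exI[of _ "k + m"]) auto
  qed
  define G where "G = {n. T 0 \<le> n \<and> n \<in> J (lev n)}"
  show ?thesis
  proof (rule that)
    show "1 \<le> T i" for i by (rule T2)
    show "\<exists>k\<ge>i. n \<in> J k" if "n \<in> G" "T i \<le> n" for i n
      using lev_ex[OF \<open>T i \<le> n\<close>] lev_eq[of _ n] that by (auto simp: G_def)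
    show "has_dens ({1..} - G) 0"
      unfolding has_dens_def
    proof (rule LIMSEQ_I)
      fix r :: real assume r: "r > 0"
      obtain q where q: "(1/2)^q < r / 6" using real_arch_pow_inv[of "r / 6" "1/2"] r by auto
      obtain N0 where N0: "real (T q) * 2 / r < real N0" using reals_Archimedean2 by blast
      show "\<exists>no. \<forall>N\<ge>no. norm (real (card (({1..} - G) \<inter> {1..N})) / real N - 0) < r"
      proof (intro exI[of _ "N0 + T q + 1"] allI impI)
        fix N assume N: "N0 + T q + 1 \<le> N"
        have "(\<Sum>n=T q..N. indicator (- G) n) \<le> 3 * (1/2)^q * real N"
        proof (rule block_sum_bound[of T "\<lambda>i n. indicator (- J i) n"])
          fix i M assume i: "q \<le> i" "T i \<le> M"
          have "(\<Sum>n=1..M. indicator (- J i) n) = real (card ({1..M} - J i))"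
            by (simp add: indicator_def sum.If_cases Diff_eq Compl_eq del: sum_mult_indicator)
          also have "\<dots> \<le> (1/2)^i * real M" using T0[of i M] T3[of i] i by auto
          also have "\<dots> \<le> (1/2)^q * real M" using i by (intro mult_right_mono power_decreasing) auto
          finally show "(\<Sum>n=1..M. indicator (- J i) n) \<le> (1/2::real)^q * real M" .
        next
          fix i n assume "T i \<le> n" "n < T (Suc i)"
          moreover have "T 0 \<le> T i" using strict_mono_less_eq[OF sm, of 0 i] by simp
          ultimately show "indicator (- G) n = (indicator (- J i) n :: real)"
            using lev_eq[of i n] by (auto simp: G_def indicator_def)
        qed (use T1 T2 N in auto)
        moreover have "(\<Sum>n=T q..N. indicator (- G) n) = real (card ({T q..N} - G))"
          by (simp add: indicator_def sum.If_cases Diff_eq Compl_eq del: sum_mult_indicator)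
        ultimately have 1: "real (card ({T q..N} - G)) \<le> 3 * (1/2)^q * real N" by simp
        have "card (({1..} - G) \<inter> {1..N}) \<le> card ({..<T q} \<union> ({T q..N} - G))"
          by (rule card_mono) auto
        also have "\<dots> \<le> T q + card ({T q..N} - G)"
          using card_Un_le[of "{..<T q}" "{T q..N} - G"] by simp
        finally have "real (card (({1..} - G) \<inter> {1..N})) \<le> real (T q) + 3 * (1/2)^q * real N"
          using 1 by linarith
        also have "real (T q) < r / 2 * real N"
        proof -
          have "real (T q) * 2 / r < real N" using N0 N by linarith
          then show ?thesis using r by (simp add: field_simps)
        qed
        also have "3 * (1/2)^q * real N \<le> r / 2 * real N" using q by (intro mult_right_mono) auto
        finally show "norm (real (card (({1..} - G) \<inter> {1..N})) / real N - 0) < r"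
          using N by (simp add: field_simps)
      qed
    qed
    show "\<forall>\<^sub>F N in sequentially. \<forall>c\<in>\<C> q. (\<Sum>n=T (\<rho> q)..N. indicator G n * c n) \<le> 4 * B q * real N" for q
    proof -
      have "\<exists>D\<ge>0. \<forall>c\<in>\<C> q. indicator G n * c n \<le> D" if "T (\<rho> q) \<le> n" for n
      proof (cases "n \<in> G")
        case True
        then obtain i where "i \<ge> \<rho> q" "n \<in> J i" using lev_ex[OF \<open>T (\<rho> q) \<le> n\<close>] lev_eq[of _ n] by (auto simp: G_def)
        from bdd[OF this] obtain D where "\<forall>c\<in>\<C> q. c n \<le> D" by auto
        then show ?thesis using True by (intro exI[of _ "max 0 D"]) auto
      qed auto
      then obtain D where D: "\<And>n. T (\<rho> q) \<le> n \<Longrightarrow> D n \<ge> 0"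
        "\<And>n c. T (\<rho> q) \<le> n \<Longrightarrow> c \<in> \<C> q \<Longrightarrow> indicator G n * c n \<le> D n" by metis
      define E where "E = (\<Sum>n=T (\<rho> q)..<T q. D n)"
      obtain N0 where N0: "E / B q < real N0" using reals_Archimedean2 by blast
      have "\<forall>\<^sub>F N in sequentially. N \<ge> N0 + T q" by (rule eventually_ge_at_top)
      then show ?thesis
      proof eventually_elim
        case (elim N)
        show ?case
        proof
          fix c assume c: "c \<in> \<C> q"
          have 0: "0 \<le> indicator G n * c n" for n using nonneg[OF c] by (auto simp: indicator_def)
          have "(\<Sum>n=T (\<rho> q)..N. indicator G n * c n) \<le>
            (\<Sum>n\<in>{T (\<rho> q)..<T q} \<union> {T q..N}. indicator G n * c n)"
            by (rule sum_mono2) (auto simp: 0)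
          also have "\<dots> = (\<Sum>n=T (\<rho> q)..<T q. indicator G n * c n) + (\<Sum>n=T q..N. indicator G n * c n)"
            by (rule sum.union_disjoint) auto
          also have "(\<Sum>n=T (\<rho> q)..<T q. indicator G n * c n) \<le> E"
            unfolding E_def by (rule sum_mono) (use D c in auto)
          also have "(\<Sum>n=T q..N. indicator G n * c n) \<le> 3 * B q * real N"
          proof (rule block_sum_bound[of T "\<lambda>i n. indicator (J i) n * c n"])
            fix i n assume "T i \<le> n" "n < T (Suc i)"
            moreover have "T 0 \<le> T i" using strict_mono_less_eq[OF sm, of 0 i] by simp
            ultimately show "indicator G n * c n = indicator (J i) n * c n"
              using lev_eq[of i n] by (auto simp: G_def indicator_def)
          next
            fix i M assume "q \<le> i" "T i \<le> M"
            then show "(\<Sum>n=1..M. indicator (J i) n * c n) \<le> B q * real M"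
              using T0[of i M] T3[of i] c by auto
          qed (use T1 T2 elim B[of q] nonneg[OF c] in \<open>auto simp: less_imp_le\<close>)
          also have "E \<le> B q * real N"
          proof -
            have "E / B q \<le> real N" using N0 elim by linarith
            then show ?thesis using B[of q] by (simp add: field_simps)
          qed
          finally show "(\<Sum>n=T (\<rho> q)..N. indicator G n * c n) \<le> 4 * B q * real N" by simp
        qed
      qed
    qed
  qed
qed

section \<open>Characters and Haar measure\<close>

lemma freq_group_add: "x \<in> freq_group l \<Longrightarrow> y \<in> freq_group l \<Longrightarrow> x + y \<in> freq_group l"
  and freq_group_base: "x \<in> Lambda_gen l \<Longrightarrow> x \<in> freq_group l"
  unfolding freq_group_def
  by (auto simp: group_closure_add group_closure.base)

lemma ln_nat_in_freq_group: "n \<ge> 1 \<Longrightarrow> ln (real n) \<in> freq_group l"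
proof (induction n rule: less_induct)
  case (less n)
  show ?case
  proof (cases "n = 1")
    case True
    then show ?thesis by (simp add: freq_group_def)
  next
    case False
    then obtain p where p: "prime p" "p dvd n" using prime_factor_nat by blast
    then obtain m where m: "n = p * m" by auto
    have m1: "m \<ge> 1" using m less.prems by (cases m) auto
    have "m < n" using m m1 prime_gt_1_nat[OF p(1)] by simp
    then have "ln (real m) \<in> freq_group l" using less.IH m1 by blast
    moreover have "ln (real p) \<in> freq_group l"
      using p by (intro freq_group_base) (auto simp: Lambda_gen_def)
    moreover have "ln (real n) = ln (real p) + ln (real m)"
      using m m1 prime_gt_0_nat[OF p(1)] by (simp add: ln_mult)
    ultimately show ?thesis using freq_group_add by simp
  qed
qed

text \<open>The one-parameter subgroup of the dual group along which \<open>t\<close> moves: the flow at \<open>-t\<close> is the character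
  \<open>log n \<mapsto> n\<^bsup>-it\<^esup>\<close>.\<close>

definition flow :: "real set \<Rightarrow> real \<Rightarrow> real \<Rightarrow> complex" where
  "flow G t = restrict (\<lambda>\<gamma>. cis (t * \<gamma>)) G"

lemma flow_in_dual_group:
  assumes "\<And>x y. x \<in> G \<Longrightarrow> y \<in> G \<Longrightarrow> x + y \<in> G"
  shows "flow G t \<in> dual_group G"
  using assms by (auto simp: flow_def dual_group_def cis_mult distrib_left)

lemma character_unimodular_mult:
  assumes G: "\<And>n. n \<ge> 1 \<Longrightarrow> ln (real n) \<in> G" and x: "x \<in> dual_group G"
  shows "unimodular_mult (\<lambda>n. x (ln (real n)))"
  unfolding unimodular_mult_def
proof (intro conjI allI impI)
  show "cmod (x (ln (real n))) = 1" if "1 \<le> n" for n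
    using x G[OF that] by (auto simp: dual_group_def)
  show "x (ln (real (m * n))) = x (ln (real m)) * x (ln (real n))" if "1 \<le> m" "1 \<le> n" for m n
    using x G[OF that(1)] G[OF that(2)] that by (auto simp: dual_group_def ln_mult)
qed

lemma topspace_char_topology: "H \<subseteq> dual_group G \<Longrightarrow> topspace (char_topology G H) = H"
  by (auto simp: char_topology_def dual_group_def PiE_def)

lemma haar_eval_measurable:
  assumes M: "haar_prob G H M" and H: "H \<subseteq> dual_group G" and \<gamma>: "\<gamma> \<in> G"
  shows "(\<lambda>x. x \<gamma>) \<in> borel_measurable M"
proof (rule borel_measurableI)
  fix S :: "complex set" assume S: "open S"
  have sp: "space M = H" and sets: "sets M = sigma_sets H {U. openin (char_topology G H) U}"
    using M by (auto simp: haar_prob_def)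
  have "continuous_map (char_topology G H) euclidean (\<lambda>x. x \<gamma>)"
    unfolding char_topology_def
    by (intro continuous_map_from_subtopology continuous_map_product_projection \<gamma>)
  then have "openin (char_topology G H) {x \<in> topspace (char_topology G H). x \<gamma> \<in> S}"
    using S by (intro openin_continuous_map_preimage[of _ euclidean]) auto
  also have "{x \<in> topspace (char_topology G H). x \<gamma> \<in> S} = (\<lambda>x. x \<gamma>) -` S \<inter> space M"
    unfolding topspace_char_topology[OF H] sp by auto
  finally show "(\<lambda>x. x \<gamma>) -` S \<inter> space M \<in> sets M"
    unfolding sets by (auto intro: sigma_sets.Basic)
qed

text \<open>Invariance is given for images of measurable sets; measurability of the translation turns it
  into invariance of integrals.\<close>

lemma haar_translation_measurable:
  assumes M: "haar_prob G H M" and H: "H \<subseteq> dual_group G"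
    and y: "\<And>x. x \<in> H \<Longrightarrow> char_mult G y x \<in> H"
  shows "char_mult G y \<in> measurable M M"
proof -
  have sp: "space M = H" and sets: "sets M = sigma_sets H {U. openin (char_topology G H) U}"
    using M by (auto simp: haar_prob_def)
  have "continuous_map (char_topology G H) (product_topology (\<lambda>_. euclidean) G) (char_mult G y)"
    unfolding continuous_map_componentwise
  proof (intro conjI ballI)
    show "char_mult G y ` topspace (char_topology G H) \<subseteq> extensional G"
      by (auto simp: char_mult_def)
    fix \<gamma> assume \<gamma>: "\<gamma> \<in> G"
    have "continuous_map (char_topology G H) euclidean (\<lambda>x. x \<gamma>)"
      unfolding char_topology_def
      by (intro continuous_map_from_subtopology continuous_map_product_projection \<gamma>)
    then have "continuous_map (char_topology G H) euclidean ((\<lambda>z. y \<gamma> * z) \<circ> (\<lambda>x. x \<gamma>))"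
      by (rule continuous_map_compose) (auto intro!: continuous_intros)
    then show "continuous_map (char_topology G H) euclidean (\<lambda>x. char_mult G y x \<gamma>)"
      using \<gamma> by (simp add: char_mult_def o_def)
  qed
  then have cm: "continuous_map (char_topology G H) (char_topology G H) (char_mult G y)"
    unfolding char_topology_def[of G H] continuous_map_in_subtopology
    using y topspace_char_topology[OF H] by (auto simp: char_topology_def)
  have "char_mult G y \<in> measurable M (sigma H {U. openin (char_topology G H) U})"
  proof (rule measurable_measure_of)
    show "{U. openin (char_topology G H) U} \<subseteq> Pow H"
      using openin_subset topspace_char_topology[OF H] by blast
    show "char_mult G y \<in> space M \<rightarrow> H" using y sp by auto
    fix U assume "U \<in> {U. openin (char_topology G H) U}"
    then have "openin (char_topology G H) {x \<in> topspace (char_topology G H). char_mult G y x \<in> U}"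
      using openin_continuous_map_preimage[OF cm] by auto
    also have "{x \<in> topspace (char_topology G H). char_mult G y x \<in> U} = char_mult G y -` U \<inter> space M"
      unfolding topspace_char_topology[OF H] sp by auto
    finally show "char_mult G y -` U \<inter> space M \<in> sets M"
      unfolding sets by (auto intro: sigma_sets.Basic)
  qed
  moreover have "sets (sigma H {U. openin (char_topology G H) U}) = sets M"
    unfolding sets using openin_subset topspace_char_topology[OF H] by (intro sets_measure_of) blast
  ultimately show ?thesis using measurable_cong_sets by blast
qed

text \<open>Translation by an element of the flow multiplies the integral by a number different from \<open>1\<close>.\<close>

lemma haar_orthogonal:
  assumes M: "haar_prob G H M" and H: "H \<subseteq> dual_group G"
    and mult: "\<And>x. x \<in> H \<Longrightarrow> char_mult G (flow G t) x \<in> H" "\<And>x. x \<in> H \<Longrightarrow> char_mult G (flow G (- t)) x \<in> H"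
    and flow: "flow G (- t) \<in> H"
    and \<gamma>: "\<gamma> \<in> G" "\<delta> \<in> G" and ne: "cis (t * (\<gamma> - \<delta>)) \<noteq> 1"
  shows "(\<integral>x. x \<gamma> * cnj (x \<delta>) \<partial>M) = 0"
proof -
  let ?T = "char_mult G (flow G t)" and ?T' = "char_mult G (flow G (- t))"
  have sp: "space M = H" using M by (auto simp: haar_prob_def)
  interpret prob_space M using M by (auto simp: haar_prob_def)
  have inv1: "?T' (?T x) = x" "?T (?T' x) = x" if "x \<in> H" for x
  proof -
    have "x \<in> extensional G" using that H by (auto simp: dual_group_def)
    then show "?T' (?T x) = x" "?T (?T' x) = x"
      by (auto simp: fun_eq_iff char_mult_def flow_def cis_mult mult.assoc[symmetric] restrict_def extensional_def)
  qed
  have Tm: "?T \<in> measurable M M" by (rule haar_translation_measurable[OF M H mult(1)])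
  have distr: "distr M M ?T = M"
  proof (rule measure_eqI)
    fix B assume "B \<in> sets (distr M M ?T)"
    then have B: "B \<in> sets M" by simp
    have "B \<subseteq> H" using sets.sets_into_space[OF B] sp by simp
    have "?T -` B \<inter> space M = ?T' ` B"
    proof (intro set_eqI iffI)
      fix x assume "x \<in> ?T -` B \<inter> space M"
      then have "?T x \<in> B" "x = ?T' (?T x)" using inv1(1)[of x] sp by auto
      then show "x \<in> ?T' ` B" by blast
    next
      fix x assume "x \<in> ?T' ` B"
      then obtain b where b: "b \<in> B" "x = ?T' b" by auto
      then show "x \<in> ?T -` B \<inter> space M"
        using inv1(2)[of b] mult(2)[of b] \<open>B \<subseteq> H\<close> sp by auto
    qed
    moreover have "emeasure M (?T' ` B) = emeasure M B"
      using M flow B unfolding haar_prob_def by blast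
    ultimately show "emeasure (distr M M ?T) B = emeasure M B"
      using emeasure_distr[OF Tm B] by simp
  qed simp
  let ?f = "\<lambda>x::real \<Rightarrow> complex. x \<gamma> * cnj (x \<delta>)"
  have cnj_m: "(\<lambda>x. cnj (x \<delta>)) \<in> borel_measurable M"
    by (rule borel_measurable_continuous_on[of cnj, OF _ haar_eval_measurable[OF M H \<gamma>(2)]])
       (auto intro!: continuous_intros)
  have fm: "?f \<in> borel_measurable M"
    using haar_eval_measurable[OF M H \<gamma>(1)] cnj_m by measurable
  have "(\<integral>x. ?f x \<partial>M) = (\<integral>x. ?f x \<partial>distr M M ?T)" unfolding distr ..
  also have "\<dots> = (\<integral>x. ?f (?T x) \<partial>M)" by (rule integral_distr[OF Tm fm])
  also have "\<dots> = (\<integral>x. cis (t * (\<gamma> - \<delta>)) * ?f x \<partial>M)"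
  proof (rule Bochner_Integration.integral_cong[OF refl])
    fix x
    have "cis (t * (\<gamma> - \<delta>)) = cis (t * \<gamma>) * cnj (cis (t * \<delta>))"
      by (simp add: cis_cnj cis_mult algebra_simps)
    then show "?f (?T x) = cis (t * (\<gamma> - \<delta>)) * ?f x"
      using \<gamma> by (simp add: char_mult_def flow_def)
  qed
  also have "\<dots> = cis (t * (\<gamma> - \<delta>)) * (\<integral>x. ?f x \<partial>M)" by simp
  finally show ?thesis using ne by simp
qed

lemma flow_mult_K:
  "x \<in> dual_group G \<Longrightarrow> (\<And>x y. x \<in> G \<Longrightarrow> y \<in> G \<Longrightarrow> x + y \<in> G) \<Longrightarrow>
    char_mult G (flow G t) x \<in> dual_group G"
  by (auto simp: char_mult_def flow_def dual_group_def norm_mult distrib_left cis_mult[symmetric])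

lemma orthonormal_characters_K:
  assumes "haar_prob (freq_group l) (K_group l) \<mu>"
  shows "orthonormal_characters \<mu> (\<lambda>x n. x (ln (real n)))"
proof (rule orthonormal_characters.intro)
  have sp: "space \<mu> = K_group l" using assms by (auto simp: haar_prob_def)
  show "prob_space \<mu>" using assms by (auto simp: haar_prob_def)
  show "(\<lambda>x. x (ln (real n))) \<in> borel_measurable \<mu>" if "1 \<le> n" for n
    using haar_eval_measurable[OF assms _ ln_nat_in_freq_group[OF that]] by (auto simp: K_group_def)
  show "unimodular_mult (\<lambda>n. x (ln (real n)))" if "x \<in> space \<mu>" for x
    using that sp by (intro character_unimodular_mult[of "freq_group l"] ln_nat_in_freq_group) (auto simp: K_group_def)
  fix A B :: nat assume AB: "1 \<le> A" "1 \<le> B" "A \<noteq> B"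
  have ne: "ln (real A) \<noteq> ln (real B)" using AB by simp
  show "(\<integral>x. x (ln (real A)) * cnj (x (ln (real B))) \<partial>\<mu>) = 0"
  proof (rule haar_orthogonal[OF assms, of "pi / (ln (real A) - ln (real B))"])
    show "cis (pi / (ln (real A) - ln (real B)) * (ln (real A) - ln (real B))) \<noteq> 1"
      using ne by simp
  qed (use AB ln_nat_in_freq_group freq_group_add in
      \<open>auto simp: K_group_def intro!: flow_mult_K flow_in_dual_group\<close>)
qed

text \<open>This is where the assumption on \<open>l\<close> is used: \<open>l log(A/B) = 2\<pi>k\<close> would put \<open>l\<close> into \<open>\<Gamma>\<^sub>P\<close>,
  with \<open>k \<noteq> 0\<close> as \<open>A \<noteq> B\<close>.\<close>

lemma cis_neq_1_outside_Gamma_P: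
  assumes l: "0 < l" "l \<notin> Gamma_P" and AB: "1 \<le> A" "1 \<le> B" "A \<noteq> B"
  shows "cis (l * (ln (real A) - ln (real B))) \<noteq> 1"
proof
  assume 1: "cis (l * (ln (real A) - ln (real B))) = 1"
  have wlog: False if c: "cis (l * (ln (real A) - ln (real B))) = 1" and AB: "1 \<le> B" "B < A" for A B
  proof -
    have "ln (real A) > ln (real B)" using AB by simp
    then have pos: "l * (ln (real A) - ln (real B)) > 0" using l by simp
    have "cos (l * (ln (real A) - ln (real B))) = 1"
      using c by (simp add: complex_eq_iff)
    then obtain k :: int where k: "l * (ln (real A) - ln (real B)) = of_int k * (2 * pi)"
      unfolding cos_one_2pi_int by auto
    then have "k > 0" using pos by (simp add: zero_less_mult_iff)
    then obtain m where m: "k = int m" "m \<ge> 1" by (metis int_one_le_iff_zero_less of_nat_1 of_nat_le_iff zero_less_imp_eq_int zero_le_imp_eq_int order_less_imp_le)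
    have "ln (real A / real B) = ln (real A) - ln (real B)" using AB by (simp add: ln_div)
    with k m have "l * ln (real A / real B) = 2 * pi * real m" "ln (real A / real B) \<noteq> 0"
      using \<open>ln (real A) > ln (real B)\<close> by (simp_all add: mult_ac)
    then have "l = 2 * pi * real m / ln (real A / real B)"
      by (simp add: eq_divide_eq)
    then have "l \<in> Gamma_P" unfolding Gamma_P_def using AB m by (intro CollectI exI[of _ m] exI[of _ A] exI[of _ B]) auto
    with l show False by simp
  qed
  show False
  proof (cases "B < A")
    case True
    then show False using wlog[OF 1] AB by auto
  next
    case False
    have "cnj (cis (l * (ln (real A) - ln (real B)))) = 1" unfolding 1 by simp
    then have "cis (l * (ln (real B) - ln (real A))) = 1"
      by (simp add: cis_cnj algebra_simps)
    then show False using wlog[of B A] AB False by auto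
  qed
qed

text \<open>The flow at time \<open>l\<close> stays in the subgroup, its value at \<open>2\<pi>/l\<close> being \<open>1\<close>, and still separates
  the logarithms of distinct integers.\<close>

lemma orthonormal_characters_K_sub:
  assumes haar: "haar_prob (freq_group l) (K_sub l) \<tau>" and l: "0 < l" "l \<notin> Gamma_P"
  shows "orthonormal_characters \<tau> (\<lambda>x n. x (ln (real n)))"
proof (rule orthonormal_characters.intro)
  have sp: "space \<tau> = K_sub l" using haar by (auto simp: haar_prob_def)
  have sub: "K_sub l \<subseteq> dual_group (freq_group l)" by (auto simp: K_sub_def K_group_def)
  show "prob_space \<tau>" using haar by (auto simp: haar_prob_def)
  show "(\<lambda>x. x (ln (real n))) \<in> borel_measurable \<tau>" if "1 \<le> n" for n
    using haar_eval_measurable[OF haar sub ln_nat_in_freq_group[OF that]] .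
  show "unimodular_mult (\<lambda>n. x (ln (real n)))" if "x \<in> space \<tau>" for x
    using that sp sub by (intro character_unimodular_mult[of "freq_group l"] ln_nat_in_freq_group) auto
  fix A B :: nat assume AB: "1 \<le> A" "1 \<le> B" "A \<noteq> B"
  have mem: "2 * pi / l \<in> freq_group l"
    using l by (intro freq_group_base) (auto simp: Lambda_gen_def)
  have per: "cis (l * (2 * pi / l)) = 1" "cis (- l * (2 * pi / l)) = 1"
    using l by (simp_all add: cis_cnj[symmetric])
  show "(\<integral>x. x (ln (real A)) * cnj (x (ln (real B))) \<partial>\<tau>) = 0"
  proof (rule haar_orthogonal[OF haar sub])
    show "flow (freq_group l) (- l) \<in> K_sub l"
      using mem per freq_group_add flow_in_dual_group[of "freq_group l" "- l"]
      by (auto simp: K_sub_def K_group_def flow_def)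
    show "char_mult (freq_group l) (flow (freq_group l) l) x \<in> K_sub l" if "x \<in> K_sub l" for x
      using that mem per freq_group_add flow_mult_K[of x "freq_group l" l]
      by (auto simp: K_sub_def K_group_def flow_def char_mult_def)
    show "char_mult (freq_group l) (flow (freq_group l) (- l)) x \<in> K_sub l" if "x \<in> K_sub l" for x
      using that mem per freq_group_add flow_mult_K[of x "freq_group l" "- l"]
      by (auto simp: K_sub_def K_group_def flow_def char_mult_def)
    show "cis (l * (ln (real A) - ln (real B))) \<noteq> 1" by (rule cis_neq_1_outside_Gamma_P[OF l AB])
  qed (use AB ln_nat_in_freq_group in auto)
qed

section \<open>Averages over time and over an arithmetic progression\<close>

lemma nat_powr_imag: "1 \<le> n \<Longrightarrow> of_nat n powr (- (\<i> * complex_of_real t)) = cis (- (t * ln (real n)))"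
  by (simp add: powr_def cis_conv_exp Ln_of_nat mult_ac)

lemma unimodular_mult_nat_powr: "unimodular_mult (\<lambda>n. of_nat n powr (- (\<i> * complex_of_real t)))"
  unfolding unimodular_mult_def
proof (intro conjI allI impI)
  fix m n :: nat assume mn: "1 \<le> m" "1 \<le> n"
  then have "1 \<le> m * n" by simp
  note eqs = nat_powr_imag[OF this, of t] nat_powr_imag[OF mn(1), of t] nat_powr_imag[OF mn(2), of t]
  show "of_nat (m * n) powr (- (\<i> * complex_of_real t)) =
      of_nat m powr (- (\<i> * complex_of_real t)) * of_nat n powr (- (\<i> * complex_of_real t))"
    unfolding eqs using mn by (simp add: ln_mult cis_mult algebra_simps)
qed (simp add: nat_powr_imag)

lemma nat_powr_imag_pair:
  "1 \<le> A \<Longrightarrow> 1 \<le> B \<Longrightarrow> of_nat A powr (- (\<i> * complex_of_real t)) * cnj (of_nat B powr (- (\<i> * complex_of_real t)))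
     = cis (- (t * (ln (real A) - ln (real B))))"
  by (simp add: nat_powr_imag cis_cnj cis_mult algebra_simps)

lemma nat_powr_imag_measurable [measurable]:
  "(\<lambda>t. of_nat n powr (- (\<i> * complex_of_real t))) \<in> borel_measurable borel"
proof (cases "n = 0")
  case False
  then have "(\<lambda>t. of_nat n powr (- (\<i> * complex_of_real t))) = (\<lambda>t. cis (- (t * ln (real n))))"
    by (auto simp: nat_powr_imag)
  then show ?thesis by (simp only:) (intro borel_measurable_continuous_onI continuous_intros)
qed simp

lemma integral_uniform_measure:
  fixes h :: "'a \<Rightarrow> 'b::{banach, second_countable_topology}"
  assumes A: "A \<in> sets M" "emeasure M A \<noteq> 0" "emeasure M A < \<infinity>"
    and h: "h \<in> borel_measurable M"
  shows "integrable (uniform_measure M A) h \<longleftrightarrow> set_integrable M A h"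
    and "(\<integral>x. h x \<partial>uniform_measure M A) = (1 / measure M A) *\<^sub>R (\<integral>x\<in>A. h x \<partial>M)"
proof -
  have pos: "measure M A > 0" using A by (simp add: measure_def enn2real_positive_iff less_top zero_less_iff_neq_zero)
  have "uniform_measure M A = density M (\<lambda>x. ennreal (indicator A x / measure M A))"
    unfolding uniform_measure_def
  proof (rule density_cong)
    have "indicator A x / emeasure M A = ennreal (indicator A x / measure M A)" for x
    proof -
      have "emeasure M A = ennreal (measure M A)" by (rule emeasure_eq_ennreal_measure) (use A in auto)
      then show ?thesis using pos by (simp add: divide_ennreal flip: ennreal_indicator)
    qed
    then show "AE x in M. indicator A x / emeasure M A = ennreal (indicator A x / measure M A)" by simp
  qed (use A in auto)
  note eq = this
  have m: "(\<lambda>x. indicator A x / measure M A) \<in> borel_measurable M" using A by simp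
  have "integrable (uniform_measure M A) h \<longleftrightarrow> integrable M (\<lambda>x. (indicator A x / measure M A) *\<^sub>R h x)"
    unfolding eq by (rule integrable_density[OF h m]) (use pos in auto)
  also have "\<dots> \<longleftrightarrow> integrable M (\<lambda>x. (1 / measure M A) *\<^sub>R (indicator A x *\<^sub>R h x))" by simp
  also have "\<dots> \<longleftrightarrow> set_integrable M A h" unfolding set_integrable_def
  proof
    assume "integrable M (\<lambda>x. (1 / measure M A) *\<^sub>R (indicator A x *\<^sub>R h x))"
    then have "integrable M (\<lambda>x. measure M A *\<^sub>R ((1 / measure M A) *\<^sub>R (indicator A x *\<^sub>R h x)))"
      by (rule integrable_scaleR_right)
    then show "integrable M (\<lambda>x. indicator A x *\<^sub>R h x)" using pos by simp
  qed (rule integrable_scaleR_right)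
  finally show "integrable (uniform_measure M A) h \<longleftrightarrow> set_integrable M A h" .
  have "(\<integral>x. h x \<partial>uniform_measure M A) = (\<integral>x. (indicator A x / measure M A) *\<^sub>R h x \<partial>M)"
    unfolding eq by (rule integral_density[OF h m]) (use pos in auto)
  also have "\<dots> = (\<integral>x. (1 / measure M A) *\<^sub>R (indicator A x *\<^sub>R h x) \<partial>M)" by simp
  also have "\<dots> = (1 / measure M A) *\<^sub>R (\<integral>x\<in>A. h x \<partial>M)"
    unfolding set_lebesgue_integral_def by (rule integral_scaleR_right)
  finally show "(\<integral>x. h x \<partial>uniform_measure M A) = (1 / measure M A) *\<^sub>R (\<integral>x\<in>A. h x \<partial>M)" .
qed

text \<open>The maximum with \<open>1\<close> makes this a probability measure for all \<open>T\<close>; only large \<open>T\<close> matter.\<close>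

definition time_avg :: "real \<Rightarrow> real measure" where
  "time_avg T = uniform_measure lborel {0..max 1 T}"

lemma sets_time_avg [measurable_cong, simp]: "sets (time_avg T) = sets borel"
  and space_time_avg [simp]: "space (time_avg T) = UNIV"
  by (simp_all add: time_avg_def)

lemma prob_space_time_avg: "prob_space (time_avg T)"
  unfolding time_avg_def by (rule prob_space_uniform_measure) auto

lemma integral_time_avg:
  fixes h :: "real \<Rightarrow> 'b::{banach, second_countable_topology}"
  assumes h: "h \<in> borel_measurable borel" and T: "1 \<le> T"
  shows "integrable (time_avg T) h \<longleftrightarrow> set_integrable lborel {0..T} h"
    and "(\<integral>x. h x \<partial>time_avg T) = (1 / T) *\<^sub>R (LBINT x:{0..T}. h x)"
  using integral_uniform_measure[of "{0..max 1 T}" lborel h] h T by (auto simp: time_avg_def max_def)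

lemma measure_time_avg:
  assumes "A \<in> sets borel" "1 \<le> T"
  shows "measure (time_avg T) A = measure lborel ({0..T} \<inter> A) / T"
  using assms measure_uniform_measure[of lborel "{0..max 1 T}" A] by (auto simp: time_avg_def max_def)

text \<open>The mean of \<open>e\<^bsup>-it\<omega>\<^esup>\<close> over \<open>[0, T]\<close> is at most \<open>2/(|\<omega>|T)\<close>.\<close>

lemma averaging_scheme_time:
  "averaging_scheme at_top time_avg (\<lambda>(_::unit) t n. of_nat n powr (- (\<i> * complex_of_real t))) {()}"
proof (rule averaging_scheme.intro)
  show "prob_space (time_avg i)" for i by (rule prob_space_time_avg)
  show "(\<lambda>t. of_nat n powr (- (\<i> * complex_of_real t))) \<in> borel_measurable (time_avg i)" for n i
    by (simp add: measurable_cong_sets[OF sets_time_avg refl])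
  show "unimodular_mult (\<lambda>n. of_nat n powr (- (\<i> * complex_of_real t)))" for t by (rule unimodular_mult_nat_powr)
  fix A B :: nat assume AB: "1 \<le> A" "1 \<le> B" "A \<noteq> B"
  define \<omega> where "\<omega> = ln (real A) - ln (real B)"
  have \<omega>: "\<omega> \<noteq> 0" using AB by (simp add: \<omega>_def)
  have I: "(\<integral>t. of_nat A powr (- (\<i> * complex_of_real t)) * cnj (of_nat B powr (- (\<i> * complex_of_real t))) \<partial>time_avg T)
     = (1 / T) *\<^sub>R (\<i> / \<omega> * cis (- (T * \<omega>)) - \<i> / \<omega>)" if T: "1 \<le> T" for T
  proof -
    have "(\<integral>t. of_nat A powr (- (\<i> * complex_of_real t)) * cnj (of_nat B powr (- (\<i> * complex_of_real t))) \<partial>time_avg T)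
       = (\<integral>t. cis (- (t * \<omega>)) \<partial>time_avg T)"
      using AB by (simp add: nat_powr_imag_pair \<omega>_def)
    also have "\<dots> = (1 / T) *\<^sub>R (LBINT t:{0..T}. cis (- (t * \<omega>)))"
      by (rule integral_time_avg[OF _ T]) (intro borel_measurable_continuous_onI continuous_intros)
    also have "(LBINT t:{0..T}. cis (- (t * \<omega>))) = (\<integral>t. indicator {0..T} t *\<^sub>R cis (- (t * \<omega>)) \<partial>lborel)"
      by (simp add: set_lebesgue_integral_def)
    also have "\<dots> = \<i> / \<omega> * cis (- (T * \<omega>)) - \<i> / \<omega> * cis (- (0 * \<omega>))"
    proof (rule integral_FTC_Icc)
      show "((\<lambda>t. \<i> / \<omega> * cis (- (t * \<omega>))) has_vector_derivative cis (- (x * \<omega>))) (at x within {0..T})" for x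
      proof -
        have cis_exp: "cis (- (t * \<omega>)) = exp (t *\<^sub>R (- \<i> * \<omega>))" for t
          by (simp add: cis_conv_exp scaleR_conv_of_real mult_ac)
        have "((\<lambda>t. \<i> / \<omega> * cis (- (t * \<omega>))) has_vector_derivative
            \<i> / \<omega> * (cis (- (x * \<omega>)) * (- \<i> * \<omega>))) (at x within {0..T})"
          unfolding cis_exp
          by (intro has_vector_derivative_mult_right exp_scaleR_has_vector_derivative_right)
        moreover have "\<i> / \<omega> * (cis (- (x * \<omega>)) * (- \<i> * \<omega>)) = cis (- (x * \<omega>))"
          using \<omega> by (simp add: field_simps)
        ultimately show ?thesis by simp
      qed
    qed (use T in \<open>auto intro!: continuous_intros\<close>)
    finally show ?thesis by simp
  qed
  show "uniform_limit {()} (\<lambda>T (_::unit). \<integral>t. of_nat A powr (- (\<i> * complex_of_real t)) *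
      cnj (of_nat B powr (- (\<i> * complex_of_real t))) \<partial>time_avg T) (\<lambda>_. 0) at_top"
  proof (rule uniform_limitI)
    fix e :: real assume e: "0 < e"
    have "\<forall>\<^sub>F T in at_top. T > max 1 (2 / \<bar>\<omega>\<bar> / e)" by (rule eventually_gt_at_top)
    then show "\<forall>\<^sub>F T in at_top. \<forall>y\<in>{()}. dist (\<integral>t. of_nat A powr (- (\<i> * complex_of_real t)) *
      cnj (of_nat B powr (- (\<i> * complex_of_real t))) \<partial>time_avg T) 0 < e"
    proof eventually_elim
      case (elim T)
      have "cmod (\<i> / \<omega> * cis (- (T * \<omega>)) - \<i> / \<omega>) \<le> 2 / \<bar>\<omega>\<bar>"
        using norm_triangle_ineq4[of "\<i> / \<omega> * cis (- (T * \<omega>))" "\<i> / \<omega>"] by (simp add: norm_mult norm_divide)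
      also have "\<dots> < T * e"
        by (rule pos_divide_less_eq[THEN iffD1, OF e]) (use elim in simp)
      finally have lt: "cmod (\<i> / \<omega> * cis (- (T * \<omega>)) - \<i> / \<omega>) < T * e" .
      have "cmod ((1 / T) *\<^sub>R (\<i> / \<omega> * cis (- (T * \<omega>)) - \<i> / \<omega>)) < e"
        unfolding norm_scaleR using elim mult_strict_left_mono[OF lt, of "1 / T"] by simp
      then show ?case using I[of T] elim by simp
    qed
  qed
qed

definition count_avg :: "nat \<Rightarrow> nat measure" where
  "count_avg N = uniform_measure (count_space UNIV) {1..max 1 N}"

lemma sets_count_avg [measurable_cong, simp]: "sets (count_avg N) = UNIV"
  and space_count_avg [simp]: "space (count_avg N) = UNIV"
  by (simp_all add: count_avg_def)

lemma prob_space_count_avg: "prob_space (count_avg N)"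
  unfolding count_avg_def by (rule prob_space_uniform_measure) auto

lemma integral_count_avg:
  fixes h :: "nat \<Rightarrow> 'b::{banach, second_countable_topology}"
  assumes N: "1 \<le> N"
  shows "integrable (count_avg N) h"
    and "(\<integral>x. h x \<partial>count_avg N) = (1 / real N) *\<^sub>R (\<Sum>n=1..N. h n)"
proof -
  have i: "set_integrable (count_space UNIV) {1..N} h" and
    s: "(\<integral>x\<in>{1..N}. h x \<partial>count_space UNIV) = (\<Sum>n=1..N. h n)"
    unfolding set_integrable_def set_lebesgue_integral_def
  proof -
    have supp: "{n \<in> UNIV. indicator {1..N} n *\<^sub>R h n \<noteq> 0} \<subseteq> {1..N}"
      by (auto simp: indicator_def split: if_splits)
    show "integrable (count_space UNIV) (\<lambda>n. indicator {1..N} n *\<^sub>R h n)"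
      unfolding integrable_count_space_nat_iff by (rule summable_finite[of "{1..N}"]) auto
    have "(\<integral>n. indicator {1..N} n *\<^sub>R h n \<partial>count_space UNIV) =
        (\<Sum>n\<in>{n \<in> UNIV. indicator {1..N} n *\<^sub>R h n \<noteq> 0}. indicator {1..N} n *\<^sub>R h n)"
      by (rule lebesgue_integral_count_space_finite_support) (rule finite_subset[OF supp], simp)
    also have "\<dots> = (\<Sum>n\<in>{1..N}. indicator {1..N} n *\<^sub>R h n)"
      by (rule sum.mono_neutral_left[OF _ supp]) auto
    also have "\<dots> = (\<Sum>n=1..N. h n)" by (rule sum.cong) auto
    finally show "(\<integral>n. indicator {1..N} n *\<^sub>R h n \<partial>count_space UNIV) = (\<Sum>n=1..N. h n)" .
  qed
  show "integrable (count_avg N) h" "(\<integral>x. h x \<partial>count_avg N) = (1 / real N) *\<^sub>R (\<Sum>n=1..N. h n)"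
    using integral_uniform_measure[of "{1..max 1 N}" "count_space UNIV" h] N i s
    by (auto simp: count_avg_def max_def measure_count_space less_top[symmetric])
qed

lemma measure_count_avg:
  assumes "1 \<le> N"
  shows "measure (count_avg N) A = real (card ({1..N} \<inter> A)) / real N"
  using assms measure_uniform_measure[of "count_space UNIV" "{1..max 1 N}" A]
  by (auto simp: count_avg_def max_def measure_count_space)

text \<open>The mean of \<open>e\<^bsup>-i(y + nl)\<omega>\<^esup>\<close> over \<open>n \<le> N\<close> is a geometric sum with ratio \<open>q \<noteq> 1\<close>, hence
  at most \<open>2/(|1 - q|N)\<close>; the parameter \<open>y\<close> contributes only a unimodular factor.\<close>

lemma averaging_scheme_count:
  assumes l: "0 < l" "l \<notin> Gamma_P"
  shows "averaging_scheme sequentially count_avg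
     (\<lambda>y n m. of_nat m powr (- (\<i> * complex_of_real (y + real n * l)))) {0..l}"
proof (rule averaging_scheme.intro)
  show "prob_space (count_avg i)" for i by (rule prob_space_count_avg)
  show "(\<lambda>n. of_nat m powr (- (\<i> * complex_of_real (y + real n * l)))) \<in> borel_measurable (count_avg i)" for m i y
    by (simp add: measurable_def)
  show "unimodular_mult (\<lambda>m. of_nat m powr (- (\<i> * complex_of_real (y + real n * l))))" for n y
    by (rule unimodular_mult_nat_powr)
  fix A B :: nat assume AB: "1 \<le> A" "1 \<le> B" "A \<noteq> B"
  define \<omega> where "\<omega> = ln (real A) - ln (real B)"
  define q where "q = cis (- (l * \<omega>))"
  have q: "q \<noteq> 1"
  proof
    assume "q = 1"
    then have "cnj q = 1" by simp
    then show False using cis_neq_1_outside_Gamma_P[OF l AB] by (simp add: q_def cis_cnj \<omega>_def)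
  qed
  have I: "cmod (\<integral>n. of_nat A powr (- (\<i> * complex_of_real (y + real n * l))) *
      cnj (of_nat B powr (- (\<i> * complex_of_real (y + real n * l)))) \<partial>count_avg N)
     \<le> 2 / cmod (1 - q) / real N" if N: "1 \<le> N" for N y
  proof -
    have "of_nat A powr (- (\<i> * complex_of_real (y + real n * l))) *
      cnj (of_nat B powr (- (\<i> * complex_of_real (y + real n * l)))) = cis (- (y * \<omega>)) * q ^ n" for n
      unfolding nat_powr_imag_pair[OF AB(1,2)] q_def Complex.DeMoivre cis_mult
      by (rule arg_cong[of _ _ cis]) (simp add: \<omega>_def algebra_simps)
    then have "(\<integral>n. of_nat A powr (- (\<i> * complex_of_real (y + real n * l))) *
      cnj (of_nat B powr (- (\<i> * complex_of_real (y + real n * l)))) \<partial>count_avg N)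
      = (1 / real N) *\<^sub>R (\<Sum>n=1..N. cis (- (y * \<omega>)) * q ^ n)"
      by (simp only: integral_count_avg[OF N])
    also have "(\<Sum>n=1..N. cis (- (y * \<omega>)) * q ^ n) = cis (- (y * \<omega>)) * ((q - q ^ Suc N) / (1 - q))"
      unfolding sum_distrib_left[symmetric] using sum_gp[of q 1 N] N q by simp
    also have "cmod ((1 / real N) *\<^sub>R \<dots>) = cmod (q - q ^ Suc N) / cmod (1 - q) / real N"
      by (simp add: norm_mult norm_divide del: power_Suc)
    also have "cmod (q - q ^ Suc N) \<le> 2"
      using norm_triangle_ineq4[of q "q ^ Suc N"] by (simp add: q_def norm_power norm_mult)
    finally show ?thesis by (simp add: divide_right_mono)
  qed
  show "uniform_limit {0..l} (\<lambda>N y. \<integral>n. of_nat A powr (- (\<i> * complex_of_real (y + real n * l))) *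
      cnj (of_nat B powr (- (\<i> * complex_of_real (y + real n * l)))) \<partial>count_avg N) (\<lambda>_. 0) sequentially"
  proof (rule uniform_limitI)
    fix e :: real assume e: "0 < e"
    obtain N0 where N0: "2 / cmod (1 - q) / e < real N0" using reals_Archimedean2 by blast
    have "\<forall>\<^sub>F N in sequentially. N \<ge> Suc N0" by (rule eventually_ge_at_top)
    then show "\<forall>\<^sub>F N in sequentially. \<forall>y\<in>{0..l}. dist (\<integral>n. of_nat A powr (- (\<i> * complex_of_real (y + real n * l))) *
      cnj (of_nat B powr (- (\<i> * complex_of_real (y + real n * l)))) \<partial>count_avg N) 0 < e"
    proof eventually_elim
      case (elim N)
      have "2 / cmod (1 - q) / e < real N" using N0 elim by linarith
      then have "2 / cmod (1 - q) < real N * e" by (rule pos_divide_less_eq[THEN iffD1, OF e])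
      then have "2 / cmod (1 - q) / real N < e"
        using elim by (subst pos_divide_less_eq) (auto simp: mult.commute)
      then show ?case
        unfolding dist_norm diff_0_right using elim by (intro ballI le_less_trans[OF I]) auto
    qed
  qed
qed

section \<open>Mean squares of the remainders\<close>

definition poly_part :: "(nat \<Rightarrow> complex) \<Rightarrow> nat \<Rightarrow> complex \<Rightarrow> complex" where
  "poly_part a k s = (\<Sum>n=1..k. a n * of_nat n powr (- s))"

definition remainder :: "(complex \<Rightarrow> complex) \<Rightarrow> (nat \<Rightarrow> complex) \<Rightarrow> nat \<Rightarrow> complex \<Rightarrow> complex" where
  "remainder L a k s = continuation L s - poly_part a k s"

definition tail_coeff :: "(nat \<Rightarrow> complex) \<Rightarrow> nat \<Rightarrow> nat \<Rightarrow> complex" where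
  "tail_coeff a k n = (if n \<le> k then 0 else a n)"

text \<open>The square of the \<open>L\<^sup>2\<close>-norm on the group of \<open>L(\<beta>, x)\<close> minus its \<open>k\<close>-th partial sum.\<close>

definition tail_norm :: "(nat \<Rightarrow> complex) \<Rightarrow> real \<Rightarrow> nat \<Rightarrow> real" where
  "tail_norm a \<beta> k = (\<Sum>n. (cmod (tail_coeff a k (Suc n)))\<^sup>2 * real (Suc n) powr (- (2 * \<beta>)))"

lemma poly_part_holomorphic: "poly_part a k holomorphic_on A"
  unfolding poly_part_def by (intro holomorphic_intros) auto

lemma poly_part_bound:
  assumes "0 \<le> Re s"
  shows "cmod (poly_part a k s) \<le> (\<Sum>n=1..k. cmod (a n))"
  unfolding poly_part_def
proof (rule order.trans[OF norm_sum sum_mono])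
  fix n assume n: "n \<in> {1..k}"
  have "real n powr (- Re s) \<le> real n powr 0" using n assms by (intro powr_mono) auto
  then show "cmod (a n * of_nat n powr (- s)) \<le> cmod (a n)"
    using n by (auto simp: norm_mult norm_of_nat_powr intro!: mult_left_le)
qed

lemma tail_norm_summable:
  assumes "dirichlet_rep a L" "1 / 2 < \<beta>"
  shows "summable (\<lambda>n. (cmod (tail_coeff a k (Suc n)))\<^sup>2 * real (Suc n) powr (- (2 * \<beta>)))"
proof -
  have "summable (\<lambda>n. (cmod (a (Suc n)))\<^sup>2 * real (Suc n) powr (- (2 * \<beta>)))"
    using assms unfolding dirichlet_rep_def by auto
  then show ?thesis
    by (rule summable_comparison_test') (auto simp: tail_coeff_def)
qed

lemma tail_norm_nonneg:
  assumes "dirichlet_rep a L" "1 / 2 < \<beta>"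
  shows "0 \<le> tail_norm a \<beta> k"
  unfolding tail_norm_def by (intro suminf_nonneg tail_norm_summable[OF assms]) auto

lemma tail_norm_eq:
  assumes "dirichlet_rep a L" "1 / 2 < \<beta>"
  shows "tail_norm a \<beta> k = (\<Sum>n. (cmod (a (Suc (n + k)) * of_nat (Suc (n + k)) powr (- complex_of_real \<beta>)))\<^sup>2)"
proof -
  let ?g = "\<lambda>n. (cmod (tail_coeff a k (Suc n)))\<^sup>2 * real (Suc n) powr (- (2 * \<beta>))"
  have "tail_norm a \<beta> k = (\<Sum>n. ?g (n + k)) + sum ?g {..<k}"
    unfolding tail_norm_def by (rule suminf_split_initial_segment[OF tail_norm_summable[OF assms]])
  also have "sum ?g {..<k} = 0" by (rule sum.neutral) (auto simp: tail_coeff_def)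
  also have "(\<lambda>n. ?g (n + k)) = (\<lambda>n. (cmod (a (Suc (n + k)) * of_nat (Suc (n + k)) powr (- complex_of_real \<beta>)))\<^sup>2)"
    by (rule ext) (simp add: tail_coeff_def norm_mult norm_of_nat_powr power_mult_distrib powr_power mult_ac
        del: of_nat_Suc of_nat_add)
  finally show ?thesis by simp
qed

lemma coeff_square_summable:
  assumes "dirichlet_rep a L" "1 / 2 < \<sigma>"
  shows "summable (\<lambda>n. (cmod (a (Suc n) * of_nat (Suc n) powr (- complex_of_real \<sigma>)))\<^sup>2)"
proof -
  have "summable (\<lambda>n. (cmod (a (Suc n)))\<^sup>2 * real (Suc n) powr (- (2 * \<sigma>)))"
    using assms unfolding dirichlet_rep_def by auto
  also have "(\<lambda>n. (cmod (a (Suc n)))\<^sup>2 * real (Suc n) powr (- (2 * \<sigma>))) =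
     (\<lambda>n. (cmod (a (Suc n) * of_nat (Suc n) powr (- complex_of_real \<sigma>)))\<^sup>2)"
    by (rule ext) (simp add: norm_mult norm_of_nat_powr power_mult_distrib powr_power mult_ac
        del: of_nat_Suc of_nat_add)
  finally show ?thesis .
qed

lemma tail_norm_tendsto_0:
  assumes "dirichlet_rep a L" "1 / 2 < \<beta>"
  shows "tail_norm a \<beta> \<longlonglongrightarrow> 0"
proof -
  have "(\<lambda>k. tail_norm a \<beta> k) = (\<lambda>k. \<Sum>n. (cmod (a (Suc (n + k)) * of_nat (Suc (n + k)) powr (- complex_of_real \<beta>)))\<^sup>2)"
    using tail_norm_eq[OF assms] by (rule ext)
  also have "\<dots> \<longlonglongrightarrow> 0"
    using suminf_exist_split2[OF coeff_square_summable[OF assms]] by simp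
  finally show ?thesis .
qed

lemma tail_mono:
  assumes "dirichlet_rep a L" "1 / 2 < \<beta>" "\<beta> \<le> \<sigma>"
  shows "(\<Sum>n. (cmod (a (Suc (n + k)) * of_nat (Suc (n + k)) powr (- complex_of_real \<sigma>)))\<^sup>2) \<le> tail_norm a \<beta> k"
  unfolding tail_norm_eq[OF assms(1,2)]
proof (rule suminf_le)
  fix n
  have "cmod (of_nat (Suc (n + k)) powr (- complex_of_real \<sigma>)) \<le> cmod (of_nat (Suc (n + k)) powr (- complex_of_real \<beta>))"
    using assms by (auto simp: norm_of_nat_powr simp del: of_nat_Suc of_nat_add intro!: powr_mono)
  then show "(cmod (a (Suc (n + k)) * of_nat (Suc (n + k)) powr (- complex_of_real \<sigma>)))\<^sup>2
     \<le> (cmod (a (Suc (n + k)) * of_nat (Suc (n + k)) powr (- complex_of_real \<beta>)))\<^sup>2"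
    unfolding norm_mult by (intro power_mono mult_left_mono) auto
qed (use assms summable_ignore_initial_segment[OF coeff_square_summable[OF assms(1), of \<beta>], of k]
      summable_ignore_initial_segment[OF coeff_square_summable[OF assms(1), of \<sigma>], of k] in auto)

text \<open>In a regular block the remainder satisfies, with the coefficients beyond \<open>k\<close>, all that the
  mean-square estimate asks of a function at a good time.\<close>

lemma remainder_good:
  assumes reg: "regular_block L \<alpha>' \<beta> l M n" and a: "dirichlet_rep a L"
    and \<beta>: "\<alpha>' < \<beta>" "0 \<le> \<beta>" "\<alpha>' < 1" and l: "0 < l" and t: "real n * l \<le> t" "t \<le> (real n + 1) * l"
  shows "(\<lambda>s. remainder L a k (s + \<i> * of_real t)) holomorphic_on rect \<beta> (l / 2)"
    and "\<forall>z\<in>rect \<beta> (l / 2). cmod (remainder L a k (z + \<i> * of_real t)) \<le> M + (\<Sum>n=1..k. cmod (a n))"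
    and "\<forall>s. 1 < s \<longrightarrow> s < 4 \<longrightarrow>
      (\<lambda>n. tail_coeff a k (Suc n) * of_nat (Suc n) powr (- (complex_of_real s + \<i> * of_real t)))
         sums remainder L a k (of_real s + \<i> * of_real t)"
proof -
  have sub: "z + \<i> * of_real t \<in> block_strip \<alpha>' l n" if "z \<in> rect \<beta> (l / 2)" for z
    using that \<beta> l t by (auto simp: rect_def block_strip_def abs_less_iff algebra_simps)
  have hol: "continuation L holomorphic_on block_strip \<alpha>' l n"
    using reg by (simp add: regular_block_def)
  have "remainder L a k holomorphic_on block_strip \<alpha>' l n"
    unfolding remainder_def[abs_def] by (intro holomorphic_on_diff hol poly_part_holomorphic)
  then show "(\<lambda>s. remainder L a k (s + \<i> * of_real t)) holomorphic_on rect \<beta> (l / 2)"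
    by (rule holomorphic_on_compose_gen[of "\<lambda>s. s + \<i> * of_real t", unfolded o_def, rotated])
       (use sub in \<open>auto intro: holomorphic_on_add\<close>)
  show "\<forall>z\<in>rect \<beta> (l / 2). cmod (remainder L a k (z + \<i> * of_real t)) \<le> M + (\<Sum>n=1..k. cmod (a n))"
  proof
    fix z assume z: "z \<in> rect \<beta> (l / 2)"
    have "cmod (continuation L (z + \<i> * of_real t)) \<le> M"
    proof -
      have "\<beta> \<le> Re (z + \<i> * of_real t)" "Re (z + \<i> * of_real t) \<le> 4" "- (l / 2) \<le> Im z" "Im z \<le> l / 2"
        using z by (auto simp: rect_def abs_less_iff)
      moreover have "(real n - 1/2) * l \<le> Im z + t" "Im z + t \<le> (real n + 3/2) * l"
        using calculation(3,4) t by (simp_all add: algebra_simps)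
      ultimately show ?thesis using reg unfolding regular_block_def by simp
    qed
    moreover have "cmod (poly_part a k (z + \<i> * of_real t)) \<le> (\<Sum>n=1..k. cmod (a n))"
      using z \<beta> by (intro poly_part_bound) (auto simp: rect_def)
    ultimately show "cmod (remainder L a k (z + \<i> * of_real t)) \<le> M + (\<Sum>n=1..k. cmod (a n))"
      unfolding remainder_def by (intro order.trans[OF norm_triangle_ineq4] add_mono)
  qed
  show "\<forall>s. 1 < s \<longrightarrow> s < 4 \<longrightarrow>
      (\<lambda>n. tail_coeff a k (Suc n) * of_nat (Suc n) powr (- (complex_of_real s + \<i> * of_real t)))
         sums remainder L a k (of_real s + \<i> * of_real t)"
  proof (intro allI impI)
    fix s :: real assume s: "1 < s" "s < 4"
    define z where "z = of_real s + \<i> * of_real t"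
    have rz: "1 < Re z" using s by (simp add: z_def)
    have zb: "z \<in> block_strip \<alpha>' l n"
      using \<beta>(3) s t l by (auto simp: z_def block_strip_def algebra_simps)
    have L: "(\<lambda>n. a (Suc n) * of_nat (Suc n) powr (- z)) sums L z"
      using a rz unfolding dirichlet_rep_def by auto
    have P: "(\<lambda>n. if n \<in> {..<k} then a (Suc n) * of_nat (Suc n) powr (- z) else 0) sums
       (\<Sum>n<k. a (Suc n) * of_nat (Suc n) powr (- z))"
      by (rule sums_If_finite_set) simp
    have "(\<Sum>n<k. a (Suc n) * of_nat (Suc n) powr (- z)) = poly_part a k z"
      unfolding poly_part_def by (rule sum.reindex_bij_witness[of _ "\<lambda>n. n - 1" Suc]) auto
    moreover have "(\<lambda>n. a (Suc n) * of_nat (Suc n) powr (- z) -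
        (if n \<in> {..<k} then a (Suc n) * of_nat (Suc n) powr (- z) else 0)) =
        (\<lambda>n. tail_coeff a k (Suc n) * of_nat (Suc n) powr (- z))"
      by (rule ext) (simp add: tail_coeff_def Suc_le_eq del: of_nat_Suc)
    ultimately have "(\<lambda>n. tail_coeff a k (Suc n) * of_nat (Suc n) powr (- z)) sums (L z - poly_part a k z)"
      using sums_diff[OF L P] by (simp only:)
    moreover have "continuation L z = L z"
      using reg zb rz unfolding regular_block_def by blast
    ultimately show "(\<lambda>n. tail_coeff a k (Suc n) * of_nat (Suc n) powr (- (complex_of_real s + \<i> * of_real t)))
         sums remainder L a k (of_real s + \<i> * of_real t)"
      by (simp add: remainder_def z_def)
  qed
qed

lemma rect_real: "\<beta> < \<sigma> \<Longrightarrow> \<sigma> < 4 \<Longrightarrow> 0 < h \<Longrightarrow> of_real \<sigma> \<in> rect \<beta> h"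
  by (simp add: rect_def)

lemma remainder_bound_on_line:
  assumes reg: "regular_block L \<alpha>' \<beta> l M n" and a: "dirichlet_rep a L"
    and \<beta>: "\<alpha>' < \<beta>" "0 \<le> \<beta>" "\<alpha>' < 1" and l: "0 < l" and t: "real n * l \<le> t" "t \<le> (real n + 1) * l"
    and \<sigma>: "\<beta> < \<sigma>" "\<sigma> < 4"
  shows "cmod (remainder L a k (of_real \<sigma> + \<i> * of_real t)) \<le> M + (\<Sum>n=1..k. cmod (a n))"
  using remainder_good(2)[OF reg a \<beta> l t, of k] rect_real[OF \<sigma>, of "l / 2"] l by auto

lemma remainder_continuous_on_line:
  assumes reg: "regular_block L \<alpha>' \<beta> l M n" and \<beta>: "\<alpha>' < \<beta>" and l: "0 < l" and \<sigma>: "\<beta> < \<sigma>"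
  shows "continuous_on {real n * l..(real n + 1) * l} (\<lambda>t. remainder L a k (of_real \<sigma> + \<i> * of_real t))"
proof -
  have "continuation L holomorphic_on block_strip \<alpha>' l n"
    using reg by (simp add: regular_block_def)
  then have "remainder L a k holomorphic_on block_strip \<alpha>' l n"
    unfolding remainder_def[abs_def] by (intro holomorphic_on_diff poly_part_holomorphic)
  then have "continuous_on (block_strip \<alpha>' l n) (remainder L a k)"
    by (rule holomorphic_on_imp_continuous_on)
  then show ?thesis
    by (rule continuous_on_compose2[of _ _ _ "\<lambda>t. of_real \<sigma> + \<i> * of_real t"])
       (use \<beta> \<sigma> l in \<open>auto intro!: continuous_intros simp: block_strip_def algebra_simps\<close>)
qed

lemma mean_square_count:
  assumes haar: "averaging_to_characters sequentially count_avg
     (\<lambda>y n m. of_nat m powr (- (\<i> * complex_of_real (y + real n * l)))) {0..l} (\<tau> :: 'k measure) Z"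
    and a: "dirichlet_rep a L" and \<beta>: "\<alpha>' < \<beta>" "1 / 2 < \<beta>" "\<alpha>' < 1" "\<beta> < \<alpha>" "\<alpha> \<le> 2" and l: "0 < l"
    and J: "\<And>n. n \<in> J \<Longrightarrow> regular_block L \<alpha>' \<beta> l M n"
    and B: "16 * tail_norm a \<beta> k < B"
  shows "\<forall>\<^sub>F N in sequentially. \<forall>\<sigma>\<in>{\<alpha>..2}. \<forall>y\<in>{0..l}.
    (\<Sum>n=1..N. indicator J n * (cmod (remainder L a k (of_real \<sigma> + \<i> * of_real (y + real n * l))))\<^sup>2) \<le> B * real N"
proof -
  interpret averaging_to_characters sequentially count_avg
     "\<lambda>y n m. of_nat m powr (- (\<i> * complex_of_real (y + real n * l)))" "{0..l}" \<tau> Z by (rule haar)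
  have "\<forall>\<^sub>F N in sequentially. \<forall>\<sigma>\<in>{\<alpha>..2}. \<forall>y\<in>{0..l}. \<exists>g. integrable (count_avg N) g \<and> (\<forall>\<omega>. 0 \<le> g \<omega>) \<and>
      (\<forall>n\<in>J. (cmod (remainder L a k (of_real \<sigma> + \<i> * of_real (y + real n * l))))\<^sup>2 \<le> g n) \<and> (\<integral>\<omega>. g \<omega> \<partial>count_avg N) \<le> B"
  proof (rule mean_square_on_good_times[where h = "l / 2" and \<beta> = \<beta> and b = "tail_coeff a k" and f = "remainder L a k"
      and Good = "\<lambda>_. J" and \<theta> = "\<lambda>y n. y + real n * l" and C = "M + (\<Sum>n=1..k. cmod (a n))"])
    show "summable (\<lambda>n. cmod (tail_coeff a k (Suc n)) * real (Suc n) powr - s)" if "1 < s" for s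
      by (rule summable_comparison_test'[OF dirichlet_abs_summable[OF a that]]) (auto simp: tail_coeff_def)
    fix y n assume "y \<in> {0..l}" "n \<in> J"
    then have t: "real n * l \<le> y + real n * l" "y + real n * l \<le> (real n + 1) * l" by (auto simp: algebra_simps)
    note rg = remainder_good[OF J[OF \<open>n \<in> J\<close>] a \<beta>(1) _ \<beta>(3) l t, of k]
    show "(\<lambda>s. remainder L a k (s + \<i> * of_real (y + real n * l))) holomorphic_on rect \<beta> (l / 2) \<and>
        (\<forall>z\<in>rect \<beta> (l / 2). cmod (remainder L a k (z + \<i> * of_real (y + real n * l))) \<le> M + (\<Sum>n=1..k. cmod (a n))) \<and>
        (\<forall>s. 1 < s \<longrightarrow> s < 4 \<longrightarrow>
      (\<lambda>m. tail_coeff a k (Suc m) * of_nat (Suc m) powr (- (complex_of_real s + \<i> * of_real (y + real n * l))))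
         sums remainder L a k (of_real s + \<i> * of_real (y + real n * l)))"
      using rg \<beta>(2) by (intro conjI) simp_all
  qed (use l \<beta> tail_norm_summable[OF a \<beta>(2)] B in \<open>simp_all add: tail_norm_def\<close>)
  moreover have "\<forall>\<^sub>F N in sequentially. 1 \<le> N" by (rule eventually_ge_at_top)
  ultimately show ?thesis
  proof eventually_elim
    case (elim N)
    show ?case
    proof (intro ballI)
      fix \<sigma> y assume "\<sigma> \<in> {\<alpha>..2}" "y \<in> {0..l}"
      with elim(1) obtain g where g: "\<And>\<omega>. 0 \<le> g \<omega>"
        "\<And>n. n \<in> J \<Longrightarrow> (cmod (remainder L a k (of_real \<sigma> + \<i> * of_real (y + real n * l))))\<^sup>2 \<le> g n"
        "(\<integral>\<omega>. g \<omega> \<partial>count_avg N) \<le> B" by blast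
      have "(\<Sum>n=1..N. indicator J n * (cmod (remainder L a k (of_real \<sigma> + \<i> * of_real (y + real n * l))))\<^sup>2)
         \<le> (\<Sum>n=1..N. g n)"
        by (rule sum_mono) (use g in \<open>auto simp: indicator_def\<close>)
      also have "\<dots> = real N * (\<integral>\<omega>. g \<omega> \<partial>count_avg N)"
        using integral_count_avg(2)[OF elim(2), of g] elim(2) by simp
      also have "\<dots> \<le> real N * B" using g(3) by (intro mult_left_mono) auto
      finally show "(\<Sum>n=1..N. indicator J n * (cmod (remainder L a k (of_real \<sigma> + \<i> * of_real (y + real n * l))))\<^sup>2) \<le> B * real N"
        by (simp add: mult.commute)
    qed
  qed
qed

definition block_mean :: "real \<Rightarrow> (real \<Rightarrow> real) \<Rightarrow> nat \<Rightarrow> real" where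
  "block_mean l h n = (1 / l) * (LBINT t:{real n * l..<(real n + 1) * l}. h t)"

text \<open>The sum over good blocks is an integral over good times up to \<open>(N + 1)l\<close>; the factor 2 absorbs
  \<open>N + 1\<close>.\<close>

lemma mean_square_time:
  assumes haar: "averaging_to_characters at_top time_avg
     (\<lambda>(_::unit) t n. of_nat n powr (- (\<i> * complex_of_real t))) {()} (\<mu> :: 'k measure) Z"
    and a: "dirichlet_rep a L" and \<beta>: "\<alpha>' < \<beta>" "1 / 2 < \<beta>" "\<alpha>' < 1" "\<beta> < \<alpha>" "\<alpha> \<le> 2" and l: "0 < l"
    and J: "\<And>n. n \<in> J \<Longrightarrow> regular_block L \<alpha>' \<beta> l M n"
    and B: "16 * tail_norm a \<beta> k < B"
  shows "\<forall>\<^sub>F N in sequentially. \<forall>\<sigma>\<in>{\<alpha>..2}.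
    (\<Sum>n=1..N. indicator J n * block_mean l (\<lambda>t. (cmod (remainder L a k (of_real \<sigma> + \<i> * of_real t)))\<^sup>2) n) \<le> 2 * B * real N"
proof -
  interpret averaging_to_characters at_top time_avg
     "\<lambda>(_::unit) t n. of_nat n powr (- (\<i> * complex_of_real t))" "{()}" \<mu> Z by (rule haar)
  define Good where "Good = {t. \<exists>n\<in>J. real n * l \<le> t \<and> t \<le> (real n + 1) * l}"
  have B0: "0 < B" using B tail_norm_nonneg[OF a \<beta>(2), of k] by linarith
  have "\<forall>\<^sub>F T in at_top. \<forall>\<sigma>\<in>{\<alpha>..2}. \<forall>y\<in>{()}. \<exists>g. integrable (time_avg T) g \<and> (\<forall>\<omega>. 0 \<le> g \<omega>) \<and>
      (\<forall>t\<in>Good. (cmod (remainder L a k (of_real \<sigma> + \<i> * of_real t)))\<^sup>2 \<le> g t) \<and> (\<integral>\<omega>. g \<omega> \<partial>time_avg T) \<le> B"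
  proof (rule mean_square_on_good_times[where h = "l / 2" and \<beta> = \<beta> and b = "tail_coeff a k" and f = "remainder L a k"
      and Good = "\<lambda>_. Good" and \<theta> = "\<lambda>_ t. t" and C = "M + (\<Sum>n=1..k. cmod (a n))"])
    show "summable (\<lambda>n. cmod (tail_coeff a k (Suc n)) * real (Suc n) powr - s)" if "1 < s" for s
      by (rule summable_comparison_test'[OF dirichlet_abs_summable[OF a that]]) (auto simp: tail_coeff_def)
    fix t assume "t \<in> Good"
    then obtain n where n: "n \<in> J" and t: "real n * l \<le> t" "t \<le> (real n + 1) * l" by (auto simp: Good_def)
    note rg = remainder_good[OF J[OF n] a \<beta>(1) _ \<beta>(3) l t, of k]
    show "(\<lambda>s. remainder L a k (s + \<i> * of_real t)) holomorphic_on rect \<beta> (l / 2) \<and>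
        (\<forall>z\<in>rect \<beta> (l / 2). cmod (remainder L a k (z + \<i> * of_real t)) \<le> M + (\<Sum>n=1..k. cmod (a n))) \<and>
        (\<forall>s. 1 < s \<longrightarrow> s < 4 \<longrightarrow>
      (\<lambda>m. tail_coeff a k (Suc m) * of_nat (Suc m) powr (- (complex_of_real s + \<i> * of_real t)))
         sums remainder L a k (of_real s + \<i> * of_real t))"
      using rg \<beta>(2) by (intro conjI) simp_all
  qed (use l \<beta> tail_norm_summable[OF a \<beta>(2)] B in \<open>simp_all add: tail_norm_def\<close>)
  then have ev: "\<forall>\<^sub>F T in at_top. \<forall>\<sigma>\<in>{\<alpha>..2}. \<exists>g. integrable (time_avg T) g \<and> (\<forall>\<omega>. 0 \<le> g \<omega>) \<and>
      (\<forall>t\<in>Good. (cmod (remainder L a k (of_real \<sigma> + \<i> * of_real t)))\<^sup>2 \<le> g t) \<and> (\<integral>\<omega>. g \<omega> \<partial>time_avg T) \<le> B"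
    by simp
  have lim: "filterlim (\<lambda>N. (real N + 1) * l) at_top sequentially"
    using l by real_asymp
  have ev': "\<forall>\<^sub>F N in sequentially. \<forall>\<sigma>\<in>{\<alpha>..2}. \<exists>g. integrable (time_avg ((real N + 1) * l)) g \<and> (\<forall>\<omega>. 0 \<le> g \<omega>) \<and>
      (\<forall>t\<in>Good. (cmod (remainder L a k (of_real \<sigma> + \<i> * of_real t)))\<^sup>2 \<le> g t) \<and>
      (\<integral>\<omega>. g \<omega> \<partial>time_avg ((real N + 1) * l)) \<le> B"
    using lim ev unfolding filterlim_iff by blast
  have "\<forall>\<^sub>F N in sequentially. 1 \<le> (real N + 1) * l"
    using lim unfolding filterlim_at_top by blast
  moreover have "\<forall>\<^sub>F N in sequentially. 1 \<le> N" by (rule eventually_ge_at_top)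
  ultimately show ?thesis
    using ev'
  proof eventually_elim
    case (elim N)
    define T where "T = (real N + 1) * l"
    have T: "1 \<le> T" using elim by (simp add: T_def)
    show ?case
    proof
      fix \<sigma> assume \<sigma>: "\<sigma> \<in> {\<alpha>..2}"
      define h where "h t = (cmod (remainder L a k (of_real \<sigma> + \<i> * of_real t)))\<^sup>2" for t
      define I where "I n = {real n * l..<(real n + 1) * l}" for n
      have "\<exists>g. integrable (time_avg T) g \<and> (\<forall>t. 0 \<le> g t) \<and> (\<forall>t\<in>Good. h t \<le> g t) \<and> (\<integral>t. g t \<partial>time_avg T) \<le> B"
        using bspec[OF elim(3) \<sigma>] unfolding T_def h_def .
      then obtain g where g: "integrable (time_avg T) g" "\<And>t. 0 \<le> g t"
        "\<And>t. t \<in> Good \<Longrightarrow> h t \<le> g t" "(\<integral>t. g t \<partial>time_avg T) \<le> B"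
        by (elim exE conjE) (rule that, simp_all)
      have gm: "g \<in> borel_measurable borel" using borel_measurable_integrable[OF g(1)] by simp
      have gi: "set_integrable lborel {0..T} g"
        using integral_time_avg(1)[OF gm T] g(1) by simp
      have "(LBINT t:{0..T}. g t) = T * (\<integral>t. g t \<partial>time_avg T)"
        using integral_time_avg(2)[OF gm T] T by simp
      also have "\<dots> \<le> T * B" using g(4) T by (intro mult_left_mono) auto
      finally have gB: "(LBINT t:{0..T}. g t) \<le> T * B" .
      have hint: "set_integrable lborel (I n) h" if "n \<in> J" for n
      proof -
        have "continuous_on {real n * l..(real n + 1) * l} h" unfolding h_def
          by (intro continuous_intros remainder_continuous_on_line[OF J[OF that] \<beta>(1) l]) (use \<sigma> \<beta> in auto)
        then have "set_integrable lborel {real n * l..(real n + 1) * l} h"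
          by (rule borel_integrable_atLeastAtMost')
        then show ?thesis
          by (rule set_integrable_subset) (auto simp: I_def)
      qed
      have le: "(\<Sum>n=1..N. indicator J n * (indicator (I n) t * h t)) \<le> indicator {0..T} t * g t" for t
      proof (cases "\<exists>n\<in>{1..N}. n \<in> J \<and> t \<in> I n")
        case True
        then obtain n where n: "n \<in> {1..N}" "n \<in> J" "t \<in> I n" by auto
        have uniq: "m = n" if "t \<in> I m" for m
        proof -
          have "real m * l < (real n + 1) * l" "real n * l < (real m + 1) * l" using that n by (auto simp: I_def)
          then have "real m < real n + 1" "real n < real m + 1" using l by (simp_all add: mult_less_cancel_right)
          then show ?thesis by linarith
        qed
        have "(\<Sum>m=1..N. indicator J m * (indicator (I m) t * h t)) = (\<Sum>m=1..N. if m = n then h t else 0)"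
        proof (rule sum.cong[OF refl])
          fix m show "indicator J m * (indicator (I m) t * h t) = (if m = n then h t else 0)"
          proof (cases "m = n")
            case False
            then have "t \<notin> I m" using uniq by blast
            then show ?thesis using False by simp
          qed (use n(2,3) in simp)
        qed
        also have "\<dots> = h t" using n by simp
        also have "\<dots> \<le> g t" using n by (intro g) (auto simp: Good_def I_def)
        also have "g t = indicator {0..T} t * g t"
        proof -
          have "(real n + 1) * l \<le> T" unfolding T_def using n l by (intro mult_right_mono) auto
          moreover have "0 \<le> real n * l" using l by simp
          ultimately have "t \<in> {0..T}" using n(3) unfolding I_def by auto
          then show ?thesis by simp
        qed
        finally show ?thesis .
      next
        case False
        then have z: "(\<Sum>n=1..N. indicator J n * (indicator (I n) t * h t)) = 0"
          by (intro sum.neutral) (auto simp: indicator_def)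
        show ?thesis unfolding z using g(2)[of t] by (simp add: indicator_def)
      qed
      have int: "integrable lborel (\<lambda>t. indicator J n * (indicator (I n) t * h t))" for n
        using hint[of n] by (cases "n \<in> J") (auto simp: set_integrable_def)
      have "(\<Sum>n=1..N. indicator J n * block_mean l h n) =
          (1 / l) * (\<Sum>n=1..N. (\<integral>t. indicator J n * (indicator (I n) t * h t) \<partial>lborel))"
      proof -
        have "indicator J n * block_mean l h n = (1 / l) * (\<integral>t. indicator J n * (indicator (I n) t * h t) \<partial>lborel)" for n
          by (cases "n \<in> J") (simp_all add: block_mean_def I_def set_lebesgue_integral_def)
        then show ?thesis by (simp only: sum_distrib_left)
      qed
      also have "(\<Sum>n=1..N. (\<integral>t. indicator J n * (indicator (I n) t * h t) \<partial>lborel))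
          = (\<integral>t. (\<Sum>n=1..N. indicator J n * (indicator (I n) t * h t)) \<partial>lborel)"
        by (rule Bochner_Integration.integral_sum[symmetric]) (rule int)
      also have "\<dots> \<le> (\<integral>t. indicator {0..T} t * g t \<partial>lborel)"
      proof (rule integral_mono)
        show "integrable lborel (\<lambda>t. \<Sum>n=1..N. indicator J n * (indicator (I n) t * h t))"
          by (intro Bochner_Integration.integrable_sum int)
        show "integrable lborel (\<lambda>t. indicator {0..T} t * g t)" using gi by (simp add: set_integrable_def)
      qed (rule le)
      also have "\<dots> \<le> T * B" using gB by (simp add: set_lebesgue_integral_def)
      finally have "(\<Sum>n=1..N. indicator J n * block_mean l h n) \<le> (1 / l) * (T * B)"
        using l by (simp add: divide_right_mono)
      also have "\<dots> = (real N + 1) * B" using l by (simp add: T_def)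
      also have "\<dots> \<le> (2 * real N) * B" using elim B0 by (intro mult_right_mono) auto
      finally show "(\<Sum>n=1..N. indicator J n * block_mean l (\<lambda>t. (cmod (remainder L a k (of_real \<sigma> + \<i> * of_real t)))\<^sup>2) n)
        \<le> 2 * B * real N" unfolding h_def by (simp add: mult_ac)
    qed
  qed
qed

section \<open>A common set of good blocks\<close>

lemma lower_dens_card_compl:
  assumes J: "lower_dens J > ereal (1 - \<epsilon>)"
  shows "\<forall>\<^sub>F N in sequentially. real (card ({1..N} - J)) \<le> \<epsilon> * real N"
proof -
  have "\<forall>\<^sub>F N in sequentially. ereal (1 - \<epsilon>) < ereal (real (card (J \<inter> {1..N})) / real N)"
    using J unfolding lower_dens_def by (rule less_LiminfD)
  moreover have "\<forall>\<^sub>F N in sequentially. 1 \<le> N" by (rule eventually_ge_at_top)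
  ultimately show ?thesis
  proof eventually_elim
    case (elim N)
    then have "(1 - \<epsilon>) * real N < real (card (J \<inter> {1..N}))" by (simp add: field_simps)
    moreover have "card ({1..N} - J) + card (J \<inter> {1..N}) = N"
    proof -
      have "card (({1..N} - J) \<union> (J \<inter> {1..N})) = card ({1..N} - J) + card (J \<inter> {1..N})"
        by (rule card_Un_disjoint) auto
      moreover have "({1..N} - J) \<union> (J \<inter> {1..N}) = {1..N}" by auto
      ultimately show ?thesis by simp
    qed
    then have "real (card ({1..N} - J)) + real (card (J \<inter> {1..N})) = real N"
      by (simp only: of_nat_add[symmetric])
    ultimately show ?case by (simp add: algebra_simps)
  qed
qed

lemma block_mean_le:
  assumes l: "0 < l" and h: "\<And>t. real n * l \<le> t \<Longrightarrow> t \<le> (real n + 1) * l \<Longrightarrow> h t \<le> D" and D: "0 \<le> D"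
  shows "block_mean l h n \<le> D"
proof -
  have "(LBINT t:{real n * l..<(real n + 1) * l}. h t) \<le> (LBINT t:{real n * l..<(real n + 1) * l}. D)"
  proof (cases "set_integrable lborel {real n * l..<(real n + 1) * l} h")
    case True
    show ?thesis
      by (rule set_integral_mono[OF True])
         (use h l in \<open>auto simp: set_integrable_def algebra_simps\<close>)
  next
    case False
    then have "(LBINT t:{real n * l..<(real n + 1) * l}. h t) = 0"
      unfolding set_lebesgue_integral_def set_integrable_def by (rule not_integrable_integral_eq)
    then show ?thesis using D by (simp add: set_lebesgue_integral_def)
  qed
  also have "\<dots> = l * D" using l by (simp add: set_lebesgue_integral_def algebra_simps)
  finally show ?thesis using l by (simp add: block_mean_def field_simps)
qed

lemma block_mean_nonneg: "0 < l \<Longrightarrow> (\<And>t. 0 \<le> h t) \<Longrightarrow> 0 \<le> block_mean l h n"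
  unfolding block_mean_def set_lebesgue_integral_def
  by (intro mult_nonneg_nonneg Bochner_Integration.integral_nonneg) auto

text \<open>A positive number above the limiting mean square; it tends to \<open>0\<close> with \<open>k\<close>. The factor 2 is the
  one from continuous averages.\<close>

definition mean_bound :: "(nat \<Rightarrow> complex) \<Rightarrow> real \<Rightarrow> nat \<Rightarrow> real" where
  "mean_bound a \<beta> k = 2 * (16 * tail_norm a \<beta> k + 1 / (real k + 1))"

lemma mean_bound_pos: "dirichlet_rep a L \<Longrightarrow> 1 / 2 < \<beta> \<Longrightarrow> 0 < mean_bound a \<beta> k"
  using tail_norm_nonneg[of a L \<beta> k] unfolding mean_bound_def
  by (intro mult_pos_pos add_nonneg_pos) auto

lemma mean_bound_tendsto_0:
  assumes "dirichlet_rep a L" "1 / 2 < \<beta>"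
  shows "mean_bound a \<beta> \<longlonglongrightarrow> 0"
proof -
  have "(\<lambda>k. 2 * (16 * tail_norm a \<beta> k + 1 / (real k + 1))) \<longlonglongrightarrow> 2 * (16 * 0 + 0)"
  proof (intro tendsto_intros tail_norm_tendsto_0[OF assms])
    show "(\<lambda>k. 1 / (real k + 1)) \<longlonglongrightarrow> 0" by real_asymp
  qed
  then show ?thesis by (simp add: mean_bound_def[abs_def])
qed

text \<open>The diagonal choice, with requirements indexed by pairs \<open>(j, k)\<close> through \<open>prod_encode\<close>. Each
  requirement bounds the sums for all \<open>\<sigma>\<close>, and if \<open>P\<close> holds for all shifts \<open>y\<close>, at
  once. The starting points depend on \<open>j\<close> only, as the boundedness of \<open>\<L>\<^sub>j\<close> is what
  they have to ensure.\<close>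

lemma good_blocks_exist:
  fixes L :: "nat \<Rightarrow> complex \<Rightarrow> complex" and \<mu> :: "'k measure" and \<tau> :: "'h measure"
  assumes L: "\<And>j. L j \<in> class_N u" and a: "\<And>j. dirichlet_rep (a j) (L j)"
    and u: "u < \<alpha>'" "\<alpha>' < \<beta>" "\<beta> < \<alpha>" "\<alpha> \<le> 1" "1 / 2 < \<beta>" and l: "0 < l"
    and \<mu>: "averaging_to_characters at_top time_avg
       (\<lambda>(_::unit) t n. of_nat n powr (- (\<i> * complex_of_real t))) {()} \<mu> Z"
    and \<tau>: "P \<Longrightarrow> averaging_to_characters sequentially count_avg
       (\<lambda>y n m. of_nat m powr (- (\<i> * complex_of_real (y + real n * l)))) {0..l} \<tau> Z'"
  obtains G :: "nat set" and T :: "nat \<Rightarrow> nat" where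
    "has_dens ({1..} - G) 0" "\<And>j. 1 \<le> T j"
    "\<And>j n. n \<in> G \<Longrightarrow> T j \<le> n \<Longrightarrow> \<exists>M. regular_block (L j) \<alpha>' \<beta> l M n"
    "\<And>j k. \<forall>\<^sub>F N in sequentially. \<forall>\<sigma>\<in>{\<alpha>..2}.
       (\<Sum>n=T j..N. indicator G n * block_mean l (\<lambda>t. (cmod (remainder (L j) (a j) k (of_real \<sigma> + \<i> * of_real t)))\<^sup>2) n)
         \<le> 4 * mean_bound (a j) \<beta> k * real N"
    "\<And>j k. P \<Longrightarrow> \<forall>\<^sub>F N in sequentially. \<forall>\<sigma>\<in>{\<alpha>..2}. \<forall>y\<in>{0..l}.
       (\<Sum>n=T j..N. indicator G n * (cmod (remainder (L j) (a j) k (of_real \<sigma> + \<i> * of_real (y + real n * l))))\<^sup>2)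
         \<le> 4 * mean_bound (a j) \<beta> k * real N"
proof -
  \<comment> \<open>At level \<open>i\<close> the sets for the first \<open>i + 1\<close> functions are intersected; the complement then has upper
      density at most \<open>(1/2)\<^sup>i\<close>.\<close>
  define \<epsilon> where "\<epsilon> i = (1/2)^i / real (Suc i)" for i :: nat
  have \<epsilon>: "0 < \<epsilon> i" for i by (simp add: \<epsilon>_def)
  have "\<exists>J M. lower_dens J > ereal (1 - \<epsilon> i) \<and> (\<forall>n\<in>J. regular_block (L j) \<alpha>' \<beta> l M n)" for i j
  proof -
    obtain J M where "lower_dens J > ereal (1 - \<epsilon> i)" "\<And>n. n \<in> J \<Longrightarrow> regular_block (L j) \<alpha>' \<beta> l M n"
      by (rule class_N_regular_blocks[OF L a u(1) _ l \<epsilon> u(2), of i j]) (use u in auto)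
    then show ?thesis by blast
  qed
  then have "\<forall>i j. \<exists>JM. lower_dens (fst JM) > ereal (1 - \<epsilon> i) \<and> (\<forall>n\<in>fst JM. regular_block (L j) \<alpha>' \<beta> l (snd JM) n)"
    by fastforce
  then obtain JM where JM: "\<And>i j. lower_dens (fst (JM i j)) > ereal (1 - \<epsilon> i)"
     "\<And>i j n. n \<in> fst (JM i j) \<Longrightarrow> regular_block (L j) \<alpha>' \<beta> l (snd (JM i j)) n" by metis
  define J where "J i = (\<Inter>j\<in>{..i}. fst (JM i j))" for i
  have reg: "regular_block (L j) \<alpha>' \<beta> l (snd (JM i j)) n" if "j \<le> i" "n \<in> J i" for i j n
    using that JM(2) by (auto simp: J_def)
  define \<C> where "\<C> q = (\<lambda>\<sigma>. block_mean l (\<lambda>t. (cmod (remainder (L (fst (prod_decode q))) (a (fst (prod_decode q))) (snd (prod_decode q)) (of_real \<sigma> + \<i> * of_real t)))\<^sup>2)) ` {\<alpha>..2} \<union>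
     {c. P \<and> (\<exists>\<sigma>\<in>{\<alpha>..2}. \<exists>y\<in>{0..l}. c = (\<lambda>n. (cmod (remainder (L (fst (prod_decode q))) (a (fst (prod_decode q))) (snd (prod_decode q)) (of_real \<sigma> + \<i> * of_real (y + real n * l))))\<^sup>2))}" for q
  define B where "B q = mean_bound (a (fst (prod_decode q))) \<beta> (snd (prod_decode q))" for q
  have fst_le: "fst (prod_decode q) \<le> q" for q
    using le_prod_encode_1[of "fst (prod_decode q)" "snd (prod_decode q)"] by simp
  show ?thesis
  proof (rule diagonal_density[of \<C> B J "\<lambda>q. fst (prod_decode q)"])
    fix c q n assume "c \<in> \<C> q"
    then show "0 \<le> c n" using l by (auto simp: \<C>_def intro: block_mean_nonneg)
  next
    fix q show "0 < B q" unfolding B_def by (rule mean_bound_pos[OF a u(5)])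
  next
    fix i q :: nat assume qi: "q \<le> i"
    define j k where "j = fst (prod_decode q)" and "k = snd (prod_decode q)"
    have ji: "j \<le> i" using fst_le[of q] qi by (simp add: j_def)
    define B0 where "B0 = 16 * tail_norm (a j) \<beta> k + 1 / (real k + 1)"
    have B0: "16 * tail_norm (a j) \<beta> k < B0" "B q = 2 * B0" "0 < B0"
      using tail_norm_nonneg[OF a u(5), of j k] by (auto simp: B0_def B_def mean_bound_def j_def k_def intro: add_nonneg_pos)
    have \<beta>': "\<alpha>' < 1" "\<alpha> \<le> 2" using u by auto
    have 1: "\<forall>\<^sub>F N in sequentially. \<forall>\<sigma>\<in>{\<alpha>..2}.
      (\<Sum>n=1..N. indicator (J i) n * block_mean l (\<lambda>t. (cmod (remainder (L j) (a j) k (of_real \<sigma> + \<i> * of_real t)))\<^sup>2) n) \<le> 2 * B0 * real N"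
      by (rule mean_square_time[OF \<mu> a u(2) u(5) \<beta>'(1) u(3) \<beta>'(2) l reg[OF ji] B0(1)])
    have 2: "\<forall>\<^sub>F N in sequentially. P \<longrightarrow> (\<forall>\<sigma>\<in>{\<alpha>..2}. \<forall>y\<in>{0..l}.
      (\<Sum>n=1..N. indicator (J i) n * (cmod (remainder (L j) (a j) k (of_real \<sigma> + \<i> * of_real (y + real n * l))))\<^sup>2) \<le> B0 * real N)"
    proof (cases P)
      case True
      show ?thesis using mean_square_count[OF \<tau>[OF True] a u(2) u(5) \<beta>'(1) u(3) \<beta>'(2) l reg[OF ji] B0(1)] by simp
    qed simp
    show "\<forall>\<^sub>F N in sequentially. \<forall>c\<in>\<C> q. (\<Sum>n=1..N. indicator (J i) n * c n) \<le> B q * real N"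
      using 1 2
    proof eventually_elim
      case (elim N)
      show ?case
      proof
        fix c assume "c \<in> \<C> q"
        then consider \<sigma> where "\<sigma> \<in> {\<alpha>..2}" "c = block_mean l (\<lambda>t. (cmod (remainder (L j) (a j) k (of_real \<sigma> + \<i> * of_real t)))\<^sup>2)"
          | \<sigma> y where "P" "\<sigma> \<in> {\<alpha>..2}" "y \<in> {0..l}" "c = (\<lambda>n. (cmod (remainder (L j) (a j) k (of_real \<sigma> + \<i> * of_real (y + real n * l))))\<^sup>2)"
          unfolding \<C>_def j_def k_def by blast
        then show "(\<Sum>n=1..N. indicator (J i) n * c n) \<le> B q * real N"
        proof cases
          case 1
          then show ?thesis using elim(1) B0(2) by simp
        next
          case 2
          then have "(\<Sum>n=1..N. indicator (J i) n * c n) \<le> B0 * real N" using elim(2) by blast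
          also have "\<dots> \<le> B q * real N" using B0 by (intro mult_right_mono) auto
          finally show ?thesis .
        qed
      qed
    qed
  next
    fix i
    have "\<forall>\<^sub>F N in sequentially. \<forall>j\<in>{..i}. real (card ({1..N} - fst (JM i j))) \<le> \<epsilon> i * real N"
      by (intro eventually_ball_finite ballI lower_dens_card_compl JM) auto
    then show "\<forall>\<^sub>F N in sequentially. real (card ({1..N} - J i)) \<le> (1/2)^i * real N"
    proof eventually_elim
      case (elim N)
      have "{1..N} - J i = (\<Union>j\<in>{..i}. {1..N} - fst (JM i j))" by (auto simp: J_def)
      then have "card ({1..N} - J i) \<le> (\<Sum>j\<in>{..i}. card ({1..N} - fst (JM i j)))"
        by (simp only:) (rule card_UN_le, simp)
      then have "real (card ({1..N} - J i)) \<le> (\<Sum>j\<in>{..i}. real (card ({1..N} - fst (JM i j))))"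
        by (simp only: of_nat_sum[symmetric] of_nat_le_iff)
      also have "\<dots> \<le> (\<Sum>j\<in>{..i}. \<epsilon> i * real N)" using elim by (intro sum_mono) auto
      also have "\<dots> = real (Suc i) * (\<epsilon> i * real N)" by simp
      also have "\<dots> = (1/2)^i * real N" unfolding \<epsilon>_def by (simp del: of_nat_Suc)
      finally show ?case .
    qed
  next
    fix i q n assume ji: "fst (prod_decode q) \<le> i" and n: "n \<in> J i"
    define j k where "j = fst (prod_decode q)" and "k = snd (prod_decode q)"
    define D where "D = (\<bar>snd (JM i j)\<bar> + (\<Sum>n=1..k. cmod (a j n)))\<^sup>2"
    have bd: "(cmod (remainder (L j) (a j) k (of_real \<sigma> + \<i> * of_real t)))\<^sup>2 \<le> D"
      if "\<sigma> \<in> {\<alpha>..2}" "real n * l \<le> t" "t \<le> (real n + 1) * l" for \<sigma> t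
      unfolding D_def
    proof (rule power_mono)
      have "cmod (remainder (L j) (a j) k (of_real \<sigma> + \<i> * of_real t)) \<le> snd (JM i j) + (\<Sum>n=1..k. cmod (a j n))"
        by (rule remainder_bound_on_line[OF reg[OF ji[folded j_def] n] a u(2) _ _ l that(2,3)]) (use u that in auto)
      then show "cmod (remainder (L j) (a j) k (of_real \<sigma> + \<i> * of_real t)) \<le> \<bar>snd (JM i j)\<bar> + (\<Sum>n=1..k. cmod (a j n))"
        by linarith
    qed simp
    show "\<exists>D. \<forall>c\<in>\<C> q. c n \<le> D"
    proof (intro exI[of _ D] ballI)
      fix c assume "c \<in> \<C> q"
      then consider \<sigma> where "\<sigma> \<in> {\<alpha>..2}" "c = block_mean l (\<lambda>t. (cmod (remainder (L j) (a j) k (of_real \<sigma> + \<i> * of_real t)))\<^sup>2)"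
          | \<sigma> y where "P" "\<sigma> \<in> {\<alpha>..2}" "y \<in> {0..l}" "c = (\<lambda>n. (cmod (remainder (L j) (a j) k (of_real \<sigma> + \<i> * of_real (y + real n * l))))\<^sup>2)"
          unfolding \<C>_def j_def k_def by blast
      then show "c n \<le> D"
      proof cases
        case 1
        show ?thesis unfolding 1(2) by (rule block_mean_le[OF l bd[OF 1(1)]]) (auto simp: D_def)
      next
        case 2
        show ?thesis unfolding 2(4) by (rule bd[OF 2(2)]) (use 2(3) in \<open>auto simp: algebra_simps\<close>)
      qed
    qed
  next
    fix G T
    assume G: "has_dens ({1..} - G) 0" "\<And>i. 1 \<le> T i" "\<And>i n. n \<in> G \<Longrightarrow> T i \<le> n \<Longrightarrow> \<exists>k\<ge>i. n \<in> J k"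
      "\<And>q. \<forall>\<^sub>F N in sequentially. \<forall>c\<in>\<C> q. (\<Sum>n=T (fst (prod_decode q))..N. indicator G n * c n) \<le> 4 * B q * real N"
    show thesis
    proof (rule that[OF G(1,2)])
      show "\<exists>M. regular_block (L j) \<alpha>' \<beta> l M n" if n: "n \<in> G" "T j \<le> n" for j n
      proof -
        obtain k where "j \<le> k" "n \<in> J k" using G(3)[OF n] by blast
        from reg[OF this] show ?thesis by blast
      qed
      show "\<forall>\<^sub>F N in sequentially. \<forall>\<sigma>\<in>{\<alpha>..2}.
       (\<Sum>n=T j..N. indicator G n * block_mean l (\<lambda>t. (cmod (remainder (L j) (a j) k (of_real \<sigma> + \<i> * of_real t)))\<^sup>2) n)
         \<le> 4 * mean_bound (a j) \<beta> k * real N" for j k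
        using G(4)[of "prod_encode (j, k)"]
      proof eventually_elim
        case (elim N)
        have "block_mean l (\<lambda>t. (cmod (remainder (L j) (a j) k (of_real \<sigma> + \<i> * of_real t)))\<^sup>2) \<in> \<C> (prod_encode (j, k))"
          if "\<sigma> \<in> {\<alpha>..2}" for \<sigma>
          using that unfolding \<C>_def prod_encode_inverse fst_conv snd_conv by blast
        from bspec[OF elim this] show ?case unfolding B_def prod_encode_inverse fst_conv snd_conv by blast
      qed
      show "\<forall>\<^sub>F N in sequentially. \<forall>\<sigma>\<in>{\<alpha>..2}. \<forall>y\<in>{0..l}.
       (\<Sum>n=T j..N. indicator G n * (cmod (remainder (L j) (a j) k (of_real \<sigma> + \<i> * of_real (y + real n * l))))\<^sup>2)
         \<le> 4 * mean_bound (a j) \<beta> k * real N" if P for j k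
        using G(4)[of "prod_encode (j, k)"]
      proof eventually_elim
        case (elim N)
        have "(\<lambda>n. (cmod (remainder (L j) (a j) k (of_real \<sigma> + \<i> * of_real (y + real n * l))))\<^sup>2) \<in> \<C> (prod_encode (j, k))"
          if "\<sigma> \<in> {\<alpha>..2}" "y \<in> {0..l}" for \<sigma> y
          using that \<open>P\<close> unfolding \<C>_def prod_encode_inverse fst_conv snd_conv by blast
        from bspec[OF elim this] show ?case unfolding B_def prod_encode_inverse fst_conv snd_conv by blast
      qed
    qed
  qed
qed

section \<open>Mean values off the exceptional set\<close>

definition dirichlet_poly :: "(nat \<Rightarrow> complex) \<Rightarrow> nat \<Rightarrow> real \<Rightarrow> (nat \<Rightarrow> complex) \<Rightarrow> complex" where
  "dirichlet_poly a k \<sigma> \<psi> = (\<Sum>n=1..k. a n * of_nat n powr (- complex_of_real \<sigma>) * \<psi> n)"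

lemma trig_poly_dirichlet_poly:
  assumes "\<And>\<sigma>. \<sigma> \<in> S \<Longrightarrow> 0 \<le> \<sigma>"
  shows "trig_poly S (dirichlet_poly a k)"
  unfolding dirichlet_poly_def[abs_def]
proof (rule trig_poly_sum)
  fix n assume n: "n \<in> {1..k}"
  have "bounded ((\<lambda>\<sigma>. a n * of_nat n powr (- complex_of_real \<sigma>)) ` S)"
    unfolding bounded_iff
  proof (intro exI[of _ "cmod (a n)"] ballI)
    fix z assume "z \<in> (\<lambda>\<sigma>. a n * of_nat n powr (- complex_of_real \<sigma>)) ` S"
    then obtain \<sigma> where \<sigma>: "\<sigma> \<in> S" "z = a n * of_nat n powr (- complex_of_real \<sigma>)" by auto
    have "real n powr (- \<sigma>) \<le> real n powr 0" using n assms[OF \<sigma>(1)] by (intro powr_mono) auto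
    then show "cmod z \<le> cmod (a n)"
      using n by (auto simp: \<sigma>(2) norm_mult norm_of_nat_powr intro!: mult_left_le)
  qed
  then have "trig_poly S (\<lambda>\<sigma> \<psi>. a n * of_nat n powr (- complex_of_real \<sigma>) * (\<psi> n * cnj (\<psi> 1)))"
    using n by (intro trig_poly.monomial) auto
  then show "trig_poly S (\<lambda>\<sigma> \<psi>. a n * of_nat n powr (- complex_of_real \<sigma>) * \<psi> n)"
    by (rule trig_poly.cong) (simp add: unimodular_multD)
qed

lemma dirichlet_poly_eq_poly_part:
  "dirichlet_poly a k \<sigma> (\<lambda>n. of_nat n powr (- (\<i> * complex_of_real t))) = poly_part a k (Complex \<sigma> t)"
  unfolding dirichlet_poly_def poly_part_def Complex_eq minus_add_distrib powr_add by (simp add: mult.assoc)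

text \<open>The choice of a representative in \<open>dirichlet_ext\<close> is harmless: any two differ on a null set,
  and existence follows from \<open>2\<sigma> > 1\<close>.\<close>

lemma dirichlet_ext_L2:
  assumes "orthonormal_characters M (\<lambda>x n. x (ln (real n)))"
    and a: "dirichlet_rep a L" and \<beta>: "1 / 2 < \<beta>" "\<beta> \<le> \<sigma>"
  shows "dirichlet_ext M a (of_real \<sigma>) \<in> borel_measurable M"
    and "integrable M (\<lambda>x. (cmod (dirichlet_ext M a (of_real \<sigma>) x - dirichlet_poly a k \<sigma> (\<lambda>n. x (ln (real n)))))\<^sup>2)"
    and "(\<integral>x. (cmod (dirichlet_ext M a (of_real \<sigma>) x - dirichlet_poly a k \<sigma> (\<lambda>n. x (ln (real n)))))\<^sup>2 \<partial>M)
      \<le> 2 * tail_norm a \<beta> k"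
proof -
  interpret orthonormal_characters M "\<lambda>x n. x (ln (real n))" by fact
  define d where "d n = a n * of_nat n powr (- complex_of_real \<sigma>)" for n
  have s: "summable (\<lambda>n. (cmod (d (Suc n)))\<^sup>2)"
    unfolding d_def using coeff_square_summable[OF a, of \<sigma>] \<beta> by simp
  have L2: "is_L2_sum M (\<lambda>n x. d n * x (ln (real n))) (dirichlet_ext M a (of_real \<sigma>))"
    unfolding dirichlet_ext_def d_def[symmetric] by (rule someI_ex[OF L2_sum_exists[OF s]])
  then show "dirichlet_ext M a (of_real \<sigma>) \<in> borel_measurable M" by (simp add: is_L2_sum_def)
  have ps: "partial_sum d {1..k} = (\<lambda>x. dirichlet_poly a k \<sigma> (\<lambda>n. x (ln (real n))))"
    by (simp add: partial_sum_def dirichlet_poly_def d_def fun_eq_iff)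
  show "integrable M (\<lambda>x. (cmod (dirichlet_ext M a (of_real \<sigma>) x - dirichlet_poly a k \<sigma> (\<lambda>n. x (ln (real n)))))\<^sup>2)"
    using L2_sum_approx(1)[OF s L2, of k] unfolding ps .
  have "(\<integral>x. (cmod (dirichlet_ext M a (of_real \<sigma>) x - dirichlet_poly a k \<sigma> (\<lambda>n. x (ln (real n)))))\<^sup>2 \<partial>M)
      \<le> 2 * (\<Sum>n. (cmod (d (Suc (n + k))))\<^sup>2)"
    using L2_sum_approx(2)[OF s L2, of k] unfolding ps .
  also have "\<dots> \<le> 2 * tail_norm a \<beta> k"
    unfolding d_def by (intro mult_left_mono tail_mono[OF a \<beta>]) auto
  finally show "(\<integral>x. (cmod (dirichlet_ext M a (of_real \<sigma>) x - dirichlet_poly a k \<sigma> (\<lambda>n. x (ln (real n)))))\<^sup>2 \<partial>M)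
      \<le> 2 * tail_norm a \<beta> k" .
qed

text \<open>One function \<open>L\<close> of the sequence, together with the set \<open>A\<close> and the starting point \<open>N\<close>: beyond \<open>N\<close>,
  a time outside \<open>A\<close> lies in a regular block.\<close>

locale good_blocks =
  fixes L :: "complex \<Rightarrow> complex" and a :: "nat \<Rightarrow> complex" and \<alpha>' \<beta> \<alpha> l :: real
    and G :: "nat set" and n0 :: nat and A :: "real set" and N :: nat
  assumes a: "dirichlet_rep a L"
    and order: "\<alpha>' < \<beta>" "\<beta> < \<alpha>" "\<alpha> \<le> 1" "1 / 2 < \<beta>" and l: "0 < l"
    and regular: "\<And>n. n \<in> G \<Longrightarrow> n0 \<le> n \<Longrightarrow> \<exists>M. regular_block L \<alpha>' \<beta> l M n"
    and A_borel [measurable]: "A \<in> sets borel"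
    and off_A: "\<And>t. real N \<le> t \<Longrightarrow> t \<notin> A \<Longrightarrow> \<exists>n\<in>G. n0 \<le> n \<and> real n * l \<le> t \<and> t < (real n + 1) * l"
begin

definition domain :: "complex set" where
  "domain = (\<Union>n\<in>{n\<in>G. n0 \<le> n}. block_strip \<alpha>' l n)"

lemma open_domain: "open domain"
  unfolding domain_def by (intro open_UN ballI open_block_strip)

lemma continuation_continuous: "continuous_on domain (continuation L)"
  unfolding domain_def
proof (rule continuous_on_open_UN)
  show "open (block_strip \<alpha>' l n)" for n by (rule open_block_strip)
  fix n assume "n \<in> {n\<in>G. n0 \<le> n}"
  then obtain M where "regular_block L \<alpha>' \<beta> l M n" using regular by auto
  then show "continuous_on (block_strip \<alpha>' l n) (continuation L)"
    unfolding regular_block_def by (blast intro: holomorphic_on_imp_continuous_on)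
qed

text \<open>Extending the continuation by \<open>0\<close> gives a Borel function on the whole plane, from which all
  measurability statements follow.\<close>

definition cut :: "complex \<Rightarrow> complex" where
  "cut s = indicator domain s *\<^sub>R continuation L s"

lemma cut_measurable [measurable]: "cut \<in> borel_measurable borel"
  unfolding cut_def[abs_def]
  by (rule borel_measurable_continuous_on_indicator[OF _ continuation_continuous]) (simp add: open_domain)

lemma cut_eq:
  assumes "real N \<le> t" "t \<notin> A" "\<alpha> \<le> \<sigma>"
  shows "cut (Complex \<sigma> t) = continuation L (Complex \<sigma> t)" "continuable L (Complex \<sigma> t)"
proof -
  obtain n where n: "n \<in> G" "n0 \<le> n" "real n * l \<le> t" "t < (real n + 1) * l"
    using off_A[OF assms(1,2)] by auto
  have *: "Complex \<sigma> t \<in> block_strip \<alpha>' l n"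
    using n assms(3) order l by (simp add: block_strip_def algebra_simps)
  then have "Complex \<sigma> t \<in> domain" using n by (auto simp: domain_def)
  then show "cut (Complex \<sigma> t) = continuation L (Complex \<sigma> t)" by (simp add: cut_def)
  obtain M where "regular_block L \<alpha>' \<beta> l M n" using regular n by auto
  then show "continuable L (Complex \<sigma> t)" using * by (simp add: regular_block_def)
qed

lemma continuation_bounded:
  "\<exists>D\<ge>0. \<forall>t \<sigma>. real N \<le> t \<longrightarrow> t \<le> T \<longrightarrow> t \<notin> A \<longrightarrow> \<alpha> \<le> \<sigma> \<longrightarrow> \<sigma> \<le> 2 \<longrightarrow> cmod (continuation L (Complex \<sigma> t)) \<le> D"
proof -
  have "\<forall>n. \<exists>M. n \<in> G \<longrightarrow> n0 \<le> n \<longrightarrow> regular_block L \<alpha>' \<beta> l M n" using regular by blast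
  from choice[OF this] obtain M where M: "\<And>n. n \<in> G \<Longrightarrow> n0 \<le> n \<Longrightarrow> regular_block L \<alpha>' \<beta> l (M n) n" by blast
  define D where "D = (\<Sum>n\<le>nat \<lceil>T / l\<rceil>. \<bar>M n\<bar>)"
  show ?thesis
  proof (intro exI[of _ D] conjI allI impI)
    show "0 \<le> D" unfolding D_def by (intro sum_nonneg) auto
    fix t \<sigma> assume t: "real N \<le> t" "t \<le> T" "t \<notin> A" and \<sigma>: "\<alpha> \<le> \<sigma>" "\<sigma> \<le> 2"
    obtain n where n: "n \<in> G" "n0 \<le> n" "real n * l \<le> t" "t < (real n + 1) * l"
      using off_A[OF t(1,3)] by auto
    have "real n * l \<le> T" using n t by linarith
    then have "real n \<le> T / l" using l by (simp add: field_simps)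
    then have nT: "n \<le> nat \<lceil>T / l\<rceil>" by linarith
    have "(real n - 1/2) * l \<le> t" "t \<le> (real n + 3/2) * l" using n l by (auto simp: algebra_simps)
    then have "cmod (continuation L (Complex \<sigma> t)) \<le> M n"
      using M[OF n(1,2)] \<sigma> order unfolding regular_block_def by simp
    also have "\<dots> \<le> \<bar>M n\<bar>" by simp
    also have "\<dots> \<le> D" unfolding D_def using nT by (intro member_le_sum) auto
    finally show "cmod (continuation L (Complex \<sigma> t)) \<le> D" .
  qed
qed

definition good_times :: "real set" where "good_times = - A \<inter> {real N..}"

lemma good_times_borel [measurable]: "good_times \<in> sets borel"
  unfolding good_times_def by measurable

lemma time_measurable [measurable]:
  assumes "\<alpha> \<le> \<sigma>"
  shows "(\<lambda>t. continuation L (Complex \<sigma> t) * indicator good_times t) \<in> borel_measurable borel"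
proof -
  have "(\<lambda>t. cut (Complex \<sigma> t) * indicator good_times t) \<in> borel_measurable borel"
  proof (intro borel_measurable_times borel_measurable_indicator good_times_borel)
    have "(\<lambda>t. Complex \<sigma> t) \<in> borel_measurable borel"
      unfolding Complex_eq by (intro borel_measurable_continuous_onI continuous_intros)
    then show "(\<lambda>t. cut (Complex \<sigma> t)) \<in> borel_measurable borel" by measurable
  qed
  also have "(\<lambda>t. cut (Complex \<sigma> t) * indicator good_times t) = (\<lambda>t. continuation L (Complex \<sigma> t) * indicator good_times t)"
    using cut_eq(1) assms by (auto simp: fun_eq_iff good_times_def indicator_def)
  finally show ?thesis .
qed

lemma composed_measurable:
  fixes p :: "complex \<Rightarrow> complex"
  assumes p: "continuous_on UNIV p" and \<sigma>: "\<alpha> \<le> \<sigma>"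
  shows "(\<lambda>t. p (continuation L (Complex \<sigma> t)) * indicator good_times t) \<in> borel_measurable borel"
proof -
  have "(\<lambda>t. p (continuation L (Complex \<sigma> t) * indicator good_times t) * indicator good_times t) \<in> borel_measurable borel"
    by (intro borel_measurable_times borel_measurable_indicator good_times_borel
        borel_measurable_continuous_on[OF p time_measurable[OF \<sigma>]])
  also have "(\<lambda>t. p (continuation L (Complex \<sigma> t) * indicator good_times t) * indicator good_times t) =
      (\<lambda>t. p (continuation L (Complex \<sigma> t)) * indicator good_times t)"
    by (auto simp: fun_eq_iff indicator_def)
  finally show ?thesis .
qed

lemma composed_bounded:
  fixes p :: "complex \<Rightarrow> complex"
  assumes p: "continuous_on UNIV p"
  obtains B where "\<And>t \<sigma>. real N \<le> t \<Longrightarrow> t \<le> T \<Longrightarrow> t \<notin> A \<Longrightarrow> \<alpha> \<le> \<sigma> \<Longrightarrow> \<sigma> \<le> 2 \<Longrightarrow>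
      cmod (p (continuation L (Complex \<sigma> t))) \<le> B"
proof -
  obtain D where D: "0 \<le> D" "\<And>t \<sigma>. real N \<le> t \<Longrightarrow> t \<le> T \<Longrightarrow> t \<notin> A \<Longrightarrow> \<alpha> \<le> \<sigma> \<Longrightarrow> \<sigma> \<le> 2 \<Longrightarrow>
      cmod (continuation L (Complex \<sigma> t)) \<le> D"
    using continuation_bounded[of T] by blast
  have "bounded (p ` cball 0 D)"
    by (intro compact_imp_bounded compact_continuous_image continuous_on_subset[OF p]) auto
  then obtain B where B: "\<forall>z\<in>cball 0 D. cmod (p z) \<le> B" by (auto simp: bounded_iff)
  show ?thesis
  proof (rule that)
    fix t \<sigma> assume "real N \<le> t" "t \<le> T" "t \<notin> A" "\<alpha> \<le> \<sigma>" "\<sigma> \<le> 2"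
    from D(2)[OF this] show "cmod (p (continuation L (Complex \<sigma> t))) \<le> B" using B by simp
  qed
qed

lemma joint_integrable:
  fixes p :: "complex \<Rightarrow> complex"
  assumes p: "continuous_on UNIV p"
  shows "set_integrable (lborel \<Otimes>\<^sub>M lborel) ({real N..T} \<times> {\<alpha>..2})
      (\<lambda>(t, \<sigma>). p (continuation L (Complex \<sigma> t)) * indicator (- A) t)"
proof -
  obtain B where B: "\<And>t \<sigma>. real N \<le> t \<Longrightarrow> t \<le> T \<Longrightarrow> t \<notin> A \<Longrightarrow> \<alpha> \<le> \<sigma> \<Longrightarrow> \<sigma> \<le> 2 \<Longrightarrow>
      cmod (p (continuation L (Complex \<sigma> t))) \<le> B"
    using composed_bounded[OF p, of T] by blast
  have "(\<lambda>(t, \<sigma>). Complex \<sigma> t) \<in> borel_measurable (borel \<Otimes>\<^sub>M borel)"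
    unfolding Complex_eq borel_prod by (intro borel_measurable_continuous_onI) (simp add: case_prod_unfold, intro continuous_intros)
  then have m1: "(\<lambda>(t, \<sigma>). cut (Complex \<sigma> t)) \<in> borel_measurable (borel \<Otimes>\<^sub>M borel)"
    by (simp add: case_prod_unfold)
  have m2: "(\<lambda>(t, \<sigma>). p (cut (Complex \<sigma> t))) \<in> borel_measurable (borel \<Otimes>\<^sub>M borel)"
    using borel_measurable_continuous_on[OF p m1] by (simp add: case_prod_unfold)
  have m3: "(\<lambda>(t, \<sigma>). p (cut (Complex \<sigma> t)) * indicator (- A) t) \<in> borel_measurable (lborel \<Otimes>\<^sub>M lborel)"
    using m2 by (simp add: case_prod_unfold)
  have "integrable (lborel \<Otimes>\<^sub>M lborel) (\<lambda>x. indicator ({real N..T} \<times> {\<alpha>..2}) x *\<^sub>R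
      (case x of (t, \<sigma>) \<Rightarrow> p (cut (Complex \<sigma> t)) * indicator (- A) t))"
  proof (rule integrableI_bounded_set_indicator[OF _ m3, where B = "\<bar>B\<bar>"])
    show "{real N..T} \<times> {\<alpha>..2} \<in> sets (lborel \<Otimes>\<^sub>M lborel)" by simp
    have "emeasure (lborel \<Otimes>\<^sub>M lborel) ({real N..T} \<times> {\<alpha>..2}) = emeasure lborel {real N..T} * emeasure lborel {\<alpha>..2}"
      by (rule lborel.emeasure_pair_measure_Times) auto
    also have "\<dots> < \<infinity>" by (auto simp: emeasure_lborel_Icc_eq ennreal_mult_less_top)
    finally show "emeasure (lborel \<Otimes>\<^sub>M lborel) ({real N..T} \<times> {\<alpha>..2}) < \<infinity>" .
    show "AE x in lborel \<Otimes>\<^sub>M lborel. x \<in> {real N..T} \<times> {\<alpha>..2} \<longrightarrow>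
      norm (case x of (t, \<sigma>) \<Rightarrow> p (cut (Complex \<sigma> t)) * indicator (- A) t) \<le> \<bar>B\<bar>"
    proof (rule AE_I2, intro impI)
      fix x :: "real \<times> real" assume x: "x \<in> {real N..T} \<times> {\<alpha>..2}"
      obtain t \<sigma> where ts: "x = (t, \<sigma>)" by (cases x)
      show "norm (case x of (t, \<sigma>) \<Rightarrow> p (cut (Complex \<sigma> t)) * indicator (- A) t) \<le> \<bar>B\<bar>"
      proof (cases "t \<in> A")
        case False
        then have "cmod (p (cut (Complex \<sigma> t))) \<le> B" using x ts cut_eq(1)[of t \<sigma>] B[of t \<sigma>] by auto
        then show ?thesis using False ts by simp
      qed (simp add: ts)
    qed
  qed
  also have "(\<lambda>x. indicator ({real N..T} \<times> {\<alpha>..2}) x *\<^sub>R (case x of (t, \<sigma>) \<Rightarrow> p (cut (Complex \<sigma> t)) * indicator (- A) t))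
     = (\<lambda>x. indicator ({real N..T} \<times> {\<alpha>..2}) x *\<^sub>R (case x of (t, \<sigma>) \<Rightarrow> p (continuation L (Complex \<sigma> t)) * indicator (- A) t))"
    using cut_eq(1) by (auto simp: fun_eq_iff indicator_def)
  finally show ?thesis unfolding set_integrable_def .
qed

lemma remainder_square_integrable:
  assumes \<sigma>: "\<sigma> \<in> {\<alpha>..2}" and T: "1 \<le> T"
  shows "integrable (time_avg T) (\<lambda>t. (cmod (remainder L a k (Complex \<sigma> t)))\<^sup>2 * indicator good_times t)"
proof -
  obtain D where D: "0 \<le> D" "\<And>t \<sigma>. real N \<le> t \<Longrightarrow> t \<le> T \<Longrightarrow> t \<notin> A \<Longrightarrow> \<alpha> \<le> \<sigma> \<Longrightarrow> \<sigma> \<le> 2 \<Longrightarrow>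
      cmod (continuation L (Complex \<sigma> t)) \<le> D"
    using continuation_bounded[of T] by blast
  define B where "B = (D + (\<Sum>n=1..k. cmod (a n)))\<^sup>2"
  have cp: "continuous_on UNIV (\<lambda>t. poly_part a k (Complex \<sigma> t))"
    by (rule continuous_on_compose2[OF holomorphic_on_imp_continuous_on[OF poly_part_holomorphic[of a k UNIV]]])
       (auto simp: Complex_eq intro!: continuous_intros)
  have tm [measurable]: "(\<lambda>t. continuation L (Complex \<sigma> t) * indicator good_times t) \<in> borel_measurable borel"
    by (rule time_measurable) (use \<sigma> in simp)
  have pm [measurable]: "(\<lambda>t. poly_part a k (Complex \<sigma> t)) \<in> borel_measurable borel"
    by (rule borel_measurable_continuous_onI[OF cp])
  have "(\<lambda>t. (cmod (continuation L (Complex \<sigma> t) * indicator good_times t - poly_part a k (Complex \<sigma> t) * indicator good_times t))\<^sup>2)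
     \<in> borel_measurable borel"
    by measurable
  also have "(\<lambda>t. (cmod (continuation L (Complex \<sigma> t) * indicator good_times t - poly_part a k (Complex \<sigma> t) * indicator good_times t))\<^sup>2)
     = (\<lambda>t. (cmod (remainder L a k (Complex \<sigma> t)))\<^sup>2 * indicator good_times t)"
    by (auto simp: fun_eq_iff remainder_def indicator_def)
  finally have m: "(\<lambda>t. (cmod (remainder L a k (Complex \<sigma> t)))\<^sup>2 * indicator good_times t) \<in> borel_measurable borel" .
  have "set_integrable lborel {0..T} (\<lambda>t. (cmod (remainder L a k (Complex \<sigma> t)))\<^sup>2 * indicator good_times t)"
    unfolding set_integrable_def
  proof (rule integrableI_bounded_set_indicator[where B = B])
    show "AE t in lborel. t \<in> {0..T} \<longrightarrow> norm ((cmod (remainder L a k (Complex \<sigma> t)))\<^sup>2 * indicator good_times t) \<le> B"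
    proof (rule AE_I2, intro impI)
      fix t assume t: "t \<in> {0..T}"
      show "norm ((cmod (remainder L a k (Complex \<sigma> t)))\<^sup>2 * indicator good_times t) \<le> B"
      proof (cases "t \<in> good_times")
        case True
        have "cmod (remainder L a k (Complex \<sigma> t)) \<le> D + (\<Sum>n=1..k. cmod (a n))"
          unfolding remainder_def using True t \<sigma> order
          by (intro order.trans[OF norm_triangle_ineq4] add_mono D poly_part_bound) (auto simp: good_times_def)
        then show ?thesis using True by (simp add: B_def power_mono)
      qed (simp add: B_def)
    qed
  qed (use m T in auto)
  then show ?thesis using integral_time_avg(1)[OF m T] by simp
qed

text \<open>Good times up to \<open>T\<close> are covered by the good blocks with index at most \<open>T/l\<close>; the last one may stick
  out beyond \<open>T\<close>.\<close>

lemma remainder_mean_square_time: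
  assumes \<sigma>: "\<sigma> \<in> {\<alpha>..2}" and T: "1 \<le> T"
    and sum: "(\<Sum>n=n0..nat \<lfloor>T / l\<rfloor>. indicator G n * block_mean l (\<lambda>t. (cmod (remainder L a k (of_real \<sigma> + \<i> * of_real t)))\<^sup>2) n)
      \<le> B * real (nat \<lfloor>T / l\<rfloor>)" and B: "0 \<le> B"
  shows "(\<integral>t. (cmod (remainder L a k (Complex \<sigma> t)))\<^sup>2 * indicator good_times t \<partial>time_avg T) \<le> B"
proof -
  define h where "h t = (cmod (remainder L a k (Complex \<sigma> t)))\<^sup>2" for t
  define Q where "Q = nat \<lfloor>T / l\<rfloor>"
  define I where "I n = {real n * l..<(real n + 1) * l}" for n
  have Q: "real Q * l \<le> T"
  proof -
    have "real Q \<le> T / l" using T l by (simp add: Q_def)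
    then show ?thesis using l by (simp add: field_simps)
  qed
  have int0: "integrable (time_avg T) (\<lambda>t. h t * indicator good_times t)"
    unfolding h_def by (rule remainder_square_integrable[OF \<sigma> T])
  have m: "(\<lambda>t. h t * indicator good_times t) \<in> borel_measurable borel"
    using borel_measurable_integrable[OF int0] by simp
  have hint: "integrable lborel (\<lambda>t. indicator G n * (indicator (I n) t * h t))" if n: "n0 \<le> n" for n
  proof (cases "n \<in> G")
    case True
    then obtain M where "regular_block L \<alpha>' \<beta> l M n" using regular n by auto
    then have "continuous_on {real n * l..(real n + 1) * l} h"
      unfolding h_def Complex_eq using \<sigma> order l
      by (intro continuous_intros remainder_continuous_on_line[of L \<alpha>' \<beta> l M n]) auto
    then have "set_integrable lborel {real n * l..(real n + 1) * l} h"
      by (rule borel_integrable_atLeastAtMost')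
    then have "set_integrable lborel (I n) h"
      by (rule set_integrable_subset) (auto simp: I_def)
    then show ?thesis using True by (simp add: set_integrable_def)
  qed simp
  have le: "indicator {0..T} t * (h t * indicator good_times t) \<le>
      (\<Sum>n=n0..Q. indicator G n * (indicator (I n) t * h t))" for t
  proof (cases "t \<in> good_times \<and> t \<in> {0..T}")
    case True
    obtain n where n: "n \<in> G" "n0 \<le> n" "real n * l \<le> t" "t < (real n + 1) * l"
      using off_A[of t] True by (auto simp: good_times_def)
    have "real n * l \<le> T" using n True by auto
    then have "real n \<le> T / l" using l by (simp add: field_simps)
    then have "n \<le> Q" unfolding Q_def by (simp add: le_nat_floor)
    then have "indicator G n * (indicator (I n) t * h t) \<le> (\<Sum>n=n0..Q. indicator G n * (indicator (I n) t * h t))"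
      using n by (intro member_le_sum) (auto simp: h_def)
    then show ?thesis using True n by (simp add: I_def)
  next
    case False
    then have "indicator {0..T} t * (h t * indicator good_times t) = 0" by (auto simp: indicator_def)
    also have "0 \<le> (\<Sum>n=n0..Q. indicator G n * (indicator (I n) t * h t))"
      by (intro sum_nonneg mult_nonneg_nonneg) (auto simp: h_def)
    finally show ?thesis .
  qed
  have "(LBINT t:{0..T}. h t * indicator good_times t) \<le> (\<integral>t. (\<Sum>n=n0..Q. indicator G n * (indicator (I n) t * h t)) \<partial>lborel)"
    unfolding set_lebesgue_integral_def
  proof (rule integral_mono)
    show "integrable lborel (\<lambda>t. indicator {0..T} t *\<^sub>R (h t * indicator good_times t))"
      using integral_time_avg(1)[OF m T] int0 by (simp add: set_integrable_def)
    show "integrable lborel (\<lambda>t. \<Sum>n=n0..Q. indicator G n * (indicator (I n) t * h t))"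
      by (intro Bochner_Integration.integrable_sum hint) auto
  qed (use le in simp)
  also have "\<dots> = (\<Sum>n=n0..Q. \<integral>t. indicator G n * (indicator (I n) t * h t) \<partial>lborel)"
    by (rule Bochner_Integration.integral_sum) (use hint in auto)
  also have "\<dots> = l * (\<Sum>n=n0..Q. indicator G n * block_mean l h n)"
  proof -
    have "(\<integral>t. indicator G n * (indicator (I n) t * h t) \<partial>lborel) = l * (indicator G n * block_mean l h n)" for n
      using l by (cases "n \<in> G") (simp_all add: block_mean_def I_def set_lebesgue_integral_def)
    then show ?thesis by (simp only: sum_distrib_left)
  qed
  also have "\<dots> \<le> l * (B * real Q)"
    using sum l unfolding h_def Complex_eq Q_def by (intro mult_left_mono) auto
  also have "\<dots> = B * (real Q * l)" by simp
  also have "\<dots> \<le> B * T" using Q B by (intro mult_left_mono)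
  finally have "(LBINT t:{0..T}. h t * indicator good_times t) \<le> B * T" .
  then have "T * (\<integral>t. h t * indicator good_times t \<partial>time_avg T) \<le> T * B"
    using integral_time_avg(2)[OF m T] T by (simp add: mult.commute)
  then have "(\<integral>t. h t * indicator good_times t \<partial>time_avg T) \<le> B"
    by (rule mult_left_le_imp_le) (use T in simp)
  then show ?thesis unfolding h_def .
qed

end

context good_blocks
begin

text \<open>The error sequence \<open>e\<close> adds the mean-square errors over good times and on the group.\<close>

lemma time_mean_value:
  fixes p :: "complex \<Rightarrow> complex" and \<mu> :: "(real \<Rightarrow> complex) measure"
  assumes atc: "averaging_to_characters at_top time_avg
       (\<lambda>(_::unit) t n. of_nat n powr (- (\<i> * complex_of_real t))) {()} \<mu> (\<lambda>x n. x (ln (real n)))"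
    and p: "continuous_on UNIV p" "p \<in> O[at_infinity](\<lambda>z. of_real ((cmod z)\<^sup>2))"
    and mass: "((\<lambda>T. measure (time_avg T) (- good_times)) \<longlongrightarrow> 0) at_top"
    and sums: "\<And>k. \<forall>\<^sub>F Q in sequentially. \<forall>\<sigma>\<in>{\<alpha>..2}.
       (\<Sum>n=n0..Q. indicator G n * block_mean l (\<lambda>t. (cmod (remainder L a k (of_real \<sigma> + \<i> * of_real t)))\<^sup>2) n)
         \<le> B k * real Q"
    and B: "B \<longlonglongrightarrow> 0" "\<And>k. 0 \<le> B k"
  shows "\<And>\<sigma>. \<sigma> \<in> {\<alpha>..2} \<Longrightarrow> integrable \<mu> (\<lambda>x. p (dirichlet_ext \<mu> a (of_real \<sigma>) x))"
    and "uniform_limit {\<alpha>..2} (\<lambda>T \<sigma>. (1 / T) *\<^sub>R (LBINT t:{real N..T}. p (continuation L (Complex \<sigma> t)) * indicator (- A) t))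
      (\<lambda>\<sigma>. LINT x|\<mu>. p (dirichlet_ext \<mu> a (of_real \<sigma>) x)) at_top"
proof -
  have \<mu>: "orthonormal_characters \<mu> (\<lambda>x n. x (ln (real n)))"
    using atc by (rule averaging_to_characters.axioms(2))
  obtain C where C: "0 < C" "\<And>z. cmod (p z) \<le> C * (1 + (cmod z)\<^sup>2)"
    using quadratic_growth_bound[OF p] by blast
  define e where "e k = B k + 2 * tail_norm a \<beta> k" for k
  have e: "e \<longlonglongrightarrow> 0"
    using tendsto_add[OF B(1) tendsto_mult_left[OF tail_norm_tendsto_0[OF a order(4)], of 2]]
    by (simp add: e_def[abs_def])
  have eB: "B k \<le> e k" "2 * tail_norm a \<beta> k \<le> e k" for k
    using tail_norm_nonneg[OF a order(4), of k] B(2)[of k] by (auto simp: e_def)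
  have lim: "filterlim (\<lambda>T. nat \<lfloor>T / l\<rfloor>) sequentially at_top"
    using l by real_asymp
  have approx: "\<forall>\<^sub>F T in at_top. \<forall>\<sigma>\<in>{\<alpha>..2}. \<forall>y\<in>{()}.
        integrable (time_avg T) (\<lambda>t. (cmod (continuation L (Complex \<sigma> t) -
          dirichlet_poly a k \<sigma> (\<lambda>n. of_nat n powr (- (\<i> * complex_of_real t)))))\<^sup>2 * indicator good_times t) \<and>
        (\<integral>t. (cmod (continuation L (Complex \<sigma> t) -
          dirichlet_poly a k \<sigma> (\<lambda>n. of_nat n powr (- (\<i> * complex_of_real t)))))\<^sup>2 * indicator good_times t \<partial>time_avg T) \<le> e k" for k
  proof -
    have "\<forall>\<^sub>F T in at_top. \<forall>\<sigma>\<in>{\<alpha>..2}.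
       (\<Sum>n=n0..nat \<lfloor>T / l\<rfloor>. indicator G n * block_mean l (\<lambda>t. (cmod (remainder L a k (of_real \<sigma> + \<i> * of_real t)))\<^sup>2) n)
         \<le> B k * real (nat \<lfloor>T / l\<rfloor>)"
      using lim sums[of k] unfolding filterlim_iff by blast
    moreover have "\<forall>\<^sub>F T in at_top. (1::real) \<le> T" by (rule eventually_ge_at_top)
    ultimately show ?thesis
    proof eventually_elim
      case (elim T)
      have "integrable (time_avg T) (\<lambda>t. (cmod (remainder L a k (Complex \<sigma> t)))\<^sup>2 * indicator good_times t) \<and>
        (\<integral>t. (cmod (remainder L a k (Complex \<sigma> t)))\<^sup>2 * indicator good_times t \<partial>time_avg T) \<le> e k"
        if "\<sigma> \<in> {\<alpha>..2}" for \<sigma>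
        using remainder_square_integrable[OF that elim(2)]
          remainder_mean_square_time[OF that elim(2) bspec[OF elim(1) that] B(2)] eB(1)[of k] by auto
      then show ?case unfolding dirichlet_poly_eq_poly_part remainder_def by blast
    qed
  qed
  have trig: "trig_poly {\<alpha>..2} (dirichlet_poly a k)" for k
    by (rule trig_poly_dirichlet_poly) (use order in auto)
  have K: "integrable \<mu> (\<lambda>x. (cmod (dirichlet_ext \<mu> a (of_real \<sigma>) x - dirichlet_poly a k \<sigma> (\<lambda>n. x (ln (real n)))))\<^sup>2) \<and>
      (\<integral>x. (cmod (dirichlet_ext \<mu> a (of_real \<sigma>) x - dirichlet_poly a k \<sigma> (\<lambda>n. x (ln (real n)))))\<^sup>2 \<partial>\<mu>) \<le> e k"
    if "\<sigma> \<in> {\<alpha>..2}" for \<sigma> k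
    using dirichlet_ext_L2(2,3)[OF \<mu> a order(4), of \<sigma> k] that order eB(2)[of k] by auto
  have Km: "dirichlet_ext \<mu> a (of_real \<sigma>) \<in> borel_measurable \<mu>" if "\<sigma> \<in> {\<alpha>..2}" for \<sigma>
    using dirichlet_ext_L2(1)[OF \<mu> a order(4), of \<sigma>] that order by auto
  have mt: "(\<lambda>t. continuation L (Complex \<sigma> t) * indicator good_times t) \<in> borel_measurable (time_avg T)"
    if "\<sigma> \<in> {\<alpha>..2}" for \<sigma> T
    using time_measurable[of \<sigma>] that by (simp add: measurable_cong_sets[OF sets_time_avg refl])
  have mass': "((\<lambda>T. measure (time_avg T) (space (time_avg T) - good_times)) \<longlongrightarrow> 0) at_top"
    using mass by (simp add: Compl_eq_Diff_UNIV)
  have gs: "good_times \<in> sets (time_avg T)" for T by simp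
  note main = mean_value_of_quadratic_growth[OF atc trig p(1) C e gs mt mass' approx Km K]
  show "\<And>\<sigma>. \<sigma> \<in> {\<alpha>..2} \<Longrightarrow> integrable \<mu> (\<lambda>x. p (dirichlet_ext \<mu> a (of_real \<sigma>) x))"
    by (rule main(1))
  have conv: "(\<integral>t. p (continuation L (Complex \<sigma> t)) * indicator good_times t \<partial>time_avg T) =
      (1 / T) *\<^sub>R (LBINT t:{real N..T}. p (continuation L (Complex \<sigma> t)) * indicator (- A) t)"
    if "\<sigma> \<in> {\<alpha>..2}" "1 \<le> T" for \<sigma> T
  proof -
    have m: "(\<lambda>t. p (continuation L (Complex \<sigma> t)) * indicator good_times t) \<in> borel_measurable borel"
      by (rule composed_measurable[OF p(1)]) (use that in simp)
    have "(LBINT t:{0..T}. p (continuation L (Complex \<sigma> t)) * indicator good_times t) =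
       (LBINT t:{real N..T}. p (continuation L (Complex \<sigma> t)) * indicator (- A) t)"
      unfolding set_lebesgue_integral_def
      by (rule Bochner_Integration.integral_cong) (auto simp: good_times_def indicator_def)
    with integral_time_avg(2)[OF m that(2)] show ?thesis by simp
  qed
  have ev1: "\<forall>\<^sub>F T in at_top. (1::real) \<le> T" by (rule eventually_ge_at_top)
  have main2: "\<forall>\<^sub>F T in at_top. \<forall>\<sigma>\<in>{\<alpha>..2}.
      dist ((1 / T) *\<^sub>R (LBINT t:{real N..T}. p (continuation L (Complex \<sigma> t)) * indicator (- A) t))
        (LINT x|\<mu>. p (dirichlet_ext \<mu> a (of_real \<sigma>) x)) < e'" if "0 < e'" for e'
  proof -
    have "\<forall>\<^sub>F T in at_top. \<forall>q\<in>{\<alpha>..2} \<times> {()}. dist (case q of (\<sigma>, _) \<Rightarrow> \<integral>t. p (continuation L (Complex \<sigma> t)) * indicator good_times t \<partial>time_avg T)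
        (case q of (\<sigma>, _) \<Rightarrow> LINT x|\<mu>. p (dirichlet_ext \<mu> a (of_real \<sigma>) x)) < e'"
      by (rule uniform_limitD[OF main(2) that])
    with ev1 show ?thesis
    proof eventually_elim
      case (elim T)
      show ?case
      proof
        fix \<sigma> assume \<sigma>: "\<sigma> \<in> {\<alpha>..2}"
        show "dist ((1 / T) *\<^sub>R (LBINT t:{real N..T}. p (continuation L (Complex \<sigma> t)) * indicator (- A) t))
        (LINT x|\<mu>. p (dirichlet_ext \<mu> a (of_real \<sigma>) x)) < e'"
          using bspec[OF elim(2), of "(\<sigma>, ())"] \<sigma> unfolding conv[OF \<sigma> elim(1), symmetric] by simp
      qed
    qed
  qed
  show "uniform_limit {\<alpha>..2} (\<lambda>T \<sigma>. (1 / T) *\<^sub>R (LBINT t:{real N..T}. p (continuation L (Complex \<sigma> t)) * indicator (- A) t))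
      (\<lambda>\<sigma>. LINT x|\<mu>. p (dirichlet_ext \<mu> a (of_real \<sigma>) x)) at_top"
    by (rule uniform_limitI) (rule main2)
qed

lemma count_mean_value:
  fixes p :: "complex \<Rightarrow> complex" and \<tau> :: "(real \<Rightarrow> complex) measure"
  assumes atc: "averaging_to_characters sequentially count_avg
       (\<lambda>y n m. of_nat m powr (- (\<i> * complex_of_real (y + real n * l)))) {0..l} \<tau> (\<lambda>x n. x (ln (real n)))"
    and p: "continuous_on UNIV p" "p \<in> O[at_infinity](\<lambda>z. of_real ((cmod z)\<^sup>2))"
    and offG: "\<And>n. N \<le> n \<Longrightarrow> real n * l \<notin> A \<Longrightarrow> n \<in> G \<and> n0 \<le> n" and N: "1 \<le> N" "n0 \<le> N"
    and mass: "(\<lambda>Q. measure (count_avg Q) {n. n < N \<or> real n * l \<in> A}) \<longlonglongrightarrow> 0"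
    and sums: "\<And>k. \<forall>\<^sub>F Q in sequentially. \<forall>\<sigma>\<in>{\<alpha>..2}. \<forall>y\<in>{0..l}.
       (\<Sum>n=n0..Q. indicator G n * (cmod (remainder L a k (of_real \<sigma> + \<i> * of_real (y + real n * l))))\<^sup>2)
         \<le> B k * real Q"
    and B: "B \<longlonglongrightarrow> 0" "\<And>k. 0 \<le> B k"
  shows "\<And>\<sigma>. \<sigma> \<in> {\<alpha>..2} \<Longrightarrow> integrable \<tau> (\<lambda>x. p (dirichlet_ext \<tau> a (of_real \<sigma>) x))"
    and "uniform_limit ({\<alpha>..2} \<times> {0..l})
        (\<lambda>M (\<sigma>, h). (1 / real M) *\<^sub>R (\<Sum>n = N..M.
            p (continuation L (Complex \<sigma> (h + real n * l))) * indicator (- A) (real n * l)))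
        (\<lambda>(\<sigma>, h). LINT x|\<tau>. p (dirichlet_ext \<tau> a (of_real \<sigma>) x)) sequentially"
proof -
  define H where "H = {n. N \<le> n \<and> real n * l \<notin> A}"
  have \<tau>: "orthonormal_characters \<tau> (\<lambda>x n. x (ln (real n)))"
    using atc by (rule averaging_to_characters.axioms(2))
  obtain C where C: "0 < C" "\<And>z. cmod (p z) \<le> C * (1 + (cmod z)\<^sup>2)"
    using quadratic_growth_bound[OF p] by blast
  define e where "e k = B k + 2 * tail_norm a \<beta> k" for k
  have e: "e \<longlonglongrightarrow> 0"
    using tendsto_add[OF B(1) tendsto_mult_left[OF tail_norm_tendsto_0[OF a order(4)], of 2]]
    by (simp add: e_def[abs_def])
  have eB: "B k \<le> e k" "2 * tail_norm a \<beta> k \<le> e k" for k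
    using tail_norm_nonneg[OF a order(4), of k] B(2)[of k] by (auto simp: e_def)
  have approx: "\<forall>\<^sub>F Q in sequentially. \<forall>\<sigma>\<in>{\<alpha>..2}. \<forall>y\<in>{0..l}.
        integrable (count_avg Q) (\<lambda>n. (cmod (continuation L (Complex \<sigma> (y + real n * l)) -
          dirichlet_poly a k \<sigma> (\<lambda>m. of_nat m powr (- (\<i> * complex_of_real (y + real n * l))))))\<^sup>2 * indicator H n) \<and>
        (\<integral>n. (cmod (continuation L (Complex \<sigma> (y + real n * l)) -
          dirichlet_poly a k \<sigma> (\<lambda>m. of_nat m powr (- (\<i> * complex_of_real (y + real n * l))))))\<^sup>2 * indicator H n \<partial>count_avg Q) \<le> e k" for k
  proof -
    have "\<forall>\<^sub>F Q in sequentially. 1 \<le> Q" by (rule eventually_ge_at_top)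
    with sums[of k] show ?thesis
    proof eventually_elim
      case (elim Q)
      show ?case
      proof (intro ballI conjI)
        fix \<sigma> y assume \<sigma>: "\<sigma> \<in> {\<alpha>..2}" and y: "y \<in> {0..l}"
        define h where "h n = (cmod (remainder L a k (of_real \<sigma> + \<i> * of_real (y + real n * l))))\<^sup>2" for n
        have h: "(cmod (continuation L (Complex \<sigma> (y + real n * l)) -
          dirichlet_poly a k \<sigma> (\<lambda>m. of_nat m powr (- (\<i> * complex_of_real (y + real n * l))))))\<^sup>2 = h n" for n
          unfolding dirichlet_poly_eq_poly_part remainder_def Complex_eq h_def ..
        have h0: "0 \<le> h n" for n by (simp add: h_def)
        show "integrable (count_avg Q) (\<lambda>n. (cmod (continuation L (Complex \<sigma> (y + real n * l)) -
          dirichlet_poly a k \<sigma> (\<lambda>m. of_nat m powr (- (\<i> * complex_of_real (y + real n * l))))))\<^sup>2 * indicator H n)"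
          by (rule integral_count_avg(1)[OF elim(2)])
        have "(\<Sum>n=1..Q. h n * indicator H n) = (\<Sum>n\<in>{1..Q} \<inter> H. indicator G n * h n)"
          by (rule sum.mono_neutral_cong_right) (use offG in \<open>auto simp: H_def indicator_def\<close>)
        also have "\<dots> \<le> (\<Sum>n\<in>{n0..Q}. indicator G n * h n)"
          by (rule sum_mono2) (use N h0 in \<open>auto simp: H_def\<close>)
        also have "\<dots> \<le> B k * real Q"
          using elim(1) \<sigma> y unfolding h_def by blast
        finally have "(1 / real Q) * (\<Sum>n=1..Q. h n * indicator H n) \<le> (1 / real Q) * (B k * real Q)"
          by (rule mult_left_mono) simp
        then have "(\<integral>n. h n * indicator H n \<partial>count_avg Q) \<le> B k"
          using integral_count_avg(2)[OF elim(2), of "\<lambda>n. h n * indicator H n"] elim(2) by simp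
        then have "(\<integral>n. h n * indicator H n \<partial>count_avg Q) \<le> e k"
          using eB(1)[of k] by (rule order.trans)
        then show "(\<integral>n. (cmod (continuation L (Complex \<sigma> (y + real n * l)) -
          dirichlet_poly a k \<sigma> (\<lambda>m. of_nat m powr (- (\<i> * complex_of_real (y + real n * l))))))\<^sup>2 * indicator H n \<partial>count_avg Q) \<le> e k"
          unfolding h .
      qed
    qed
  qed
  have trig: "trig_poly {\<alpha>..2} (dirichlet_poly a k)" for k
    by (rule trig_poly_dirichlet_poly) (use order in auto)
  have K: "integrable \<tau> (\<lambda>x. (cmod (dirichlet_ext \<tau> a (of_real \<sigma>) x - dirichlet_poly a k \<sigma> (\<lambda>n. x (ln (real n)))))\<^sup>2) \<and>
      (\<integral>x. (cmod (dirichlet_ext \<tau> a (of_real \<sigma>) x - dirichlet_poly a k \<sigma> (\<lambda>n. x (ln (real n)))))\<^sup>2 \<partial>\<tau>) \<le> e k"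
    if "\<sigma> \<in> {\<alpha>..2}" for \<sigma> k
    using dirichlet_ext_L2(2,3)[OF \<tau> a order(4), of \<sigma> k] that order eB(2)[of k] by auto
  have Km: "dirichlet_ext \<tau> a (of_real \<sigma>) \<in> borel_measurable \<tau>" if "\<sigma> \<in> {\<alpha>..2}" for \<sigma>
    using dirichlet_ext_L2(1)[OF \<tau> a order(4), of \<sigma>] that order by auto
  have mt: "(\<lambda>n. continuation L (Complex \<sigma> (y + real n * l)) * indicator H n) \<in> borel_measurable (count_avg Q)"
    if "\<sigma> \<in> {\<alpha>..2}" "y \<in> {0..l}" for \<sigma> y Q
    by (simp add: measurable_def)
  have "space (count_avg Q) - H = {n. n < N \<or> real n * l \<in> A}" for Q by (auto simp: H_def)
  then have mass': "(\<lambda>Q. measure (count_avg Q) (space (count_avg Q) - H)) \<longlonglongrightarrow> 0"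
    using mass by simp
  have gs: "H \<in> sets (count_avg Q)" for Q by simp
  note main = mean_value_of_quadratic_growth[OF atc trig p(1) C e gs mt mass' approx Km K]
  show "\<And>\<sigma>. \<sigma> \<in> {\<alpha>..2} \<Longrightarrow> integrable \<tau> (\<lambda>x. p (dirichlet_ext \<tau> a (of_real \<sigma>) x))"
    by (rule main(1))
  have conv: "(\<integral>n. p (continuation L (Complex \<sigma> (y + real n * l))) * indicator H n \<partial>count_avg Q) =
      (1 / real Q) *\<^sub>R (\<Sum>n = N..Q. p (continuation L (Complex \<sigma> (y + real n * l))) * indicator (- A) (real n * l))"
    if "1 \<le> Q" for \<sigma> y Q
  proof -
    have "(\<Sum>n=1..Q. p (continuation L (Complex \<sigma> (y + real n * l))) * indicator H n) =
       (\<Sum>n = N..Q. p (continuation L (Complex \<sigma> (y + real n * l))) * indicator (- A) (real n * l))"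
      by (rule sum.mono_neutral_cong_right) (use N in \<open>auto simp: H_def indicator_def\<close>)
    with integral_count_avg(2)[OF that, of "\<lambda>n. p (continuation L (Complex \<sigma> (y + real n * l))) * indicator H n"]
    show ?thesis by simp
  qed
  have ev1: "\<forall>\<^sub>F Q in sequentially. 1 \<le> Q" by (rule eventually_ge_at_top)
  show "uniform_limit ({\<alpha>..2} \<times> {0..l})
        (\<lambda>M (\<sigma>, h). (1 / real M) *\<^sub>R (\<Sum>n = N..M.
            p (continuation L (Complex \<sigma> (h + real n * l))) * indicator (- A) (real n * l)))
        (\<lambda>(\<sigma>, h). LINT x|\<tau>. p (dirichlet_ext \<tau> a (of_real \<sigma>) x)) sequentially"
  proof (rule uniform_limitI)
    fix e' :: real assume e': "0 < e'"
    have "\<forall>\<^sub>F Q in sequentially. \<forall>q\<in>{\<alpha>..2} \<times> {0..l}.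
        dist (case q of (\<sigma>, y) \<Rightarrow> \<integral>n. p (continuation L (Complex \<sigma> (y + real n * l))) * indicator H n \<partial>count_avg Q)
         (case q of (\<sigma>, y) \<Rightarrow> LINT x|\<tau>. p (dirichlet_ext \<tau> a (of_real \<sigma>) x)) < e'"
      by (rule uniform_limitD[OF main(2) e'])
    from this ev1
    show "\<forall>\<^sub>F M in sequentially. \<forall>q\<in>{\<alpha>..2} \<times> {0..l}.
        dist (case q of (\<sigma>, h) \<Rightarrow> (1 / real M) *\<^sub>R (\<Sum>n = N..M.
            p (continuation L (Complex \<sigma> (h + real n * l))) * indicator (- A) (real n * l)))
         (case q of (\<sigma>, h) \<Rightarrow> LINT x|\<tau>. p (dirichlet_ext \<tau> a (of_real \<sigma>) x)) < e'"
    proof eventually_elim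
      case (elim Q)
      then show ?case by (simp only: conv[OF elim(2)])
    qed
  qed
qed

end

context good_blocks
begin

text \<open>After interchanging the integrals, uniformity in \<open>\<sigma>\<close> allows to integrate the limit. The limit
  function is measurable as a pointwise limit.\<close>

lemma integrated_mean_value:
  fixes p :: "complex \<Rightarrow> complex" and \<Phi> :: "real \<Rightarrow> complex"
  assumes p: "continuous_on UNIV p"
    and lim: "uniform_limit {\<alpha>..2} (\<lambda>T \<sigma>. (1 / T) *\<^sub>R (LBINT t:{real N..T}. p (continuation L (Complex \<sigma> t)) * indicator (- A) t))
      \<Phi> at_top"
  shows "\<forall>\<sigma>\<in>{\<alpha>..2}. \<forall>T. set_integrable lborel {real N..T} (\<lambda>t. p (continuation L (Complex \<sigma> t)) * indicator (- A) t)"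
    and "set_integrable lborel {\<alpha>..2} \<Phi>"
    and "((\<lambda>T. (1 / T) *\<^sub>R (LBINT t:{real N..T}. LBINT \<sigma>:{\<alpha>..2}. p (continuation L (Complex \<sigma> t)) * indicator (- A) t))
        \<longlongrightarrow> (LBINT \<sigma>:{\<alpha>..2}. \<Phi> \<sigma>)) at_top"
proof -
  define k where "k t \<sigma> = p (continuation L (Complex \<sigma> t)) * indicator (- A) t" for t \<sigma>
  define H where "H T t \<sigma> = indicator {real N..T} t *\<^sub>R (indicator {\<alpha>..2} \<sigma> *\<^sub>R k t \<sigma>)" for T t \<sigma>
  define \<phi> where "\<phi> T \<sigma> = (1 / T) *\<^sub>R (LBINT t:{real N..T}. k t \<sigma>)" for T \<sigma>
  have lim': "uniform_limit {\<alpha>..2} \<phi> \<Phi> at_top" using lim unfolding \<phi>_def[abs_def] k_def .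
  show "\<forall>\<sigma>\<in>{\<alpha>..2}. \<forall>T. set_integrable lborel {real N..T} (\<lambda>t. p (continuation L (Complex \<sigma> t)) * indicator (- A) t)"
  proof (intro ballI allI)
    fix \<sigma> T assume \<sigma>: "\<sigma> \<in> {\<alpha>..2}"
    obtain B where B: "\<And>t \<sigma>. real N \<le> t \<Longrightarrow> t \<le> T \<Longrightarrow> t \<notin> A \<Longrightarrow> \<alpha> \<le> \<sigma> \<Longrightarrow> \<sigma> \<le> 2 \<Longrightarrow>
        cmod (p (continuation L (Complex \<sigma> t))) \<le> B"
      using composed_bounded[OF p, of T] by blast
    have m: "(\<lambda>t. p (continuation L (Complex \<sigma> t)) * indicator good_times t) \<in> borel_measurable lborel"
      using composed_measurable[OF p, of \<sigma>] \<sigma> by simp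
    have "integrable lborel (\<lambda>t. indicator {real N..T} t *\<^sub>R (p (continuation L (Complex \<sigma> t)) * indicator good_times t))"
    proof (rule integrableI_bounded_set_indicator[OF _ m, where B = "\<bar>B\<bar>"])
      show "AE t in lborel. t \<in> {real N..T} \<longrightarrow> norm (p (continuation L (Complex \<sigma> t)) * indicator good_times t) \<le> \<bar>B\<bar>"
      proof (rule AE_I2, intro impI)
        fix t assume t: "t \<in> {real N..T}"
        show "norm (p (continuation L (Complex \<sigma> t)) * indicator good_times t) \<le> \<bar>B\<bar>"
        proof (cases "t \<in> good_times")
          case True
          then have "cmod (p (continuation L (Complex \<sigma> t))) \<le> B"
            using t \<sigma> by (intro B) (auto simp: good_times_def)
          then show ?thesis using True by simp
        qed simp
      qed
    qed (auto simp: emeasure_lborel_Icc_eq)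
    also have "(\<lambda>t. indicator {real N..T} t *\<^sub>R (p (continuation L (Complex \<sigma> t)) * indicator good_times t))
      = (\<lambda>t. indicator {real N..T} t *\<^sub>R (p (continuation L (Complex \<sigma> t)) * indicator (- A) t))"
      by (auto simp: fun_eq_iff indicator_def good_times_def)
    finally show "set_integrable lborel {real N..T} (\<lambda>t. p (continuation L (Complex \<sigma> t)) * indicator (- A) t)"
      unfolding set_integrable_def .
  qed
  have "integrable (lborel \<Otimes>\<^sub>M lborel) (case_prod (H T))" for T
  proof -
    have "case_prod (H T) = (\<lambda>x. indicator ({real N..T} \<times> {\<alpha>..2}) x *\<^sub>R
        (case x of (t, \<sigma>) \<Rightarrow> p (continuation L (Complex \<sigma> t)) * indicator (- A) t))"
      by (auto simp: fun_eq_iff H_def k_def indicator_def)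
    then show ?thesis using joint_integrable[OF p, of T] unfolding set_integrable_def by simp
  qed
  note Hint = this
  have inner: "(\<integral>t. H T t \<sigma> \<partial>lborel) = indicator {\<alpha>..2} \<sigma> *\<^sub>R (LBINT t:{real N..T}. k t \<sigma>)" for T \<sigma>
  proof -
    have "(\<integral>t. H T t \<sigma> \<partial>lborel) = (\<integral>t. indicator {\<alpha>..2} \<sigma> *\<^sub>R (indicator {real N..T} t *\<^sub>R k t \<sigma>) \<partial>lborel)"
      by (simp add: H_def mult.commute)
    also have "\<dots> = indicator {\<alpha>..2} \<sigma> *\<^sub>R (LBINT t:{real N..T}. k t \<sigma>)"
      unfolding set_lebesgue_integral_def by (rule integral_scaleR_right)
    finally show ?thesis .
  qed
  have \<phi>int: "integrable lborel (\<lambda>\<sigma>. indicator {\<alpha>..2} \<sigma> *\<^sub>R \<phi> T \<sigma>)" for T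
  proof -
    have "integrable lborel (\<lambda>\<sigma>. (1 / T) *\<^sub>R (\<integral>t. H T t \<sigma> \<partial>lborel))"
      by (intro integrable_scaleR_right lborel_pair.integrable_snd Hint)
    then show ?thesis unfolding inner \<phi>_def by (simp add: mult.commute)
  qed
  have eq: "(1 / T) *\<^sub>R (LBINT t:{real N..T}. LBINT \<sigma>:{\<alpha>..2}. k t \<sigma>) = (LBINT \<sigma>:{\<alpha>..2}. \<phi> T \<sigma>)" for T
  proof -
    have "(LBINT t:{real N..T}. LBINT \<sigma>:{\<alpha>..2}. k t \<sigma>) = (\<integral>t. (\<integral>\<sigma>. H T t \<sigma> \<partial>lborel) \<partial>lborel)"
      unfolding set_lebesgue_integral_def H_def integral_scaleR_right ..
    also have "\<dots> = (\<integral>\<sigma>. (\<integral>t. H T t \<sigma> \<partial>lborel) \<partial>lborel)"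
      by (rule lborel_pair.Fubini_integral[symmetric, OF Hint])
    finally have "(1 / T) *\<^sub>R (LBINT t:{real N..T}. LBINT \<sigma>:{\<alpha>..2}. k t \<sigma>) =
        (\<integral>\<sigma>. (1 / T) *\<^sub>R (indicator {\<alpha>..2} \<sigma> *\<^sub>R (LBINT t:{real N..T}. k t \<sigma>)) \<partial>lborel)"
      by (simp only: inner integral_scaleR_right)
    also have "\<dots> = (\<integral>\<sigma>. indicator {\<alpha>..2} \<sigma> *\<^sub>R \<phi> T \<sigma> \<partial>lborel)"
      unfolding \<phi>_def scaleR_scaleR mult.commute[of "1 / T"] ..
    also have "\<dots> = (LBINT \<sigma>:{\<alpha>..2}. \<phi> T \<sigma>)"
      unfolding set_lebesgue_integral_def ..
    finally show ?thesis .
  qed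
  have \<Phi>m: "(\<lambda>\<sigma>. indicator {\<alpha>..2} \<sigma> *\<^sub>R \<Phi> \<sigma>) \<in> borel_measurable lborel"
  proof (rule borel_measurable_LIMSEQ_metric)
    show "(\<lambda>\<sigma>. indicator {\<alpha>..2} \<sigma> *\<^sub>R \<phi> (real n) \<sigma>) \<in> borel_measurable lborel" for n
      by (rule borel_measurable_integrable[OF \<phi>int])
    fix \<sigma> :: real
    show "(\<lambda>n. indicator {\<alpha>..2} \<sigma> *\<^sub>R \<phi> (real n) \<sigma>) \<longlonglongrightarrow> indicator {\<alpha>..2} \<sigma> *\<^sub>R \<Phi> \<sigma>"
    proof (cases "\<sigma> \<in> {\<alpha>..2}")
      case True
      have "((\<lambda>T. \<phi> T \<sigma>) \<longlongrightarrow> \<Phi> \<sigma>) at_top" by (rule tendsto_uniform_limitI[OF lim' True])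
      then have "(\<lambda>n. \<phi> (real n) \<sigma>) \<longlonglongrightarrow> \<Phi> \<sigma>"
        by (rule filterlim_compose[OF _ filterlim_real_sequentially])
      then show ?thesis using True by simp
    qed simp
  qed
  have \<Phi>int: "integrable lborel (\<lambda>\<sigma>. indicator {\<alpha>..2} \<sigma> *\<^sub>R \<Phi> \<sigma>)"
  proof -
    have "\<forall>\<^sub>F T in at_top. \<forall>\<sigma>\<in>{\<alpha>..2}. dist (\<phi> T \<sigma>) (\<Phi> \<sigma>) < 1" by (rule uniform_limitD[OF lim']) simp
    then obtain T where T: "\<forall>\<sigma>\<in>{\<alpha>..2}. dist (\<phi> T \<sigma>) (\<Phi> \<sigma>) < 1" by (auto simp: eventually_at_top_linorder)
    show ?thesis
    proof (rule Bochner_Integration.integrable_bound[OF _ \<Phi>m])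
      show "integrable lborel (\<lambda>\<sigma>. norm (indicator {\<alpha>..2} \<sigma> *\<^sub>R \<phi> T \<sigma>) + indicator {\<alpha>..2} \<sigma>)"
        by (intro Bochner_Integration.integrable_add integrable_norm \<phi>int integrable_real_indicator) (auto simp: emeasure_lborel_Icc_eq)
      show "AE \<sigma> in lborel. norm (indicator {\<alpha>..2} \<sigma> *\<^sub>R \<Phi> \<sigma>) \<le>
          norm (norm (indicator {\<alpha>..2} \<sigma> *\<^sub>R \<phi> T \<sigma>) + indicator {\<alpha>..2} \<sigma>)"
      proof (rule AE_I2)
        fix \<sigma>
        show "norm (indicator {\<alpha>..2} \<sigma> *\<^sub>R \<Phi> \<sigma>) \<le> norm (norm (indicator {\<alpha>..2} \<sigma> *\<^sub>R \<phi> T \<sigma>) + indicator {\<alpha>..2} \<sigma>)"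
        proof (cases "\<sigma> \<in> {\<alpha>..2}")
          case True
          then have "dist (\<phi> T \<sigma>) (\<Phi> \<sigma>) < 1" using T by blast
          then show ?thesis using True norm_triangle_ineq2[of "\<Phi> \<sigma>" "\<phi> T \<sigma>"]
            by (simp add: dist_norm norm_minus_commute)
        qed simp
      qed
    qed
  qed
  then show "set_integrable lborel {\<alpha>..2} \<Phi>" by (simp add: set_integrable_def)
  have "((\<lambda>T. LBINT \<sigma>:{\<alpha>..2}. \<phi> T \<sigma>) \<longlongrightarrow> (LBINT \<sigma>:{\<alpha>..2}. \<Phi> \<sigma>)) at_top"
  proof (rule tendstoI)
    fix e :: real assume e: "0 < e"
    have "\<forall>\<^sub>F T in at_top. \<forall>\<sigma>\<in>{\<alpha>..2}. dist (\<phi> T \<sigma>) (\<Phi> \<sigma>) < e / (2 * (2 - \<alpha>))"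
      by (rule uniform_limitD[OF lim']) (use e order in auto)
    then show "\<forall>\<^sub>F T in at_top. dist (LBINT \<sigma>:{\<alpha>..2}. \<phi> T \<sigma>) (LBINT \<sigma>:{\<alpha>..2}. \<Phi> \<sigma>) < e"
    proof eventually_elim
      case (elim T)
      have "dist (LBINT \<sigma>:{\<alpha>..2}. \<phi> T \<sigma>) (LBINT \<sigma>:{\<alpha>..2}. \<Phi> \<sigma>) =
         norm (\<integral>\<sigma>. indicator {\<alpha>..2} \<sigma> *\<^sub>R \<phi> T \<sigma> - indicator {\<alpha>..2} \<sigma> *\<^sub>R \<Phi> \<sigma> \<partial>lborel)"
        using \<phi>int \<Phi>int by (simp add: dist_norm set_lebesgue_integral_def)
      also have "\<dots> \<le> (\<integral>\<sigma>. indicator {\<alpha>..2} \<sigma> * (e / (2 * (2 - \<alpha>))) \<partial>lborel)"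
      proof (rule order.trans[OF integral_norm_bound], rule integral_mono)
        show "integrable lborel (\<lambda>\<sigma>. norm (indicator {\<alpha>..2} \<sigma> *\<^sub>R \<phi> T \<sigma> - indicator {\<alpha>..2} \<sigma> *\<^sub>R \<Phi> \<sigma>))"
          by (intro integrable_norm Bochner_Integration.integrable_diff \<phi>int \<Phi>int)
        show "integrable lborel (\<lambda>\<sigma>. indicator {\<alpha>..2} \<sigma> * (e / (2 * (2 - \<alpha>))))"
          by (intro integrable_mult_left integrable_real_indicator) (auto simp: emeasure_lborel_Icc_eq)
        fix \<sigma> :: real
        show "norm (indicator {\<alpha>..2} \<sigma> *\<^sub>R \<phi> T \<sigma> - indicator {\<alpha>..2} \<sigma> *\<^sub>R \<Phi> \<sigma>) \<le> indicator {\<alpha>..2} \<sigma> * (e / (2 * (2 - \<alpha>)))"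
          using elim by (cases "\<sigma> \<in> {\<alpha>..2}") (auto simp: dist_norm intro: less_imp_le)
      qed
      also have "\<dots> = e / 2" using order by (simp add: field_simps)
      also have "\<dots> < e" using e by simp
      finally show ?case .
    qed
  qed
  then show "((\<lambda>T. (1 / T) *\<^sub>R (LBINT t:{real N..T}. LBINT \<sigma>:{\<alpha>..2}. p (continuation L (Complex \<sigma> t)) * indicator (- A) t))
        \<longlongrightarrow> (LBINT \<sigma>:{\<alpha>..2}. \<Phi> \<sigma>)) at_top"
    unfolding eq[symmetric] k_def .
qed

end

definition l_blocks :: "real \<Rightarrow> nat set \<Rightarrow> real set" where
  "l_blocks l J = (\<Union>n\<in>J. {real n * l..<(real n + 1) * l})"

lemma l_blocks_unique:
  assumes "0 < l" "real n * l \<le> t" "t < (real n + 1) * l"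
  shows "t \<in> l_blocks l J \<longleftrightarrow> n \<in> J"
proof -
  have "m = n" if "real m * l \<le> t" "t < (real m + 1) * l" for m
  proof -
    have "real m * l < (real n + 1) * l" "real n * l < (real m + 1) * l" using that assms by linarith+
    then have "real m < real n + 1" "real n < real m + 1" using assms(1) by (simp_all add: mult_less_cancel_right)
    then show ?thesis by linarith
  qed
  then have *: "n \<in> J" if "m \<in> J" "real m * l \<le> t" "t < (real m + 1) * l" for m
    using that by metis
  show ?thesis
  proof
    assume "t \<in> l_blocks l J"
    then obtain m where "m \<in> J" "real m * l \<le> t" "t < (real m + 1) * l" by (auto simp: l_blocks_def)
    then show "n \<in> J" by (rule *)
  next
    assume "n \<in> J"
    then show "t \<in> l_blocks l J" using assms(2,3) unfolding l_blocks_def by (intro UN_I[of n]) auto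
  qed
qed

lemma l_blocks_borel [measurable]: "l_blocks l J \<in> sets borel"
  unfolding l_blocks_def by (rule sets.countable_UN'') auto

lemma block_index_exists:
  assumes "0 < l" "0 \<le> t"
  obtains n :: nat where "real n * l \<le> t" "t < (real n + 1) * l"
proof -
  define n where "n = nat \<lfloor>t / l\<rfloor>"
  have "0 \<le> t / l" using assms by simp
  then have "real n \<le> t / l" "t / l < real n + 1" unfolding n_def by linarith+
  then show ?thesis using assms that[of n] by (simp add: field_simps)
qed

text \<open>The half-line \<open>{..<c}\<close> accounts for the times before the starting point.\<close>

lemma l_blocks_measure_tendsto_0:
  assumes l: "0 < l" and J: "J \<subseteq> {1..}" "has_dens J 0"
  shows "((\<lambda>T. measure (time_avg T) (l_blocks l J \<union> {..<c})) \<longlongrightarrow> 0) at_top"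
proof -
  have lim: "filterlim (\<lambda>T. nat \<lfloor>T / l\<rfloor>) sequentially at_top"
    using l by real_asymp
  have bound: "measure (time_avg T) (l_blocks l J \<union> {..<c}) \<le>
      real (card (J \<inter> {1..nat \<lfloor>T / l\<rfloor>})) / real (nat \<lfloor>T / l\<rfloor>) + \<bar>c\<bar> / T" if T: "1 \<le> T" "l \<le> T" for T
  proof -
    define Q where "Q = nat \<lfloor>T / l\<rfloor>"
    have "1 \<le> T / l" using T l by simp
    then have Q1: "1 \<le> Q" "real Q \<le> T / l" unfolding Q_def by linarith+
    have Ql: "real Q * l \<le> T" using Q1 l by (simp add: field_simps)
    have sub: "{0..T} \<inter> (l_blocks l J \<union> {..<c}) \<subseteq> (\<Union>n\<in>J \<inter> {1..Q}. {real n * l..<(real n + 1) * l}) \<union> {0..\<bar>c\<bar>}"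
    proof
      fix t assume t: "t \<in> {0..T} \<inter> (l_blocks l J \<union> {..<c})"
      show "t \<in> (\<Union>n\<in>J \<inter> {1..Q}. {real n * l..<(real n + 1) * l}) \<union> {0..\<bar>c\<bar>}"
      proof (cases "t \<in> l_blocks l J")
        case True
        then obtain n where n: "n \<in> J" "real n * l \<le> t" "t < (real n + 1) * l" by (auto simp: l_blocks_def)
        have "real n * l \<le> T" using n t by auto
        then have "real n \<le> T / l" using l by (simp add: field_simps)
        then have "n \<le> Q" unfolding Q_def by (simp add: le_nat_floor)
        then show ?thesis using n J by auto
      qed (use t in auto)
    qed
    have e1: "emeasure lborel ({0..T} \<inter> (l_blocks l J \<union> {..<c})) \<le>
       (\<Sum>n\<in>J \<inter> {1..Q}. emeasure lborel {real n * l..<(real n + 1) * l}) + emeasure lborel {0..\<bar>c\<bar>}"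
    proof -
      have "emeasure lborel ({0..T} \<inter> (l_blocks l J \<union> {..<c})) \<le>
        emeasure lborel ((\<Union>n\<in>J \<inter> {1..Q}. {real n * l..<(real n + 1) * l}) \<union> {0..\<bar>c\<bar>})"
        by (rule emeasure_mono[OF sub]) auto
      also have "\<dots> \<le> emeasure lborel (\<Union>n\<in>J \<inter> {1..Q}. {real n * l..<(real n + 1) * l}) + emeasure lborel {0..\<bar>c\<bar>}"
        by (rule emeasure_subadditive) auto
      also have "emeasure lborel (\<Union>n\<in>J \<inter> {1..Q}. {real n * l..<(real n + 1) * l}) \<le>
          (\<Sum>n\<in>J \<inter> {1..Q}. emeasure lborel {real n * l..<(real n + 1) * l})"
        by (rule emeasure_subadditive_finite) auto
      finally show ?thesis by (simp add: add_right_mono)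
    qed
    also have "\<dots> = (\<Sum>n\<in>J \<inter> {1..Q}. ennreal l) + ennreal \<bar>c\<bar>"
      using l by (simp add: algebra_simps)
    also have "\<dots> = ennreal (real (card (J \<inter> {1..Q})) * l + \<bar>c\<bar>)"
      using l by (simp add: ennreal_of_nat_eq_real_of_nat ennreal_mult'[symmetric] ennreal_plus[symmetric] del: ennreal_plus)
    finally have "measure lborel ({0..T} \<inter> (l_blocks l J \<union> {..<c})) \<le> real (card (J \<inter> {1..Q})) * l + \<bar>c\<bar>"
      unfolding measure_def using l by (intro enn2real_leI) auto
    then have "measure (time_avg T) (l_blocks l J \<union> {..<c}) \<le> (real (card (J \<inter> {1..Q})) * l + \<bar>c\<bar>) / T"
      using T by (subst measure_time_avg) (auto intro: divide_right_mono)
    also have "\<dots> = real (card (J \<inter> {1..Q})) * l / T + \<bar>c\<bar> / T" by (simp add: add_divide_distrib)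
    also have "real (card (J \<inter> {1..Q})) * l / T \<le> real (card (J \<inter> {1..Q})) * l / (real Q * l)"
      using Ql Q1 l T by (intro divide_left_mono) auto
    also have "\<dots> = real (card (J \<inter> {1..Q})) / real Q" using l by simp
    finally show ?thesis unfolding Q_def by simp
  qed
  have "((\<lambda>T. real (card (J \<inter> {1..nat \<lfloor>T / l\<rfloor>})) / real (nat \<lfloor>T / l\<rfloor>) + \<bar>c\<bar> / T) \<longlongrightarrow> 0 + 0) at_top"
  proof (rule tendsto_add)
    show "((\<lambda>T. real (card (J \<inter> {1..nat \<lfloor>T / l\<rfloor>})) / real (nat \<lfloor>T / l\<rfloor>)) \<longlongrightarrow> 0) at_top"
      using J(2) lim unfolding has_dens_def by (rule filterlim_compose)
    show "((\<lambda>T. \<bar>c\<bar> / T) \<longlongrightarrow> 0) at_top" by real_asymp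
  qed
  then have lim0: "((\<lambda>T. real (card (J \<inter> {1..nat \<lfloor>T / l\<rfloor>})) / real (nat \<lfloor>T / l\<rfloor>) + \<bar>c\<bar> / T) \<longlongrightarrow> 0) at_top" by simp
  show ?thesis
  proof (rule tendsto_sandwich[OF _ _ tendsto_const lim0])
    have "\<forall>\<^sub>F T in at_top. max 1 l \<le> T" by (rule eventually_ge_at_top)
    then show "\<forall>\<^sub>F T in at_top. measure (time_avg T) (l_blocks l J \<union> {..<c}) \<le>
        real (card (J \<inter> {1..nat \<lfloor>T / l\<rfloor>})) / real (nat \<lfloor>T / l\<rfloor>) + \<bar>c\<bar> / T"
      by eventually_elim (rule bound, simp_all)
  qed simp
qed

lemma count_measure_tendsto_0:
  assumes J: "has_dens J 0" and B: "B \<subseteq> {..<c} \<union> J"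
  shows "(\<lambda>Q. measure (count_avg Q) B) \<longlonglongrightarrow> 0"
proof (rule tendsto_sandwich[OF _ _ tendsto_const])
  have "(\<lambda>Q. real (card (J \<inter> {1..Q})) / real Q + real c / real Q) \<longlonglongrightarrow> 0 + 0"
  proof (rule tendsto_add)
    show "(\<lambda>Q. real (card (J \<inter> {1..Q})) / real Q) \<longlonglongrightarrow> 0" using J unfolding has_dens_def .
    show "(\<lambda>Q. real c / real Q) \<longlonglongrightarrow> 0" by real_asymp
  qed
  then show "(\<lambda>Q. real (card (J \<inter> {1..Q})) / real Q + real c / real Q) \<longlonglongrightarrow> 0" by simp
  have "\<forall>\<^sub>F Q in sequentially. 1 \<le> Q" by (rule eventually_ge_at_top)
  then show "\<forall>\<^sub>F Q in sequentially. measure (count_avg Q) B \<le> real (card (J \<inter> {1..Q})) / real Q + real c / real Q"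
  proof eventually_elim
    case (elim Q)
    have "card ({1..Q} \<inter> B) \<le> card ({..<c} \<union> (J \<inter> {1..Q}))"
      using B by (intro card_mono) auto
    also have "\<dots> \<le> c + card (J \<inter> {1..Q})"
      using card_Un_le[of "{..<c}" "J \<inter> {1..Q}"] by simp
    finally have "real (card ({1..Q} \<inter> B)) \<le> real (card (J \<inter> {1..Q})) + real c" by linarith
    then show ?case unfolding measure_count_avg[OF elim] add_divide_distrib[symmetric]
      by (rule divide_right_mono) simp
  qed
qed simp

section \<open>Mean values for sequences in the class N(u)\<close>

theorem theorem9p1:
  fixes u \<alpha> l :: real
    and L :: "nat \<Rightarrow> complex \<Rightarrow> complex"
    and a :: "nat \<Rightarrow> nat \<Rightarrow> complex"
    and p :: "nat \<Rightarrow> complex \<Rightarrow> complex"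
    and \<mu> \<tau> :: "(real \<Rightarrow> complex) measure"
  assumes "1 / 2 \<le> u" and "u < 1"
    and "\<And>j. L j \<in> class_N u"
    and "\<And>j. dirichlet_rep (a j) (L j)"
    and "\<And>j. continuous_on UNIV (p j)"
    and "\<And>j. p j \<in> O[at_infinity](\<lambda>z. of_real ((cmod z)\<^sup>2))"
    and "u < \<alpha>" and "\<alpha> \<le> 1" and "0 < l"
    and "haar_prob (freq_group l) (K_group l) \<mu>"
    and "l \<notin> Gamma_P \<Longrightarrow> haar_prob (freq_group l) (K_sub l) \<tau>"
  shows "\<exists>(A :: real set) (N :: nat \<Rightarrow> nat).
    l_set_dens_zero l A \<and> (\<forall>j. N j \<ge> 1) \<and>
    (\<forall>j t \<sigma>. real (N j) \<le> t \<and> t \<notin> A \<and> \<sigma> \<in> {\<alpha>..2} \<longrightarrow> continuable (L j) (Complex \<sigma> t)) \<and>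
    \<comment> \<open>(i)\<close>
    (\<forall>j.
      (\<forall>T. set_integrable (lborel \<Otimes>\<^sub>M lborel) ({real (N j)..T} \<times> {\<alpha>..2})
         (\<lambda>(t, \<sigma>). p j (continuation (L j) (Complex \<sigma> t)) * indicator (- A) t)) \<and>
      set_integrable lborel {\<alpha>..2}
        (\<lambda>\<sigma>. LINT x|\<mu>. p j (dirichlet_ext \<mu> (a j) (of_real \<sigma>) x)) \<and>
      ((\<lambda>T. (1 / T) *\<^sub>R (LBINT t:{real (N j)..T}. LBINT \<sigma>:{\<alpha>..2}.
            p j (continuation (L j) (Complex \<sigma> t)) * indicator (- A) t))
        \<longlongrightarrow> (LBINT \<sigma>:{\<alpha>..2}. LINT x|\<mu>. p j (dirichlet_ext \<mu> (a j) (of_real \<sigma>) x))) at_top) \<and>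
    \<comment> \<open>(ii)\<close>
    (\<forall>j.
      (\<forall>\<sigma>\<in>{\<alpha>..2}. \<forall>T. set_integrable lborel {real (N j)..T}
         (\<lambda>t. p j (continuation (L j) (Complex \<sigma> t)) * indicator (- A) t)) \<and>
      (\<forall>\<sigma>\<in>{\<alpha>..2}. integrable \<mu> (\<lambda>x. p j (dirichlet_ext \<mu> (a j) (of_real \<sigma>) x))) \<and>
      uniform_limit {\<alpha>..2}
        (\<lambda>T \<sigma>. (1 / T) *\<^sub>R (LBINT t:{real (N j)..T}.
            p j (continuation (L j) (Complex \<sigma> t)) * indicator (- A) t))
        (\<lambda>\<sigma>. LINT x|\<mu>. p j (dirichlet_ext \<mu> (a j) (of_real \<sigma>) x)) at_top) \<and>
    \<comment> \<open>(iii)\<close>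
    (l \<notin> Gamma_P \<longrightarrow> (\<forall>j.
      (\<forall>n\<ge>N j. real n * l \<notin> A \<longrightarrow> (\<forall>\<sigma>\<in>{\<alpha>..2}. \<forall>h\<in>{0..l}.
         continuable (L j) (Complex \<sigma> (h + real n * l)))) \<and>
      (\<forall>\<sigma>\<in>{\<alpha>..2}. integrable \<tau> (\<lambda>x. p j (dirichlet_ext \<tau> (a j) (of_real \<sigma>) x))) \<and>
      uniform_limit ({\<alpha>..2} \<times> {0..l})
        (\<lambda>M (\<sigma>, h). (1 / real M) *\<^sub>R (\<Sum>n = N j..M.
            p j (continuation (L j) (Complex \<sigma> (h + real n * l))) * indicator (- A) (real n * l)))
        (\<lambda>(\<sigma>, h). LINT x|\<tau>. p j (dirichlet_ext \<tau> (a j) (of_real \<sigma>) x)) sequentially))"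
proof -
  note l = \<open>0 < l\<close> and rep = assms(4) and pc = assms(5,6)
  \<comment> \<open>Normality is used on the half-plane beyond \<open>\<alpha>'\<close>, boundedness beyond \<open>\<beta>\<close>; as \<open>\<beta> > u \<ge> 1/2\<close>,
      the coefficients are square-summable against \<open>n\<^bsup>-2\<beta>\<^esup>\<close>.\<close>
  define \<alpha>' where "\<alpha>' = (u + \<alpha>) / 2"
  define \<beta> where "\<beta> = (\<alpha>' + \<alpha>) / 2"
  have "u < \<alpha>'" "\<alpha>' < \<alpha>" using assms(7) by (simp_all add: \<alpha>'_def)
  then have order: "u < \<alpha>'" "\<alpha>' < \<beta>" "\<beta> < \<alpha>" "\<alpha> \<le> 1" "1 / 2 < \<beta>"
    using assms(1,8) by (simp_all add: \<beta>_def)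
  have time: "averaging_to_characters at_top time_avg
       (\<lambda>(_::unit) t n. of_nat n powr (- (\<i> * complex_of_real t))) {()} \<mu> (\<lambda>x n. x (ln (real n)))"
    by (intro averaging_to_characters.intro averaging_scheme_time orthonormal_characters_K[OF assms(10)])
  have count: "averaging_to_characters sequentially count_avg
       (\<lambda>y n m. of_nat m powr (- (\<i> * complex_of_real (y + real n * l)))) {0..l} \<tau> (\<lambda>x n. x (ln (real n)))"
    if "l \<notin> Gamma_P"
    by (intro averaging_to_characters.intro averaging_scheme_count[OF l that]
        orthonormal_characters_K_sub[OF assms(11)[OF that] l that])
  obtain G T where G: "has_dens ({1..} - G) 0" "\<And>j. 1 \<le> T j"
    "\<And>j n. n \<in> G \<Longrightarrow> T j \<le> n \<Longrightarrow> \<exists>M. regular_block (L j) \<alpha>' \<beta> l M n"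
    "\<And>j k. \<forall>\<^sub>F N in sequentially. \<forall>\<sigma>\<in>{\<alpha>..2}.
       (\<Sum>n=T j..N. indicator G n * block_mean l (\<lambda>t. (cmod (remainder (L j) (a j) k (of_real \<sigma> + \<i> * of_real t)))\<^sup>2) n)
         \<le> 4 * mean_bound (a j) \<beta> k * real N"
    "\<And>j k. l \<notin> Gamma_P \<Longrightarrow> \<forall>\<^sub>F N in sequentially. \<forall>\<sigma>\<in>{\<alpha>..2}. \<forall>y\<in>{0..l}.
       (\<Sum>n=T j..N. indicator G n * (cmod (remainder (L j) (a j) k (of_real \<sigma> + \<i> * of_real (y + real n * l))))\<^sup>2)
         \<le> 4 * mean_bound (a j) \<beta> k * real N"
    by (rule good_blocks_exist[where L = L and a = a and P = "l \<notin> Gamma_P", OF assms(3) rep order l time count])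
       (assumption, rule that)
  \<comment> \<open>The second condition keeps \<open>A\<close> inside \<open>[1, \<infinity>)\<close>.\<close>
  define Jb where "Jb = {n::nat. 1 \<le> n \<and> 1 \<le> real n * l \<and> n \<notin> G}"
  define A where "A = l_blocks l Jb"
  \<comment> \<open>Covers both meanings of the starting point: a lower bound for the time \<open>t\<close>, whose block index must be
      at least \<open>T j\<close> and at least \<open>1/l\<close>, and a lower bound for the index \<open>n\<close> itself.\<close>
  define N where "N j = T j + nat \<lceil>real (T j) * l\<rceil> + nat \<lceil>1 + l\<rceil> + nat \<lceil>1 / l\<rceil> + 1" for j
  have N: "1 \<le> N j" "T j \<le> N j" "real (T j) * l \<le> real (N j)" "1 + l \<le> real (N j)" "1 / l \<le> real (N j)" for j
  proof -
    have "real (N j) = real (T j) + real (nat \<lceil>real (T j) * l\<rceil>) + real (nat \<lceil>1 + l\<rceil>) + real (nat \<lceil>1 / l\<rceil>) + 1"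
      by (simp only: N_def of_nat_add of_nat_1)
    then show "1 \<le> N j" "T j \<le> N j" "real (T j) * l \<le> real (N j)" "1 + l \<le> real (N j)" "1 / l \<le> real (N j)"
      using real_nat_ceiling_ge[of "real (T j) * l"] real_nat_ceiling_ge[of "1 + l"] real_nat_ceiling_ge[of "1 / l"]
      by linarith+
  qed
  have Jb1: "Jb \<subseteq> {1..}" by (auto simp: Jb_def)
  have Jb_dens: "has_dens Jb 0"
    unfolding has_dens_def
  proof (rule tendsto_sandwich[OF _ _ tendsto_const G(1)[unfolded has_dens_def]])
    show "\<forall>\<^sub>F N in sequentially. real (card (Jb \<inter> {1..N})) / real N \<le> real (card (({1..} - G) \<inter> {1..N})) / real N"
      by (intro always_eventually allI divide_right_mono of_nat_mono card_mono) (auto simp: Jb_def)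
  qed simp
  have A_dens: "l_set_dens_zero l A"
    unfolding l_set_dens_zero_def
  proof (intro conjI exI[of _ Jb])
    show "A \<subseteq> {1..}" by (auto simp: A_def l_blocks_def Jb_def)
  qed (use Jb1 Jb_dens in \<open>auto simp: A_def l_blocks_def\<close>)
  have A_mult: "real n * l \<in> A \<longleftrightarrow> n \<in> Jb" for n
    unfolding A_def using l by (intro l_blocks_unique) (auto simp: algebra_simps)
  have blocks: "good_blocks (L j) (a j) \<alpha>' \<beta> \<alpha> l G (T j) A (N j)" for j
  proof
    show "\<exists>M. regular_block (L j) \<alpha>' \<beta> l M n" if "n \<in> G" "T j \<le> n" for n
      by (rule G(3)[OF that])
    show "A \<in> sets borel" unfolding A_def by (rule l_blocks_borel)
    fix t assume t: "real (N j) \<le> t" "t \<notin> A"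
    have "0 \<le> t" using t(1) by linarith
    then obtain n where n: "real n * l \<le> t" "t < (real n + 1) * l"
      by (rule block_index_exists[OF l])
    have "1 + l \<le> t" "real (T j) * l \<le> t" using N[of j] t(1) by linarith+
    then have "1 + l < (real n + 1) * l" "real (T j) * l < (real n + 1) * l" using n(2) by linarith+
    then have 1: "1 \<le> real n * l" and "real (T j) < real n + 1"
      by (simp_all only: mult_less_cancel_right_pos[OF l]) (simp add: algebra_simps)
    then have 2: "T j \<le> n" by linarith
    have "n \<in> G"
    proof (rule ccontr)
      assume "n \<notin> G"
      then have "n \<in> Jb" using 1 2 G(2)[of j] by (simp add: Jb_def)
      then show False using t(2) l_blocks_unique[OF l n] unfolding A_def by blast
    qed
    then show "\<exists>n\<in>G. T j \<le> n \<and> real n * l \<le> t \<and> t < (real n + 1) * l" using 2 n by blast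
  qed (use order l rep in auto)
  have offG: "n \<in> G \<and> T j \<le> n" if "N j \<le> n" "real n * l \<notin> A" for n j
  proof -
    have "1 / l \<le> real n" using N(5)[of j] that(1) by linarith
    then have "1 \<le> real n * l" using l by (simp add: field_simps)
    then show ?thesis using that N(1,2)[of j] unfolding A_mult Jb_def by auto
  qed
  have mb: "(\<lambda>k. 4 * mean_bound (a j) \<beta> k) \<longlonglongrightarrow> 0" "0 \<le> 4 * mean_bound (a j) \<beta> k" for j k
    using tendsto_mult_left[OF mean_bound_tendsto_0[OF rep order(5), of j], of 4]
      mean_bound_pos[OF rep order(5), of j k] by simp_all
  have mass: "((\<lambda>T. measure (time_avg T) (- good_blocks.good_times A (N j))) \<longlongrightarrow> 0) at_top" for j
  proof -
    have "- good_blocks.good_times A (N j) = l_blocks l Jb \<union> {..<real (N j)}"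
      unfolding good_blocks.good_times_def[OF blocks[of j]] by (auto simp: A_def)
    then show ?thesis using l_blocks_measure_tendsto_0[OF l Jb1 Jb_dens] by simp
  qed
  note tm = good_blocks.time_mean_value[OF blocks time pc mass G(4) mb]
  note im = good_blocks.integrated_mean_value[OF blocks pc(1) tm(2)]
  have continuable_off_A: "continuable (L j) (Complex \<sigma> t)"
    if "real (N j) \<le> t" "t \<notin> A" "\<sigma> \<in> {\<alpha>..2}" for j t \<sigma>
    using good_blocks.cut_eq(2)[OF blocks that(1,2)] that(3) by simp
  have iii: "(\<forall>n\<ge>N j. real n * l \<notin> A \<longrightarrow> (\<forall>\<sigma>\<in>{\<alpha>..2}. \<forall>h\<in>{0..l}.
         continuable (L j) (Complex \<sigma> (h + real n * l)))) \<and>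
      (\<forall>\<sigma>\<in>{\<alpha>..2}. integrable \<tau> (\<lambda>x. p j (dirichlet_ext \<tau> (a j) (of_real \<sigma>) x))) \<and>
      uniform_limit ({\<alpha>..2} \<times> {0..l})
        (\<lambda>M (\<sigma>, h). (1 / real M) *\<^sub>R (\<Sum>n = N j..M.
            p j (continuation (L j) (Complex \<sigma> (h + real n * l))) * indicator (- A) (real n * l)))
        (\<lambda>(\<sigma>, h). LINT x|\<tau>. p j (dirichlet_ext \<tau> (a j) (of_real \<sigma>) x)) sequentially"
    if lP: "l \<notin> Gamma_P" for j
  proof -
    have mass_count: "(\<lambda>Q. measure (count_avg Q) {n. n < N j \<or> real n * l \<in> A}) \<longlonglongrightarrow> 0"
      by (rule count_measure_tendsto_0[OF Jb_dens, of _ "N j"]) (auto simp: A_mult)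
    note cm = good_blocks.count_mean_value[OF blocks count[OF lP] pc offG N(1,2) mass_count G(5)[OF lP] mb]
    have "continuable (L j) (Complex \<sigma> (h + real n * l))"
      if n: "N j \<le> n" "real n * l \<notin> A" and \<sigma>: "\<sigma> \<in> {\<alpha>..2}" and h: "h \<in> {0..l}" for n \<sigma> h
    proof -
      obtain M where "regular_block (L j) \<alpha>' \<beta> l M n" using offG[OF n] G(3) by blast
      moreover have "Complex \<sigma> (h + real n * l) \<in> block_strip \<alpha>' l n"
        using \<sigma> h l order by (simp add: block_strip_def algebra_simps)
      ultimately show ?thesis by (simp add: regular_block_def)
    qed
    then show ?thesis using cm by (intro conjI) blast+
  qed
  show ?thesis
  proof (intro exI[of _ A] exI[of _ N] conjI allI impI)
    show "l_set_dens_zero l A" by (rule A_dens)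
    show "1 \<le> N j" for j by (rule N)
    show "continuable (L j) (Complex \<sigma> t)" if "real (N j) \<le> t \<and> t \<notin> A \<and> \<sigma> \<in> {\<alpha>..2}" for j t \<sigma>
      using that continuable_off_A by blast
    show "set_integrable (lborel \<Otimes>\<^sub>M lborel) ({real (N j)..T} \<times> {\<alpha>..2})
         (\<lambda>(t, \<sigma>). p j (continuation (L j) (Complex \<sigma> t)) * indicator (- A) t)" for j T
      by (rule good_blocks.joint_integrable[OF blocks pc(1)])
    show "set_integrable lborel {\<alpha>..2} (\<lambda>\<sigma>. LINT x|\<mu>. p j (dirichlet_ext \<mu> (a j) (of_real \<sigma>) x))" for j
      by (rule im(2))
    show "((\<lambda>T. (1 / T) *\<^sub>R (LBINT t:{real (N j)..T}. LBINT \<sigma>:{\<alpha>..2}.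
            p j (continuation (L j) (Complex \<sigma> t)) * indicator (- A) t))
        \<longlongrightarrow> (LBINT \<sigma>:{\<alpha>..2}. LINT x|\<mu>. p j (dirichlet_ext \<mu> (a j) (of_real \<sigma>) x))) at_top" for j
      by (rule im(3))
    show "\<forall>\<sigma>\<in>{\<alpha>..2}. \<forall>T. set_integrable lborel {real (N j)..T}
         (\<lambda>t. p j (continuation (L j) (Complex \<sigma> t)) * indicator (- A) t)" for j
      by (rule im(1))
    show "\<forall>\<sigma>\<in>{\<alpha>..2}. integrable \<mu> (\<lambda>x. p j (dirichlet_ext \<mu> (a j) (of_real \<sigma>) x))" for j
      using tm(1) by blast
    show "uniform_limit {\<alpha>..2}
        (\<lambda>T \<sigma>. (1 / T) *\<^sub>R (LBINT t:{real (N j)..T}.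
            p j (continuation (L j) (Complex \<sigma> t)) * indicator (- A) t))
        (\<lambda>\<sigma>. LINT x|\<mu>. p j (dirichlet_ext \<mu> (a j) (of_real \<sigma>) x)) at_top" for j
      by (rule tm(2))
    show "\<forall>\<sigma>\<in>{\<alpha>..2}. \<forall>h\<in>{0..l}. continuable (L j) (Complex \<sigma> (h + real n * l))"
      if "l \<notin> Gamma_P" "N j \<le> n" "real n * l \<notin> A" for j n
      using iii[OF that(1)] that by blast
  qed (use iii in blast)+
qed

end
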